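(* Let $n\geqslant3$, and let $C$ be an $n$-dimensional proper polyhedral cone with exactly $n+1$ extreme rays. Then the minimal operator system $C^{\min}$ is subhomogeneous if and only if $$C\cong C_{\square}\oplus\mathbb R_+^{n-3},$$ and in this case $C^{\min}$ is $2$-subhomogeneous. Consequently, every three-dimensional proper polyhedral cone with four extreme rays has a $2$-subhomogeneous minimal operator system, whereas for every $n\geqslant4$ there is an $n$-dimensional proper polyhedral cone with $n+1$ extreme rays whose minimal operator system is not subhomogeneous.
   Context: A proper polyhedral cone $C\subseteq V$ in a finite-dimensional real vector space is a finitely generated convex cone that is pointed ($C\cap(-C)=\{0\}$) and has nonempty interior; its dimension is $\dim V$. Isomorphism $\cong$ of cones means a linear isomorphism of the ambient spaces mapping one cone onto the other. $C\oplus D\subseteq V\oplus W$ is the direct sum of cones. $\mathbb R_+^k$ is the nonnegative orthant in $\mathbb R^k$. $C_\square$ denotes a three-dimensional proper polyhedral cone with four extreme rays (all such cones are isomorphic). Minimal operator system: an interior point $u$ of $C$ is (arbitrarily) fixed. With $\operatorname{Her}_s$ the complex Hermitian $s\times s$ matrices and $\operatorname{Her}_s(V)=\operatorname{Her}_s\otimes_{\mathbb R}V$, set $C_s^{\min}=\operatorname{cone}\{A\otimes c\mid A\in\operatorname{Her}_s,\ A\geqslant0,\ c\in C\}\subseteq\operatorname{Her}_s(V)$ and $C^{\min}=(V,(C_s^{\min})_{s\geqslant1},u)$, with matrix order unit $I_s\otimes u$ at level $s$. It is called $d$-subhomogeneous if it admits a unital complete order embedding into $\operatorname{Mat}_d(\mathcal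 A)$ for some commutative $C^*$-algebra $\mathcal A$, i.e. a real-linear map $\Phi$ from $V$ to the Hermitian elements of $\operatorname{Mat}_d(\mathcal A)$ with $\Phi(u)=1$ such that for all $s\geqslant1$ and $X\in\operatorname{Her}_s(V)$: $X\in C_s^{\min}$ if and only if $(\mathrm{id}\otimes\Phi)(X)\geqslant0$ in $\operatorname{Mat}_s(\operatorname{Mat}_d(\mathcal A))$. It is subhomogeneous if it is $d$-subhomogeneous for some $d\geqslant1$. *)

theory Defs
  imports
    "HOL-Analysis.Analysis"
    "HOL-Analysis.Finite_Function_Topology"
    "HOL-Algebra.Module"
begin

section \<open>Polyhedral cones\<close>

definition proper_polyhedral_cone :: "'v::euclidean_space set \<Rightarrow> bool" where
  "proper_polyhedral_cone C \<longleftrightarrow>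
     (\<exists>S. finite S \<and> C = convex_cone hull S) \<and> C \<inter> uminus ` C = {0} \<and> interior C \<noteq> {}"

definition extreme_rays :: "'v::euclidean_space set \<Rightarrow> 'v set set" where
  "extreme_rays C = {R. R face_of C \<and> aff_dim R = 1}"

text \<open>The cones that may serve as \<open>C\<^sub>\<box>\<close>.\<close>

definition square_cone :: "'q::euclidean_space set \<Rightarrow> bool" where
  "square_cone Q \<longleftrightarrow> DIM('q) = 3 \<and> proper_polyhedral_cone Q \<and> card (extreme_rays Q) = 4"

text \<open>The ambient spaces \<open>V\<close> and \<open>W\<close> of the two cones are explicit, since they may be proper
  subspaces of their types. A linear map on a subspace extends to the whole type, so that
  nothing is lost by taking \<open>f\<close> linear everywhere.\<close>

definition cone_isomorphic ::
  "'v::real_vector set \<Rightarrow> 'v set \<Rightarrow> 'w::real_vector set \<Rightarrow> 'w set \<Rightarrow> bool" where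
  "cone_isomorphic V C W D \<longleftrightarrow> (\<exists>f. linear f \<and> bij_betw f V W \<and> f ` C = D)"

text \<open>\<open>\<real>\<^sup>k\<close>, including \<open>k = 0\<close>, as the subspace of finitely supported sequences vanishing from
  index \<open>k\<close> on.\<close>

definition coord_space :: "nat \<Rightarrow> (nat \<Rightarrow>\<^sub>0 real) set" where
  "coord_space k = {x. \<forall>i\<ge>k. Poly_Mapping.lookup x i = 0}"

definition orthant :: "nat \<Rightarrow> (nat \<Rightarrow>\<^sub>0 real) set" where
  "orthant k = {x \<in> coord_space k. \<forall>i<k. 0 \<le> Poly_Mapping.lookup x i}"


section \<open>Commutative unital \<open>C\<^sup>*\<close>-algebras\<close>

definition complex_ring :: "complex ring" where
  "complex_ring = \<lparr>carrier = UNIV, mult = (*), one = 1, zero = 0, add = (+)\<rparr>"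

record 'b cstar = "(complex, 'b) module" +
  star :: "'b \<Rightarrow> 'b"
  cnorm :: "'b \<Rightarrow> real"

text \<open>The locale \<^locale>\<open>Module.algebra\<close> already requires its algebras to be commutative and unital.\<close>

locale comm_cstar_algebra =
  Module.algebra complex_ring A for A :: "'b cstar" (structure) +
  assumes star_closed: "x \<in> carrier A \<Longrightarrow> star A x \<in> carrier A"
    and star_star: "x \<in> carrier A \<Longrightarrow> star A (star A x) = x"
    and star_add: "\<lbrakk>x \<in> carrier A; y \<in> carrier A\<rbrakk>
      \<Longrightarrow> star A (x \<oplus>\<^bsub>A\<^esub> y) = star A x \<oplus>\<^bsub>A\<^esub> star A y"
    and star_mult: "\<lbrakk>x \<in> carrier A; y \<in> carrier A\<rbrakk>
      \<Longrightarrow> star A (x \<otimes>\<^bsub>A\<^esub> y) = star A y \<otimes>\<^bsub>A\<^esub> star A x"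
    and star_smult: "x \<in> carrier A \<Longrightarrow> star A (c \<odot>\<^bsub>A\<^esub> x) = cnj c \<odot>\<^bsub>A\<^esub> star A x"
    and cnorm_nonneg: "x \<in> carrier A \<Longrightarrow> 0 \<le> cnorm A x"
    and cnorm_eq_zero: "x \<in> carrier A \<Longrightarrow> cnorm A x = 0 \<longleftrightarrow> x = \<zero>\<^bsub>A\<^esub>"
    and cnorm_triangle: "\<lbrakk>x \<in> carrier A; y \<in> carrier A\<rbrakk>
      \<Longrightarrow> cnorm A (x \<oplus>\<^bsub>A\<^esub> y) \<le> cnorm A x + cnorm A y"
    and cnorm_smult: "x \<in> carrier A \<Longrightarrow> cnorm A (c \<odot>\<^bsub>A\<^esub> x) = cmod c * cnorm A x"
    and cnorm_mult: "\<lbrakk>x \<in> carrier A; y \<in> carrier A\<rbrakk>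
      \<Longrightarrow> cnorm A (x \<otimes>\<^bsub>A\<^esub> y) \<le> cnorm A x * cnorm A y"
    and cstar_identity: "x \<in> carrier A \<Longrightarrow> cnorm A (star A x \<otimes>\<^bsub>A\<^esub> x) = (cnorm A x)\<^sup>2"
    and complete:
      "\<And>f :: nat \<Rightarrow> 'b. \<lbrakk>range f \<subseteq> carrier A;
          \<forall>e>0. \<exists>N. \<forall>m\<ge>N. \<forall>n\<ge>N. cnorm A (f m \<ominus>\<^bsub>A\<^esub> f n) < e\<rbrakk>
        \<Longrightarrow> \<exists>x\<in>carrier A. (\<lambda>n. cnorm A (f n \<ominus>\<^bsub>A\<^esub> x)) \<longlonglongrightarrow> 0"

text \<open>A square matrix is a function of two indices, of which only the values at indices from the
  stated finite index set matter. An element of the \<open>C\<^sup>*\<close>-algebra of matrices over \<open>A\<close> is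
  positive if it is of the form \<open>Y\<^sup>* Y\<close>.\<close>

definition cstar_mat_positive :: "'b cstar \<Rightarrow> 'i set \<Rightarrow> ('i \<Rightarrow> 'i \<Rightarrow> 'b) \<Rightarrow> bool" where
  "cstar_mat_positive A I X \<longleftrightarrow>
     (\<exists>Y. (\<forall>i\<in>I. \<forall>j\<in>I. Y i j \<in> carrier A) \<and>
          (\<forall>i\<in>I. \<forall>j\<in>I. X i j = (\<Oplus>\<^bsub>A\<^esub>k\<in>I. star A (Y k i) \<otimes>\<^bsub>A\<^esub> Y k j)))"


section \<open>Matrix cones\<close>

definition hermitian_psd :: "nat \<Rightarrow> (nat \<Rightarrow> nat \<Rightarrow> complex) \<Rightarrow> bool" where
  "hermitian_psd s A \<longleftrightarrow>
     (\<forall>i<s. \<forall>j<s. A j i = cnj (A i j)) \<and>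
     (\<forall>x. 0 \<le> Re (\<Sum>i<s. \<Sum>j<s. cnj (x i) * A i j * x j))"

text \<open>The complexification \<open>V \<oplus> \<i>V\<close> is represented by \<^typ>\<open>'v \<times> 'v\<close>, and
  \<open>Her\<^sub>s \<otimes>\<^sub>\<real> V\<close> by the \<open>s \<times> s\<close> Hermitian matrices with entries in it;
  the conjugate of \<open>(a, b)\<close> is \<open>(a, - b)\<close>.\<close>

type_synonym 'v vmat = "nat \<Rightarrow> nat \<Rightarrow> 'v \<times> 'v"

definition Her :: "nat \<Rightarrow> 'v::real_vector vmat set" where
  "Her s = {X. \<forall>i<s. \<forall>j<s. X j i = (fst (X i j), - snd (X i j))}"

definition tensor :: "(nat \<Rightarrow> nat \<Rightarrow> complex) \<Rightarrow> 'v::real_vector \<Rightarrow> 'v vmat" where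
  "tensor A c = (\<lambda>i j. (Re (A i j) *\<^sub>R c, Im (A i j) *\<^sub>R c))"

definition min_cone :: "'v::real_vector set \<Rightarrow> nat \<Rightarrow> 'v vmat set" where
  "min_cone C s = {X. \<exists>(m::nat) t A c.
     (\<forall>k<m. 0 \<le> (t k :: real) \<and> hermitian_psd s (A k) \<and> c k \<in> C) \<and>
     (\<forall>i<s. \<forall>j<s. X i j = (\<Sum>k<m. t k *\<^sub>R tensor (A k) (c k) i j))}"


section \<open>Subhomogeneity\<close>

text \<open>Real-linear maps from \<open>V\<close> into the Hermitian elements of \<open>Mat\<^sub>d(A)\<close>.\<close>

definition linear_to_hermitian :: "'b cstar \<Rightarrow> nat \<Rightarrow> ('v::real_vector \<Rightarrow> nat \<Rightarrow> nat \<Rightarrow> 'b) \<Rightarrow> bool" where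
  "linear_to_hermitian A d \<Phi> \<longleftrightarrow>
     (\<forall>p<d. \<forall>q<d. \<forall>v.
        \<Phi> v p q \<in> carrier A \<and>
        \<Phi> v q p = star A (\<Phi> v p q) \<and>
        (\<forall>w. \<Phi> (v + w) p q = \<Phi> v p q \<oplus>\<^bsub>A\<^esub> \<Phi> w p q) \<and>
        (\<forall>r. \<Phi> (r *\<^sub>R v) p q = complex_of_real r \<odot>\<^bsub>A\<^esub> \<Phi> v p q))"

text \<open>\<open>(id \<otimes> \<Phi>)(X)\<close> in \<open>Mat\<^sub>s(Mat\<^sub>d(A))\<close>, with rows and columns indexed by pairs of an outer
  index below \<open>s\<close> and an inner index below \<open>d\<close>.\<close>

definition amplify ::
  "'b cstar \<Rightarrow> ('v \<Rightarrow> nat \<Rightarrow> nat \<Rightarrow> 'b) \<Rightarrow> 'v vmat \<Rightarrow> nat \<times> nat \<Rightarrow> nat \<times> nat \<Rightarrow> 'b" where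
  "amplify A \<Phi> X = (\<lambda>(i, p) (j, q).
     \<Phi> (fst (X i j)) p q \<oplus>\<^bsub>A\<^esub> \<i> \<odot>\<^bsub>A\<^esub> \<Phi> (snd (X i j)) p q)"

text \<open>Here \<open>K\<close> is the family of matrix cones and \<open>u\<close> the order unit of an operator system.\<close>

definition unital_complete_order_embedding ::
  "'b cstar \<Rightarrow> nat \<Rightarrow> (nat \<Rightarrow> 'v::real_vector vmat set) \<Rightarrow> 'v \<Rightarrow> ('v \<Rightarrow> nat \<Rightarrow> nat \<Rightarrow> 'b) \<Rightarrow> bool" where
  "unital_complete_order_embedding A d K u \<Phi> \<longleftrightarrow>
     linear_to_hermitian A d \<Phi> \<and>
     (\<forall>p<d. \<forall>q<d. \<Phi> u p q = (if p = q then \<one>\<^bsub>A\<^esub> else \<zero>\<^bsub>A\<^esub>)) \<and>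
     (\<forall>s\<ge>1. \<forall>X\<in>Her s.
        X \<in> K s \<longleftrightarrow> cstar_mat_positive A ({..<s} \<times> {..<d}) (amplify A \<Phi> X))"

text \<open>HOL cannot quantify existentially over types, so the type \<^typ>\<open>'b\<close> containing the carriers of
  the \<open>C\<^sup>*\<close>-algebras is a parameter. For finite-dimensional \<open>V\<close> the entries of a map
  \<open>\<Phi>\<close> into \<open>Mat\<^sub>d(A)\<close> generate a separable \<open>C\<^sup>*\<close>-subalgebra of \<open>A\<close>, which has at most the
  cardinality of the continuum, so all types \<^typ>\<open>'b\<close> of at least that cardinality give the same
  notion.\<close>

definition d_subhomogeneous ::
  "'b itself \<Rightarrow> nat \<Rightarrow> (nat \<Rightarrow> 'v::real_vector vmat set) \<Rightarrow> 'v \<Rightarrow> bool" where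
  "d_subhomogeneous _ d K u \<longleftrightarrow>
     (\<exists>(A :: 'b cstar) \<Phi>. comm_cstar_algebra A \<and> unital_complete_order_embedding A d K u \<Phi>)"

definition subhomogeneous ::
  "'b itself \<Rightarrow> (nat \<Rightarrow> 'v::real_vector vmat set) \<Rightarrow> 'v \<Rightarrow> bool" where
  "subhomogeneous T K u \<longleftrightarrow> (\<exists>d\<ge>1. d_subhomogeneous T d K u)"

end

theory Submission
  imports Defs "HOL-Combinatorics.Permutations"
begin

text \<open>Rescale the generators of \<open>C\<close> so that their only linear relation reads \<open>\<Sum>P = \<Sum>Q\<close>, and let \<open>Z\<close> be the
  generators that do not occur in it. Then \<open>C \<cong> C\<^sub>\<box> \<oplus> \<real>\<^sub>+\<^bsup>n-3\<^esup>\<close> says that both sides have two terms.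

  For \<open>v1 + v2 = w1 + w2\<close>, consider the maps into the \<open>2 \<times> 2\<close> matrices with \<open>v1 \<mapsto> E\<^sub>1\<^sub>1\<close>, \<open>v2 \<mapsto> E\<^sub>2\<^sub>2\<close> and
  \<open>w1 \<mapsto> q q\<^sup>T\<close>, where \<open>q = (cos \<theta>, sin \<theta>)\<close> with \<open>\<theta>\<close> rational, together with the coordinates along \<open>Z\<close>.
  If all of them send \<open>A1 \<otimes> v1 + A2 \<otimes> v2 + B \<otimes> w1\<close> to positive matrices, then some \<open>G \<ge> 0\<close> satisfies
  \<open>-B \<le> G \<le> A1, A2\<close>, and \<open>(A1 - G) \<otimes> v1 + (A2 - G) \<otimes> v2 + (B + G) \<otimes> w1 + G \<otimes> w2\<close> lies in the minimal
  cone. So countably many maps into \<open>2 \<times> 2\<close> matrices embed the operator system into \<open>Mat\<^sub>2(l\<^sup>\<infinity>)\<close>. The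
  dual form of the interpolation is that a quadruple of positive matrices with \<open>T1 + T2 = T3 + T4\<close> is
  a sum of rank-one quadruples of vectors \<open>x, y, c x + s y, s x - c y\<close>.

  If one side has at least three terms, a three-outcome and a two-outcome measurement generate all
  \<open>N \<times> N\<close> matrices, for every \<open>N\<close>. Such a positive representation of \<open>V\<close> is a
  functional on the minimal cone of level \<open>N\<close>. Under an embedding into \<open>Mat\<^sub>d(A)\<close>, its GNS space is
  acted on by \<open>Mat\<^sub>d(A)\<close>, and the matrix units of size \<open>N\<close> are limits of elements of \<open>Mat\<^sub>d(A)\<close>. But
  \<open>Mat\<^sub>d(A)\<close> satisfies a standard polynomial identity, which the matrix units of large size violate.\<close>

section \<open>Hermitian forms\<close>

text \<open>Two two-outcome measurements split into blocks of size at most 2, one for each angle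
  between two lines; a three-outcome and a two-outcome measurement together have irreducible
  representations of arbitrarily large size. Hence the border between two terms and three.

  The order unit is an arbitrary interior point, unrelated to the generators. In the positive
  direction each map into 2 x 2 matrices is made unital by a congruence that depends on the angle.
  In the negative direction the outcomes do not add up to the unit, so their sum is inverted inside
  Mat_d(A) by polynomials, as in a Neumann series; this is why the matrix units appear only as
  limits.

  The functional is known only on real symmetric matrices over V. It is never extended and no GNS
  space is built: a norm bound is a finite certificate, a majorant with entries in V together with a
  sum of squares. The representing matrices are real, so symmetric matrices over V suffice. The
  angles are rational to keep the family countable, so that it fits into sequences; continuity
  recovers the other angles.\<close>

definition dp :: "nat \<Rightarrow> (nat \<Rightarrow> complex) \<Rightarrow> (nat \<Rightarrow> complex) \<Rightarrow> complex" where
  "dp s x y = (\<Sum>i<s. cnj (x i) * y i)"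

definition mv :: "nat \<Rightarrow> (nat \<Rightarrow> nat \<Rightarrow> complex) \<Rightarrow> (nat \<Rightarrow> complex) \<Rightarrow> nat \<Rightarrow> complex" where
  "mv s A x = (\<lambda>i. \<Sum>j<s. A i j * x j)"

definition qf :: "nat \<Rightarrow> (nat \<Rightarrow> nat \<Rightarrow> complex) \<Rightarrow> (nat \<Rightarrow> complex) \<Rightarrow> real" where
  "qf s A x = Re (dp s x (mv s A x))"

definition herm :: "nat \<Rightarrow> (nat \<Rightarrow> nat \<Rightarrow> complex) \<Rightarrow> bool" where
  "herm s A \<longleftrightarrow> (\<forall>i<s. \<forall>j<s. A j i = cnj (A i j))"

lemma hermD: "herm s A \<Longrightarrow> i < s \<Longrightarrow> j < s \<Longrightarrow> cnj (A i j) = A j i"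
  unfolding herm_def by (rule sym) blast

lemma hermitian_psd_iff: "hermitian_psd s A \<longleftrightarrow> herm s A \<and> (\<forall>x. 0 \<le> qf s A x)"
  unfolding hermitian_psd_def herm_def qf_def dp_def mv_def
  by (simp add: sum_distrib_left mult.assoc)

lemma dp_cnj: "cnj (dp s x y) = dp s y x"
  by (simp add: dp_def mult.commute)

lemma dp_combine_right: "dp s x (\<lambda>i. a * y i + b * z i) = a * dp s x y + b * dp s x z"
  by (simp add: dp_def algebra_simps sum.distrib sum_distrib_left)

lemma dp_combine_left: "dp s (\<lambda>i. a * y i + b * z i) x = cnj a * dp s y x + cnj b * dp s z x"
  by (simp add: dp_def algebra_simps sum.distrib sum_distrib_left)

lemma mv_combine: "mv s A (\<lambda>i. a * y i + b * z i) = (\<lambda>i. a * mv s A y i + b * mv s A z i)"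
  by (simp add: mv_def algebra_simps sum.distrib sum_distrib_left)

lemma mv_add_matrix: "mv s (\<lambda>i j. A i j + B i j) x = (\<lambda>i. mv s A x i + mv s B x i)"
  by (simp add: mv_def algebra_simps sum.distrib)

lemma mv_diff_matrix: "mv s (\<lambda>i j. A i j - B i j) x = (\<lambda>i. mv s A x i - mv s B x i)"
  by (simp add: mv_def algebra_simps sum_subtractf)

lemma mv_scale_matrix: "mv s (\<lambda>i j. c * A i j) x = (\<lambda>i. c * mv s A x i)"
  by (simp add: mv_def algebra_simps sum_distrib_left)

lemma dp_add_right: "dp s x (\<lambda>i. y i + z i) = dp s x y + dp s x z"
  by (simp add: dp_def algebra_simps sum.distrib)

lemma dp_diff_right: "dp s x (\<lambda>i. y i - z i) = dp s x y - dp s x z"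
  by (simp add: dp_def algebra_simps sum_subtractf)

lemma dp_scale_right: "dp s x (\<lambda>i. c * y i) = c * dp s x y"
  by (simp add: dp_def algebra_simps sum_distrib_left)

lemma dp_scale_left: "dp s (\<lambda>i. c * y i) x = cnj c * dp s y x"
  by (simp add: dp_def algebra_simps sum_distrib_left)

lemma dp_cong_right: "(\<And>i. i < s \<Longrightarrow> y i = z i) \<Longrightarrow> dp s x y = dp s x z"
  by (simp add: dp_def)

lemma mv_cong_matrix: "(\<And>j. j < s \<Longrightarrow> A i j = B i j) \<Longrightarrow> mv s A x i = mv s B x i"
  by (simp add: mv_def)

lemma qf_cong: "(\<And>i j. i < s \<Longrightarrow> j < s \<Longrightarrow> A i j = B i j) \<Longrightarrow> qf s A x = qf s B x"
  by (simp add: qf_def dp_def mv_def)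

lemma qf_add: "qf s (\<lambda>i j. A i j + B i j) x = qf s A x + qf s B x"
  by (simp add: qf_def mv_add_matrix dp_add_right)

lemma qf_diff: "qf s (\<lambda>i j. A i j - B i j) x = qf s A x - qf s B x"
  by (simp add: qf_def mv_diff_matrix dp_diff_right)

lemma qf_scale: "qf s (\<lambda>i j. complex_of_real c * A i j) x = c * qf s A x"
  by (simp add: qf_def mv_scale_matrix dp_scale_right)

lemma qf_scale_vec: "qf s A (\<lambda>i. c * x i) = (cmod c)\<^sup>2 * qf s A x"
proof -
  have "mv s A (\<lambda>i. c * x i) = (\<lambda>i. c * mv s A x i)"
    by (simp add: mv_def algebra_simps sum_distrib_left)
  then have "dp s (\<lambda>i. c * x i) (mv s A (\<lambda>i. c * x i)) = (cnj c * c) * dp s x (mv s A x)"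
    by (simp add: dp_scale_left dp_scale_right)
  also have "cnj c * c = complex_of_real ((cmod c)\<^sup>2)"
    by (metis complex_norm_square mult.commute)
  finally show ?thesis by (simp add: qf_def)
qed

lemma dp_mv_swap: "herm s A \<Longrightarrow> dp s (mv s A x) y = dp s x (mv s A y)"
proof -
  assume h: "herm s A"
  have "dp s (mv s A x) y = (\<Sum>i<s. \<Sum>j<s. cnj (A i j) * cnj (x j) * y i)"
    by (simp add: dp_def mv_def sum_distrib_right)
  also have "\<dots> = (\<Sum>i<s. \<Sum>j<s. A j i * cnj (x j) * y i)"
    by (intro sum.cong refl) (simp add: hermD[OF h])
  also have "\<dots> = (\<Sum>j<s. \<Sum>i<s. A j i * cnj (x j) * y i)" by (rule sum.swap)
  also have "\<dots> = dp s x (mv s A y)"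
    by (simp add: dp_def mv_def sum_distrib_left algebra_simps)
  finally show ?thesis .
qed

lemma dp_self: "dp s x x = complex_of_real (\<Sum>i<s. (cmod (x i))\<^sup>2)"
  by (simp add: dp_def complex_norm_square[unfolded of_real_power] mult.commute)

lemma dp_self_eq_0: "dp s x x = 0 \<longleftrightarrow> (\<forall>i<s. x i = 0)"
  unfolding dp_self of_real_eq_0_iff by (subst sum_nonneg_eq_0_iff) auto

lemma qf_plus_scaled:
  assumes "herm s A"
  shows "qf s A (\<lambda>i. x i + t * y i) =
    qf s A x + 2 * Re (t * dp s x (mv s A y)) + (cmod t)\<^sup>2 * qf s A y"
proof -
  have "dp s y (mv s A x) = cnj (dp s x (mv s A y))"
    using dp_mv_swap[OF assms, of x y] dp_cnj by metis
  moreover have "dp s (\<lambda>i. 1 * x i + t * y i) (mv s A (\<lambda>i. 1 * x i + t * y i)) =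
    dp s x (mv s A x) + t * dp s x (mv s A y) + cnj t * dp s y (mv s A x)
      + (cnj t * t) * dp s y (mv s A y)"
    unfolding mv_combine dp_combine_left dp_combine_right by (simp add: algebra_simps)
  moreover have "cnj t * t = complex_of_real ((cmod t)\<^sup>2)"
    by (metis complex_norm_square mult.commute)
  ultimately show ?thesis
    by (simp add: qf_def)
qed

text \<open>A nonzero linear term in \<open>t\<close> would make the form negative near
  \<open>v\<close>. Nonnegativity is assumed only on the complex line through \<open>v\<close> in
  the direction \<open>m\<close>, because the later use is \<open>l * S - T3\<close>, which is known
  to be nonnegative just on the kernel of \<open>T2\<close>.\<close>

lemma null_vector_orthogonal:
  assumes "herm s A" "qf s A v = 0" "\<And>t. 0 \<le> qf s A (\<lambda>i. v i + t * m i)"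
  shows "dp s v (mv s A m) = 0"
proof -
  define d where "d = dp s v (mv s A m)"
  define k where "k = qf s A m"
  have k0: "0 \<le> -2 * e * (cmod d)\<^sup>2 + e\<^sup>2 * (cmod d)\<^sup>2 * k" for e :: real
  proof -
    have "Re (- (of_real e) * cnj d * d) = - e * (cmod d)\<^sup>2"
      unfolding cmod_power2 by (simp add: power2_eq_square algebra_simps)
    moreover have "(cmod (- (of_real e) * cnj d))\<^sup>2 = e\<^sup>2 * (cmod d)\<^sup>2"
      by (simp add: norm_mult power_mult_distrib)
    ultimately show ?thesis
      using assms(3)[of "- (of_real e) * cnj d"]
      unfolding qf_plus_scaled[OF assms(1)] assms(2) d_def[symmetric] k_def[symmetric]
      by simp
  qed
  have "cmod d = 0"
  proof (rule ccontr)
    assume "cmod d \<noteq> 0"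
    then have p: "(cmod d)\<^sup>2 > 0" by simp
    have *: "0 \<le> -2 * e + e\<^sup>2 * k" for e :: real
    proof -
      have "0 \<le> (cmod d)\<^sup>2 * (-2 * e + e\<^sup>2 * k)" using k0[of e] by (simp add: algebra_simps)
      then show ?thesis using p by (simp add: zero_le_mult_iff)
    qed
    \<comment> \<open>Small enough that \<open>e * k\<close> is at most 1, so the quadratic term is
      at most \<open>e\<close> and loses against \<open>- 2 * e\<close>.\<close>
    define e where "e = 1 / (1 + \<bar>k\<bar>)"
    have "e > 0" "e * k \<le> 1" by (auto simp: e_def divide_simps)
    then have "e * (e * k) \<le> e" by simp
    then show False using *[of e] \<open>e > 0\<close> by (simp add: power2_eq_square)
  qed
  then show ?thesis by (simp add: d_def)
qed

lemma psd_cauchy_schwarz: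
  assumes "hermitian_psd s A"
  shows "(cmod (dp s x (mv s A y)))\<^sup>2 \<le> qf s A x * qf s A y"
proof -
  have h: "herm s A" and p: "\<And>x. 0 \<le> qf s A x" using assms by (auto simp: hermitian_psd_iff)
  define d where "d = dp s x (mv s A y)"
  show ?thesis
  proof (cases "qf s A y = 0")
    case True
    have "dp s y (mv s A x) = 0" by (rule null_vector_orthogonal[OF h True p])
    then have "dp s x (mv s A y) = 0" using dp_mv_swap[OF h] dp_cnj by (metis complex_cnj_zero)
    then show ?thesis using True by simp
  next
    case False
    then have k: "qf s A y > 0" using p[of y] by simp
    \<comment> \<open>The minimiser of the quadratic polynomial in \<open>e\<close> that appears
      below.\<close>
    define e where "e = 1 / qf s A y"
    have "Re (- (of_real e) * cnj d * d) = - e * (cmod d)\<^sup>2"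
      unfolding cmod_power2 by (simp add: power2_eq_square algebra_simps)
    moreover have "(cmod (- (of_real e) * cnj d))\<^sup>2 = e\<^sup>2 * (cmod d)\<^sup>2"
      by (simp add: norm_mult power_mult_distrib)
    ultimately have "0 \<le> qf s A x - 2 * e * (cmod d)\<^sup>2 + e\<^sup>2 * (cmod d)\<^sup>2 * qf s A y"
      using p[of "\<lambda>i. x i + (- (of_real e) * cnj d) * y i"]
      unfolding qf_plus_scaled[OF h] d_def[symmetric] by simp
    moreover have "e\<^sup>2 * (cmod d)\<^sup>2 * qf s A y = e * (cmod d)\<^sup>2"
      using k by (simp add: e_def power2_eq_square)
    ultimately have "e * (cmod d)\<^sup>2 \<le> qf s A x" by simp
    then show ?thesis using k by (simp add: e_def d_def field_simps)
  qed
qed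

lemma psd_null_iff:
  assumes "hermitian_psd s A"
  shows "qf s A x = 0 \<longleftrightarrow> (\<forall>i<s. mv s A x i = 0)"
proof
  assume "qf s A x = 0"
  \<comment> \<open>Cauchy-Schwarz against the vector \<open>A x\<close> itself.\<close>
  then have "(cmod (dp s (mv s A x) (mv s A x)))\<^sup>2 \<le> 0"
    using psd_cauchy_schwarz[OF assms, of "mv s A x" x] by simp
  then show "\<forall>i<s. mv s A x i = 0" using dp_self_eq_0 by simp
next
  assume "\<forall>i<s. mv s A x i = 0"
  then show "qf s A x = 0" by (simp add: qf_def dp_def)
qed

text \<open>Induction on the number of functionals: on the kernel of \<open>f n\<close> the first
  \<open>n\<close> of them suffice, and one vector outside that kernel fixes the last coefficient.
  The set \<open>U\<close> is there so that the induction can pass to the kernel.\<close>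

lemma functional_in_span:
  fixes f :: "nat \<Rightarrow> (nat \<Rightarrow> complex) \<Rightarrow> complex" and g :: "(nat \<Rightarrow> complex) \<Rightarrow> complex"
  assumes f: "\<And>i a b x y. i < n \<Longrightarrow> f i (\<lambda>k. a * x k + b * y k) = a * f i x + b * f i y"
    and g: "\<And>a b x y. g (\<lambda>k. a * x k + b * y k) = a * g x + b * g y"
    and U: "\<And>a b x y. x \<in> U \<Longrightarrow> y \<in> U \<Longrightarrow> (\<lambda>k. a * x k + b * y k) \<in> U"
    and z: "\<And>x. x \<in> U \<Longrightarrow> \<forall>i<n. f i x = 0 \<Longrightarrow> g x = 0"
  shows "\<exists>c. \<forall>x\<in>U. g x = (\<Sum>i<n. c i * f i x)"
  using assms
proof (induction n arbitrary: U)
  case 0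
  have "g x = 0" if "x \<in> U" for x by (rule 0(4)[OF that]) simp
  then show ?case by simp
next
  case (Suc n)
  have lin: "f n (\<lambda>k. a * x k + b * y k) = a * f n x + b * f n y" for a b x y
    by (rule Suc.prems(1)) simp
  define U' where "U' = {x \<in> U. f n x = 0}"
  have "\<exists>c. \<forall>x\<in>U'. g x = (\<Sum>i<n. c i * f i x)"
  proof (rule Suc.IH)
    show "g x = 0" if "x \<in> U'" "\<forall>i<n. f i x = 0" for x
      by (rule Suc.prems(4)) (use that in \<open>auto simp: U'_def less_Suc_eq\<close>)
    show "(\<lambda>k. a * x k + b * y k) \<in> U'" if "x \<in> U'" "y \<in> U'" for a b x y
    proof -
      have "(\<lambda>k. a * x k + b * y k) \<in> U" by (rule Suc.prems(3)) (use that in \<open>simp_all add: U'_def\<close>)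
      moreover have "f n (\<lambda>k. a * x k + b * y k) = 0" unfolding lin using that by (simp add: U'_def)
      ultimately show ?thesis by (simp add: U'_def)
    qed
    show "f i (\<lambda>k. a * x k + b * y k) = a * f i x + b * f i y" if "i < n" for i a b x y
      by (rule Suc.prems(1)) (use that in simp)
    show "g (\<lambda>k. a * x k + b * y k) = a * g x + b * g y" for a b x y
      by (rule Suc.prems(2))
  qed
  then obtain c where c: "\<And>x. x \<in> U' \<Longrightarrow> g x = (\<Sum>i<n. c i * f i x)" by auto
  show ?case
  proof (cases "\<exists>u\<in>U. f n u \<noteq> 0")
    case False
    then have "g x = (\<Sum>i<Suc n. c i * f i x)" if "x \<in> U" for x
      using c[of x] that by (auto simp: U'_def)
    then show ?thesis by blast
  next
    case True
    then obtain u where u: "u \<in> U" "f n u \<noteq> 0" by auto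
    define e where "e = (g u - (\<Sum>i<n. c i * f i u)) / f n u"
    have "g x = (\<Sum>i<Suc n. (c(n := e)) i * f i x)" if x: "x \<in> U" for x
    proof -
      define t where "t = - (f n x / f n u)"
      have "f n (\<lambda>k. 1 * x k + t * u k) = 0" unfolding lin using u by (simp add: t_def)
      then have "(\<lambda>k. 1 * x k + t * u k) \<in> U'"
        unfolding U'_def using Suc.prems(3)[OF x u(1), of 1 t] by (intro CollectI conjI)
      have "g (\<lambda>k. 1 * x k + t * u k) = (\<Sum>i<n. c i * f i (\<lambda>k. 1 * x k + t * u k))"
        by (rule c) fact
      also have "\<dots> = (\<Sum>i<n. c i * (1 * f i x + t * f i u))"
        by (rule sum.cong[OF refl], rule arg_cong[where f = "(*) _"], rule Suc.prems(1)) simp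
      also have "\<dots> = (\<Sum>i<n. c i * f i x) + t * (\<Sum>i<n. c i * f i u)"
        by (simp add: algebra_simps sum.distrib sum_distrib_left)
      finally have "g x + t * g u = (\<Sum>i<n. c i * f i x) + t * (\<Sum>i<n. c i * f i u)"
        using Suc.prems(2)[of 1 x t u] by simp
      then have "g x = (\<Sum>i<n. c i * f i x) + (-t) * (g u - (\<Sum>i<n. c i * f i u))"
        by (simp add: right_diff_distrib add_diff_eq eq_diff_eq)
      also have "(-t) * (g u - (\<Sum>i<n. c i * f i u)) = e * f n x"
        using u by (simp add: t_def e_def)
      finally show ?thesis by simp
    qed
    then show ?thesis by blast
  qed
qed

text \<open>Fredholm alternative: the functional \<open>dp s y\<close> vanishes where all rows of
  \<open>A\<close> vanish, hence it is a combination of the rows. As \<open>A\<close> is Hermitian,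
  conjugating the coefficients turns rows into columns and yields a solution.\<close>

lemma herm_solvable:
  assumes h: "herm s A" and y: "\<And>k. \<forall>i<s. mv s A k i = 0 \<Longrightarrow> dp s k y = 0"
  shows "\<exists>x. \<forall>i<s. mv s A x i = y i"
proof -
  have *: "dp s y x = 0" if "\<forall>i<s. mv s A x i = 0" for x
    using y[OF that] dp_cnj[of s x y] by simp
  have "\<exists>c. \<forall>x\<in>UNIV. dp s y x = (\<Sum>i<s. c i * mv s A x i)"
  proof (rule functional_in_span[where f = "\<lambda>i x. mv s A x i" and g = "dp s y" and n = s])
    show "mv s A (\<lambda>k. a * x k + b * z k) i = a * mv s A x i + b * mv s A z i" for a b x z i
      using fun_cong[OF mv_combine[of s A a x b z]] .
    show "dp s y (\<lambda>k. a * x k + b * z k) = a * dp s y x + b * dp s y z" for a b x z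
      by (fact dp_combine_right[of s y a x b z])
    show "dp s y x = 0" if "\<forall>i<s. mv s A x i = 0" for x
      by (rule *[OF that])
  qed (rule UNIV_I)
  then obtain c where c: "\<And>x. dp s y x = (\<Sum>i<s. c i * mv s A x i)" by blast
  have "mv s A (\<lambda>i. cnj (c i)) j = y j" if j: "j < s" for j
  proof -
    have "cnj (y j) = (\<Sum>i<s. c i * A i j)"
      using c[of "\<lambda>k. if k = j then 1 else 0"] j by (simp add: dp_def mv_def mult_delta_right)
    then have "y j = cnj (\<Sum>i<s. c i * A i j)" by (metis complex_cnj_cnj)
    also have "\<dots> = (\<Sum>i<s. A j i * cnj (c i))"
      unfolding cnj_sum using j by (intro sum.cong refl) (simp add: hermD[OF h] mult.commute)
    finally show ?thesis by (simp add: mv_def)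
  qed
  then show ?thesis by blast
qed

section \<open>Compactness and continuity of Hermitian forms\<close>

lemma compact_box:
  fixes K :: "'i \<Rightarrow> 'a::topological_space set"
  assumes "\<And>i. compact (K i)"
  shows "compact {f. \<forall>i. f i \<in> K i}"
proof -
  have "compactin (product_topology (\<lambda>i. euclidean) UNIV) (PiE UNIV K)"
    using assms by (subst compactin_PiE) (auto simp: compactin_euclidean_iff)
  moreover have "PiE UNIV K = {f. \<forall>i. f i \<in> K i}" by (auto simp: PiE_def)
  ultimately show ?thesis by (simp add: euclidean_product_topology compactin_euclidean_iff)
qed

lemmas continuous_on_eval = continuous_on_product_then_coordinatewise

lemma continuous_on_dp [continuous_intros]:
  assumes "continuous_on A f" "continuous_on A g"
  shows "continuous_on A (\<lambda>x. dp s (f x) (g x))"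
  unfolding dp_def
  by (intro continuous_on_sum continuous_on_mult continuous_on_cnj assms[THEN continuous_on_eval])

lemma continuous_on_mv [continuous_intros]:
  assumes "continuous_on A f" "continuous_on A g"
  shows "continuous_on A (\<lambda>x. mv s (f x) (g x) i)"
  unfolding mv_def
  by (intro continuous_on_sum continuous_on_mult assms(2)[THEN continuous_on_eval]
      assms(1)[THEN continuous_on_eval, THEN continuous_on_eval])

lemma continuous_on_qf [continuous_intros]:
  assumes "continuous_on A f" "continuous_on A g"
  shows "continuous_on A (\<lambda>x. qf s (f x) (g x))"
  unfolding qf_def dp_def
  by (intro continuous_on_sum continuous_on_mult continuous_on_cnj continuous_on_Re
      continuous_on_mv assms assms(2)[THEN continuous_on_eval])

text \<open>Says that \<open>x x^*\<close> lies below a multiple of \<open>T\<close>; for positive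
  \<open>T\<close> this means that \<open>x\<close> lies in the range of \<open>T\<close>. A small
  multiple of \<open>x x^*\<close> can then be split off from \<open>T\<close>.\<close>

definition dominated :: "nat \<Rightarrow> (nat \<Rightarrow> nat \<Rightarrow> complex) \<Rightarrow> (nat \<Rightarrow> complex) \<Rightarrow> bool" where
  "dominated s T x \<longleftrightarrow> (\<exists>k\<ge>0. \<forall>z. (cmod (dp s x z))\<^sup>2 \<le> k * qf s T z)"

lemma dominated_mv:
  assumes "hermitian_psd s T"
  shows "dominated s T (mv s T v)"
proof -
  have h: "herm s T" and "0 \<le> qf s T v" using assms by (auto simp: hermitian_psd_iff)
  moreover have "(cmod (dp s (mv s T v) z))\<^sup>2 \<le> qf s T v * qf s T z" for z
    using psd_cauchy_schwarz[OF assms, of v z] by (simp add: dp_mv_swap[OF h])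
  ultimately show ?thesis unfolding dominated_def by blast
qed

lemma dominated_scale:
  assumes "dominated s T x"
  shows "dominated s T (\<lambda>i. c * x i)"
proof -
  obtain k where k: "k \<ge> 0" "\<And>z. (cmod (dp s x z))\<^sup>2 \<le> k * qf s T z"
    using assms by (auto simp: dominated_def)
  have "(cmod (dp s (\<lambda>i. c * x i) z))\<^sup>2 \<le> ((cmod c)\<^sup>2 * k) * qf s T z" for z
    using mult_left_mono[OF k(2), of "(cmod c)\<^sup>2" z]
    by (simp add: dp_scale_left norm_mult power_mult_distrib mult.assoc)
  moreover have "(cmod c)\<^sup>2 * k \<ge> 0" using k by simp
  ultimately show ?thesis unfolding dominated_def by blast
qed

lemma dominated_cong:
  assumes "dominated s T x" "\<And>i. i < s \<Longrightarrow> x i = y i"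
  shows "dominated s T y"
proof -
  have "dp s x z = dp s y z" for z using assms(2) by (simp add: dp_def)
  then show ?thesis using assms(1) by (simp add: dominated_def)
qed

lemma dominated_zero: "dominated s T (\<lambda>i. 0)"
  unfolding dominated_def by (intro exI[of _ 0]) (simp add: dp_def)

text \<open>The range of a Hermitian matrix is the orthogonal complement of its kernel.\<close>

lemma dominated_perp_kernel:
  assumes "hermitian_psd s T" "\<And>k. \<forall>i<s. mv s T k i = 0 \<Longrightarrow> dp s k x = 0"
  shows "dominated s T x"
proof -
  have "herm s T" using assms(1) by (simp add: hermitian_psd_iff)
  then obtain v where "\<And>i. i < s \<Longrightarrow> mv s T v i = x i"
    using herm_solvable[OF _ assms(2)] by blast
  then show ?thesis using dominated_cong[OF dominated_mv[OF assms(1)]] by blast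
qed

section \<open>Interpolation of positive matrices\<close>

text \<open>The pairs \<open>T1 + T2 = T3 + T4\<close> of positive matrices are dual to the matrices that can be
  interpolated between two lower and two upper bounds.\<close>

definition quad where
  "quad s T1 T2 T3 T4 \<longleftrightarrow> hermitian_psd s T1 \<and> hermitian_psd s T2 \<and> hermitian_psd s T3 \<and>
     hermitian_psd s T4 \<and> (\<forall>i<s. \<forall>j<s. T1 i j + T2 i j = T3 i j + (T4 i j :: complex))"

text \<open>With \<open>z = c x + r y\<close> and \<open>w = c y - r x\<close> the rank-one matrices
  satisfy \<open>x x^* + y y^* = z z^* + w w^*\<close>. Peelable means that a small multiple of such
  a nonzero quadruple can be subtracted while all four matrices stay positive.\<close>

definition peelable where
  "peelable s T1 T2 T3 T4 \<longleftrightarrow> (\<exists>x y (c::real) (r::real). c\<^sup>2 + r\<^sup>2 = 1 \<and>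
     dominated s T1 x \<and> dominated s T2 y \<and>
     dominated s T3 (\<lambda>i. of_real c * x i + of_real r * y i) \<and>
     dominated s T4 (\<lambda>i. of_real c * y i - of_real r * x i) \<and> (\<exists>i<s. x i \<noteq> 0 \<or> y i \<noteq> 0))"

text \<open>Exchanging \<open>x\<close> and \<open>y\<close> exchanges \<open>c\<close> and
  \<open>r\<close> and flips the sign of the fourth vector, which domination does not see.\<close>

lemma peelable_swap12:
  assumes "peelable s T2 T1 T3 T4"
  shows "peelable s T1 T2 T3 T4"
proof -
  obtain x y and c r :: real where *: "c\<^sup>2 + r\<^sup>2 = 1" "dominated s T2 x" "dominated s T1 y"
    "dominated s T3 (\<lambda>i. of_real c * x i + of_real r * y i)"
    "dominated s T4 (\<lambda>i. of_real c * y i - of_real r * x i)" "\<exists>i<s. x i \<noteq> 0 \<or> y i \<noteq> 0"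
    using assms unfolding peelable_def by blast
  have "dominated s T4 (\<lambda>i. of_real r * x i - of_real c * y i)"
    using dominated_scale[OF *(5), of "-1"] by (simp add: algebra_simps)
  moreover have "dominated s T3 (\<lambda>i. of_real r * y i + of_real c * x i)"
    using *(4) by (simp add: add.commute)
  moreover have "r\<^sup>2 + c\<^sup>2 = 1" using *(1) by simp
  ultimately show ?thesis unfolding peelable_def using *(2,3,6) by blast
qed

text \<open>The pair \<open>(z, w)\<close> is a rotation of \<open>(x, y)\<close>; the inverse
  rotation has \<open>- r\<close> in place of \<open>r\<close>.\<close>

lemma peelable_swap_pairs:
  assumes "peelable s T3 T4 T1 T2"
  shows "peelable s T1 T2 T3 T4"
proof -
  obtain x y and c r :: real where *: "c\<^sup>2 + r\<^sup>2 = 1" "dominated s T3 x" "dominated s T4 y"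
    "dominated s T1 (\<lambda>i. of_real c * x i + of_real r * y i)"
    "dominated s T2 (\<lambda>i. of_real c * y i - of_real r * x i)" "\<exists>i<s. x i \<noteq> 0 \<or> y i \<noteq> 0"
    using assms unfolding peelable_def by blast
  define z w where "z = (\<lambda>i. of_real c * x i + of_real r * y i)"
    and "w = (\<lambda>i. of_real c * y i - of_real r * x i)"
  have one: "complex_of_real c * complex_of_real c + complex_of_real r * complex_of_real r = 1"
    using *(1) by (simp add: power2_eq_square flip: of_real_mult of_real_add)
  have x: "x i = of_real c * z i + of_real (-r) * w i" for i
  proof -
    have "of_real c * z i + of_real (-r) * w i = (of_real c * of_real c + of_real r * of_real r) * x i"
      by (simp add: z_def w_def algebra_simps)
    then show ?thesis by (simp add: one)
  qed
  have y: "y i = of_real c * w i - of_real (-r) * z i" for i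
  proof -
    have "of_real c * w i - of_real (-r) * z i = (of_real c * of_real c + of_real r * of_real r) * y i"
      by (simp add: z_def w_def algebra_simps)
    then show ?thesis by (simp add: one)
  qed
  have "dominated s T3 (\<lambda>i. of_real c * z i + of_real (-r) * w i)"
    "dominated s T4 (\<lambda>i. of_real c * w i - of_real (-r) * z i)"
    using *(2,3) by (simp_all only: x[symmetric] y[symmetric])
  moreover have "dominated s T1 z" "dominated s T2 w" using *(4,5) by (simp_all add: z_def w_def)
  moreover have "\<exists>i<s. z i \<noteq> 0 \<or> w i \<noteq> 0" using *(6) x y by (metis add.right_neutral diff_zero mult_zero_right)
  moreover have "c\<^sup>2 + (-r)\<^sup>2 = 1" using *(1) by simp
  ultimately show ?thesis unfolding peelable_def by blast
qed

lemma quad_nonneg: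
  assumes "quad s T1 T2 T3 T4"
  shows "qf s T1 x + qf s T2 x = qf s T3 x + qf s T4 x"
    and "0 \<le> qf s T1 x" "0 \<le> qf s T2 x" "0 \<le> qf s T3 x" "0 \<le> qf s T4 x"
proof -
  have "qf s (\<lambda>i j. T1 i j + T2 i j) x = qf s (\<lambda>i j. T3 i j + T4 i j) x"
    by (rule qf_cong) (use assms in \<open>auto simp: quad_def\<close>)
  then show "qf s T1 x + qf s T2 x = qf s T3 x + qf s T4 x" by (simp add: qf_add)
qed (use assms in \<open>auto simp: quad_def hermitian_psd_iff\<close>)

lemma hermI: "(\<And>i j. i < s \<Longrightarrow> j < s \<Longrightarrow> cnj (A i j) = A j i) \<Longrightarrow> herm s A"
  by (simp add: herm_def)

lemma hermitian_psd_add: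
  assumes "hermitian_psd s A" "hermitian_psd s B"
  shows "hermitian_psd s (\<lambda>i j. A i j + B i j)"
  using assms by (auto simp: hermitian_psd_iff qf_add intro!: hermI simp: hermD)

lemma dp_perp_kernel:
  assumes "herm s S" "\<forall>i<s. mv s S k i = 0"
  shows "dp s k (mv s S v) = 0"
proof -
  have "dp s (mv s S k) v = 0" using assms(2) by (simp add: dp_def)
  then show ?thesis by (simp add: dp_mv_swap[OF assms(1)])
qed

text \<open>\<open>S\<close> and its square have the same kernel, hence the same range. So
  \<open>v\<close> can be replaced by a vector in the range of \<open>S\<close>, which is orthogonal
  to the kernel, without changing \<open>S v\<close>.\<close>

lemma range_representative:
  assumes h: "herm s S"
  shows "\<exists>w. \<forall>i<s. mv s S (mv s S w) i = mv s S v i"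
proof -
  define S2 where "S2 = (\<lambda>i j. \<Sum>k<s. S i k * S k j)"
  have S2: "mv s S2 x i = mv s S (mv s S x) i" for x i
    unfolding S2_def mv_def sum_distrib_left sum_distrib_right mult.assoc by (rule sum.swap)
  have "herm s S2"
    unfolding herm_def S2_def
  proof (intro allI impI)
    fix i j assume "i < s" "j < s"
    then have "S j k * S k i = cnj (S i k * S k j)" if "k < s" for k
      using that by (simp add: hermD[OF h] mult.commute)
    then show "(\<Sum>k<s. S j k * S k i) = cnj (\<Sum>k<s. S i k * S k j)"
      unfolding cnj_sum by (intro sum.cong) auto
  qed
  moreover have "dp s k (mv s S v) = 0" if "\<forall>i<s. mv s S2 k i = 0" for k
  proof (rule dp_perp_kernel[OF h])
    have "dp s (mv s S k) (mv s S k) = dp s k (mv s S (mv s S k))" by (rule dp_mv_swap[OF h])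
    also have "\<dots> = 0" using that by (simp add: S2 dp_def)
    finally show "\<forall>i<s. mv s S k i = 0" by (simp add: dp_self_eq_0)
  qed
  ultimately show ?thesis using herm_solvable[of s S2 "mv s S v"] by (simp add: S2)
qed

lemma closed_Collect_ball:
  assumes "\<And>i. i \<in> I \<Longrightarrow> closed {x. P i x}"
  shows "closed {x. \<forall>i\<in>I. P i x}"
proof -
  have "{x. \<forall>i\<in>I. P i x} = (\<Inter>i\<in>I. {x. P i x})" by auto
  then show ?thesis using assms by (simp add: closed_INT)
qed

text \<open>Vectors are functions on all of \<open>nat\<close>, compared in the product topology.
  With the coordinates from \<open>s\<close> on set to zero, unit vectors lie in a compact
  box.\<close>

lemma compact_unit_sphere_subset:
  fixes s :: nat
  assumes "\<And>v. v \<in> \<Omega> \<Longrightarrow> (\<Sum>i<s. (cmod (v i))\<^sup>2) = 1 \<and> (\<forall>i\<ge>s. v i = 0)" "closed \<Omega>"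
  shows "compact \<Omega>"
proof -
  have "compact {f::nat \<Rightarrow> complex. \<forall>i. f i \<in> cball 0 1}"
    by (rule compact_box) simp
  moreover have "\<Omega> \<subseteq> {f. \<forall>i. f i \<in> cball 0 1}"
  proof (intro subsetI CollectI allI)
    fix v i assume v: "v \<in> \<Omega>"
    have "(cmod (v i))\<^sup>2 \<le> 1"
    proof (cases "i < s")
      case True
      have "(cmod (v i))\<^sup>2 \<le> (\<Sum>i<s. (cmod (v i))\<^sup>2)"
        by (rule member_le_sum) (use True in auto)
      then show ?thesis using assms(1)[OF v] by simp
    qed (use assms(1)[OF v] in auto)
    then show "v i \<in> cball 0 1" by (simp add: abs_square_le_1)
  qed
  ultimately show ?thesis using assms(2) closed_Int_compact[of \<Omega>] by (metis Int_absorb2)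
qed

text \<open>The number \<open>l\<close> is the maximum of the quotient of \<open>T3\<close> by
  \<open>S\<close> on the kernel of \<open>T2\<close>. As \<open>S\<close> may be singular, the
  quotient is maximised over unit vectors orthogonal to the kernel of \<open>S\<close>, where it is
  continuous.\<close>

lemma exists_top_eigenvector:
  assumes q: "quad s T1 T2 T3 T4" and S: "S = (\<lambda>i j. T1 i j + T2 i j)"
    and v0: "\<forall>i<s. mv s T2 v0 i = 0" "\<not> (\<forall>i<s. mv s S v0 i = 0)"
  shows "\<exists>v l. (\<forall>i<s. mv s T2 v i = 0) \<and> qf s S v > 0 \<and> qf s T3 v = l * qf s S v \<and>
    (\<forall>m. (\<forall>i<s. mv s T2 m i = 0) \<longrightarrow> qf s T3 m \<le> l * qf s S m)"
proof -
  have psd: "hermitian_psd s T1" "hermitian_psd s T2" "hermitian_psd s T3" "hermitian_psd s T4"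
    using q by (auto simp: quad_def)
  have psdS: "hermitian_psd s S" unfolding S using psd by (intro hermitian_psd_add)
  then have hS: "herm s S" by (simp add: hermitian_psd_iff)
  have qS: "qf s S x = qf s T1 x + qf s T2 x" for x by (simp add: S qf_add)
  note nn = quad_nonneg[OF q]
  define \<Omega> where "\<Omega> = {v. (\<forall>i\<in>{s..}. v i = 0) \<and> (\<Sum>i<s. (cmod (v i))\<^sup>2) = 1 \<and>
    (\<forall>i\<in>{..<s}. mv s T2 v i = 0) \<and> (\<forall>k\<in>{k. \<forall>i<s. mv s S k i = 0}. dp s k v = 0)}"
  have id: "continuous_on UNIV (\<lambda>v::nat \<Rightarrow> complex. v)" by (rule continuous_on_id)
  have "closed \<Omega>"
    unfolding \<Omega>_def
    by (intro closed_Collect_conj closed_Collect_ball closed_Collect_eq continuous_on_sum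
        continuous_on_power continuous_on_norm continuous_on_eval[OF id] continuous_on_const
        continuous_on_mv continuous_on_dp id)
  then have "compact \<Omega>"
    by (rule compact_unit_sphere_subset[rotated, where s = s]) (auto simp: \<Omega>_def)
  have pos: "qf s S v > 0" if "v \<in> \<Omega>" for v
  proof (rule ccontr)
    assume "\<not> qf s S v > 0"
    then have "qf s S v = 0" using psdS by (simp add: hermitian_psd_iff order_less_le)
    then have "dp s v v = 0" using that by (auto simp: \<Omega>_def psd_null_iff[OF psdS])
    then show False using that by (auto simp: \<Omega>_def dp_self_eq_0)
  qed
  have lift: "\<exists>w\<in>\<Omega>. \<exists>c>0. qf s S m = c * qf s S w \<and> qf s T3 m = c * qf s T3 w"
    if m: "\<forall>i<s. mv s T2 m i = 0" "\<not> (\<forall>i<s. mv s S m i = 0)" for m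
  proof -
    obtain w0 where w0: "\<forall>i<s. mv s S (mv s S w0) i = mv s S m i"
      using range_representative[OF hS] by blast
    define w1 where "w1 = (\<lambda>i. if i < s then mv s S w0 i else 0)"
    have Sw1: "\<forall>i<s. mv s S w1 i = mv s S m i" using w0 by (simp add: w1_def mv_def)
    have perp: "dp s k w1 = 0" if "\<forall>i<s. mv s S k i = 0" for k
      using dp_perp_kernel[OF hS that, of w0] by (simp add: w1_def dp_def)
    \<comment> \<open>\<open>S\<close> kills \<open>d\<close>, and \<open>T2\<close> and
      \<open>T3\<close> lie below \<open>S = T1 + T2 = T3 + T4\<close>, so they kill
      \<open>d\<close> too. Replacing \<open>m\<close> by \<open>w1\<close> therefore changes none
      of the three forms.\<close>
    define d where "d = (\<lambda>i. w1 i + (-1) * m i)"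
    have "mv s S d i = 0" if "i < s" for i
      using Sw1 that mv_combine[of s S 1 w1 "-1" m] by (simp add: d_def)
    then have "qf s S d = 0" by (simp add: psd_null_iff[OF psdS])
    then have d0: "qf s T2 d = 0" "qf s T3 d = 0"
      using nn[of d] qS[of d] by linarith+
    have same: "\<forall>i<s. mv s T w1 i = mv s T m i" if "hermitian_psd s T" "qf s T d = 0" for T
      using that(2) mv_combine[of s T 1 w1 "-1" m] unfolding psd_null_iff[OF that(1)] by (simp add: d_def)
    have sameq: "qf s T w1 = qf s T m" if T: "hermitian_psd s T" "qf s T d = 0" for T
    proof -
      have hT: "herm s T" using T by (simp add: hermitian_psd_iff)
      have "dp s w1 (mv s T w1) = dp s w1 (mv s T m)"
        using same[OF T] by (intro dp_cong_right) auto
      also have "\<dots> = dp s (mv s T w1) m" by (simp add: dp_mv_swap[OF hT])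
      also have "\<dots> = dp s (mv s T m) m" using same[OF T] by (simp add: dp_def)
      also have "\<dots> = dp s m (mv s T m)" by (simp add: dp_mv_swap[OF hT])
      finally show ?thesis by (simp add: qf_def)
    qed
    define n where "n = (\<Sum>i<s. (cmod (w1 i))\<^sup>2)"
    have "n \<noteq> 0"
    proof
      assume "n = 0"
      then have "\<forall>i<s. w1 i = 0" unfolding n_def by (subst (asm) sum_nonneg_eq_0_iff) auto
      then have "\<forall>i<s. mv s S w1 i = 0" by (simp add: mv_def)
      then show False using Sw1 m(2) by simp
    qed
    moreover have "n \<ge> 0" unfolding n_def by (intro sum_nonneg) auto
    ultimately have n: "n > 0" by simp
    define w where "w = (\<lambda>i. complex_of_real (1 / sqrt n) * w1 i)"
    have mvw: "mv s T w i = complex_of_real (1 / sqrt n) * mv s T w1 i" for T i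
      by (simp add: w_def mv_def sum_distrib_left mult.left_commute)
    have "w \<in> \<Omega>"
    proof -
      have "(\<Sum>i<s. (cmod (w i))\<^sup>2) = (1 / n) * (\<Sum>i<s. (cmod (w1 i))\<^sup>2)"
        using n by (simp add: w_def norm_mult norm_divide power_mult_distrib sum_divide_distrib power_divide)
      then have "(\<Sum>i<s. (cmod (w i))\<^sup>2) = 1" using n by (simp flip: n_def)
      moreover have "\<forall>i<s. mv s T2 w i = 0" using same[OF psd(2) d0(1)] m(1) by (simp add: mvw)
      moreover have "dp s k w = 0" if "\<forall>i<s. mv s S k i = 0" for k
        unfolding w_def dp_scale_right using perp[OF that] by simp
      ultimately show ?thesis by (simp add: \<Omega>_def w_def w1_def)
    qed
    moreover have "qf s T w1 = n * qf s T w" for T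
      unfolding w_def qf_scale_vec using n by (simp add: norm_divide power_divide)
    ultimately show ?thesis
      using n sameq[OF psdS \<open>qf s S d = 0\<close>] sameq[OF psd(3) d0(2)] by metis
  qed
  have "\<Omega> \<noteq> {}" using lift[OF v0] by blast
  moreover have "continuous_on \<Omega> (\<lambda>v. qf s T3 v / qf s S v)"
    by (intro continuous_on_divide continuous_on_qf continuous_on_id continuous_on_const)
      (use pos in fastforce)
  ultimately obtain v where v: "v \<in> \<Omega>"
    "\<And>w. w \<in> \<Omega> \<Longrightarrow> qf s T3 w / qf s S w \<le> qf s T3 v / qf s S v"
    using continuous_attains_sup[OF \<open>compact \<Omega>\<close>] by blast
  define l where "l = qf s T3 v / qf s S v"
  have top: "qf s T3 m \<le> l * qf s S m" if m: "\<forall>i<s. mv s T2 m i = 0" for m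
  proof (cases "\<forall>i<s. mv s S m i = 0")
    case True
    then have "qf s S m = 0" by (simp add: psd_null_iff[OF psdS])
    then show ?thesis using nn[of m] qS[of m] by simp
  next
    case False
    then obtain w c where w: "w \<in> \<Omega>" "c > 0" "qf s S m = c * qf s S w" "qf s T3 m = c * qf s T3 w"
      using lift[OF m] by blast
    have "qf s T3 w \<le> l * qf s S w"
      using v(2)[OF w(1)] pos[OF w(1)] by (simp add: l_def pos_divide_le_eq)
    then show ?thesis using w by (simp add: mult.left_commute)
  qed
  show ?thesis
    by (rule exI[of _ v], rule exI[of _ l]) (use v(1) pos[OF v(1)] top in \<open>auto simp: \<Omega>_def l_def\<close>)
qed

text \<open>Let \<open>v\<close> maximise the quotient of \<open>T3\<close> by \<open>S\<close> on
  the kernel of \<open>T2\<close>, with maximum \<open>l\<close>. The first-order condition says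
  that \<open>y = T3 v - l S v\<close> is orthogonal to the kernel of \<open>T2\<close>, hence in
  the range of \<open>T2\<close>, while \<open>S v = T1 v\<close> is in the range of
  \<open>T1\<close>. With \<open>c = sqrt l\<close> and \<open>r = sqrt (1 - l)\<close>, the vector
  \<open>x = c r S v\<close> gives \<open>c x + r y = r T3 v\<close> and
  \<open>c y - r x = - c T4 v\<close>.\<close>

lemma degenerate_peelable:
  assumes q: "quad s T1 T2 T3 T4"
    and v0: "\<forall>i<s. mv s T2 v0 i = 0" "\<not> (\<forall>i<s. mv s (\<lambda>i j. T1 i j + T2 i j) v0 i = 0)"
  shows "peelable s T1 T2 T3 T4"
proof -
  define S where "S = (\<lambda>i j. T1 i j + T2 i j)"
  have psd: "hermitian_psd s T1" "hermitian_psd s T2" "hermitian_psd s T3" "hermitian_psd s T4"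
    using q by (auto simp: quad_def)
  have hS: "herm s S" and psdS: "hermitian_psd s S"
    using hermitian_psd_add[OF psd(1,2)] by (simp_all add: S_def hermitian_psd_iff)
  have h3: "herm s T3" using psd(3) by (simp add: hermitian_psd_iff)
  have qS: "qf s S x = qf s T1 x + qf s T2 x" for x by (simp add: S_def qf_add)
  note nn = quad_nonneg[OF q]
  obtain v l where v: "\<forall>i<s. mv s T2 v i = 0" "qf s S v > 0" and l: "qf s T3 v = l * qf s S v"
    and top: "\<And>m. \<forall>i<s. mv s T2 m i = 0 \<Longrightarrow> qf s T3 m \<le> l * qf s S m"
    using exists_top_eigenvector[OF q S_def v0(1) v0(2)[folded S_def]] by blast
  define D where "D = (\<lambda>i j. complex_of_real l * S i j - T3 i j)"
  have hD: "herm s D" by (rule hermI) (simp add: D_def hermD[OF hS] hermD[OF h3])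
  have qD: "qf s D x = l * qf s S x - qf s T3 x" for x
    unfolding D_def by (simp add: qf_diff qf_scale)
  have mvD: "mv s D x i = complex_of_real l * mv s S x i - mv s T3 x i" for x i
    unfolding D_def by (simp add: mv_diff_matrix mv_scale_matrix)
  define y where "y = (\<lambda>i. mv s T3 v i - complex_of_real l * mv s S v i)"
  have "dp s k y = 0" if k: "\<forall>i<s. mv s T2 k i = 0" for k
  proof -
    have "dp s v (mv s D k) = 0"
    proof (rule null_vector_orthogonal[OF hD])
      show "qf s D v = 0" by (simp add: qD l)
      show "0 \<le> qf s D (\<lambda>i. v i + t * k i)" for t
        using top[of "\<lambda>i. v i + t * k i"] mv_combine[of s T2 1 v t k] v(1) k by (simp add: qD)
    qed
    then have "dp s k (mv s D v) = 0"
      using dp_cnj[of s "mv s D k" v] dp_cnj[of s v "mv s D k"] dp_mv_swap[OF hD] by (metis complex_cnj_zero)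
    moreover have "y = (\<lambda>i. (-1) * mv s D v i)" by (simp add: y_def mvD)
    ultimately show ?thesis using dp_scale_right[of s k "-1" "mv s D v"] by simp
  qed
  then have domy: "dominated s T2 y" by (rule dominated_perp_kernel[OF psd(2)])
  have S1: "mv s S v i = mv s T1 v i" if "i < s" for i
    using v(1) that by (simp add: S_def mv_add_matrix)
  have S34: "mv s S v i = mv s T3 v i + mv s T4 v i" if "i < s" for i
  proof -
    have "mv s S v i = mv s (\<lambda>i j. T3 i j + T4 i j) v i"
      by (rule mv_cong_matrix) (use q that in \<open>auto simp: quad_def S_def\<close>)
    then show ?thesis by (simp add: mv_add_matrix)
  qed
  have domS: "dominated s T1 (mv s S v)"
    by (rule dominated_cong[OF dominated_mv[OF psd(1)]]) (simp add: S1)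
  have ne: "\<exists>i<s. mv s S v i \<noteq> 0" using v(2) psd_null_iff[OF psdS, of v] by auto
  have l01: "0 \<le> l" "l \<le> 1"
  proof -
    have "0 \<le> l * qf s S v" "l * qf s S v \<le> 1 * qf s S v" using nn[of v] qS[of v] l by linarith+
    then show "0 \<le> l" "l \<le> 1" using v(2) by (simp_all add: zero_le_mult_iff mult_le_cancel_right)
  qed
  \<comment> \<open>For \<open>l\<close> equal to 0 or 1 the product \<open>c * r\<close> vanishes
    and \<open>x\<close> with it. There \<open>v\<close> is killed by \<open>T3\<close> or by
    \<open>T4\<close>, and \<open>x = S v\<close>, \<open>y = 0\<close> works.\<close>
  consider "l = 0" | "l = 1" | "0 < l" "l < 1" using l01 by fastforce
  then show ?thesis
  proof cases
    case 1
    then have "\<forall>i<s. mv s T3 v i = 0" using l by (simp add: psd_null_iff[OF psd(3)])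
    then have "dominated s T4 (mv s S v)"
      by (intro dominated_cong[OF dominated_mv[OF psd(4)]]) (simp add: S34)
    then have "dominated s T4 (\<lambda>i. of_real 0 * 0 - of_real 1 * mv s S v i)"
      using dominated_scale[of s T4 _ "-1"] by fastforce
    moreover have "dominated s T3 (\<lambda>i. of_real 0 * mv s S v i + of_real 1 * 0)"
      by (simp add: dominated_zero)
    moreover have "(0::real)\<^sup>2 + 1\<^sup>2 = 1" by simp
    ultimately show ?thesis
      unfolding peelable_def using domS dominated_zero[of s T2] ne by blast
  next
    case 2
    then have "qf s T4 v = 0" using l nn(1)[of v] qS[of v] by simp
    then have "\<forall>i<s. mv s T4 v i = 0" by (simp add: psd_null_iff[OF psd(4)])
    then have "dominated s T3 (mv s S v)"
      by (intro dominated_cong[OF dominated_mv[OF psd(3)]]) (simp add: S34)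
    then have "dominated s T3 (\<lambda>i. of_real 1 * mv s S v i + of_real 0 * 0)" by simp
    moreover have "dominated s T4 (\<lambda>i. of_real 1 * 0 - of_real 0 * mv s S v i)"
      by (simp add: dominated_zero)
    moreover have "(1::real)\<^sup>2 + 0\<^sup>2 = 1" by simp
    ultimately show ?thesis
      unfolding peelable_def using domS dominated_zero[of s T2] ne by blast
  next
    case 3
    define c r where "c = sqrt l" and "r = sqrt (1 - l)"
    have cr: "c\<^sup>2 = l" "r\<^sup>2 = 1 - l" "c > 0" "r > 0" using 3 by (simp_all add: c_def r_def)
    have lc: "complex_of_real l = of_real c * of_real c"
      using cr(1) by (metis of_real_mult power2_eq_square)
    have lr: "complex_of_real r * of_real r = 1 - of_real l"
      using cr(2) by (metis of_real_mult of_real_diff of_real_1 power2_eq_square)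
    define x where "x = (\<lambda>i. of_real (c * r) * mv s S v i)"
    have "dominated s T1 x" unfolding x_def by (rule dominated_scale[OF domS])
    moreover have "dominated s T3 (\<lambda>i. of_real c * x i + of_real r * y i)"
    proof -
      have "of_real c * x i + of_real r * y i = of_real r * mv s T3 v i" for i
        by (simp add: x_def y_def lc algebra_simps)
      then show ?thesis using dominated_scale[OF dominated_mv[OF psd(3)]] by simp
    qed
    moreover have "dominated s T4 (\<lambda>i. of_real c * y i - of_real r * x i)"
    proof (rule dominated_cong)
      show "dominated s T4 (\<lambda>i. (- of_real c) * mv s T4 v i)"
        by (rule dominated_scale[OF dominated_mv[OF psd(4)]])
      fix i assume "i < s"
      have "of_real c * y i - of_real r * x i =
          of_real c * (mv s T3 v i - of_real l * mv s S v i) - of_real c * (of_real r * of_real r) * mv s S v i"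
        by (simp add: x_def y_def algebra_simps)
      also have "\<dots> = - of_real c * mv s T4 v i"
        unfolding lr using S34[OF \<open>i < s\<close>] by (simp add: algebra_simps)
      finally show "(- of_real c) * mv s T4 v i = of_real c * y i - of_real r * x i" by simp
    qed
    moreover have "\<exists>i<s. x i \<noteq> 0 \<or> y i \<noteq> 0" using ne cr by (auto simp: x_def)
    moreover have "c\<^sup>2 + r\<^sup>2 = 1" using cr by simp
    ultimately show ?thesis unfolding peelable_def using domy by blast
  qed
qed

lemma quad_swap12: "quad s T1 T2 T3 T4 \<Longrightarrow> quad s T2 T1 T3 T4"
  by (simp add: quad_def add.commute)

lemma quad_swap_pairs: "quad s T1 T2 T3 T4 \<Longrightarrow> quad s T3 T4 T1 T2"
  by (simp add: quad_def)

text \<open>If one of the four matrices kills a vector that \<open>S\<close> does not, the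
  degenerate case applies after a symmetry. Otherwise all their kernels lie in that of
  \<open>S\<close>, so \<open>S v\<close> is in the range of \<open>T1\<close> and of
  \<open>T3\<close>, and \<open>x = S v\<close>, \<open>y = 0\<close>, \<open>c = 1\<close>,
  \<open>r = 0\<close> will do.\<close>

lemma quad_peelable:
  assumes q: "quad s T1 T2 T3 T4"
    and v: "\<not> (\<forall>i<s. mv s (\<lambda>i j. T1 i j + T2 i j) v i = 0)"
  shows "peelable s T1 T2 T3 T4"
proof -
  define S where "S = (\<lambda>i j. T1 i j + T2 i j)"
  have psd: "hermitian_psd s T1" "hermitian_psd s T2" "hermitian_psd s T3" "hermitian_psd s T4"
    using q by (auto simp: quad_def)
  have hS: "herm s S"
    using hermitian_psd_add[OF psd(1,2)] by (simp_all add: S_def hermitian_psd_iff)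
  have S21: "(\<lambda>i j. T2 i j + T1 i j) = S" by (simp add: S_def add.commute)
  have S34: "mv s (\<lambda>i j. T3 i j + T4 i j) k i = mv s S k i" if "i < s" for k i
    by (rule mv_cong_matrix) (use q that in \<open>auto simp: quad_def S_def\<close>)
  then have S43: "mv s (\<lambda>i j. T4 i j + T3 i j) k i = mv s S k i" if "i < s" for k i
    using that by (simp add: add.commute)
  show ?thesis
  proof (cases "\<exists>T\<in>{T1,T2,T3,T4}. \<exists>k. (\<forall>i<s. mv s T k i = 0) \<and> \<not> (\<forall>i<s. mv s S k i = 0)")
    case True
    then obtain k T where k: "\<not> (\<forall>i<s. mv s S k i = 0)" "\<forall>i<s. mv s T k i = 0"
      and T: "T = T1 \<or> T = T2 \<or> T = T3 \<or> T = T4" by auto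
    from T show ?thesis
    proof (elim disjE)
      assume T': "T = T1"
      show ?thesis
        by (rule peelable_swap12[OF degenerate_peelable[OF quad_swap12[OF q], of k]]) (use k T' in \<open>simp_all add: S21\<close>)
    next
      assume T': "T = T2"
      show ?thesis
        by (rule degenerate_peelable[OF q, of k]) (use k T' in \<open>simp_all add: S_def\<close>)
    next
      assume T': "T = T3"
      show ?thesis
        by (rule peelable_swap_pairs[OF peelable_swap12[OF
            degenerate_peelable[OF quad_swap12[OF quad_swap_pairs[OF q]], of k]]]) (use k T' S43 in \<open>simp_all\<close>)
    next
      assume T': "T = T4"
      show ?thesis
        by (rule peelable_swap_pairs[OF
            degenerate_peelable[OF quad_swap_pairs[OF q], of k]]) (use k T' S34 in \<open>simp_all\<close>)
    qed
  next
    case False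
    have "dominated s T (mv s S v)" if "T \<in> {T1, T3}" "hermitian_psd s T" for T
      by (rule dominated_perp_kernel[OF that(2)]) (use False that(1) dp_perp_kernel[OF hS] in blast)
    then have "dominated s T1 (mv s S v)" "dominated s T3 (mv s S v)" using psd by auto
    then have "dominated s T1 (mv s S v)" "dominated s T3 (\<lambda>i. of_real 1 * mv s S v i + of_real 0 * 0)"
      by simp_all
    moreover have "dominated s T4 (\<lambda>i. of_real 1 * 0 - of_real 0 * mv s S v i)"
      by (simp add: dominated_zero)
    moreover have "(1::real)\<^sup>2 + 0\<^sup>2 = 1" by simp
    moreover have "\<exists>i<s. mv s S v i \<noteq> 0" using v by (simp add: S_def)
    ultimately show ?thesis
      unfolding peelable_def using dominated_zero[of s T2] by blast
  qed
qed

section \<open>Trace pairing, traces and compact sets of positive matrices\<close>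

definition outer :: "(nat \<Rightarrow> complex) \<Rightarrow> nat \<Rightarrow> nat \<Rightarrow> complex" where
  "outer x = (\<lambda>i j. x i * cnj (x j))"

definition ip :: "nat \<Rightarrow> (nat \<Rightarrow> nat \<Rightarrow> complex) \<Rightarrow> (nat \<Rightarrow> nat \<Rightarrow> complex) \<Rightarrow> real" where
  "ip s A B = (\<Sum>i<s. \<Sum>j<s. Re (A i j * cnj (B i j)))"

definition retr :: "nat \<Rightarrow> (nat \<Rightarrow> nat \<Rightarrow> complex) \<Rightarrow> real" where
  "retr s A = (\<Sum>i<s. Re (A i i))"

lemma qf_outer: "qf s (outer x) z = (cmod (dp s x z))\<^sup>2"
proof -
  have "mv s (outer x) z = (\<lambda>i. dp s x z * x i)"
    by (simp add: mv_def outer_def dp_def sum_distrib_left sum_distrib_right algebra_simps)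
  then have "dp s z (mv s (outer x) z) = dp s x z * dp s z x"
    by (simp add: dp_scale_right)
  also have "\<dots> = complex_of_real ((cmod (dp s x z))\<^sup>2)"
    using dp_cnj[of s x z] by (metis complex_norm_square)
  finally show ?thesis by (simp add: qf_def)
qed

lemma hermitian_psd_outer: "hermitian_psd s (outer x)"
proof -
  have "herm s (outer x)" by (rule hermI) (simp add: outer_def)
  then show ?thesis by (simp add: hermitian_psd_iff qf_outer)
qed

lemma ip_outer: "ip s (outer x) A = qf s A x"
proof -
  have "cnj (dp s x (mv s A x)) = (\<Sum>i<s. \<Sum>j<s. outer x i j * cnj (A i j))"
    by (simp add: dp_def mv_def outer_def sum_distrib_left algebra_simps)
  then have "Re (dp s x (mv s A x)) = Re (\<Sum>i<s. \<Sum>j<s. outer x i j * cnj (A i j))"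
    by (metis complex_cnj(1) cnj.sel(1))
  then show ?thesis by (simp add: qf_def ip_def)
qed

lemma ip_commute: "ip s A B = ip s B A"
  by (simp add: ip_def algebra_simps)

lemma ip_add_left: "ip s (\<lambda>i j. A i j + B i j) C = ip s A C + ip s B C"
  by (simp add: ip_def algebra_simps sum.distrib)

lemma ip_diff_left: "ip s (\<lambda>i j. A i j - B i j) C = ip s A C - ip s B C"
  by (simp add: ip_def algebra_simps sum.distrib sum_subtractf)

lemma ip_scale_left: "ip s (\<lambda>i j. of_real c * A i j) C = c * ip s A C"
  by (simp add: ip_def algebra_simps sum_distrib_left)

lemma ip_add_right: "ip s C (\<lambda>i j. A i j + B i j) = ip s C A + ip s C B"
  by (simp add: ip_def algebra_simps sum.distrib)

lemma ip_diff_right: "ip s C (\<lambda>i j. A i j - B i j) = ip s C A - ip s C B"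
  by (simp add: ip_def algebra_simps sum.distrib sum_subtractf)

lemma ip_scale_right: "ip s C (\<lambda>i j. of_real c * A i j) = c * ip s C A"
  by (simp add: ip_def algebra_simps sum_distrib_left)

lemma ip_cong:
  assumes "\<And>i j. i < s \<Longrightarrow> j < s \<Longrightarrow> A i j = A' i j" "\<And>i j. i < s \<Longrightarrow> j < s \<Longrightarrow> B i j = B' i j"
  shows "ip s A B = ip s A' B'"
  using assms by (simp add: ip_def)

lemma ip_self: "ip s A A = (\<Sum>i<s. \<Sum>j<s. (cmod (A i j))\<^sup>2)"
  unfolding ip_def by (intro sum.cong refl) (unfold cmod_power2, simp add: power2_eq_square)

lemma ip_self_nonneg: "0 \<le> ip s A A"
  unfolding ip_self by (intro sum_nonneg) auto

lemma ip_self_entry: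
  assumes "i < s" "j < s"
  shows "(cmod (A i j))\<^sup>2 \<le> ip s A A"
proof -
  have "(cmod (A i j))\<^sup>2 \<le> (\<Sum>j<s. (cmod (A i j))\<^sup>2)"
    by (rule member_le_sum) (use assms in auto)
  also have "\<dots> \<le> ip s A A"
    unfolding ip_self by (rule member_le_sum[where f = "\<lambda>i. \<Sum>j<s. (cmod (A i j))\<^sup>2"])
      (use assms in \<open>auto intro: sum_nonneg\<close>)
  finally show ?thesis .
qed

lemma retr_add: "retr s (\<lambda>i j. A i j + B i j) = retr s A + retr s B"
  by (simp add: retr_def sum.distrib)

lemma retr_diff: "retr s (\<lambda>i j. A i j - B i j) = retr s A - retr s B"
  by (simp add: retr_def sum_subtractf)

lemma retr_scale: "retr s (\<lambda>i j. of_real c * A i j) = c * retr s A"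
  by (simp add: retr_def sum_distrib_left)

definition unitv :: "nat \<Rightarrow> nat \<Rightarrow> complex" where
  "unitv i = (\<lambda>k. if k = i then 1 else 0)"

lemma dp_unitv: "i < s \<Longrightarrow> dp s (unitv i) x = x i"
proof -
  have "dp s (unitv i) x = (\<Sum>k<s. if k = i then x k else 0)"
    unfolding dp_def unitv_def by (intro sum.cong) auto
  then show "i < s \<Longrightarrow> dp s (unitv i) x = x i" by simp
qed

lemma mv_unitv: "j < s \<Longrightarrow> mv s A (unitv j) i = A i j"
proof -
  have "mv s A (unitv j) i = (\<Sum>k<s. if k = j then A i k else 0)"
    unfolding mv_def unitv_def by (intro sum.cong) auto
  then show "j < s \<Longrightarrow> mv s A (unitv j) i = A i j" by simp
qed

lemma psd_diag_nonneg:
  assumes "hermitian_psd s T" "i < s"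
  shows "0 \<le> Re (T i i)"
proof -
  have "0 \<le> qf s T (unitv i)" using assms by (simp add: hermitian_psd_iff)
  then show ?thesis using assms by (simp add: qf_def dp_unitv mv_unitv)
qed

lemma psd_diag_le_retr:
  assumes "hermitian_psd s T" "i < s"
  shows "Re (T i i) \<le> retr s T"
  unfolding retr_def by (rule member_le_sum) (use assms psd_diag_nonneg in auto)

lemma psd_retr_nonneg: "hermitian_psd s T \<Longrightarrow> 0 \<le> retr s T"
  unfolding retr_def by (intro sum_nonneg) (auto intro: psd_diag_nonneg)

lemma psd_entry_le_retr:
  assumes T: "hermitian_psd s T" and ij: "i < s" "j < s"
  shows "cmod (T i j) \<le> retr s T"
proof -
  have "(cmod (T i j))\<^sup>2 \<le> Re (T i i) * Re (T j j)"
    using psd_cauchy_schwarz[OF T, of "unitv i" "unitv j"] ij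
    by (simp add: qf_def dp_unitv mv_unitv)
  also have "\<dots> \<le> retr s T * retr s T"
    by (intro mult_mono psd_diag_le_retr[OF T] psd_diag_nonneg[OF T] psd_retr_nonneg[OF T] ij)
  finally show ?thesis
    using psd_retr_nonneg[OF T] by (intro power2_le_imp_le[of "cmod (T i j)"]) (simp_all add: power2_eq_square)
qed

lemma hermitian_psd_scale:
  assumes "hermitian_psd s A" "0 \<le> c"
  shows "hermitian_psd s (\<lambda>i j. of_real c * A i j)"
  using assms by (auto simp: hermitian_psd_iff qf_scale intro!: hermI simp: hermD)

lemma hermitian_psd_cong:
  assumes "hermitian_psd s A" "\<And>i j. i < s \<Longrightarrow> j < s \<Longrightarrow> A i j = B i j"
  shows "hermitian_psd s B"
proof -
  have "herm s B" by (rule hermI) (use assms in \<open>auto simp: hermitian_psd_iff hermD simp flip: assms(2)\<close>)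
  moreover have "qf s B x = qf s A x" for x by (rule qf_cong) (simp add: assms(2))
  ultimately show ?thesis using assms(1) by (simp add: hermitian_psd_iff)
qed

lemma dominated_subtract:
  assumes T: "hermitian_psd s T"
    and k: "\<And>z. (cmod (dp s x z))\<^sup>2 \<le> k * qf s T z" and e: "0 \<le> e" "e * k \<le> 1"
  shows "hermitian_psd s (\<lambda>i j. T i j - of_real e * outer x i j)"
proof -
  have h: "herm s T" and nn: "0 \<le> qf s T z" for z using T by (auto simp: hermitian_psd_iff)
  have "e * (cmod (dp s x z))\<^sup>2 \<le> qf s T z" for z
  proof -
    have "e * (cmod (dp s x z))\<^sup>2 \<le> (e * k) * qf s T z"
      using mult_left_mono[OF k e(1), of z] by (simp add: mult.assoc)
    also have "\<dots> \<le> 1 * qf s T z" by (intro mult_right_mono e nn)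
    finally show ?thesis by simp
  qed
  moreover have "herm s (\<lambda>i j. T i j - of_real e * outer x i j)"
    by (rule hermI) (simp add: hermD[OF h] outer_def)
  ultimately show ?thesis
    by (simp add: hermitian_psd_iff qf_diff qf_scale qf_outer)
qed

lemma closed_Collect_psd:
  assumes "continuous_on UNIV F"
  shows "closed {p. hermitian_psd s (F p)}"
proof -
  have "{p. hermitian_psd s (F p)} = {p. (\<forall>i\<in>{..<s}. \<forall>j\<in>{..<s}. F p j i = cnj (F p i j)) \<and>
      (\<forall>x. 0 \<le> qf s (F p) x)}"
    by (auto simp: hermitian_psd_iff herm_def)
  also have "closed \<dots>"
    by (intro closed_Collect_conj closed_Collect_ball closed_Collect_all closed_Collect_eq closed_Collect_le
        continuous_on_qf continuous_on_cnj continuous_on_const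
        assms assms[THEN continuous_on_eval, THEN continuous_on_eval])
  finally show ?thesis .
qed

lemma continuous_on_ip:
  assumes "continuous_on A F"
  shows "continuous_on A (\<lambda>p. ip s (F p) B)"
  unfolding ip_def
  by (intro continuous_on_sum continuous_on_Re continuous_on_mult continuous_on_const
      assms[THEN continuous_on_eval, THEN continuous_on_eval])

lemma continuous_on_retr:
  assumes "continuous_on A F"
  shows "continuous_on A (\<lambda>p. retr s (F p))"
  unfolding retr_def
  by (intro continuous_on_sum continuous_on_Re assms[THEN continuous_on_eval, THEN continuous_on_eval])

lemma continuous_on_matrix_add_diff:
  fixes F G :: "'p::topological_space \<Rightarrow> nat \<Rightarrow> nat \<Rightarrow> complex"
  assumes "continuous_on A F" "continuous_on A G"
  shows "continuous_on A (\<lambda>p i j. F p i j + G p i j)" "continuous_on A (\<lambda>p i j. F p i j - G p i j)"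
  by (intro continuous_on_coordinatewise_then_product continuous_on_add continuous_on_diff
      assms[THEN continuous_on_eval, THEN continuous_on_eval])+

lemma compact_matrix_box: "compact {T::nat \<Rightarrow> nat \<Rightarrow> complex. \<forall>i. T i \<in> {f. \<forall>j. f j \<in> cball 0 K}}"
  by (intro compact_box compact_cball)

text \<open>Clears the entries that carry no meaning, so that a positive matrix of bounded trace
  lies in a compact box.\<close>

definition trunc :: "nat \<Rightarrow> (nat \<Rightarrow> nat \<Rightarrow> complex) \<Rightarrow> nat \<Rightarrow> nat \<Rightarrow> complex" where
  "trunc s T = (\<lambda>i j. if i < s \<and> j < s then T i j else 0)"

lemma trunc_psd: "hermitian_psd s T \<Longrightarrow> hermitian_psd s (trunc s T)"
  by (rule hermitian_psd_cong) (auto simp: trunc_def)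

lemma ip_trunc: "ip s (trunc s T) A = ip s T A"
  by (rule ip_cong) (auto simp: trunc_def)

lemma retr_trunc: "retr s (trunc s T) = retr s T"
  by (simp add: retr_def trunc_def)

lemma trunc_in_box:
  assumes "hermitian_psd s T" "retr s T \<le> K"
  shows "trunc s T \<in> {T. \<forall>i. T i \<in> {f. \<forall>j. f j \<in> cball 0 K}}"
  using psd_entry_le_retr[OF assms(1)] psd_retr_nonneg[OF assms(1)] assms(2)
  by (force simp: trunc_def intro: order_trans)

lemma retr_ge_zero_entries:
  assumes "hermitian_psd s T" "retr s T = 0" "i < s" "j < s"
  shows "T i j = 0"
  using psd_entry_le_retr[OF assms(1,3,4)] assms(2) by simp

text \<open>On rank-one quadruples the functional is nonnegative by \<open>pos\<close>. On
  quadruples of trace 1 it attains a minimum by compactness; were it negative, peeling a rank-one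
  quadruple off the minimiser would leave one of smaller trace whose value is no larger, against
  homogeneity. This takes the place of an actual decomposition into rank-one quadruples.\<close>

theorem quad_functional_nonneg:
  assumes pos: "\<And>x y (c::real) (r::real). c\<^sup>2 + r\<^sup>2 = 1 \<Longrightarrow>
      0 \<le> qf s A1 x + qf s A2 y + qf s B (\<lambda>i. of_real c * x i + of_real r * y i)"
    and q: "quad s T1 T2 T3 T4"
  shows "0 \<le> ip s T1 A1 + ip s T2 A2 + ip s T3 B"
proof -
  define f where "f = (\<lambda>T1 T2 T3. ip s T1 A1 + ip s T2 A2 + ip s T3 B)"
  define Box where "Box = {T::nat \<Rightarrow> nat \<Rightarrow> complex. \<forall>i. T i \<in> {f. \<forall>j. f j \<in> cball 0 1}}"
  \<comment> \<open>The fourth matrix is encoded as \<open>T1 + T2 - T3\<close>, and the trace is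
    normalised through \<open>T1 + T2\<close>.\<close>
  define \<Omega> where "\<Omega> = {p. hermitian_psd s (fst p) \<and> hermitian_psd s (fst (snd p)) \<and>
      hermitian_psd s (snd (snd p)) \<and>
      hermitian_psd s (\<lambda>i j. (fst p i j + fst (snd p) i j) - snd (snd p) i j) \<and>
      retr s (fst p) + retr s (fst (snd p)) = 1} \<inter> (Box \<times> Box \<times> Box)"
  have c1: "continuous_on UNIV (\<lambda>p::(nat \<Rightarrow> nat \<Rightarrow> complex) \<times> (nat \<Rightarrow> nat \<Rightarrow> complex) \<times> (nat \<Rightarrow> nat \<Rightarrow> complex). fst p)"
    and c2: "continuous_on UNIV (\<lambda>p::(nat \<Rightarrow> nat \<Rightarrow> complex) \<times> (nat \<Rightarrow> nat \<Rightarrow> complex) \<times> (nat \<Rightarrow> nat \<Rightarrow> complex). fst (snd p))"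
    and c3: "continuous_on UNIV (\<lambda>p::(nat \<Rightarrow> nat \<Rightarrow> complex) \<times> (nat \<Rightarrow> nat \<Rightarrow> complex) \<times> (nat \<Rightarrow> nat \<Rightarrow> complex). snd (snd p))"
    by (intro continuous_intros)+
  have "closed {p. hermitian_psd s (fst p) \<and> hermitian_psd s (fst (snd p)) \<and>
      hermitian_psd s (snd (snd p)) \<and>
      hermitian_psd s (\<lambda>i j. (fst p i j + fst (snd p) i j) - snd (snd p) i j) \<and>
      retr s (fst p) + retr s (fst (snd p)) = 1}"
    by (intro closed_Collect_conj closed_Collect_psd closed_Collect_eq continuous_on_retr
        continuous_on_matrix_add_diff c1 c2 c3 continuous_on_add continuous_on_const)
  moreover have "compact (Box \<times> Box \<times> Box)"
    unfolding Box_def by (intro compact_Times compact_matrix_box)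
  ultimately have comp: "compact \<Omega>" unfolding \<Omega>_def by (rule closed_Int_compact)
  have cont: "continuous_on \<Omega> (\<lambda>p. f (fst p) (fst (snd p)) (snd (snd p)))"
    unfolding f_def
    by (intro continuous_on_add continuous_on_ip continuous_on_subset[OF c1] continuous_on_subset[OF c2]
        continuous_on_subset[OF c3] subset_UNIV)
  define tr where "tr = (\<lambda>T1 T2. retr s T1 + retr s T2)"
  have tr_nonneg: "0 \<le> tr T1 T2" if "quad s T1 T2 T3 T4" for T1 T2 T3 T4
    using that psd_retr_nonneg by (auto simp: quad_def tr_def)
  have normalise: "\<exists>p\<in>\<Omega>. f T1 T2 T3 = tr T1 T2 * f (fst p) (fst (snd p)) (snd (snd p))"
    if q: "quad s T1 T2 T3 T4" and t: "tr T1 T2 > 0" for T1 T2 T3 T4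
  proof -
    define t where "t = 1 / tr T1 T2"
    define N where "N = (\<lambda>T. trunc s (\<lambda>i j. of_real t * T i j))"
    have t0: "t > 0" "t * tr T1 T2 = 1" using t by (simp_all add: t_def)
    have psdN: "hermitian_psd s (N T)" if "hermitian_psd s T" for T
      unfolding N_def using that t0 by (intro trunc_psd hermitian_psd_scale) auto
    have retrN: "retr s (N T) = t * retr s T" for T
      by (simp add: N_def retr_trunc retr_scale)
    have ipN: "ip s (N T) A = t * ip s T A" for T A
      by (simp add: N_def ip_trunc ip_scale_left)
    have psd: "hermitian_psd s T1" "hermitian_psd s T2" "hermitian_psd s T3" "hermitian_psd s T4"
      using q by (auto simp: quad_def)
    have sum: "retr s (N T1) + retr s (N T2) = 1"
      using t0 by (simp add: retrN tr_def algebra_simps)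
    have "retr s T1 + retr s T2 = retr s T3 + retr s T4"
      using q by (simp add: quad_def retr_def flip: sum.distrib Re_sum plus_complex.sel)
    then have sum': "retr s (N T3) + retr s (N T4) = 1"
      using t0 by (simp add: retrN tr_def flip: distrib_left)
    have le: "retr s (N T1) \<le> 1" "retr s (N T2) \<le> 1" "retr s (N T3) \<le> 1"
      using sum sum' psd_retr_nonneg[OF psdN[OF psd(1)]] psd_retr_nonneg[OF psdN[OF psd(2)]]
        psd_retr_nonneg[OF psdN[OF psd(4)]] by linarith+
    have box: "N T \<in> Box" if "hermitian_psd s T" "retr s (N T) \<le> 1" for T
    proof -
      have "trunc s (N T) \<in> Box"
        unfolding Box_def by (rule trunc_in_box[OF psdN]) (use that in auto)
      moreover have "trunc s (N T) = N T" by (auto simp: N_def trunc_def fun_eq_iff)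
      ultimately show ?thesis by simp
    qed
    have "hermitian_psd s (\<lambda>i j. (N T1 i j + N T2 i j) - N T3 i j)"
    proof (rule hermitian_psd_cong[OF psdN[OF psd(4)]])
      fix i j assume ij: "i < s" "j < s"
      then have "T4 i j = T1 i j + T2 i j - T3 i j" using q by (simp add: quad_def eq_diff_eq add.commute)
      from this show "N T4 i j = (N T1 i j + N T2 i j) - N T3 i j"
        using ij by (simp add: N_def trunc_def right_diff_distrib distrib_left)
    qed
    then have "(N T1, N T2, N T3) \<in> \<Omega>"
      using psdN psd sum box le by (simp add: \<Omega>_def)
    moreover have "f T1 T2 T3 = tr T1 T2 * f (N T1) (N T2) (N T3)"
    proof -
      have "tr T1 T2 * f (N T1) (N T2) (N T3) = (t * tr T1 T2) * f T1 T2 T3"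
        by (simp add: f_def ipN algebra_simps)
      then show ?thesis using t0 by simp
    qed
    ultimately show ?thesis by force
  qed
  show ?thesis
  proof (rule ccontr)
    assume neg: "\<not> ?thesis"
    have "tr T1 T2 \<noteq> 0"
    proof
      assume "tr T1 T2 = 0"
      then have "retr s T1 = 0" "retr s T2 = 0"
        using q psd_retr_nonneg[of s T1] psd_retr_nonneg[of s T2] by (auto simp: tr_def quad_def)
      then have z: "T1 i j = 0" "T2 i j = 0" if "i < s" "j < s" for i j
        using q that retr_ge_zero_entries by (auto simp: quad_def)
      have p34: "hermitian_psd s T3" "hermitian_psd s T4" using q by (auto simp: quad_def)
      have "T3 i i = - T4 i i" if "i < s" for i
      proof -
        have "T1 i i + T2 i i = T3 i i + T4 i i" using q that by (simp add: quad_def)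
        then show ?thesis using z[OF that that] by (simp add: eq_neg_iff_add_eq_0)
      qed
      then have "retr s T3 = - retr s T4" by (simp add: retr_def sum_negf)
      then have "retr s T3 = 0" using psd_retr_nonneg[OF p34(1)] psd_retr_nonneg[OF p34(2)] by simp
      then have "T3 i j = 0" if "i < s" "j < s" for i j
        using retr_ge_zero_entries[OF p34(1)] that by auto
      then show False using neg z by (simp add: ip_def)
    qed
    then have "tr T1 T2 > 0" using tr_nonneg[OF q] by simp
    then obtain p where p: "p \<in> \<Omega>" "f T1 T2 T3 = tr T1 T2 * f (fst p) (fst (snd p)) (snd (snd p))"
      using normalise[OF q] by blast
    then have "f (fst p) (fst (snd p)) (snd (snd p)) < 0"
      using neg \<open>tr T1 T2 > 0\<close> by (auto simp: f_def not_le mult_less_0_iff)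
    moreover obtain m where m: "m \<in> \<Omega>" and min: "\<And>p. p \<in> \<Omega> \<Longrightarrow>
        f (fst m) (fst (snd m)) (snd (snd m)) \<le> f (fst p) (fst (snd p)) (snd (snd p))"
      using continuous_attains_inf[OF comp _ cont] p(1) by blast
    ultimately have mu: "f (fst m) (fst (snd m)) (snd (snd m)) < 0" using p(1) by fastforce
    define M1 M2 M3 where "M1 = fst m" and "M2 = fst (snd m)" and "M3 = snd (snd m)"
    define M4 where "M4 = (\<lambda>i j. (M1 i j + M2 i j) - M3 i j)"
    have qM: "quad s M1 M2 M3 M4" and trM: "tr M1 M2 = 1"
      using m by (auto simp: \<Omega>_def quad_def M1_def M2_def M3_def M4_def tr_def)
    define \<mu> where "\<mu> = f M1 M2 M3"
    have mu: "\<mu> < 0" using mu by (simp add: \<mu>_def M1_def M2_def M3_def)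
    have psd: "hermitian_psd s M1" "hermitian_psd s M2" "hermitian_psd s M3" "hermitian_psd s M4"
      using qM by (auto simp: quad_def)
    have psdS: "hermitian_psd s (\<lambda>i j. M1 i j + M2 i j)" by (rule hermitian_psd_add[OF psd(1,2)])
    have "\<exists>v. \<not> (\<forall>i<s. mv s (\<lambda>i j. M1 i j + M2 i j) v i = 0)"
    proof (rule ccontr)
      assume "\<not> ?thesis"
      then have "mv s (\<lambda>i j. M1 i j + M2 i j) (unitv i) i = 0" if "i < s" for i using that by blast
      then have "M1 i i + M2 i i = 0" if "i < s" for i using that by (simp add: mv_unitv)
      then have "retr s (\<lambda>i j. M1 i j + M2 i j) = 0" by (simp add: retr_def del: plus_complex.sel)
      then show False using trM by (simp add: tr_def retr_add)
    qed
    then have "peelable s M1 M2 M3 M4" using quad_peelable[OF qM] by blast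
    then obtain x y and c r :: real where cr: "c\<^sup>2 + r\<^sup>2 = 1"
      and d: "dominated s M1 x" "dominated s M2 y"
        "dominated s M3 (\<lambda>i. of_real c * x i + of_real r * y i)"
        "dominated s M4 (\<lambda>i. of_real c * y i - of_real r * x i)" and xy: "\<exists>i<s. x i \<noteq> 0 \<or> y i \<noteq> 0"
      unfolding peelable_def by blast
    define z w where "z = (\<lambda>i. of_real c * x i + of_real r * y i)"
      and "w = (\<lambda>i. of_real c * y i - of_real r * x i)"
    obtain k1 k2 k3 k4 where k: "k1 \<ge> 0" "k2 \<ge> 0" "k3 \<ge> 0" "k4 \<ge> 0"
      "\<And>v. (cmod (dp s x v))\<^sup>2 \<le> k1 * qf s M1 v" "\<And>v. (cmod (dp s y v))\<^sup>2 \<le> k2 * qf s M2 v"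
      "\<And>v. (cmod (dp s z v))\<^sup>2 \<le> k3 * qf s M3 v" "\<And>v. (cmod (dp s w v))\<^sup>2 \<le> k4 * qf s M4 v"
      using d unfolding dominated_def z_def[symmetric] w_def[symmetric] by blast
    \<comment> \<open>One step size for which all four subtractions keep positivity.\<close>
    define e where "e = 1 / (1 + k1 + k2 + k3 + k4)"
    have e: "e > 0" "e * k1 \<le> 1" "e * k2 \<le> 1" "e * k3 \<le> 1" "e * k4 \<le> 1"
      using k(1-4) by (simp_all add: e_def divide_simps)
    define sub where "sub = (\<lambda>T v i j. T i j - of_real e * outer v i j)"
    have psub: "hermitian_psd s (sub M1 x)" "hermitian_psd s (sub M2 y)"
      "hermitian_psd s (sub M3 z)" "hermitian_psd s (sub M4 w)"
      unfolding sub_def using e k psd by (auto intro!: dominated_subtract)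
    have one: "complex_of_real c * complex_of_real c + complex_of_real r * complex_of_real r = 1"
      using cr by (simp add: power2_eq_square flip: of_real_mult of_real_add)
    have out: "outer x i j + outer y i j = outer z i j + outer w i j" for i j
    proof -
      have "outer z i j + outer w i j =
        (of_real c * of_real c + of_real r * of_real r) * (outer x i j + outer y i j)"
        by (simp add: outer_def z_def w_def algebra_simps)
      then show ?thesis by (simp add: one)
    qed
    have qsub: "quad s (sub M1 x) (sub M2 y) (sub M3 z) (sub M4 w)"
    proof -
      have "sub M1 x i j + sub M2 y i j = sub M3 z i j + sub M4 w i j" for i j
      proof -
        have "sub M1 x i j + sub M2 y i j = (M1 i j + M2 i j) - of_real e * (outer x i j + outer y i j)"
          by (simp add: sub_def algebra_simps)
        also have "\<dots> = sub M3 z i j + sub M4 w i j"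
          unfolding out by (simp add: sub_def M4_def algebra_simps)
        finally show ?thesis .
      qed
      then show ?thesis using psub by (simp add: quad_def)
    qed
    define tau where "tau = retr s (outer x) + retr s (outer y)"
    have retr_out: "retr s (outer v) = (\<Sum>i<s. (cmod (v i))\<^sup>2)" for v
      unfolding retr_def outer_def
      by (intro sum.cong refl) (metis Re_complex_of_real complex_norm_square of_real_power)
    have "tau > 0"
    proof -
      obtain i where i: "i < s" "x i \<noteq> 0 \<or> y i \<noteq> 0" using xy by auto
      have "0 < (\<Sum>i<s. (cmod (x i))\<^sup>2 + (cmod (y i))\<^sup>2)"
        by (rule sum_pos2[of _ i]) (use i in \<open>auto simp: add_pos_nonneg add_nonneg_pos\<close>)
      then show ?thesis by (simp add: tau_def retr_out sum.distrib)
    qed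
    have trsub: "tr (sub M1 x) (sub M2 y) = 1 - e * tau"
      using trM by (simp add: tr_def sub_def retr_diff retr_scale tau_def algebra_simps)
    have fsub: "\<mu> = f (sub M1 x) (sub M2 y) (sub M3 z) + e * (qf s A1 x + qf s A2 y + qf s B z)"
      by (simp add: \<mu>_def f_def sub_def ip_diff_left ip_scale_left ip_outer algebra_simps)
    have "0 \<le> e * (qf s A1 x + qf s A2 y + qf s B z)"
      using pos[OF cr, of x y] e(1) by (simp add: z_def)
    then have le: "f (sub M1 x) (sub M2 y) (sub M3 z) \<le> \<mu>" using fsub by linarith
    \<comment> \<open>Minimality of \<open>\<mu>\<close>, extended by homogeneity from trace 1; a
      quadruple of trace zero consists of zero matrices.\<close>
    have ge: "tr (sub M1 x) (sub M2 y) * \<mu> \<le> f (sub M1 x) (sub M2 y) (sub M3 z)"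
    proof (cases "tr (sub M1 x) (sub M2 y) > 0")
      case True
      then obtain p where "p \<in> \<Omega>" "f (sub M1 x) (sub M2 y) (sub M3 z) =
          tr (sub M1 x) (sub M2 y) * f (fst p) (fst (snd p)) (snd (snd p))"
        using normalise[OF qsub] by blast
      then show ?thesis
        using min[of p] True by (simp add: \<mu>_def M1_def M2_def M3_def)
    next
      case False
      then have t0: "retr s (sub M1 x) = 0" "retr s (sub M2 y) = 0"
        using psub psd_retr_nonneg[OF psub(1)] psd_retr_nonneg[OF psub(2)] by (auto simp: tr_def)
      moreover have "retr s (sub M3 z) + retr s (sub M4 w) = retr s (sub M1 x) + retr s (sub M2 y)"
      proof -
        have "retr s (sub M1 x) + retr s (sub M2 y) = retr s (\<lambda>i j. sub M1 x i j + sub M2 y i j)"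
          by (simp add: retr_add)
        also have "\<dots> = retr s (\<lambda>i j. sub M3 z i j + sub M4 w i j)"
          using qsub by (simp add: quad_def retr_def)
        finally show ?thesis by (simp add: retr_add)
      qed
      ultimately have "retr s (sub M3 z) = 0"
        using psd_retr_nonneg[OF psub(3)] psd_retr_nonneg[OF psub(4)] by linarith
      then have "f (sub M1 x) (sub M2 y) (sub M3 z) = 0"
        using retr_ge_zero_entries[OF psub(1) t0(1)] retr_ge_zero_entries[OF psub(2) t0(2)]
          retr_ge_zero_entries[OF psub(3)] by (simp add: f_def ip_def)
      then show ?thesis using t0 by (simp add: tr_def)
    qed
    \<comment> \<open>The trace dropped by \<open>e * tau > 0\<close> while the value did not rise,
      which is impossible for a negative \<open>\<mu>\<close>.\<close>
    have "(1 - e * tau) * \<mu> \<le> \<mu>" using le ge trsub by simp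
    then have "0 \<le> (e * tau) * \<mu>" by (simp add: algebra_simps)
    moreover have "(e * tau) * \<mu> < 0" using \<open>tau > 0\<close> e(1) mu by (simp add: mult_pos_neg)
    ultimately show False by simp
  qed
qed

text \<open>The first-order condition at a minimum of a quadratic function along a segment; for a
  negative slope a small \<open>t\<close> would violate the assumption.\<close>

lemma quadratic_slope_nonneg:
  fixes a b :: real
  assumes "\<And>t. 0 < t \<Longrightarrow> t \<le> 1 \<Longrightarrow> 0 \<le> 2 * t * a + t\<^sup>2 * b"
  shows "0 \<le> a"
proof (rule ccontr)
  assume "\<not> 0 \<le> a"
  define t where "t = min 1 (- a / (1 + \<bar>b\<bar>))"
  have t: "0 < t" "t \<le> 1" using \<open>\<not> 0 \<le> a\<close> by (auto simp: t_def divide_simps)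
  have "t * (1 + \<bar>b\<bar>) \<le> - a"
    using pos_le_divide_eq[of "1 + \<bar>b\<bar>" t "-a"] by (simp add: t_def)
  then have "t * b \<le> - a" using t(1) mult_left_mono[of b "1 + \<bar>b\<bar>" t] by linarith
  then have "t * (t * b) \<le> t * (- a)" using t(1) by (intro mult_left_mono) auto
  moreover have "2 * t * a + t\<^sup>2 * b = 2 * (t * a) + t * (t * b)" by (simp add: power2_eq_square)
  moreover have "t * (- a) = - (t * a)" by simp
  ultimately have "2 * t * a + t\<^sup>2 * b \<le> t * a" by linarith
  also have "\<dots> < 0" using t(1) \<open>\<not> 0 \<le> a\<close> by (simp add: mult_pos_neg)
  finally show False using assms[OF t] by simp
qed

lemma ip_add_scaled_self:
  "ip s (\<lambda>i j. A i j + of_real t * B i j) (\<lambda>i j. A i j + of_real t * B i j) =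
    ip s A A + 2 * t * ip s A B + t\<^sup>2 * ip s B B"
  using ip_commute[of s A B]
  by (simp add: ip_add_left ip_add_right ip_scale_left ip_scale_right power2_eq_square algebra_simps)

text \<open>The interpolant is read off the point of the cone of all
  \<open>(G + R1, G + R2, R3 - G)\<close> nearest to \<open>(A1, A2, B)\<close>.\<close>

theorem psd_interpolation:
  assumes herm: "herm s A1" "herm s A2" "herm s B"
    and pos: "\<And>x y (c::real) (r::real). c\<^sup>2 + r\<^sup>2 = 1 \<Longrightarrow>
      0 \<le> qf s A1 x + qf s A2 y + qf s B (\<lambda>i. of_real c * x i + of_real r * y i)"
  shows "\<exists>G. hermitian_psd s G \<and> hermitian_psd s (\<lambda>i j. A1 i j - G i j) \<and>
    hermitian_psd s (\<lambda>i j. A2 i j - G i j) \<and> hermitian_psd s (\<lambda>i j. B i j + G i j)"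
proof -
  define D1 D2 D3 where "D1 = (\<lambda>G R i j. (G i j + R i j) - A1 i j)"
    and "D2 = (\<lambda>G R i j. (G i j + R i j) - A2 i j)"
    and "D3 = (\<lambda>G R i j. (R i j - G i j) - B i j)"
  define \<Psi> where "\<Psi> = (\<lambda>G R1 R2 R3. ip s (D1 G R1) (D1 G R1) + ip s (D2 G R2) (D2 G R2)
      + ip s (D3 G R3) (D3 G R3))"
  define Z :: "nat \<Rightarrow> nat \<Rightarrow> complex" where "Z = (\<lambda>i j. 0)"
  have Z: "hermitian_psd s Z"
    by (simp add: hermitian_psd_def Z_def)
  define M0 where "M0 = \<Psi> Z Z Z Z"
  \<comment> \<open>Bounds the diagonals of all points no farther away than the zero point:
    \<open>G\<close> and \<open>R1\<close> are nonnegative and \<open>G + R1\<close> is near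
    \<open>A1\<close>, which bounds both, and \<open>R2\<close> likewise; \<open>R3\<close> is near
    \<open>B + G\<close>, whence the factor 2 in \<open>K\<close>.\<close>
  define a where "a = sqrt M0 + (\<Sum>i<s. cmod (A1 i i) + cmod (A2 i i) + cmod (B i i))"
  define K where "K = real s * (2 * a)"
  have a: "sqrt M0 + cmod (A1 i i) \<le> a" "sqrt M0 + cmod (A2 i i) \<le> a" "sqrt M0 + cmod (B i i) \<le> a"
    if "i < s" for i
  proof -
    have "cmod (A1 i i) + cmod (A2 i i) + cmod (B i i) \<le>
        (\<Sum>i<s. cmod (A1 i i) + cmod (A2 i i) + cmod (B i i))"
      by (rule member_le_sum) (use that in auto)
    then show "sqrt M0 + cmod (A1 i i) \<le> a" "sqrt M0 + cmod (A2 i i) \<le> a" "sqrt M0 + cmod (B i i) \<le> a"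
      unfolding a_def using norm_ge_zero[of "A1 i i"] norm_ge_zero[of "A2 i i"] norm_ge_zero[of "B i i"]
      by linarith+
  qed
  have M0: "0 \<le> M0" unfolding M0_def \<Psi>_def by (intro add_nonneg_nonneg ip_self_nonneg)
  then have a0: "0 \<le> a" unfolding a_def by (intro add_nonneg_nonneg sum_nonneg) auto
  have diag: "Re (C i i) \<le> sqrt M0" if "ip s C C \<le> M0" "i < s" for C i
  proof -
    have "(cmod (C i i))\<^sup>2 \<le> M0" using ip_self_entry[OF that(2,2), of C] that(1) by simp
    then have "cmod (C i i) \<le> sqrt M0" by (simp add: real_le_rsqrt)
    then show ?thesis using complex_Re_le_cmod order_trans by blast
  qed
  have bound: "retr s G \<le> K \<and> retr s R1 \<le> K \<and> retr s R2 \<le> K \<and> retr s R3 \<le> K"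
    if psd: "hermitian_psd s G" "hermitian_psd s R1" "hermitian_psd s R2" "hermitian_psd s R3"
      and le: "\<Psi> G R1 R2 R3 \<le> M0" for G R1 R2 R3
  proof -
    have D: "ip s (D1 G R1) (D1 G R1) \<le> M0" "ip s (D2 G R2) (D2 G R2) \<le> M0" "ip s (D3 G R3) (D3 G R3) \<le> M0"
      using le ip_self_nonneg[of s "D1 G R1"] ip_self_nonneg[of s "D2 G R2"] ip_self_nonneg[of s "D3 G R3"]
      unfolding \<Psi>_def by linarith+
    have d: "Re (G i i) \<le> 2 * a \<and> Re (R1 i i) \<le> 2 * a \<and> Re (R2 i i) \<le> 2 * a \<and> Re (R3 i i) \<le> 2 * a"
      if i: "i < s" for i
    proof -
      have "Re (G i i) + Re (R1 i i) - Re (A1 i i) \<le> sqrt M0"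
        "Re (G i i) + Re (R2 i i) - Re (A2 i i) \<le> sqrt M0"
        "Re (R3 i i) - Re (G i i) - Re (B i i) \<le> sqrt M0"
        using diag[OF D(1) i] diag[OF D(2) i] diag[OF D(3) i] by (simp_all add: D1_def D2_def D3_def)
      moreover have "0 \<le> Re (G i i)" "0 \<le> Re (R1 i i)" "0 \<le> Re (R2 i i)" "0 \<le> Re (R3 i i)"
        using psd i psd_diag_nonneg by auto
      ultimately show ?thesis
        using a[OF i] complex_Re_le_cmod[of "A1 i i"] complex_Re_le_cmod[of "A2 i i"]
          complex_Re_le_cmod[of "B i i"] a0 by linarith
    qed
    have "retr s T \<le> K" if "\<And>i. i < s \<Longrightarrow> Re (T i i) \<le> 2 * a" for T
      using sum_bounded_above[of "{..<s}" "\<lambda>i. Re (T i i)" "2 * a"] that by (simp add: retr_def K_def)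
    then show ?thesis using d by blast
  qed
  define Box where "Box = {T::nat \<Rightarrow> nat \<Rightarrow> complex. \<forall>i. T i \<in> {f. \<forall>j. f j \<in> cball 0 K}} \<inter>
      {T. hermitian_psd s T}"
  have "closed {T. hermitian_psd s T}" by (rule closed_Collect_psd[OF continuous_on_id])
  then have "compact Box" unfolding Box_def by (intro compact_Int_closed compact_matrix_box)
  then have "compact (Box \<times> Box \<times> Box \<times> Box)" by (intro compact_Times)
  moreover have "Z \<in> Box"
    using trunc_in_box[OF Z, of K] Z a0 by (simp add: Box_def trunc_def Z_def retr_def K_def)
  moreover have "continuous_on A (\<lambda>p. \<Psi> (fst p) (fst (snd p)) (fst (snd (snd p))) (snd (snd (snd p))))" for A
  proof -
    have c: "continuous_on A (\<lambda>p::(nat \<Rightarrow> nat \<Rightarrow> complex) \<times> (nat \<Rightarrow> nat \<Rightarrow> complex) \<times>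
        (nat \<Rightarrow> nat \<Rightarrow> complex) \<times> (nat \<Rightarrow> nat \<Rightarrow> complex). fst p)"
      "continuous_on A (\<lambda>p::(nat \<Rightarrow> nat \<Rightarrow> complex) \<times> (nat \<Rightarrow> nat \<Rightarrow> complex) \<times>
        (nat \<Rightarrow> nat \<Rightarrow> complex) \<times> (nat \<Rightarrow> nat \<Rightarrow> complex). fst (snd p))"
      "continuous_on A (\<lambda>p::(nat \<Rightarrow> nat \<Rightarrow> complex) \<times> (nat \<Rightarrow> nat \<Rightarrow> complex) \<times>
        (nat \<Rightarrow> nat \<Rightarrow> complex) \<times> (nat \<Rightarrow> nat \<Rightarrow> complex). fst (snd (snd p)))"
      "continuous_on A (\<lambda>p::(nat \<Rightarrow> nat \<Rightarrow> complex) \<times> (nat \<Rightarrow> nat \<Rightarrow> complex) \<times>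
        (nat \<Rightarrow> nat \<Rightarrow> complex) \<times> (nat \<Rightarrow> nat \<Rightarrow> complex). snd (snd (snd p)))"
      by (intro continuous_intros)+
    show ?thesis
      unfolding \<Psi>_def ip_self D1_def D2_def D3_def
      by (intro continuous_on_add continuous_on_sum continuous_on_power continuous_on_norm
          continuous_on_diff continuous_on_const c[THEN continuous_on_eval, THEN continuous_on_eval])
  qed
  ultimately obtain m where m: "m \<in> Box \<times> Box \<times> Box \<times> Box" and min: "\<And>p. p \<in> Box \<times> Box \<times> Box \<times> Box \<Longrightarrow>
      \<Psi> (fst m) (fst (snd m)) (fst (snd (snd m))) (snd (snd (snd m))) \<le>
      \<Psi> (fst p) (fst (snd p)) (fst (snd (snd p))) (snd (snd (snd p)))"
    using continuous_attains_inf[of "Box \<times> Box \<times> Box \<times> Box"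
        "\<lambda>p. \<Psi> (fst p) (fst (snd p)) (fst (snd (snd p))) (snd (snd (snd p)))"] by blast
  define G R1 R2 R3 where "G = fst m" and "R1 = fst (snd m)" and "R2 = fst (snd (snd m))"
    and "R3 = snd (snd (snd m))"
  have psd: "hermitian_psd s G" "hermitian_psd s R1" "hermitian_psd s R2" "hermitian_psd s R3"
    using m by (auto simp: Box_def G_def R1_def R2_def R3_def)
  \<comment> \<open>A point whose truncation leaves the box is farther away than the zero point, so
    the minimum over the box is global.\<close>
  have global: "\<Psi> G R1 R2 R3 \<le> \<Psi> G' R1' R2' R3'"
    if p': "hermitian_psd s G'" "hermitian_psd s R1'" "hermitian_psd s R2'" "hermitian_psd s R3'"
    for G' R1' R2' R3'
  proof (cases "\<Psi> G' R1' R2' R3' \<le> M0")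
    case True
    then have "retr s G' \<le> K" "retr s R1' \<le> K" "retr s R2' \<le> K" "retr s R3' \<le> K"
      using bound[OF p'] by auto
    then have "(trunc s G', trunc s R1', trunc s R2', trunc s R3') \<in> Box \<times> Box \<times> Box \<times> Box"
      using p' trunc_in_box trunc_psd unfolding Box_def by blast
    from min[OF this] have "\<Psi> G R1 R2 R3 \<le> \<Psi> (trunc s G') (trunc s R1') (trunc s R2') (trunc s R3')"
      by (simp add: G_def R1_def R2_def R3_def)
    also have "\<dots> = \<Psi> G' R1' R2' R3'"
      unfolding \<Psi>_def D1_def D2_def D3_def by (intro arg_cong2[where f = "(+)"] ip_cong) (auto simp: trunc_def)
    finally show ?thesis .
  next
    case False
    have "\<Psi> G R1 R2 R3 \<le> M0"
      using min[of "(Z, Z, Z, Z)"] \<open>Z \<in> Box\<close> by (simp add: M0_def G_def R1_def R2_def R3_def)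
    then show ?thesis using False by simp
  qed
  define T1 T2 T3 where "T1 = D1 G R1" and "T2 = D2 G R2" and "T3 = D3 G R3"
  \<comment> \<open>Up to a factor 2, the derivative of the squared distance at the minimiser in the
    direction of a cone element.\<close>
  define L where "L = (\<lambda>G' R1' R2' R3'. ip s T1 (\<lambda>i j. G' i j + R1' i j) + ip s T2 (\<lambda>i j. G' i j + R2' i j)
      + ip s T3 (\<lambda>i j. R3' i j - G' i j))"
  have vi: "L G R1 R2 R3 \<le> L G' R1' R2' R3'"
    if p': "hermitian_psd s G'" "hermitian_psd s R1'" "hermitian_psd s R2'" "hermitian_psd s R3'"
    for G' R1' R2' R3'
  proof -
    define E1 E2 E3 where "E1 = (\<lambda>i j. (G' i j + R1' i j) - (G i j + R1 i j))"
      and "E2 = (\<lambda>i j. (G' i j + R2' i j) - (G i j + R2 i j))"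
      and "E3 = (\<lambda>i j. (R3' i j - G' i j) - (R3 i j - G i j))"
    have "0 \<le> ip s T1 E1 + ip s T2 E2 + ip s T3 E3"
    proof (rule quadratic_slope_nonneg)
      fix t :: real assume t: "0 < t" "t \<le> 1"
      define mix where "mix = (\<lambda>A B (i::nat) (j::nat). of_real (1 - t) * A i j + complex_of_real t * B i j)"
      have mix: "hermitian_psd s (mix A B)" if "hermitian_psd s A" "hermitian_psd s B" for A B
        unfolding mix_def using that t by (intro hermitian_psd_add hermitian_psd_scale) auto
      have "D1 (mix G G') (mix R1 R1') = (\<lambda>i j. T1 i j + of_real t * E1 i j)"
        "D2 (mix G G') (mix R2 R2') = (\<lambda>i j. T2 i j + of_real t * E2 i j)"
        "D3 (mix G G') (mix R3 R3') = (\<lambda>i j. T3 i j + of_real t * E3 i j)"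
        by (simp_all add: fun_eq_iff D1_def D2_def D3_def T1_def T2_def T3_def E1_def E2_def E3_def
            mix_def algebra_simps)
      then have "\<Psi> (mix G G') (mix R1 R1') (mix R2 R2') (mix R3 R3') = \<Psi> G R1 R2 R3 +
          2 * t * (ip s T1 E1 + ip s T2 E2 + ip s T3 E3) + t\<^sup>2 * (ip s E1 E1 + ip s E2 E2 + ip s E3 E3)"
        by (simp add: \<Psi>_def ip_add_scaled_self flip: T1_def T2_def T3_def) (simp add: algebra_simps)
      moreover have "\<Psi> G R1 R2 R3 \<le> \<Psi> (mix G G') (mix R1 R1') (mix R2 R2') (mix R3 R3')"
        by (intro global mix psd p')
      ultimately show "0 \<le> 2 * t * (ip s T1 E1 + ip s T2 E2 + ip s T3 E3)
          + t\<^sup>2 * (ip s E1 E1 + ip s E2 E2 + ip s E3 E3)" by simp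
    qed
    then show ?thesis unfolding E1_def E2_def E3_def L_def ip_diff_right by simp
  qed
  \<comment> \<open>The minimiser may be scaled by 0 and by 2 within the cone, so the derivative
    along it vanishes.\<close>
  have L0: "L G R1 R2 R3 = 0"
  proof -
    have "L G R1 R2 R3 \<le> L Z Z Z Z" by (intro vi Z)
    also have "L Z Z Z Z = 0" by (simp add: L_def Z_def ip_def)
    finally have "L G R1 R2 R3 \<le> 0" .
    define dbl where "dbl = (\<lambda>A (i::nat) (j::nat). complex_of_real 2 * A i j)"
    have "hermitian_psd s (dbl A)" if "hermitian_psd s A" for A
      unfolding dbl_def using that by (rule hermitian_psd_scale) simp
    then have "L G R1 R2 R3 \<le> L (dbl G) (dbl R1) (dbl R2) (dbl R3)" by (intro vi) (use psd in auto)
    also have "\<dots> = 2 * L G R1 R2 R3"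
      unfolding L_def dbl_def ip_add_right ip_diff_right ip_scale_right by simp
    finally show ?thesis using \<open>L G R1 R2 R3 \<le> 0\<close> by simp
  qed
  have Lnn: "0 \<le> L G' R1' R2' R3'"
    if "hermitian_psd s G'" "hermitian_psd s R1'" "hermitian_psd s R2'" "hermitian_psd s R3'"
    for G' R1' R2' R3'
    using vi[OF that] L0 by simp
  have hp: "herm s G" "herm s R1" "herm s R2" "herm s R3"
    using psd by (auto simp: hermitian_psd_iff)
  have hT: "herm s T1" "herm s T2" "herm s T3"
    unfolding T1_def T2_def T3_def D1_def D2_def D3_def
    by (rule hermI, simp add: hermD[OF hp(1)] hermD[OF hp(2)] hermD[OF hp(3)] hermD[OF hp(4)]
        hermD[OF herm(1)] hermD[OF herm(2)] hermD[OF herm(3)])+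
  have ipZ: "ip s T (\<lambda>i j. Z i j + A i j) = ip s T A" "ip s T (\<lambda>i j. A i j + Z i j) = ip s T A"
    "ip s T (\<lambda>i j. A i j - Z i j) = ip s T A" "ip s T (\<lambda>i j. Z i j - A i j) = - ip s T A" for T A
    by (simp_all add: Z_def ip_def sum_negf flip: minus_add_distrib)
  have ipo: "ip s T (outer x) = qf s T x" for T x
    using ip_commute ip_outer by metis
  \<comment> \<open>Testing \<open>L\<close> on a rank-one matrix in one slot at a time shows that
    the residuals \<open>T1\<close>, \<open>T2\<close>, \<open>T3\<close> form a quadruple with
    fourth member \<open>T1 + T2 - T3\<close>.\<close>
  have T4: "hermitian_psd s (\<lambda>i j. (T1 i j + T2 i j) - T3 i j)"
    "hermitian_psd s T1" "hermitian_psd s T2" "hermitian_psd s T3"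
  proof -
    have "0 \<le> qf s T1 x" "0 \<le> qf s T2 x" "0 \<le> qf s T3 x" "0 \<le> (qf s T1 x + qf s T2 x) - qf s T3 x" for x
      using Lnn[OF Z hermitian_psd_outer[of s x] Z Z] Lnn[OF Z Z hermitian_psd_outer[of s x] Z]
        Lnn[OF Z Z Z hermitian_psd_outer[of s x]] Lnn[OF hermitian_psd_outer[of s x] Z Z Z]
      unfolding L_def ipZ ipo by (simp_all add: Z_def ip_def)
    then show "hermitian_psd s (\<lambda>i j. (T1 i j + T2 i j) - T3 i j)"
      "hermitian_psd s T1" "hermitian_psd s T2" "hermitian_psd s T3"
      using hT unfolding hermitian_psd_iff qf_add qf_diff
      by (auto intro!: hermI simp: hermD)
  qed
  have "quad s T1 T2 T3 (\<lambda>i j. (T1 i j + T2 i j) - T3 i j)"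
    using T4 by (simp add: quad_def)
  from quad_functional_nonneg[OF pos this]
  have f: "0 \<le> ip s T1 A1 + ip s T2 A2 + ip s T3 B" by blast
  \<comment> \<open>The data are nearest point minus residual, and \<open>L\<close> vanishes at the
    nearest point. So the pairing of residual and data is minus the squared distance, while duality
    makes it nonnegative.\<close>
  have "A1 = (\<lambda>i j. (G i j + R1 i j) - T1 i j)" "A2 = (\<lambda>i j. (G i j + R2 i j) - T2 i j)"
    "B = (\<lambda>i j. (R3 i j - G i j) - T3 i j)"
    by (simp_all add: T1_def T2_def T3_def D1_def D2_def D3_def)
  then have "ip s T1 A1 + ip s T2 A2 + ip s T3 B = L G R1 R2 R3 - (ip s T1 T1 + ip s T2 T2 + ip s T3 T3)"
    unfolding L_def using ip_diff_right[of s T1 "\<lambda>i j. G i j + R1 i j" T1]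
      ip_diff_right[of s T2 "\<lambda>i j. G i j + R2 i j" T2] ip_diff_right[of s T3 "\<lambda>i j. R3 i j - G i j" T3]
    by simp
  then have "ip s T1 T1 + ip s T2 T2 + ip s T3 T3 \<le> 0" using f L0 by simp
  then have "ip s T1 T1 = 0" "ip s T2 T2 = 0" "ip s T3 T3 = 0"
    using ip_self_nonneg[of s T1] ip_self_nonneg[of s T2] ip_self_nonneg[of s T3] by linarith+
  then have "T1 i j = 0" "T2 i j = 0" "T3 i j = 0" if "i < s" "j < s" for i j
    using ip_self_entry[OF that, of T1] ip_self_entry[OF that, of T2] ip_self_entry[OF that, of T3]
    by simp_all
  then have e: "G i j + R1 i j - A1 i j = 0" "G i j + R2 i j - A2 i j = 0" "R3 i j - G i j - B i j = 0"
    if "i < s" "j < s" for i j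
    using that by (simp_all add: T1_def T2_def T3_def D1_def D2_def D3_def)
  have "R1 i j = A1 i j - G i j" "R2 i j = A2 i j - G i j" "R3 i j = B i j + G i j"
    if "i < s" "j < s" for i j
  proof -
    show "R1 i j = A1 i j - G i j" using e(1)[OF that] by (simp add: algebra_simps)
    show "R2 i j = A2 i j - G i j" using e(2)[OF that] by (simp add: algebra_simps)
    show "R3 i j = B i j + G i j" using e(3)[OF that] by (simp add: algebra_simps)
  qed
  then show ?thesis
    using psd(1) hermitian_psd_cong[OF psd(2)] hermitian_psd_cong[OF psd(3)] hermitian_psd_cong[OF psd(4)]
    by (intro exI[of _ G] conjI) simp_all
qed

section \<open>Positive functionals on real star rings\<close>

text \<open>Abstracts the algebraic side of Mat_d(A): an involution and real scalars, with sums of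
  squares as the positive elements.\<close>

locale real_star_ring = ring B for B (structure) +
  fixes st :: "'a \<Rightarrow> 'a" and sc :: "real \<Rightarrow> 'a \<Rightarrow> 'a"
  assumes st_closed [simp, intro]: "a \<in> carrier B \<Longrightarrow> st a \<in> carrier B"
    and st_st: "a \<in> carrier B \<Longrightarrow> st (st a) = a"
    and st_add: "\<lbrakk>a \<in> carrier B; b \<in> carrier B\<rbrakk> \<Longrightarrow> st (a \<oplus> b) = st a \<oplus> st b"
    and st_mult: "\<lbrakk>a \<in> carrier B; b \<in> carrier B\<rbrakk> \<Longrightarrow> st (a \<otimes> b) = st b \<otimes> st a"
    and st_sc: "a \<in> carrier B \<Longrightarrow> st (sc r a) = sc r (st a)"
    and sc_closed [simp, intro]: "a \<in> carrier B \<Longrightarrow> sc r a \<in> carrier B"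
    and sc_add_right: "\<lbrakk>a \<in> carrier B; b \<in> carrier B\<rbrakk> \<Longrightarrow> sc r (a \<oplus> b) = sc r a \<oplus> sc r b"
    and sc_add_left: "a \<in> carrier B \<Longrightarrow> sc (r + s) a = sc r a \<oplus> sc s a"
    and sc_sc: "a \<in> carrier B \<Longrightarrow> sc r (sc s a) = sc (r * s) a"
    and sc_one: "a \<in> carrier B \<Longrightarrow> sc 1 a = a"
    and sc_mult_left: "\<lbrakk>a \<in> carrier B; b \<in> carrier B\<rbrakk> \<Longrightarrow> sc r a \<otimes> b = sc r (a \<otimes> b)"
    and sc_mult_right: "\<lbrakk>a \<in> carrier B; b \<in> carrier B\<rbrakk> \<Longrightarrow> a \<otimes> sc r b = sc r (a \<otimes> b)"
begin

lemma sc_zero_left: "a \<in> carrier B \<Longrightarrow> sc 0 a = \<zero>"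
proof -
  assume a: "a \<in> carrier B"
  have "sc 0 a \<oplus> sc 0 a = sc 0 a" using sc_add_left[OF a, of 0 0] by simp
  then show ?thesis using a by (metis add.l_cancel_one sc_closed)
qed

lemma sc_zero_right: "sc r \<zero> = \<zero>"
proof -
  have "sc r (sc 0 \<zero>) = sc 0 \<zero>" by (subst sc_sc) auto
  then show ?thesis by (simp add: sc_zero_left)
qed

lemma sc_minus_one: "a \<in> carrier B \<Longrightarrow> sc (-1) a = \<ominus> a"
proof -
  assume a: "a \<in> carrier B"
  have "sc (-1) a \<oplus> a = \<zero>"
    using sc_add_left[OF a, of "-1" 1] by (simp add: sc_one sc_zero_left a)
  then show ?thesis using a by (simp add: minus_equality)
qed

lemma sc_neg: "a \<in> carrier B \<Longrightarrow> sc (- r) a = \<ominus> sc r a"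
  using sc_sc[of a "-1" r] sc_minus_one[of "sc r a"] by simp

lemma sc_minus: "a \<in> carrier B \<Longrightarrow> sc r (\<ominus> a) = \<ominus> sc r a"
  using sc_sc[of a r "-1"] sc_minus_one[of a] sc_neg[of a r] by simp

lemma st_zero: "st \<zero> = \<zero>"
proof -
  have "st \<zero> \<oplus> st \<zero> = st \<zero>" using st_add[of \<zero> \<zero>] by simp
  then show ?thesis by (metis add.l_cancel_one st_closed zero_closed)
qed

lemma st_minus: "a \<in> carrier B \<Longrightarrow> st (\<ominus> a) = \<ominus> st a"
  using st_sc[of a "-1"] by (simp add: sc_minus_one)

lemma st_one: "st \<one> = \<one>"
proof -
  have "st (st \<one> \<otimes> \<one>) = st \<one> \<otimes> st (st \<one>)" by (rule st_mult) auto
  then show ?thesis by (simp add: st_st)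
qed

section \<open>Words, standard polynomials and sums of squares\<close>

primrec word :: "(nat \<Rightarrow> 'a) \<Rightarrow> (nat \<Rightarrow> nat) \<Rightarrow> nat \<Rightarrow> 'a" where
  "word x \<sigma> 0 = \<one>"
| "word x \<sigma> (Suc n) = word x \<sigma> n \<otimes> x (\<sigma> n)"

definition standard_polynomial :: "nat \<Rightarrow> (nat \<Rightarrow> 'a) \<Rightarrow> 'a" where
  "standard_polynomial k x =
    (\<Oplus>\<sigma>\<in>{\<sigma>. \<sigma> permutes {..<k}}. sc (of_int (sign \<sigma>)) (word x \<sigma> k))"

text \<open>Positive \<open>N x N\<close> matrices over the ring, as finite sums of Gram matrices of
  rows. Fusing such a sum into a single square would take square roots, so the number of squares
  stays free.\<close>

inductive sos :: "nat \<Rightarrow> (nat \<Rightarrow> nat \<Rightarrow> 'a) \<Rightarrow> bool" for N where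
  sos_zero: "(\<And>i j. \<lbrakk>i < N; j < N\<rbrakk> \<Longrightarrow> M i j = \<zero>) \<Longrightarrow> sos N M"
| sos_step: "\<lbrakk>sos N M; \<And>i. i < N \<Longrightarrow> z i \<in> carrier B;
    \<And>i j. \<lbrakk>i < N; j < N\<rbrakk> \<Longrightarrow> M' i j = M i j \<oplus> st (z i) \<otimes> z j\<rbrakk> \<Longrightarrow> sos N M'"

lemma sos_closed: "sos N M \<Longrightarrow> i < N \<Longrightarrow> j < N \<Longrightarrow> M i j \<in> carrier B"
  by (induction rule: sos.induct) auto

lemma sos_cong: "sos N M \<Longrightarrow> (\<And>i j. \<lbrakk>i < N; j < N\<rbrakk> \<Longrightarrow> M' i j = M i j) \<Longrightarrow> sos N M'"
proof (induction rule: sos.induct)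
  case (sos_zero M)
  then show ?case by (intro sos.sos_zero) simp
next
  case (sos_step M z L)
  show ?case by (rule sos.sos_step[of N M z]) (use sos_step in auto)
qed

lemma sos_gram:
  assumes "\<And>i. i < N \<Longrightarrow> z i \<in> carrier B"
  shows "sos N (\<lambda>i j. st (z i) \<otimes> z j)"
  by (rule sos_step[of N "\<lambda>i j. \<zero>" z]) (use assms in \<open>auto intro: sos_zero\<close>)

lemma sos_add:
  assumes "sos N L"
  shows "sos N M \<Longrightarrow> sos N (\<lambda>i j. M i j \<oplus> L i j)"
  using assms
proof (induction rule: sos.induct)
  case (sos_zero L)
  then show ?case by (auto intro!: sos_cong[OF sos_zero(2)] simp: sos_closed)
next
  case (sos_step L z L')
  have "sos N (\<lambda>i j. M i j \<oplus> L i j)" by (rule sos_step.IH) fact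
  then show ?case
  proof (rule sos.sos_step)
    fix i j assume ij: "i < N" "j < N"
    then show "M i j \<oplus> L' i j = M i j \<oplus> L i j \<oplus> st (z i) \<otimes> z j"
      using sos_step sos_closed by (simp add: a_assoc)
  qed (use sos_step in auto)
qed

lemma sos_scale:
  assumes "0 \<le> r"
  shows "sos N M \<Longrightarrow> sos N (\<lambda>i j. sc r (M i j))"
proof (induction rule: sos.induct)
  case (sos_zero M)
  then show ?case by (intro sos.sos_zero) (simp add: sc_zero_right)
next
  case (sos_step M z M')
  show ?case
  proof (rule sos.sos_step[OF sos_step.IH])
    fix i j assume ij: "i < N" "j < N"
    have z: "z i \<in> carrier B" "z j \<in> carrier B" "M i j \<in> carrier B"
      using sos_step ij sos_closed by auto
    have "st (sc (sqrt r) (z i)) \<otimes> sc (sqrt r) (z j) = sc r (st (z i) \<otimes> z j)"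
      using z assms by (simp add: st_sc sc_mult_left sc_mult_right sc_sc)
    then show "sc r (M' i j) = sc r (M i j) \<oplus> st (sc (sqrt r) (z i)) \<otimes> sc (sqrt r) (z j)"
      using z ij sos_step by (simp add: sc_add_right)
  qed (use sos_step in auto)
qed

definition pos :: "'a \<Rightarrow> bool" where
  "pos h \<longleftrightarrow> sos 1 (\<lambda>i j. h)"

lemma pos_closed: "pos h \<Longrightarrow> h \<in> carrier B"
  unfolding pos_def by (drule sos_closed[of 1 _ 0 0]) auto

lemma pos_square: "y \<in> carrier B \<Longrightarrow> pos (st y \<otimes> y)"
  unfolding pos_def by (rule sos_gram)

lemma pos_add: "pos h \<Longrightarrow> pos k \<Longrightarrow> pos (h \<oplus> k)"
  unfolding pos_def by (rule sos_add)

lemma pos_scale: "0 \<le> r \<Longrightarrow> pos h \<Longrightarrow> pos (sc r h)"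
  unfolding pos_def by (rule sos_scale)

text \<open>A square \<open>y^* y\<close> between \<open>z_i^*\<close> and \<open>z_j\<close>
  becomes the Gram matrix of the row of all \<open>y z_i\<close>.\<close>

lemma sos_sandwich:
  assumes "pos h" and z: "\<And>i. i < N \<Longrightarrow> z i \<in> carrier B"
  shows "sos N (\<lambda>i j. st (z i) \<otimes> h \<otimes> z j)"
proof -
  have "sos N (\<lambda>i j. st (z i) \<otimes> H 0 0 \<otimes> z j)" if "sos 1 H" for H
    using that
  proof (induction rule: sos.induct)
    case (sos_zero H)
    then show ?case using z by (intro sos.sos_zero) auto
  next
    case (sos_step H y H')
    have y: "y 0 \<in> carrier B" "H 0 0 \<in> carrier B" using sos_step sos_closed[of 1 H 0 0] by auto
    show ?case
    proof (rule sos.sos_step[OF sos_step.IH, of "\<lambda>i. y 0 \<otimes> z i"])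
      fix i j assume "i < N" "j < N"
      then have zz: "z i \<in> carrier B" "z j \<in> carrier B" using z by auto
      show "st (z i) \<otimes> H' 0 0 \<otimes> z j = st (z i) \<otimes> H 0 0 \<otimes> z j \<oplus> st (y 0 \<otimes> z i) \<otimes> (y 0 \<otimes> z j)"
        using sos_step(3)[of 0 0] y zz by (simp add: st_mult l_distr r_distr m_assoc)
    qed (use y z in auto)
  qed
  then show ?thesis using assms(1) unfolding pos_def by blast
qed

lemma pos_sandwich:
  assumes "pos h" "z \<in> carrier B"
  shows "pos (st z \<otimes> h \<otimes> z)"
  unfolding pos_def by (rule sos_sandwich) (use assms in auto)

lemma pos_selfadjoint:
  assumes "pos h"
  shows "st h = h"
proof -
  have "st (H 0 0) = H 0 0" if "sos 1 H" for H
    using that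
  proof (induction rule: sos.induct)
    case (sos_zero H)
    then show ?case by (simp add: st_zero)
  next
    case (sos_step H y H')
    have "y 0 \<in> carrier B" "H 0 0 \<in> carrier B" using sos_step sos_closed[of 1 H 0 0] by auto
    then show ?case using sos_step by (simp add: st_add st_mult st_st)
  qed
  then show ?thesis using assms unfolding pos_def by blast
qed

text \<open>\<open>c E - E\<^sup>2 = (E (c - E) E + (c - E) E (c - E)) / c\<close>.\<close>

lemma square_le:
  assumes E: "pos E" and D: "pos D" and C: "sc c \<one> = E \<oplus> D" "0 < c"
  shows "\<exists>P. pos P \<and> sc c E = E \<otimes> E \<oplus> P"
proof -
  have cl: "E \<in> carrier B" "D \<in> carrier B" and sE: "st E = E" "st D = D"
    using E D by (auto intro: pos_closed pos_selfadjoint)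
  have cX: "sc c X = E \<otimes> X \<oplus> D \<otimes> X" "sc c X = X \<otimes> E \<oplus> X \<otimes> D" if "X \<in> carrier B" for X
  proof -
    have "sc c X = sc c \<one> \<otimes> X" "sc c X = X \<otimes> sc c \<one>"
      using that by (simp_all add: sc_mult_left sc_mult_right)
    then show "sc c X = E \<otimes> X \<oplus> D \<otimes> X" "sc c X = X \<otimes> E \<oplus> X \<otimes> D"
      unfolding C using that cl by (simp_all add: l_distr r_distr)
  qed
  have "sc c E = E \<otimes> E \<oplus> E \<otimes> D" by (rule cX(2)[OF cl(1)])
  moreover have "pos (E \<otimes> D)"
  proof -
    have pp: "pos (E \<otimes> D \<otimes> E \<oplus> D \<otimes> E \<otimes> D)"
      using pos_add[OF pos_sandwich[OF D cl(1)] pos_sandwich[OF E cl(2)]] by (simp add: sE)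
    \<comment> \<open>\<open>D = c - E\<close>, so the two commute.\<close>
    have ED: "E \<otimes> D = D \<otimes> E" using cX[OF cl(1)] cl by simp
    have "sc c (E \<otimes> D) = E \<otimes> D \<otimes> E \<oplus> D \<otimes> E \<otimes> D"
      using cX(2)[of "E \<otimes> D"] cl ED by (simp add: m_assoc)
    then have "pos (sc c (E \<otimes> D))" using pp by simp
    then have "pos (sc (1 / c) (sc c (E \<otimes> D)))" by (rule pos_scale[rotated]) (use C(2) in simp)
    then show ?thesis using cl C(2) by (simp add: sc_sc sc_one)
  qed
  ultimately show ?thesis by blast
qed

end

text \<open>\<open>F\<close> is the functional of a representation of \<open>V\<close> on \<open>\<real>\<^sup>N\<close>. The predicate \<open>nb z c\<close> says that \<open>z\<close> has
  norm at most \<open>c\<close> in the GNS space of any extension of \<open>F\<close> to the matrices over \<open>B\<close>.\<close>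

locale star_functional = real_star_ring B st sc
  for B (structure) and st :: "'a \<Rightarrow> 'a" and sc +
  fixes \<Psi> :: "'v::real_vector \<Rightarrow> 'a" and N :: nat and \<phi> :: "nat \<Rightarrow> nat \<Rightarrow> 'v \<Rightarrow> real" and u :: 'v
  assumes Psi_closed [simp, intro]: "\<Psi> v \<in> carrier B"
    and Psi_add: "\<Psi> (v + w) = \<Psi> v \<oplus> \<Psi> w"
    and Psi_scale: "\<Psi> (r *\<^sub>R v) = sc r (\<Psi> v)"
    and Psi_unit: "\<Psi> u = \<one>"
    and phi_linear: "linear (\<phi> i j)"
    and phi_nonneg: "\<lbrakk>\<And>i j. \<lbrakk>i < N; j < N\<rbrakk> \<Longrightarrow> x i j = x j i; sos N (\<lambda>i j. \<Psi> (x i j))\<rbrakk> \<Longrightarrow>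
      0 \<le> (\<Sum>i<N. \<Sum>j<N. \<phi> i j (x i j))"
begin

definition F :: "(nat \<Rightarrow> nat \<Rightarrow> 'v) \<Rightarrow> real" where
  "F x = (\<Sum>i<N. \<Sum>j<N. \<phi> i j (x i j))"

lemma F_add: "F (\<lambda>i j. x i j + y i j) = F x + F y"
  by (simp add: F_def linear_add[OF phi_linear] sum.distrib)

lemma F_scale: "F (\<lambda>i j. r *\<^sub>R x i j) = r * F x"
  by (simp add: F_def linear_scale[OF phi_linear] sum_distrib_left)

lemma Psi_diff: "\<Psi> (v - w) = \<Psi> v \<ominus> \<Psi> w"
  using Psi_add[of v "(-1) *\<^sub>R w"] Psi_scale[of "-1" w] by (simp add: sc_minus_one minus_eq)

lemma F_diff: "F (\<lambda>i j. x i j - y i j) = F x - F y"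
  by (simp add: F_def linear_diff[OF phi_linear] sum_subtractf)

lemma Psi_zero: "\<Psi> 0 = \<zero>"
  using Psi_scale[of 0 0] by (simp add: sc_zero_left)

text \<open>\<open>F\<close> is available only on matrices over \<open>'v\<close>, and
  \<open>z^* z\<close> need not be in the image of \<open>\<Psi>\<close>. The witness
  \<open>x\<close> is a majorant of it there, with a sum of squares \<open>M\<close> as the
  difference.\<close>

definition nb :: "(nat \<Rightarrow> 'a) \<Rightarrow> real \<Rightarrow> bool" where
  "nb z c \<longleftrightarrow> 0 < c \<and> (\<forall>i<N. z i \<in> carrier B) \<and>
    (\<exists>x M. (\<forall>i<N. \<forall>j<N. x i j = x j i) \<and> sos N M \<and>
      (\<forall>i<N. \<forall>j<N. \<Psi> (x i j) = M i j \<oplus> st (z i) \<otimes> z j) \<and> F x \<le> c\<^sup>2)"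

lemma nbI:
  assumes "0 < c" "\<And>i. i < N \<Longrightarrow> z i \<in> carrier B" "\<And>i j. \<lbrakk>i < N; j < N\<rbrakk> \<Longrightarrow> x i j = x j i" "sos N M"
    "\<And>i j. \<lbrakk>i < N; j < N\<rbrakk> \<Longrightarrow> \<Psi> (x i j) = M i j \<oplus> st (z i) \<otimes> z j" "F x \<le> c\<^sup>2"
  shows "nb z c"
  unfolding nb_def using assms by blast

lemma nb_pos: "nb z c \<Longrightarrow> 0 < c"
  by (simp add: nb_def)

lemma nb_closed: "nb z c \<Longrightarrow> i < N \<Longrightarrow> z i \<in> carrier B"
  by (simp add: nb_def)

lemma nb_cong: "nb z c \<Longrightarrow> (\<And>i. i < N \<Longrightarrow> w i = z i) \<Longrightarrow> nb w c"
  by (simp add: nb_def)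

lemma nb_mono:
  assumes "nb z c" "c \<le> d"
  shows "nb z d"
proof -
  have cd: "c\<^sup>2 \<le> d\<^sup>2" using assms nb_pos[OF assms(1)] by (simp add: power_mono)
  obtain x M where "0 < c" "\<forall>i<N. z i \<in> carrier B"
    "\<forall>i<N. \<forall>j<N. x i j = x j i" "sos N M"
    "\<forall>i<N. \<forall>j<N. \<Psi> (x i j) = M i j \<oplus> st (z i) \<otimes> z j" "F x \<le> c\<^sup>2"
    using assms(1) unfolding nb_def by blast
  moreover from this have "F x \<le> d\<^sup>2" "0 < d"
    using assms(2) cd by linarith+
  ultimately show ?thesis unfolding nb_def using \<open>sos N M\<close> \<open>\<forall>i<N. z i \<in> carrier B\<close>
      \<open>\<forall>i<N. \<forall>j<N. \<Psi> (x i j) = M i j \<oplus> st (z i) \<otimes> z j\<close>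
    by (intro conjI exI[of _ x] exI[of _ M]) assumption+
qed

lemma nb_zero: "0 < c \<Longrightarrow> nb (\<lambda>i. \<zero>) c"
  by (rule nbI[where x = "\<lambda>i j. 0" and M = "\<lambda>i j. \<zero>"])
    (auto simp: Psi_zero F_def linear_0[OF phi_linear] intro: sos_zero)

text \<open>The triangle inequality:
  \<open>(z + w)\<^sup>*(z + w) + (\<surd>t z - w/\<surd>t)\<^sup>*(\<surd>t z - w/\<surd>t) = (1 + t) z\<^sup>*z + (1 + 1/t) w\<^sup>*w\<close> with \<open>t = d / c\<close>.\<close>

lemma nb_add:
  assumes "nb z c" "nb w d"
  shows "nb (\<lambda>i. z i \<oplus> w i) (c + d)"
proof -
  obtain x M where x0: "0 < c" "\<forall>i<N. z i \<in> carrier B"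
    "\<forall>i<N. \<forall>j<N. x i j = x j i" "sos N M"
    "\<forall>i<N. \<forall>j<N. \<Psi> (x i j) = M i j \<oplus> st (z i) \<otimes> z j" "F x \<le> c\<^sup>2"
    using assms(1) unfolding nb_def by blast
  note x = x0[rule_format]
  obtain y L where y0: "0 < d" "\<forall>i<N. w i \<in> carrier B"
    "\<forall>i<N. \<forall>j<N. y i j = y j i" "sos N L"
    "\<forall>i<N. \<forall>j<N. \<Psi> (y i j) = L i j \<oplus> st (w i) \<otimes> w j" "F y \<le> d\<^sup>2"
    using assms(2) unfolding nb_def by blast
  note y = y0[rule_format]
  define t where "t = d / c"
  define a where "a = sqrt t"
  have t: "t > 0" and a: "a > 0" "a * a = t" "(1 / a) * (1 / a) = 1 / t" "a * (1 / a) = 1"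
    using x(1) y(1) by (simp_all add: t_def a_def)
  define p where "p = (\<lambda>i. sc a (z i) \<ominus> sc (1 / a) (w i))"
  show ?thesis
  proof (rule nbI[where x = "\<lambda>i j. (1 + t) *\<^sub>R x i j + (1 + 1 / t) *\<^sub>R y i j"
        and M = "\<lambda>i j. (sc (1 + t) (M i j) \<oplus> sc (1 + 1 / t) (L i j)) \<oplus> st (p i) \<otimes> p j"])
    show "0 < c + d" using x(1) y(1) by simp
    show "z i \<oplus> w i \<in> carrier B" if "i < N" for i using that x(2) y(2) by simp
    show "(1 + t) *\<^sub>R x i j + (1 + 1 / t) *\<^sub>R y i j = (1 + t) *\<^sub>R x j i + (1 + 1 / t) *\<^sub>R y j i"
      if "i < N" "j < N" for i j using x(3)[OF that] y(3)[OF that] by simp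
    show "sos N (\<lambda>i j. (sc (1 + t) (M i j) \<oplus> sc (1 + 1 / t) (L i j)) \<oplus> st (p i) \<otimes> p j)"
      by (intro sos_add sos_scale sos_gram x(4) y(4)) (use t x y in \<open>auto simp: p_def\<close>)
    show "F (\<lambda>i j. (1 + t) *\<^sub>R x i j + (1 + 1 / t) *\<^sub>R y i j) \<le> (c + d)\<^sup>2"
    proof -
      have "(1 + t) * F x + (1 + 1 / t) * F y \<le> (1 + t) * c\<^sup>2 + (1 + 1 / t) * d\<^sup>2"
        using x(6) y(6) t by (intro add_mono mult_left_mono) auto
      also have "\<dots> = (c + d)\<^sup>2"
        using x(1) y(1) by (simp add: t_def field_simps power2_eq_square)
      finally show ?thesis by (simp add: F_add F_scale)
    qed
    fix i j assume ij: "i < N" "j < N"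
    have cl: "M i j \<in> carrier B" "L i j \<in> carrier B" "z i \<in> carrier B" "z j \<in> carrier B"
      "w i \<in> carrier B" "w j \<in> carrier B"
      using x y ij by (auto intro: sos_closed)
    define zz zw wz ww where "zz = st (z i) \<otimes> z j" and "zw = st (z i) \<otimes> w j"
      and "wz = st (w i) \<otimes> z j" and "ww = st (w i) \<otimes> w j"
    have c2: "zz \<in> carrier B" "zw \<in> carrier B" "wz \<in> carrier B" "ww \<in> carrier B"
      "sc t zz \<in> carrier B" "sc (1/t) ww \<in> carrier B" "sc (1 + t) (M i j) \<in> carrier B"
      "sc (1 + 1 / t) (L i j) \<in> carrier B"
      using cl by (auto simp: zz_def zw_def wz_def ww_def)
    have pp: "st (p i) \<otimes> p j = (sc t zz \<ominus> zw) \<ominus> (wz \<ominus> sc (1 / t) ww)"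
    proof -
      have "sc a (st (z i)) \<otimes> sc a (z j) = sc t zz" "sc a (st (z i)) \<otimes> sc (1 / a) (w j) = zw"
        "sc (1 / a) (st (w i)) \<otimes> sc a (z j) = wz" "sc (1 / a) (st (w i)) \<otimes> sc (1 / a) (w j) = sc (1 / t) ww"
        using cl a(2-) by (simp_all only: sc_mult_left sc_mult_right sc_sc st_closed sc_closed m_closed
            zz_def zw_def wz_def ww_def sc_one mult.commute[of "1 / a" a])
      moreover have "st (p i) \<otimes> p j = (sc a (st (z i)) \<otimes> sc a (z j) \<ominus> sc a (st (z i)) \<otimes> sc (1 / a) (w j))
          \<ominus> (sc (1 / a) (st (w i)) \<otimes> sc a (z j) \<ominus> sc (1 / a) (st (w i)) \<otimes> sc (1 / a) (w j))"
      proof -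
        have "st (p i) = sc a (st (z i)) \<ominus> sc (1 / a) (st (w i))"
          using cl by (simp add: p_def minus_eq st_add st_minus st_sc)
        moreover have "sc a (st (z i)) \<in> carrier B" "sc a (z j) \<in> carrier B" "sc (1 / a) (st (w i)) \<in> carrier B"
          "sc (1 / a) (w j) \<in> carrier B" using cl by auto
        ultimately show ?thesis unfolding p_def by algebra
      qed
      ultimately show ?thesis by simp
    qed
    have "\<Psi> ((1 + t) *\<^sub>R x i j + (1 + 1 / t) *\<^sub>R y i j) =
        (sc (1 + t) (M i j) \<oplus> (zz \<oplus> sc t zz)) \<oplus> (sc (1 + 1 / t) (L i j) \<oplus> (ww \<oplus> sc (1 / t) ww))"
      using x(5)[OF ij] y(5)[OF ij] cl c2
      by (simp add: Psi_add Psi_scale sc_add_right sc_add_left[of zz] sc_add_left[of ww] sc_one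
          flip: zz_def ww_def)
    also have "\<dots> = ((sc (1 + t) (M i j) \<oplus> sc (1 + 1 / t) (L i j)) \<oplus>
        ((sc t zz \<ominus> zw) \<ominus> (wz \<ominus> sc (1 / t) ww))) \<oplus> (zz \<oplus> zw \<oplus> (wz \<oplus> ww))"
      using c2 by algebra
    also have "zz \<oplus> zw \<oplus> (wz \<oplus> ww) = st (z i \<oplus> w i) \<otimes> (z j \<oplus> w j)"
      using cl by (simp add: st_add l_distr r_distr zz_def zw_def wz_def ww_def a_ac)
    finally show "\<Psi> ((1 + t) *\<^sub>R x i j + (1 + 1 / t) *\<^sub>R y i j) =
      ((sc (1 + t) (M i j) \<oplus> sc (1 + 1 / t) (L i j)) \<oplus> st (p i) \<otimes> p j) \<oplus> st (z i \<oplus> w i) \<otimes> (z j \<oplus> w j)"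
      unfolding pp .
  qed
qed

text \<open>An operator norm bound for left multiplication by \<open>b\<close> on the GNS space,
  expressed through the certificates.\<close>

definition opb :: "'a \<Rightarrow> real \<Rightarrow> bool" where
  "opb b C \<longleftrightarrow> 0 < C \<and> b \<in> carrier B \<and> (\<forall>z c. nb z c \<longrightarrow> nb (\<lambda>i. b \<otimes> z i) (C * c))"

lemma opbD: "opb b C \<Longrightarrow> nb z c \<Longrightarrow> nb (\<lambda>i. b \<otimes> z i) (C * c)"
  by (simp add: opb_def)

lemma opb_closed: "opb b C \<Longrightarrow> b \<in> carrier B"
  by (simp add: opb_def)

lemma opb_pos: "opb b C \<Longrightarrow> 0 < C"
  by (simp add: opb_def)

text \<open>Since \<open>C^2 - b^* b\<close> is positive, \<open>(b z)^* (b z)\<close> lies below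
  \<open>C^2 z^* z\<close>; sandwiching \<open>h\<close> supplies the difference as a sum of
  squares.\<close>

lemma opb_square:
  assumes C: "0 < C" and b: "b \<in> carrier B" and h: "pos h" and eq: "sc (C\<^sup>2) \<one> = st b \<otimes> b \<oplus> h"
  shows "opb b C"
  unfolding opb_def
proof (intro conjI allI impI C b)
  fix z c assume z: "nb z c"
  obtain x M where x0: "0 < c" "\<forall>i<N. z i \<in> carrier B"
    "\<forall>i<N. \<forall>j<N. x i j = x j i" "sos N M"
    "\<forall>i<N. \<forall>j<N. \<Psi> (x i j) = M i j \<oplus> st (z i) \<otimes> z j" "F x \<le> c\<^sup>2"
    using z unfolding nb_def by blast
  note x = x0[rule_format]
  have hc: "h \<in> carrier B" using h by (rule pos_closed)
  show "nb (\<lambda>i. b \<otimes> z i) (C * c)"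
  proof (rule nbI[where x = "\<lambda>i j. C\<^sup>2 *\<^sub>R x i j"
        and M = "\<lambda>i j. sc (C\<^sup>2) (M i j) \<oplus> st (z i) \<otimes> h \<otimes> z j"])
    show "sos N (\<lambda>i j. sc (C\<^sup>2) (M i j) \<oplus> st (z i) \<otimes> h \<otimes> z j)"
      by (intro sos_add sos_scale sos_sandwich x(4) h x(2)) auto
    show "F (\<lambda>i j. C\<^sup>2 *\<^sub>R x i j) \<le> (C * c)\<^sup>2"
      using x(6) C by (simp add: F_scale power_mult_distrib)
    fix i j assume ij: "i < N" "j < N"
    have cl: "M i j \<in> carrier B" "z i \<in> carrier B" "z j \<in> carrier B"
      using x ij by (auto intro: sos_closed)
    have "sc (C\<^sup>2) (st (z i) \<otimes> z j) = st (z i) \<otimes> (sc (C\<^sup>2) \<one>) \<otimes> z j"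
      using cl by (simp add: sc_mult_left sc_mult_right)
    also have "\<dots> = st (z i) \<otimes> h \<otimes> z j \<oplus> st (b \<otimes> z i) \<otimes> (b \<otimes> z j)"
      unfolding eq using cl b hc by (simp add: st_mult l_distr r_distr m_assoc a_comm)
    finally show "\<Psi> (C\<^sup>2 *\<^sub>R x i j) = (sc (C\<^sup>2) (M i j) \<oplus> st (z i) \<otimes> h \<otimes> z j) \<oplus> st (b \<otimes> z i) \<otimes> (b \<otimes> z j)"
      using x(5)[OF ij] cl b hc by (simp add: Psi_scale sc_add_right a_assoc)
  qed (use x C b in auto)
qed

lemma opb_zero: "0 < C \<Longrightarrow> opb \<zero> C"
  unfolding opb_def by (auto intro!: nb_cong[OF nb_zero] dest: nb_pos nb_closed)

lemma opb_scalar: "0 < \<bar>r\<bar> \<Longrightarrow> opb (sc r \<one>) \<bar>r\<bar>"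
  by (rule opb_square[where h = \<zero>])
    (auto simp: pos_def st_sc st_one sc_mult_left sc_mult_right sc_sc power2_eq_square intro: sos_zero)

lemma opb_one: "opb \<one> 1"
  using opb_scalar[of 1] by (simp add: sc_one)

lemma opb_add:
  assumes "opb a C" "opb b D"
  shows "opb (a \<oplus> b) (C + D)"
  unfolding opb_def
proof (intro conjI allI impI)
  show "0 < C + D" using assms by (simp add: opb_def)
  show "a \<oplus> b \<in> carrier B" using assms by (simp add: opb_def)
  fix z c assume z: "nb z c"
  have "nb (\<lambda>i. a \<otimes> z i \<oplus> b \<otimes> z i) (C * c + D * c)"
    by (intro nb_add opbD assms z)
  then show "nb (\<lambda>i. (a \<oplus> b) \<otimes> z i) ((C + D) * c)"
    unfolding distrib_right
    by (rule nb_cong) (use assms nb_closed[OF z] in \<open>simp add: opb_def l_distr\<close>)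
qed

lemma opb_mult:
  assumes "opb a C" "opb b D"
  shows "opb (a \<otimes> b) (C * D)"
  unfolding opb_def
proof (intro conjI allI impI)
  show "0 < C * D" using assms by (simp add: opb_def)
  show "a \<otimes> b \<in> carrier B" using assms by (simp add: opb_def)
  fix z c assume z: "nb z c"
  have "nb (\<lambda>i. a \<otimes> (b \<otimes> z i)) (C * (D * c))"
    by (intro opbD assms z)
  then show "nb (\<lambda>i. (a \<otimes> b) \<otimes> z i) ((C * D) * c)"
    unfolding mult.assoc
    by (rule nb_cong) (use assms nb_closed[OF z] in \<open>simp add: opb_def m_assoc\<close>)
qed

lemma opb_sc:
  assumes "opb a C"
  shows "\<exists>D. opb (sc r a) D"
proof (cases "r = 0")
  case True
  then show ?thesis using opb_closed[OF assms] opb_zero[of 1] by (auto simp: sc_zero_left)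
next
  case False
  then have "opb (sc r \<one> \<otimes> a) (\<bar>r\<bar> * C)" by (intro opb_mult opb_scalar assms) auto
  then show ?thesis using opb_closed[OF assms] by (auto simp: sc_mult_left)
qed

lemma nb_sc: "nb z c \<Longrightarrow> r \<noteq> 0 \<Longrightarrow> nb (\<lambda>i. sc r (z i)) (\<bar>r\<bar> * c)"
  using opbD[OF opb_scalar[of r], of z c] by (auto elim!: nb_cong simp: sc_mult_left dest: nb_closed)

lemma nb_uminus: "nb z c \<Longrightarrow> nb (\<lambda>i. \<ominus> z i) c"
  using nb_cong[OF nb_sc[of z c "-1"], of "\<lambda>i. \<ominus> z i"] by (simp add: sc_minus_one nb_closed)

definition nul :: "(nat \<Rightarrow> 'a) \<Rightarrow> bool" where
  "nul z \<longleftrightarrow> (\<forall>c>0. nb z c)"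

lemma nul_cong: "nul z \<Longrightarrow> (\<And>i. i < N \<Longrightarrow> w i = z i) \<Longrightarrow> nul w"
  unfolding nul_def using nb_cong by blast

lemma nul_closed: "nul z \<Longrightarrow> i < N \<Longrightarrow> z i \<in> carrier B"
  unfolding nul_def using nb_closed[of z 1] by simp

lemma nul_add: "nul z \<Longrightarrow> nul w \<Longrightarrow> nul (\<lambda>i. z i \<oplus> w i)"
  unfolding nul_def
proof (intro allI impI)
  fix c :: real
  assume "\<forall>c>0. nb z c" "\<forall>c>0. nb w c" "0 < c"
  then have "nb (\<lambda>i. z i \<oplus> w i) (c / 2 + c / 2)" by (intro nb_add) auto
  then show "nb (\<lambda>i. z i \<oplus> w i) c" by simp
qed

lemma nul_uminus: "nul z \<Longrightarrow> nul (\<lambda>i. \<ominus> z i)"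
  unfolding nul_def using nb_uminus by blast

lemma nul_sum:
  assumes "finite S" "\<And>k. k \<in> S \<Longrightarrow> nul (z k)"
  shows "nul (\<lambda>i. \<Oplus>k\<in>S. z k i)"
  using assms
proof (induction S)
  case empty
  then show ?case by (simp add: nul_def nb_zero)
next
  case (insert k S)
  have "nul (\<lambda>i. z k i \<oplus> (\<Oplus>k\<in>S. z k i))" by (intro nul_add insert) (use insert in auto)
  moreover have "(\<Oplus>k\<in>insert k S. z k i) = z k i \<oplus> (\<Oplus>k\<in>S. z k i)" if "i < N" for i
    using insert that by (intro finsum_insert) (auto intro!: nul_closed)
  ultimately show ?case by (rule nul_cong) auto
qed

text \<open>The real vector \<open>\<xi>\<close> as a tuple of scalars in the ring; in the GNS space
  these tuples are the copy of the representation space on which limits are tested.\<close>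

definition emb :: "(nat \<Rightarrow> real) \<Rightarrow> nat \<Rightarrow> 'a" where
  "emb \<xi> i = sc (\<xi> i) \<one>"

lemma emb_closed [simp, intro]: "emb \<xi> i \<in> carrier B"
  by (simp add: emb_def)

lemma gram_emb: "a \<in> carrier B \<Longrightarrow> b \<in> carrier B \<Longrightarrow>
    st (a \<otimes> emb \<xi> i) \<otimes> (b \<otimes> emb \<xi> j) = sc (\<xi> i * \<xi> j) (st a \<otimes> b)"
  by (simp add: emb_def sc_mult_left sc_mult_right st_sc sc_sc mult.commute)

lemma nb_emb: "\<exists>c. nb (emb \<xi>) c"
proof -
  define x where "x = (\<lambda>i j. (\<xi> i * \<xi> j) *\<^sub>R u)"
  define c where "c = 1 + \<bar>F x\<bar>"
  have "c \<le> c * c" using mult_left_mono[of 1 c c] by (simp add: c_def)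
  then have "F x \<le> c\<^sup>2" unfolding power2_eq_square by (simp add: c_def)
  moreover have "\<Psi> (x i j) = \<zero> \<oplus> st (emb \<xi> i) \<otimes> emb \<xi> j" for i j
    using gram_emb[of \<one> \<one> \<xi> i j] by (simp add: x_def Psi_scale Psi_unit st_one)
  ultimately have "nb (emb \<xi>) c"
    by (intro nbI[where x = x and M = "\<lambda>i j. \<zero>"]) (auto simp: c_def x_def mult.commute intro: sos_zero)
  then show ?thesis ..
qed

text \<open>A majorant \<open>x\<close> of the Gram matrix of \<open>emb \<xi>\<close> exceeds its
  exact preimage \<open>x0\<close> under \<open>\<Psi>\<close> by a sum of squares, so
  \<open>F x0\<close> is at most \<open>F x\<close>. This is where the positivity of
  \<open>F\<close> enters.\<close>

lemma emb_not_nul: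
  assumes "0 < F (\<lambda>i j. (\<xi> i * \<xi> j) *\<^sub>R u)"
  shows "\<not> nul (emb \<xi>)"
proof
  assume nul: "nul (emb \<xi>)"
  define x0 where "x0 = (\<lambda>i j. (\<xi> i * \<xi> j) *\<^sub>R u)"
  have "F x0 \<le> c\<^sup>2" if "0 < c" for c
  proof -
    have "nb (emb \<xi>) c" using nul that by (simp add: nul_def)
    then obtain x M where x': "\<forall>i<N. \<forall>j<N. x i j = x j i" "sos N M"
      "\<forall>i<N. \<forall>j<N. \<Psi> (x i j) = M i j \<oplus> st (emb \<xi> i) \<otimes> emb \<xi> j" "F x \<le> c\<^sup>2"
      unfolding nb_def by blast
    note x = x'[rule_format]
    define y where "y = (\<lambda>i j. x i j - x0 i j)"
    have "\<Psi> (y i j) = M i j" if "i < N" "j < N" for i j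
    proof -
      have "\<Psi> (x0 i j) = st (emb \<xi> i) \<otimes> emb \<xi> j"
        using gram_emb[of \<one> \<one> \<xi> i j] by (simp add: x0_def Psi_scale Psi_unit st_one)
      moreover have "M i j \<in> carrier B" using sos_closed[OF x(2) that] .
      ultimately show ?thesis
        using x(3)[OF that] by (simp add: y_def Psi_diff minus_eq a_assoc r_neg)
    qed
    then have "sos N (\<lambda>i j. \<Psi> (y i j))" by (intro sos_cong[OF x(2)]) auto
    moreover have "y i j = y j i" if "i < N" "j < N" for i j
      using x(1)[OF that] by (simp add: y_def x0_def mult.commute)
    ultimately have "0 \<le> F y" unfolding F_def by (intro phi_nonneg) auto
    then show ?thesis using x(4) unfolding y_def F_diff by simp
  qed
  from this[of "sqrt (F x0 / 2)"] show False using assms by (simp add: x0_def)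
qed

text \<open>\<open>apx a T\<close>: the uniformly bounded sequence \<open>a\<close> tends to \<open>T\<close> on the vectors with real entries.\<close>

definition apx :: "(nat \<Rightarrow> 'a) \<Rightarrow> ((nat \<Rightarrow> real) \<Rightarrow> nat \<Rightarrow> real) \<Rightarrow> bool" where
  "apx a T \<longleftrightarrow> (\<exists>C. \<forall>m. opb (a m) C) \<and>
    (\<forall>\<xi>. \<forall>e>0. \<exists>m0. \<forall>m\<ge>m0. nb (\<lambda>i. a m \<otimes> emb \<xi> i \<ominus> emb (T \<xi>) i) e)"

lemma apx_closed: "apx a T \<Longrightarrow> a m \<in> carrier B"
  unfolding apx_def using opb_closed by blast

lemma apx_cong: "apx a T \<Longrightarrow> (\<And>\<xi> i. i < N \<Longrightarrow> T' \<xi> i = T \<xi> i) \<Longrightarrow> apx a T'"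
proof -
  assume a: "apx a T" and eq: "\<And>\<xi> i. i < N \<Longrightarrow> T' \<xi> i = T \<xi> i"
  have "nb (\<lambda>i. a m \<otimes> emb \<xi> i \<ominus> emb (T' \<xi>) i) e = nb (\<lambda>i. a m \<otimes> emb \<xi> i \<ominus> emb (T \<xi>) i) e" for m \<xi> e
    using eq by (intro iffI; elim nb_cong) (simp_all add: emb_def)
  then show ?thesis using a by (simp add: apx_def)
qed

lemma apx_one: "apx (\<lambda>m. \<one>) (\<lambda>\<xi>. \<xi>)"
proof -
  have "nb (\<lambda>i. \<one> \<otimes> emb \<xi> i \<ominus> emb \<xi> i) e" if "0 < e" for e \<xi>
    by (rule nb_cong[OF nb_zero[OF that]]) (simp add: minus_eq r_neg)
  then show ?thesis unfolding apx_def using opb_one by blast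
qed

lemma apx_zero: "apx (\<lambda>m. \<zero>) (\<lambda>\<xi> i. 0)"
proof -
  have "nb (\<lambda>i. \<zero> \<otimes> emb \<xi> i \<ominus> emb (\<lambda>i. 0) i) e" if "0 < e" for e \<xi>
    by (rule nb_cong[OF nb_zero[OF that]]) (simp add: emb_def sc_zero_left minus_eq)
  then show ?thesis unfolding apx_def using opb_zero[of 1] by (meson zero_less_one)
qed

lemma apx_add:
  assumes "apx a S" "apx b T"
  shows "apx (\<lambda>m. a m \<oplus> b m) (\<lambda>\<xi> i. S \<xi> i + T \<xi> i)"
  unfolding apx_def
proof (intro conjI allI impI)
  obtain C D where "\<forall>m. opb (a m) C" "\<forall>m. opb (b m) D" using assms unfolding apx_def by blast
  then show "\<exists>C. \<forall>m. opb (a m \<oplus> b m) C" using opb_add by blast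
  fix \<xi> and e :: real assume e: "0 < e"
  obtain m1 where m1: "nb (\<lambda>i. a m \<otimes> emb \<xi> i \<ominus> emb (S \<xi>) i) (e / 2)" if "m \<ge> m1" for m
    using assms(1) e unfolding apx_def by (meson half_gt_zero)
  obtain m2 where m2: "nb (\<lambda>i. b m \<otimes> emb \<xi> i \<ominus> emb (T \<xi>) i) (e / 2)" if "m \<ge> m2" for m
    using assms(2) e unfolding apx_def by (meson half_gt_zero)
  have "nb (\<lambda>i. (a m \<oplus> b m) \<otimes> emb \<xi> i \<ominus> emb (\<lambda>i. S \<xi> i + T \<xi> i) i) e" if "m \<ge> max m1 m2" for m
  proof -
    have "nb (\<lambda>i. (a m \<otimes> emb \<xi> i \<ominus> emb (S \<xi>) i) \<oplus> (b m \<otimes> emb \<xi> i \<ominus> emb (T \<xi>) i)) (e / 2 + e / 2)"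
      by (intro nb_add m1 m2) (use that in auto)
    moreover have "(a m \<oplus> b m) \<otimes> emb \<xi> i \<ominus> emb (\<lambda>i. S \<xi> i + T \<xi> i) i =
        (a m \<otimes> emb \<xi> i \<ominus> emb (S \<xi>) i) \<oplus> (b m \<otimes> emb \<xi> i \<ominus> emb (T \<xi>) i)" for i
    proof -
      have cl: "a m \<in> carrier B" "b m \<in> carrier B" "emb \<xi> i \<in> carrier B" "emb (S \<xi>) i \<in> carrier B" "emb (T \<xi>) i \<in> carrier B"
        using assms apx_closed by auto
      have "emb (\<lambda>i. S \<xi> i + T \<xi> i) i = emb (S \<xi>) i \<oplus> emb (T \<xi>) i" by (simp add: emb_def sc_add_left)
      then show ?thesis using cl by algebra
    qed
    ultimately show ?thesis by simp
  qed
  then show "\<exists>m0. \<forall>m\<ge>m0. nb (\<lambda>i. (a m \<oplus> b m) \<otimes> emb \<xi> i \<ominus> emb (\<lambda>i. S \<xi> i + T \<xi> i) i) e" by blast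
qed

text \<open>\<open>a b - S T = a (b - T) + (a - S) T\<close>, and the uniform bound on
  \<open>a\<close> controls the first term.\<close>

lemma apx_mult:
  assumes "apx a S" "apx b T"
  shows "apx (\<lambda>m. a m \<otimes> b m) (\<lambda>\<xi>. S (T \<xi>))"
  unfolding apx_def
proof (intro conjI allI impI)
  obtain C D where C: "\<forall>m. opb (a m) C" "\<forall>m. opb (b m) D" using assms unfolding apx_def by blast
  then show "\<exists>C. \<forall>m. opb (a m \<otimes> b m) C" using opb_mult by blast
  have Cpos: "0 < C" using C(1) opb_pos by blast
  fix \<xi> and e :: real assume e: "0 < e"
  obtain m1 where m1: "nb (\<lambda>i. a m \<otimes> emb (T \<xi>) i \<ominus> emb (S (T \<xi>)) i) (e / 2)" if "m \<ge> m1" for m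
    using assms(1) e unfolding apx_def by (meson half_gt_zero)
  have "0 < e / (2 * C)" using e Cpos by simp
  then obtain m2 where m2: "nb (\<lambda>i. b m \<otimes> emb \<xi> i \<ominus> emb (T \<xi>) i) (e / (2 * C))" if "m \<ge> m2" for m
    using assms(2) unfolding apx_def by meson
  have "nb (\<lambda>i. (a m \<otimes> b m) \<otimes> emb \<xi> i \<ominus> emb (S (T \<xi>)) i) e" if "m \<ge> max m1 m2" for m
  proof -
    have "nb (\<lambda>i. a m \<otimes> (b m \<otimes> emb \<xi> i \<ominus> emb (T \<xi>) i)) (C * (e / (2 * C)))"
      using C(1) m2[of m] that by (intro opbD) auto
    then have "nb (\<lambda>i. a m \<otimes> (b m \<otimes> emb \<xi> i \<ominus> emb (T \<xi>) i) \<oplus> (a m \<otimes> emb (T \<xi>) i \<ominus> emb (S (T \<xi>)) i))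
        (C * (e / (2 * C)) + e / 2)"
      using m1[of m] that by (intro nb_add) auto
    moreover have "C * (e / (2 * C)) + e / 2 = e" using Cpos by simp
    moreover have "(a m \<otimes> b m) \<otimes> emb \<xi> i \<ominus> emb (S (T \<xi>)) i =
        a m \<otimes> (b m \<otimes> emb \<xi> i \<ominus> emb (T \<xi>) i) \<oplus> (a m \<otimes> emb (T \<xi>) i \<ominus> emb (S (T \<xi>)) i)" for i
    proof -
      have cl: "a m \<in> carrier B" "b m \<in> carrier B" "emb \<xi> i \<in> carrier B" "emb (T \<xi>) i \<in> carrier B"
        "emb (S (T \<xi>)) i \<in> carrier B"
        using assms apx_closed by auto
      then show ?thesis by algebra
    qed
    ultimately show ?thesis by simp
  qed
  then show "\<exists>m0. \<forall>m\<ge>m0. nb (\<lambda>i. (a m \<otimes> b m) \<otimes> emb \<xi> i \<ominus> emb (S (T \<xi>)) i) e" by blast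
qed

lemma apx_sc:
  assumes "apx a T"
  shows "apx (\<lambda>m. sc r (a m)) (\<lambda>\<xi> i. r * T \<xi> i)"
proof -
  have "apx (\<lambda>m. sc r \<one>) (\<lambda>\<xi> i. r * \<xi> i)"
  proof -
    have "nb (\<lambda>i. sc r \<one> \<otimes> emb \<xi> i \<ominus> emb (\<lambda>i. r * \<xi> i) i) e" if "0 < e" for e \<xi>
      by (rule nb_cong[OF nb_zero[OF that]]) (simp add: emb_def sc_mult_left sc_sc minus_eq r_neg)
    then show ?thesis unfolding apx_def using opb_sc[OF opb_one, of r] by blast
  qed
  from apx_mult[OF this assms] show ?thesis using apx_closed[OF assms] by (simp add: sc_mult_left)
qed

lemma apx_sum:
  assumes "finite S" "\<And>k. k \<in> S \<Longrightarrow> apx (a k) (T k)"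
  shows "apx (\<lambda>m. \<Oplus>k\<in>S. a k m) (\<lambda>\<xi> i. \<Sum>k\<in>S. T k \<xi> i)"
  using assms
proof (induction S)
  case empty
  then show ?case by (simp add: apx_zero)
next
  case (insert k S)
  have "apx (\<lambda>m. a k m \<oplus> (\<Oplus>k\<in>S. a k m)) (\<lambda>\<xi> i. T k \<xi> i + (\<Sum>k\<in>S. T k \<xi> i))"
    by (intro apx_add insert) (use insert in auto)
  moreover have "(\<Oplus>k\<in>insert k S. a k m) = a k m \<oplus> (\<Oplus>k\<in>S. a k m)" for m
    using insert by (intro finsum_insert) (auto intro!: apx_closed)
  ultimately show ?case using insert(1,2) by simp
qed

definition form :: "'v \<Rightarrow> (nat \<Rightarrow> real) \<Rightarrow> real" where
  "form w \<zeta> = (\<Sum>i<N. \<Sum>j<N. \<phi> i j w * (\<zeta> i * \<zeta> j))"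

lemma F_rank_one: "F (\<lambda>i j. (\<zeta> i * \<zeta> j) *\<^sub>R w) = form w \<zeta>"
  by (simp add: F_def form_def linear_scale[OF phi_linear] mult.commute)

end

section \<open>Null vectors and approximate inverses over a cone\<close>

locale star_cone_functional = star_functional B st sc \<Psi> N \<phi> u
  for B (structure) and st :: "'a \<Rightarrow> 'a" and sc and \<Psi> :: "'v::real_vector \<Rightarrow> 'a" and N \<phi> u +
  fixes C :: "'v set"
  assumes Psi_pos: "v \<in> C \<Longrightarrow> pos (\<Psi> v)"
begin

definition bounded_by :: "real \<Rightarrow> 'v \<Rightarrow> bool" where
  "bounded_by c w \<longleftrightarrow> 0 < c \<and> w \<in> C \<and> c *\<^sub>R u - w \<in> C"

lemma bounded_square:
  assumes "bounded_by c w"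
  shows "\<exists>P. pos P \<and> sc c (\<Psi> w) = \<Psi> w \<otimes> \<Psi> w \<oplus> P"
proof (rule square_le)
  show "pos (\<Psi> w)" "pos (\<Psi> (c *\<^sub>R u - w))" "0 < c"
    using assms by (auto simp: bounded_by_def intro: Psi_pos)
  have "\<Psi> (w + (c *\<^sub>R u - w)) = \<Psi> w \<oplus> \<Psi> (c *\<^sub>R u - w)" by (rule Psi_add)
  then show "sc c \<one> = \<Psi> w \<oplus> \<Psi> (c *\<^sub>R u - w)" by (simp add: Psi_scale Psi_unit)
qed

text \<open>If the representation of \<open>w\<close> kills \<open>\<zeta>\<close>, then so does
  \<open>\<Psi> w\<close> up to null vectors: its square lies below \<open>c\<close> times
  \<open>\<Psi> w\<close>, which provides a majorant of value \<open>c * form w \<zeta> = 0\<close>.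
  This is how linear relations of the representation pass to the ring.\<close>

lemma nul_of_form:
  assumes "bounded_by c w" "form w \<zeta> = 0"
  shows "nul (\<lambda>i. \<Psi> w \<otimes> emb \<zeta> i)"
  unfolding nul_def
proof (intro allI impI)
  fix e :: real assume e: "0 < e"
  obtain P where P: "pos P" "sc c (\<Psi> w) = \<Psi> w \<otimes> \<Psi> w \<oplus> P"
    using bounded_square[OF assms(1)] by blast
  have Pc: "P \<in> carrier B" using P(1) by (rule pos_closed)
  have sw: "st (\<Psi> w) = \<Psi> w" using assms(1) by (auto simp: bounded_by_def intro: pos_selfadjoint Psi_pos)
  show "nb (\<lambda>i. \<Psi> w \<otimes> emb \<zeta> i) e"
  proof (rule nbI[where x = "\<lambda>i j. c *\<^sub>R ((\<zeta> i * \<zeta> j) *\<^sub>R w)" and M = "\<lambda>i j. st (emb \<zeta> i) \<otimes> P \<otimes> emb \<zeta> j"])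
    show "sos N (\<lambda>i j. st (emb \<zeta> i) \<otimes> P \<otimes> emb \<zeta> j)"
      by (intro sos_sandwich P) auto
    show "F (\<lambda>i j. c *\<^sub>R ((\<zeta> i * \<zeta> j) *\<^sub>R w)) \<le> e\<^sup>2"
      unfolding F_scale F_rank_one assms(2) by simp
    fix i j assume "i < N" "j < N"
    have "\<Psi> (c *\<^sub>R ((\<zeta> i * \<zeta> j) *\<^sub>R w)) = sc (\<zeta> i * \<zeta> j) (sc c (\<Psi> w))"
      by (simp add: Psi_scale sc_sc mult.commute mult.left_commute)
    also have "\<dots> = sc (\<zeta> i * \<zeta> j) P \<oplus> sc (\<zeta> i * \<zeta> j) (\<Psi> w \<otimes> \<Psi> w)"
      unfolding P(2) using Pc by (simp add: sc_add_right a_comm)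
    also have "sc (\<zeta> i * \<zeta> j) P = st (emb \<zeta> i) \<otimes> P \<otimes> emb \<zeta> j"
      using Pc by (simp add: emb_def st_sc st_one sc_mult_left sc_mult_right sc_sc mult.commute)
    also have "sc (\<zeta> i * \<zeta> j) (\<Psi> w \<otimes> \<Psi> w) = st (\<Psi> w \<otimes> emb \<zeta> i) \<otimes> (\<Psi> w \<otimes> emb \<zeta> j)"
      using gram_emb[of "\<Psi> w" "\<Psi> w" \<zeta> i j] sw by simp
    finally show "\<Psi> (c *\<^sub>R ((\<zeta> i * \<zeta> j) *\<^sub>R w)) =
        st (emb \<zeta> i) \<otimes> P \<otimes> emb \<zeta> j \<oplus> st (\<Psi> w \<otimes> emb \<zeta> i) \<otimes> (\<Psi> w \<otimes> emb \<zeta> j)" .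
  qed (use e in \<open>auto simp: mult.commute\<close>)
qed

lemma opb_bounded:
  assumes "bounded_by c w"
  shows "opb (\<Psi> w) c"
proof -
  obtain P where P: "pos P" "sc c (\<Psi> w) = \<Psi> w \<otimes> \<Psi> w \<oplus> P"
    using bounded_square[OF assms(1)] by blast
  have c: "0 < c" "w \<in> C" "c *\<^sub>R u - w \<in> C" using assms by (auto simp: bounded_by_def)
  have sw: "st (\<Psi> w) = \<Psi> w" using c by (intro pos_selfadjoint Psi_pos)
  show ?thesis
  proof (rule opb_square)
    show "pos (P \<oplus> sc c (\<Psi> (c *\<^sub>R u - w)))"
      using c by (intro pos_add pos_scale P Psi_pos) auto
    have "sc (c\<^sup>2) \<one> = \<Psi> (c *\<^sub>R w + c *\<^sub>R (c *\<^sub>R u - w))"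
      by (simp add: Psi_scale Psi_unit power2_eq_square sc_sc scaleR_right_diff_distrib)
    also have "\<dots> = sc c (\<Psi> w) \<oplus> sc c (\<Psi> (c *\<^sub>R u - w))" by (simp only: Psi_add Psi_scale)
    finally show "sc (c\<^sup>2) \<one> = st (\<Psi> w) \<otimes> \<Psi> w \<oplus> (P \<oplus> sc c (\<Psi> (c *\<^sub>R u - w)))"
      unfolding P(2) sw using pos_closed[OF P(1)] by (simp add: a_assoc)
  qed (use c in auto)
qed

text \<open>The partial sums of the series with terms \<open>t (1 - t G)^j\<close>; they tend to the
  inverse of \<open>G\<close> when \<open>1 - t G\<close> is a strict contraction.\<close>

primrec neumann :: "real \<Rightarrow> 'a \<Rightarrow> nat \<Rightarrow> 'a" where
  "neumann t G 0 = \<zero>"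
| "neumann t G (Suc m) = sc t \<one> \<oplus> (\<one> \<ominus> sc t G) \<otimes> neumann t G m"

lemma neumann_closed [simp]: "G \<in> carrier B \<Longrightarrow> neumann t G m \<in> carrier B"
  by (induction m) auto

lemma neumann_mult:
  assumes "G \<in> carrier B"
  shows "neumann t G m \<otimes> G = \<one> \<ominus> (\<one> \<ominus> sc t G) [^] m"
proof (induction m)
  case 0
  then show ?case using assms by (simp add: minus_eq r_neg)
next
  case (Suc m)
  define K where "K = \<one> \<ominus> sc t G"
  have cl: "K \<in> carrier B" "K [^] m \<in> carrier B" "sc t G \<in> carrier B" "neumann t G m \<in> carrier B"
    using assms by (auto simp: K_def)
  have "neumann t G (Suc m) \<otimes> G = sc t G \<oplus> K \<otimes> (neumann t G m \<otimes> G)"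
    using assms cl by (simp add: l_distr sc_mult_left m_assoc flip: K_def)
  also have "\<dots> = sc t G \<oplus> K \<otimes> (\<one> \<ominus> K [^] m)" unfolding Suc.IH K_def ..
  also have "K \<otimes> (\<one> \<ominus> K [^] m) = K \<ominus> K \<otimes> K [^] m" using cl(1,2) by (simp add: minus_eq r_distr r_minus)
  also have "sc t G \<oplus> (K \<ominus> K \<otimes> K [^] m) = (sc t G \<oplus> K) \<ominus> K \<otimes> K [^] m"
    using cl(1-3) by (simp add: minus_eq a_assoc)
  also have "sc t G \<oplus> K = \<one>" unfolding K_def using cl(3) one_closed by algebra
  also have "K \<otimes> K [^] m = K [^] Suc m" by (rule nat_pow_Suc2[OF cl(1), symmetric])
  finally show ?case by (simp add: K_def)
qed

text \<open>The polynomials \<open>neumann\<close> in \<open>\<Psi> g\<close> invert \<open>\<Psi> g\<close> in the limit, as \<open>e u \<le> g \<le> c u\<close>.\<close>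

lemma apx_neumann:
  assumes g: "bounded_by c g" "g - e *\<^sub>R u \<in> C" "0 < e" "e < c"
    and w: "bounded_by d w"
    and nul: "\<And>\<xi>. nul (\<lambda>i. \<Psi> w \<otimes> emb \<xi> i \<ominus> \<Psi> g \<otimes> emb (T \<xi>) i)"
  shows "apx (\<lambda>m. neumann (1 / c) (\<Psi> g) m \<otimes> \<Psi> w) T"
proof -
  define G where "G = \<Psi> g"
  define K where "K = \<one> \<ominus> sc (1 / c) G"
  have c: "0 < c" "g \<in> C" using g(1) by (auto simp: bounded_by_def)
  have sG: "st G = G" unfolding G_def using c by (intro pos_selfadjoint Psi_pos)
  have cl: "G \<in> carrier B" "K \<in> carrier B" by (auto simp: G_def K_def)
  obtain P where P: "pos P" "sc c G = G \<otimes> G \<oplus> P"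
    using bounded_square[OF g(1)] unfolding G_def by blast
  have Pc: "P \<in> carrier B" using P(1) by (rule pos_closed)
  \<comment> \<open>\<open>e <= G <= c\<close> puts \<open>K = 1 - G / c\<close> between 0 and
    \<open>1 - e / c\<close>. As \<open>K^2 <= K\<close>, the norm of \<open>K\<close> is at most
    the square root of that bound.\<close>
  define \<rho> where "\<rho> = sqrt (1 - e / c)"
  have "0 < 1 - e / c" "1 - e / c < 1" using g(3,4) c by (auto simp: field_simps)
  then have \<rho>: "0 < \<rho>" "\<rho> < 1" "\<rho>\<^sup>2 = 1 - e / c" by (simp_all add: \<rho>_def)
  have K: "opb K \<rho>"
  proof (rule opb_square)
    define D where "D = \<Psi> (g - e *\<^sub>R u)"
    show "pos (sc (1 / c) D \<oplus> sc (1 / c\<^sup>2) P)"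
      unfolding D_def using c by (intro pos_add pos_scale P Psi_pos g) auto
    define A where "A = sc (1 / c) G"
    define A2 where "A2 = sc (1 / c\<^sup>2) (G \<otimes> G)"
    define U where "U = sc (e / c) \<one>"
    have cA: "A \<in> carrier B" "A2 \<in> carrier B" "U \<in> carrier B" using cl by (auto simp: A_def A2_def U_def)
    have "st K = K" using cl sG by (simp add: K_def minus_eq st_add st_minus st_sc st_one)
    moreover have "A \<otimes> A = A2"
      using cl by (simp add: A_def A2_def sc_mult_left sc_mult_right sc_sc power2_eq_square)
    moreover have "sc (1 / c) D = A \<ominus> U"
    proof -
      have "D = G \<ominus> sc e \<one>" by (simp add: D_def G_def Psi_diff Psi_scale Psi_unit)
      then show ?thesis using cl by (simp add: A_def U_def minus_eq sc_add_right sc_minus sc_sc)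
    qed
    moreover have "sc (1 / c\<^sup>2) P = A \<ominus> A2"
    proof -
      have "P = sc c G \<ominus> G \<otimes> G"
        using cl Pc by (simp add: P(2) minus_eq a_ac r_neg1 r_neg)
      moreover have "sc (1 / c\<^sup>2) (sc c G) = A"
        using cl c by (simp add: A_def sc_sc power2_eq_square)
      ultimately show ?thesis using cl by (simp add: A2_def minus_eq sc_add_right sc_minus)
    qed
    moreover have "sc (\<rho>\<^sup>2) \<one> = \<one> \<ominus> U"
      using sc_add_left[of \<one> 1 "- (e / c)"] by (simp add: \<rho> U_def sc_one sc_neg minus_eq)
    \<comment> \<open>Exhibits \<open>(1 - e / c) - K^2\<close> as the sum of the positive elements
      \<open>A - U\<close> and \<open>A - A^2\<close>, where \<open>A = G / c\<close> and
      \<open>U = e / c\<close>.\<close>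
    moreover have "\<one> \<ominus> U = (\<one> \<ominus> A) \<otimes> (\<one> \<ominus> A) \<oplus> ((A \<ominus> U) \<oplus> (A \<ominus> A \<otimes> A))"
    proof -
      have "(\<one> \<ominus> A) \<otimes> (\<one> \<ominus> A) = (\<one> \<ominus> A) \<ominus> (A \<ominus> A \<otimes> A)"
        using cA(1) by (simp add: minus_eq l_distr r_distr l_minus r_minus minus_add a_ac)
      moreover have "X \<ominus> U = ((X \<ominus> A) \<ominus> (A \<ominus> A \<otimes> A)) \<oplus> ((A \<ominus> U) \<oplus> (A \<ominus> A \<otimes> A))"
        if "X \<in> carrier B" for X using that cA(1,3) by algebra
      ultimately show ?thesis by simp
    qed
    ultimately show "sc (\<rho>\<^sup>2) \<one> = st K \<otimes> K \<oplus> (sc (1 / c) D \<oplus> sc (1 / c\<^sup>2) P)"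
      by (simp add: K_def A_def)
  qed (use \<rho> cl in auto)
  have Kpow: "nb (\<lambda>i. K [^] m \<otimes> z i) (\<rho> ^ m * b)" if z: "nb z b" for z b and m :: nat
  proof (induction m)
    case 0
    show ?case using z nb_closed[OF z] by (auto elim!: nb_cong)
  next
    case (Suc m)
    have eq: "K [^] Suc m \<otimes> z i = K \<otimes> (K [^] m \<otimes> z i)" if i: "i < N" for i
      unfolding nat_pow_Suc2[OF cl(2)]
      by (rule m_assoc) (use cl(2) nb_closed[OF z i] in auto)
    have "nb (\<lambda>i. K \<otimes> (K [^] m \<otimes> z i)) (\<rho> * (\<rho> ^ m * b))" by (rule opbD[OF K Suc])
    then have "nb (\<lambda>i. K [^] Suc m \<otimes> z i) (\<rho> * (\<rho> ^ m * b))" by (rule nb_cong) (rule eq)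
    then show ?case by (simp add: mult.assoc)
  qed
  define q where "q = neumann (1 / c) G"
  \<comment> \<open>The sum of the geometric series with terms \<open>(1 / c) * \<rho> ^ j\<close>.
    As a fixed point of \<open>1 / c + \<rho> * Q\<close> it is reproduced by the recursion of
    \<open>neumann\<close>.\<close>
  define Q where "Q = (1 / c) / (1 - \<rho>)"
  have Q: "0 < Q" "1 / c + \<rho> * Q = Q" using c \<rho> by (auto simp: Q_def field_simps)
  have q: "opb (q m) Q" for m
  proof (induction m)
    case 0
    show ?case using opb_zero[OF Q(1)] by (simp add: q_def)
  next
    case (Suc m)
    have "opb (sc (1 / c) \<one> \<oplus> K \<otimes> q m) (1 / c + \<rho> * Q)"
      using opb_scalar[of "1 / c"] c by (intro opb_add opb_mult K Suc) auto
    then show ?case unfolding Q(2) by (simp add: q_def K_def)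
  qed
  show ?thesis
    unfolding apx_def
  proof (intro conjI allI impI)
    show "\<exists>C. \<forall>m. opb (neumann (1 / c) (\<Psi> g) m \<otimes> \<Psi> w) C"
      using opb_mult[OF q opb_bounded[OF w]] unfolding q_def G_def by blast
    fix \<xi> and \<epsilon> :: real assume \<epsilon>: "0 < \<epsilon>"
    obtain b where b: "nb (emb (T \<xi>)) b" using nb_emb by blast
    then have "0 < b" by (rule nb_pos)
    have "(\<lambda>m. \<rho> ^ m * b) \<longlonglongrightarrow> 0 * b"
      using \<rho> by (intro tendsto_mult LIMSEQ_realpow_zero tendsto_const) auto
    then have "\<forall>\<^sub>F m in sequentially. \<rho> ^ m * b < \<epsilon> / 2"
      using \<epsilon> by (intro order_tendstoD) auto
    then obtain m0 where m0: "\<And>m. m \<ge> m0 \<Longrightarrow> \<rho> ^ m * b < \<epsilon> / 2"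
      unfolding eventually_sequentially by blast
    have "nb (\<lambda>i. (neumann (1 / c) (\<Psi> g) m \<otimes> \<Psi> w) \<otimes> emb \<xi> i \<ominus> emb (T \<xi>) i) \<epsilon>" if "m \<ge> m0" for m
    proof -
      have "nb (\<lambda>i. \<Psi> w \<otimes> emb \<xi> i \<ominus> G \<otimes> emb (T \<xi>) i) (\<epsilon> / (2 * Q))"
        using nul[of \<xi>] \<epsilon> Q(1) unfolding nul_def G_def by simp
      then have "nb (\<lambda>i. q m \<otimes> (\<Psi> w \<otimes> emb \<xi> i \<ominus> G \<otimes> emb (T \<xi>) i)) (Q * (\<epsilon> / (2 * Q)))"
        by (rule opbD[OF q])
      moreover have "nb (\<lambda>i. \<ominus> (K [^] m \<otimes> emb (T \<xi>) i)) (\<epsilon> / 2)"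
        using nb_mono[OF Kpow[OF b] less_imp_le[OF m0[OF that]]] by (rule nb_uminus)
      ultimately have "nb (\<lambda>i. q m \<otimes> (\<Psi> w \<otimes> emb \<xi> i \<ominus> G \<otimes> emb (T \<xi>) i) \<oplus> \<ominus> (K [^] m \<otimes> emb (T \<xi>) i))
          (Q * (\<epsilon> / (2 * Q)) + \<epsilon> / 2)" by (rule nb_add)
      moreover have "Q * (\<epsilon> / (2 * Q)) + \<epsilon> / 2 = \<epsilon>" using Q(1) by simp
      \<comment> \<open>\<open>q m\<close> times \<open>G\<close> is \<open>1 - K^m\<close>, so the
        error splits into \<open>q m\<close> applied to a null vector and \<open>K^m\<close> applied
        to \<open>emb (T \<xi>)\<close>.\<close>
      moreover have "(q m \<otimes> \<Psi> w) \<otimes> emb \<xi> i \<ominus> emb (T \<xi>) i =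
          q m \<otimes> (\<Psi> w \<otimes> emb \<xi> i \<ominus> G \<otimes> emb (T \<xi>) i) \<oplus> \<ominus> (K [^] m \<otimes> emb (T \<xi>) i)" for i
      proof -
        define Km e1 e2 W where "Km = K [^] m" and "e1 = emb \<xi> i" and "e2 = emb (T \<xi>) i" and "W = \<Psi> w"
        have c4: "q m \<in> carrier B" "W \<in> carrier B" "e1 \<in> carrier B" "e2 \<in> carrier B" "Km \<in> carrier B"
          using cl by (auto simp: Km_def e1_def e2_def W_def q_def)
        have "q m \<otimes> G = \<one> \<ominus> Km" using neumann_mult[OF cl(1)] by (simp add: q_def Km_def K_def)
        then have "q m \<otimes> (G \<otimes> e2) = (\<one> \<ominus> Km) \<otimes> e2" using c4 cl by (simp add: m_assoc[symmetric])
        moreover have "q m \<otimes> (W \<otimes> e1 \<ominus> G \<otimes> e2) = q m \<otimes> (W \<otimes> e1) \<ominus> q m \<otimes> (G \<otimes> e2)"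
          using c4 cl(1) by algebra
        moreover have "(q m \<otimes> W) \<otimes> e1 \<ominus> e2 = (q m \<otimes> (W \<otimes> e1) \<ominus> (\<one> \<ominus> Km) \<otimes> e2) \<oplus> \<ominus> (Km \<otimes> e2)"
          using c4 one_closed by algebra
        ultimately show ?thesis by (simp add: Km_def e1_def e2_def W_def)
      qed
      ultimately show ?thesis by (simp add: q_def G_def)
    qed
    then show "\<exists>m0. \<forall>m\<ge>m0. nb (\<lambda>i. (neumann (1 / c) (\<Psi> g) m \<otimes> \<Psi> w) \<otimes> emb \<xi> i \<ominus> emb (T \<xi>) i) \<epsilon>"
      by blast
  qed
qed

lemma Psi_sum:
  assumes "finite S"
  shows "\<Psi> (sum f S) = (\<Oplus>k\<in>S. \<Psi> (f k))"
  using assms by (induction S) (auto simp: Psi_zero Psi_add)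

text \<open>The other members of \<open>S\<close> kill \<open>T \<xi>\<close>, and \<open>v\<close>
  kills \<open>\<xi> - T \<xi>\<close>; so \<open>\<Psi> v\<close> on \<open>\<xi>\<close> agrees
  with \<open>\<Psi> (\<Sum>S)\<close> on \<open>T \<xi>\<close> up to null vectors. Since
  \<open>\<Sum>S\<close> is in general not the unit, it is inverted to isolate
  \<open>T\<close>.\<close>

lemma apx_projection:
  assumes S: "finite S" "v \<in> S" "\<And>w. w \<in> S \<Longrightarrow> \<exists>d. bounded_by d w"
    and g: "bounded_by c (\<Sum>S)" "\<Sum>S - e *\<^sub>R u \<in> C" "0 < e" "e < c"
    and T: "\<And>\<xi> w. w \<in> S - {v} \<Longrightarrow> form w (T \<xi>) = 0" "\<And>\<xi>. form v (\<lambda>i. \<xi> i - T \<xi> i) = 0"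
  shows "apx (\<lambda>m. neumann (1 / c) (\<Psi> (\<Sum>S)) m \<otimes> \<Psi> v) T"
proof -
  obtain d where d: "bounded_by d v" using S by blast
  have "nul (\<lambda>i. \<Psi> v \<otimes> emb \<xi> i \<ominus> \<Psi> (\<Sum>S) \<otimes> emb (T \<xi>) i)" for \<xi>
  proof -
    have "nul (\<lambda>i. \<Psi> w \<otimes> emb (T \<xi>) i)" if w: "w \<in> S - {v}" for w
      using S(3)[of w] w nul_of_form[OF _ T(1)[OF w]] by blast
    then have "nul (\<lambda>i. \<Oplus>w\<in>S - {v}. \<Psi> w \<otimes> emb (T \<xi>) i)"
      using S(1) by (intro nul_sum) auto
    moreover have "nul (\<lambda>i. \<Psi> v \<otimes> emb (\<lambda>i. \<xi> i - T \<xi> i) i)"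
      by (rule nul_of_form[OF d T(2)])
    ultimately have "nul (\<lambda>i. \<Psi> v \<otimes> emb (\<lambda>i. \<xi> i - T \<xi> i) i \<oplus>
        \<ominus> (\<Oplus>w\<in>S - {v}. \<Psi> w \<otimes> emb (T \<xi>) i))"
      by (intro nul_add nul_uminus)
    moreover have "\<Psi> v \<otimes> emb \<xi> i \<ominus> \<Psi> (\<Sum>S) \<otimes> emb (T \<xi>) i =
      \<Psi> v \<otimes> emb (\<lambda>i. \<xi> i - T \<xi> i) i \<oplus> \<ominus> (\<Oplus>w\<in>S - {v}. \<Psi> w \<otimes> emb (T \<xi>) i)" for i
    proof -
      define R where "R = (\<Oplus>w\<in>S - {v}. \<Psi> w)"
      have R: "R \<in> carrier B" by (auto simp: R_def)
      have "\<Sum>S = v + \<Sum>(S - {v})" using S by (simp add: sum.remove)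
      then have "\<Psi> (\<Sum>S) = \<Psi> v \<oplus> R" using Psi_sum[of "S - {v}" "\<lambda>w. w"] S by (simp add: Psi_add R_def)
      moreover have "(\<Oplus>w\<in>S - {v}. \<Psi> w \<otimes> emb (T \<xi>) i) = R \<otimes> emb (T \<xi>) i"
        unfolding R_def using S by (intro finsum_ldistr[symmetric]) auto
      moreover have "emb (\<lambda>i. \<xi> i - T \<xi> i) i = emb \<xi> i \<ominus> emb (T \<xi>) i"
        using sc_add_left[of \<one> "\<xi> i" "- T \<xi> i"] by (simp add: emb_def sc_neg minus_eq)
      moreover have "W \<otimes> e1 \<ominus> (W \<oplus> R) \<otimes> e2 = W \<otimes> (e1 \<ominus> e2) \<oplus> \<ominus> (R \<otimes> e2)"
        if "W \<in> carrier B" "e1 \<in> carrier B" "e2 \<in> carrier B" for W e1 e2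
        using that R by algebra
      ultimately show ?thesis by simp
    qed
    ultimately show ?thesis by simp
  qed
  then show ?thesis by (rule apx_neumann[OF g d])
qed

definition munit :: "nat \<Rightarrow> nat \<Rightarrow> (nat \<Rightarrow> real) \<Rightarrow> nat \<Rightarrow> real" where
  "munit i j \<xi> = (\<lambda>l. if l = i then \<xi> j else 0)"

text \<open>Only the identity permutation contributes when the standard polynomial is evaluated on the
  matrix units along a path.\<close>

theorem standard_polynomial_obstruction:
  assumes pi: "\<And>x. (\<And>i. i < k \<Longrightarrow> x i \<in> carrier B) \<Longrightarrow> standard_polynomial k x = \<zero>"
    and X: "\<And>i. i < k \<Longrightarrow> apx (X i) (munit i (Suc i))"
    and u: "0 < F (\<lambda>i j. (of_bool (i = 0) * of_bool (j = 0)) *\<^sub>R u)"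
  shows False
proof -
  \<comment> \<open>The limit operator of a word: the factor multiplied last acts first. On
    \<open>\<delta> k\<close> it survives only if the factors lower the index one by one from
    \<open>k\<close> to 0, which forces the identity permutation.\<close>
  define opw where "opw = (\<lambda>\<sigma>::nat \<Rightarrow> nat. rec_nat (\<lambda>\<xi>. \<xi>) (\<lambda>n T \<xi>. T (munit (\<sigma> n) (Suc (\<sigma> n)) \<xi>)))"
  have opw: "opw \<sigma> 0 = (\<lambda>\<xi>. \<xi>)" "opw \<sigma> (Suc n) = (\<lambda>\<xi>. opw \<sigma> n (munit (\<sigma> n) (Suc (\<sigma> n)) \<xi>))" for \<sigma> n
    by (simp_all add: opw_def)
  have apw: "apx (\<lambda>m. word (\<lambda>i. X i m) \<sigma> n) (opw \<sigma> n)" if "\<And>i. i < n \<Longrightarrow> \<sigma> i < k" for \<sigma> n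
    using that
  proof (induction n)
    case 0
    then show ?case by (simp add: apx_one opw)
  next
    case (Suc n)
    then show ?case unfolding word.simps opw by (intro apx_mult X) auto
  qed
  define Perm where "Perm = {\<sigma>. \<sigma> permutes {..<k}}"
  have fin: "finite Perm" unfolding Perm_def by (rule finite_permutations) simp
  define T where "T = (\<lambda>\<xi> i. \<Sum>\<sigma>\<in>Perm. of_int (sign \<sigma>) * opw \<sigma> k \<xi> i)"
  have "apx (\<lambda>m. \<Oplus>\<sigma>\<in>Perm. sc (of_int (sign \<sigma>)) (word (\<lambda>i. X i m) \<sigma> k)) T"
    unfolding T_def using permutes_in_image
    by (intro apx_sum fin apx_sc apw) (fastforce simp: Perm_def)
  moreover have "(\<Oplus>\<sigma>\<in>Perm. sc (of_int (sign \<sigma>)) (word (\<lambda>i. X i m) \<sigma> k)) = \<zero>" for m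
    using pi[of "\<lambda>i. X i m"] apx_closed[OF X] unfolding standard_polynomial_def Perm_def by simp
  ultimately have T: "apx (\<lambda>m. \<zero>) T" by simp
  define \<delta> where "\<delta> = (\<lambda>(n::nat) (i::nat). of_bool (i = n) :: real)"
  have mu: "munit i (Suc i) (\<delta> (Suc n)) = (if i = n then \<delta> n else (\<lambda>i. 0))" for i n
    by (auto simp: munit_def \<delta>_def fun_eq_iff)
  have mu0: "munit i (Suc i) (\<lambda>i. 0) = (\<lambda>i. 0)" for i by (auto simp: munit_def)
  have op0: "opw \<sigma> n (\<lambda>i. 0) = (\<lambda>i. 0)" for \<sigma> n by (induction n) (simp_all add: opw mu0)
  have opd: "opw \<sigma> n (\<delta> n) = (if \<forall>i<n. \<sigma> i = i then \<delta> 0 else (\<lambda>i. 0))" for \<sigma> n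
  proof (induction n)
    case 0
    then show ?case by (simp add: opw)
  next
    case (Suc n)
    then show ?case by (auto simp: opw mu op0 less_Suc_eq)
  qed
  have id: "(\<forall>i<k. \<sigma> i = i) \<longleftrightarrow> \<sigma> = id" if "\<sigma> \<in> Perm" for \<sigma>
    using that by (auto simp: Perm_def permutes_def fun_eq_iff)
  have "T (\<delta> k) i = (\<Sum>\<sigma>\<in>Perm. if \<sigma> = id then \<delta> 0 i else 0)" for i
    unfolding T_def by (intro sum.cong refl) (use id in \<open>auto simp: opd\<close>)
  moreover have "id \<in> Perm" by (simp add: Perm_def permutes_id)
  ultimately have "T (\<delta> k) i = \<delta> 0 i" for i
    using fin sum.delta[of Perm id "\<lambda>\<sigma>. \<delta> 0 i"] by simp
  then have Tk: "T (\<delta> k) = \<delta> 0" by (rule ext)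
  \<comment> \<open>The standard polynomial is zero for every \<open>m\<close>, so the zero sequence
    approximates \<open>T\<close>, which nevertheless maps \<open>\<delta> k\<close> to
    \<open>\<delta> 0\<close>.\<close>
  have "nb (\<lambda>i. \<zero> \<otimes> emb (\<delta> k) i \<ominus> emb (\<delta> 0) i) e" if "0 < e" for e
    using T that Tk unfolding apx_def by (metis order_refl)
  then have "nul (\<lambda>i. \<zero> \<otimes> emb (\<delta> k) i \<ominus> emb (\<delta> 0) i)" by (simp add: nul_def)
  then have "nul (emb (\<delta> 0))"
    by (rule nul_cong[OF nul_uminus]) (simp add: minus_eq)
  then show False using emb_not_nul[of "\<delta> 0"] u by (simp add: \<delta>_def)
qed

end

section \<open>Matrices over a commutative star ring\<close>

context ring
begin

lemma finsum_swap:
  assumes "finite I" "finite J" "\<And>i j. i \<in> I \<Longrightarrow> j \<in> J \<Longrightarrow> f i j \<in> carrier R"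
  shows "(\<Oplus>i\<in>I. \<Oplus>j\<in>J. f i j) = (\<Oplus>j\<in>J. \<Oplus>i\<in>I. f i j)"
  using assms(1,3)
proof (induction I)
  case empty
  then show ?case by simp
next
  case (insert a I)
  have "(\<Oplus>i\<in>insert a I. \<Oplus>j\<in>J. f i j) = (\<Oplus>j\<in>J. f a j) \<oplus> (\<Oplus>i\<in>I. \<Oplus>j\<in>J. f i j)"
    using insert by (intro finsum_insert) auto
  also have "\<dots> = (\<Oplus>j\<in>J. f a j) \<oplus> (\<Oplus>j\<in>J. \<Oplus>i\<in>I. f i j)" using insert by simp
  also have "\<dots> = (\<Oplus>j\<in>J. f a j \<oplus> (\<Oplus>i\<in>I. f i j))"
    using insert assms(2) by (intro finsum_addf[symmetric]) auto
  also have "\<dots> = (\<Oplus>j\<in>J. \<Oplus>i\<in>insert a I. f i j)"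
    using insert by (intro finsum_cong' refl finsum_insert[symmetric]) auto
  finally show ?case .
qed

lemma finsum_Times:
  assumes "finite I" "finite J" "\<And>i j. i \<in> I \<Longrightarrow> j \<in> J \<Longrightarrow> f (i, j) \<in> carrier R"
  shows "(\<Oplus>k\<in>I \<times> J. f k) = (\<Oplus>i\<in>I. \<Oplus>j\<in>J. f (i, j))"
  using assms(1,3)
proof (induction I)
  case empty
  then show ?case by simp
next
  case (insert a I)
  have "insert a I \<times> J = Pair a ` J \<union> I \<times> J" by auto
  moreover have "(\<Oplus>k\<in>Pair a ` J \<union> I \<times> J. f k) = (\<Oplus>k\<in>Pair a ` J. f k) \<oplus> (\<Oplus>k\<in>I \<times> J. f k)"
    using insert assms(2) by (intro finsum_Un_disjoint) auto
  ultimately have "(\<Oplus>k\<in>insert a I \<times> J. f k) = (\<Oplus>k\<in>Pair a ` J. f k) \<oplus> (\<Oplus>k\<in>I \<times> J. f k)"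
    by simp
  also have "(\<Oplus>k\<in>Pair a ` J. f k) = (\<Oplus>j\<in>J. f (a, j))"
    using insert by (intro finsum_reindex) (auto simp: inj_on_def)
  also have "(\<Oplus>k\<in>I \<times> J. f k) = (\<Oplus>i\<in>I. \<Oplus>j\<in>J. f (i, j))"
    using insert by simp
  also have "(\<Oplus>j\<in>J. f (a, j)) \<oplus> (\<Oplus>i\<in>I. \<Oplus>j\<in>J. f (i, j)) = (\<Oplus>i\<in>insert a I. \<Oplus>j\<in>J. f (i, j))"
    using insert by (intro finsum_insert[symmetric]) auto
  finally show ?case .
qed

lemma finsum_delta_right:
  assumes "finite I" "k \<in> I" "\<And>i. i \<in> I \<Longrightarrow> f i \<in> carrier R"
  shows "(\<Oplus>i\<in>I. f i \<otimes> (if i = k then \<one> else \<zero>)) = f k"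
proof -
  have "(\<Oplus>i\<in>I. f i \<otimes> (if i = k then \<one> else \<zero>)) = (\<Oplus>i\<in>I. if k = i then f i else \<zero>)"
    using assms by (intro finsum_cong') (auto simp: Pi_iff)
  also have "\<dots> = f k" using assms by (intro finsum_singleton) auto
  finally show ?thesis .
qed

lemma finsum_delta_left:
  assumes "finite I" "k \<in> I" "\<And>i. i \<in> I \<Longrightarrow> f i \<in> carrier R"
  shows "(\<Oplus>i\<in>I. (if k = i then \<one> else \<zero>) \<otimes> f i) = f k"
proof -
  have "(\<Oplus>i\<in>I. (if k = i then \<one> else \<zero>) \<otimes> f i) = (\<Oplus>i\<in>I. if k = i then f i else \<zero>)"
    using assms by (intro finsum_cong') (auto simp: Pi_iff)
  also have "\<dots> = f k" using assms by (intro finsum_singleton) auto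
  finally show ?thesis .
qed

end

text \<open>Entries outside the \<open>d x d\<close> block are fixed to zero, so that equality of
  functions is equality of matrices.\<close>

definition mat_ring :: "('a, 'm) ring_scheme \<Rightarrow> nat \<Rightarrow> (nat \<Rightarrow> nat \<Rightarrow> 'a) ring" where
  "mat_ring A d = \<lparr>carrier = {X. \<forall>p q. if p < d \<and> q < d then X p q \<in> carrier A else X p q = \<zero>\<^bsub>A\<^esub>},
     mult = (\<lambda>X Y p q. if p < d \<and> q < d then \<Oplus>\<^bsub>A\<^esub>r\<in>{..<d}. X p r \<otimes>\<^bsub>A\<^esub> Y r q else \<zero>\<^bsub>A\<^esub>),
     one = (\<lambda>p q. if p < d \<and> q < d \<and> p = q then \<one>\<^bsub>A\<^esub> else \<zero>\<^bsub>A\<^esub>),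
     zero = (\<lambda>p q. \<zero>\<^bsub>A\<^esub>),
     add = (\<lambda>X Y p q. X p q \<oplus>\<^bsub>A\<^esub> Y p q)\<rparr>"

locale comm_star_ring = real_star_ring B st sc + cring B for B (structure) and st sc
begin

abbreviation Mat where "Mat d \<equiv> mat_ring B d"

definition mst where "mst X = (\<lambda>p q. st (X q p))"
definition msc where "msc r X = (\<lambda>p q. sc r (X p q))"

lemma mat_entry_closed [simp]: "X \<in> carrier (Mat d) \<Longrightarrow> X p q \<in> carrier B"
proof -
  assume "X \<in> carrier (Mat d)"
  then have "if p < d \<and> q < d then X p q \<in> carrier B else X p q = \<zero>" by (simp add: mat_ring_def)
  then show ?thesis by (auto split: if_splits)
qed

lemma mat_entry_outside: "X \<in> carrier (Mat d) \<Longrightarrow> \<not> (p < d \<and> q < d) \<Longrightarrow> X p q = \<zero>"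
  unfolding mat_ring_def by (simp split: if_splits)

lemma mat_closedI:
  "(\<And>p q. p < d \<Longrightarrow> q < d \<Longrightarrow> X p q \<in> carrier B) \<Longrightarrow> (\<And>p q. \<not> (p < d \<and> q < d) \<Longrightarrow> X p q = \<zero>) \<Longrightarrow>
    X \<in> carrier (Mat d)"
  by (simp add: mat_ring_def)

lemma mat_simps:
  "X \<otimes>\<^bsub>Mat d\<^esub> Y = (\<lambda>p q. if p < d \<and> q < d then \<Oplus>r\<in>{..<d}. X p r \<otimes> Y r q else \<zero>)"
  "\<one>\<^bsub>Mat d\<^esub> = (\<lambda>p q. if p < d \<and> q < d \<and> p = q then \<one> else \<zero>)"
  "\<zero>\<^bsub>Mat d\<^esub> = (\<lambda>p q. \<zero>)"
  "X \<oplus>\<^bsub>Mat d\<^esub> Y = (\<lambda>p q. X p q \<oplus> Y p q)"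
  by (simp_all add: mat_ring_def)

lemma st_finsum:
  assumes "finite I" "\<And>i. i \<in> I \<Longrightarrow> f i \<in> carrier B"
  shows "st (\<Oplus>i\<in>I. f i) = (\<Oplus>i\<in>I. st (f i))"
  using assms by (induction I) (auto simp: st_zero st_add Pi_iff)

lemma sc_finsum:
  assumes "finite I" "\<And>i. i \<in> I \<Longrightarrow> f i \<in> carrier B"
  shows "sc r (\<Oplus>i\<in>I. f i) = (\<Oplus>i\<in>I. sc r (f i))"
  using assms by (induction I) (auto simp: sc_zero_right sc_add_right Pi_iff)

lemma mat_mult_entry:
  "p < d \<Longrightarrow> q < d \<Longrightarrow> (X \<otimes>\<^bsub>Mat d\<^esub> Y) p q = (\<Oplus>r\<in>{..<d}. X p r \<otimes> Y r q)"
  by (simp add: mat_simps)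

lemma mat_mult_closed:
  "X \<in> carrier (Mat d) \<Longrightarrow> Y \<in> carrier (Mat d) \<Longrightarrow> X \<otimes>\<^bsub>Mat d\<^esub> Y \<in> carrier (Mat d)"
  by (rule mat_closedI) (auto simp: mat_simps intro!: finsum_closed)

lemma ring_mat: "ring (Mat d)"
proof (rule ringI)
  show "abelian_group (Mat d)"
  proof (rule abelian_groupI)
    fix X assume X: "X \<in> carrier (Mat d)"
    have "(\<lambda>p q. \<ominus> X p q) \<in> carrier (Mat d)"
      by (rule mat_closedI) (use X in \<open>auto simp: mat_entry_outside\<close>)
    moreover have "(\<lambda>p q. \<ominus> X p q) \<oplus>\<^bsub>Mat d\<^esub> X = \<zero>\<^bsub>Mat d\<^esub>"
      using X by (simp add: mat_simps l_neg)
    ultimately show "\<exists>Y\<in>carrier (Mat d). Y \<oplus>\<^bsub>Mat d\<^esub> X = \<zero>\<^bsub>Mat d\<^esub>" by blast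
  next
    fix X Y assume "X \<in> carrier (Mat d)" "Y \<in> carrier (Mat d)"
    then show "X \<oplus>\<^bsub>Mat d\<^esub> Y \<in> carrier (Mat d)"
      unfolding mat_simps by (intro mat_closedI) (auto simp: mat_entry_outside)
  qed (auto simp: mat_simps a_ac intro!: mat_closedI)
  show "monoid (Mat d)"
  proof (rule monoidI)
    fix X Y Z assume XYZ: "X \<in> carrier (Mat d)" "Y \<in> carrier (Mat d)" "Z \<in> carrier (Mat d)"
    show "X \<otimes>\<^bsub>Mat d\<^esub> Y \<otimes>\<^bsub>Mat d\<^esub> Z = X \<otimes>\<^bsub>Mat d\<^esub> (Y \<otimes>\<^bsub>Mat d\<^esub> Z)"
    proof (intro ext)
      fix p q
      show "(X \<otimes>\<^bsub>Mat d\<^esub> Y \<otimes>\<^bsub>Mat d\<^esub> Z) p q = (X \<otimes>\<^bsub>Mat d\<^esub> (Y \<otimes>\<^bsub>Mat d\<^esub> Z)) p q"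
      proof (cases "p < d \<and> q < d")
        case True
        have "(X \<otimes>\<^bsub>Mat d\<^esub> Y \<otimes>\<^bsub>Mat d\<^esub> Z) p q = (\<Oplus>r\<in>{..<d}. (\<Oplus>t\<in>{..<d}. X p t \<otimes> Y t r) \<otimes> Z r q)"
          using True XYZ by (auto simp: mat_mult_entry intro!: finsum_cong')
        also have "\<dots> = (\<Oplus>r\<in>{..<d}. \<Oplus>t\<in>{..<d}. X p t \<otimes> Y t r \<otimes> Z r q)"
          using XYZ by (intro finsum_cong' refl finsum_ldistr) auto
        also have "\<dots> = (\<Oplus>t\<in>{..<d}. \<Oplus>r\<in>{..<d}. X p t \<otimes> Y t r \<otimes> Z r q)"
          using XYZ by (intro finsum_swap) auto
        also have "\<dots> = (\<Oplus>t\<in>{..<d}. X p t \<otimes> (\<Oplus>r\<in>{..<d}. Y t r \<otimes> Z r q))"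
        proof (intro finsum_cong' refl)
          fix t
          have "X p t \<otimes> (\<Oplus>r\<in>{..<d}. Y t r \<otimes> Z r q) = (\<Oplus>r\<in>{..<d}. X p t \<otimes> (Y t r \<otimes> Z r q))"
            using XYZ by (intro finsum_rdistr) auto
          then show "(\<Oplus>r\<in>{..<d}. X p t \<otimes> Y t r \<otimes> Z r q) = X p t \<otimes> (\<Oplus>r\<in>{..<d}. Y t r \<otimes> Z r q)"
            using XYZ by (simp add: m_assoc)
        qed (use XYZ in auto)
        also have "\<dots> = (X \<otimes>\<^bsub>Mat d\<^esub> (Y \<otimes>\<^bsub>Mat d\<^esub> Z)) p q"
          using True XYZ by (auto simp: mat_mult_entry intro!: finsum_cong')
        finally show ?thesis .
      qed (auto simp: mat_simps)
    qed
  next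
    fix X assume X: "X \<in> carrier (Mat d)"
    show "\<one>\<^bsub>Mat d\<^esub> \<otimes>\<^bsub>Mat d\<^esub> X = X"
    proof (intro ext)
      fix p q show "(\<one>\<^bsub>Mat d\<^esub> \<otimes>\<^bsub>Mat d\<^esub> X) p q = X p q"
      proof (cases "p < d \<and> q < d")
        case True
        then have "(\<one>\<^bsub>Mat d\<^esub> \<otimes>\<^bsub>Mat d\<^esub> X) p q = (\<Oplus>r\<in>{..<d}. (if p = r then \<one> else \<zero>) \<otimes> X r q)"
          using X by (auto simp: mat_simps intro!: finsum_cong')
        also have "\<dots> = X p q" using True X by (intro finsum_delta_left) auto
        finally show ?thesis .
      qed (use X in \<open>auto simp: mat_simps mat_entry_outside\<close>)
    qed
    show "X \<otimes>\<^bsub>Mat d\<^esub> \<one>\<^bsub>Mat d\<^esub> = X"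
    proof (intro ext)
      fix p q show "(X \<otimes>\<^bsub>Mat d\<^esub> \<one>\<^bsub>Mat d\<^esub>) p q = X p q"
      proof (cases "p < d \<and> q < d")
        case True
        then have "(X \<otimes>\<^bsub>Mat d\<^esub> \<one>\<^bsub>Mat d\<^esub>) p q = (\<Oplus>r\<in>{..<d}. X p r \<otimes> (if r = q then \<one> else \<zero>))"
          using X by (auto simp: mat_simps intro!: finsum_cong')
        also have "\<dots> = X p q" using True X by (intro finsum_delta_right) auto
        finally show ?thesis .
      qed (use X in \<open>auto simp: mat_simps mat_entry_outside\<close>)
    qed
  next
    show "\<one>\<^bsub>Mat d\<^esub> \<in> carrier (Mat d)" by (rule mat_closedI) (auto simp: mat_simps)
  qed (rule mat_mult_closed)
next
  fix X Y Z assume XYZ: "X \<in> carrier (Mat d)" "Y \<in> carrier (Mat d)" "Z \<in> carrier (Mat d)"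
  show "(X \<oplus>\<^bsub>Mat d\<^esub> Y) \<otimes>\<^bsub>Mat d\<^esub> Z = X \<otimes>\<^bsub>Mat d\<^esub> Z \<oplus>\<^bsub>Mat d\<^esub> Y \<otimes>\<^bsub>Mat d\<^esub> Z"
  proof (intro ext)
    fix p q
    have "(\<Oplus>r\<in>{..<d}. (X p r \<oplus> Y p r) \<otimes> Z r q) = (\<Oplus>r\<in>{..<d}. X p r \<otimes> Z r q \<oplus> Y p r \<otimes> Z r q)"
      using XYZ by (intro finsum_cong') (auto simp: l_distr)
    also have "\<dots> = (\<Oplus>r\<in>{..<d}. X p r \<otimes> Z r q) \<oplus> (\<Oplus>r\<in>{..<d}. Y p r \<otimes> Z r q)"
      using XYZ by (intro finsum_addf) auto
    finally show "((X \<oplus>\<^bsub>Mat d\<^esub> Y) \<otimes>\<^bsub>Mat d\<^esub> Z) p q = (X \<otimes>\<^bsub>Mat d\<^esub> Z \<oplus>\<^bsub>Mat d\<^esub> Y \<otimes>\<^bsub>Mat d\<^esub> Z) p q"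
      by (simp add: mat_simps)
  qed
  show "Z \<otimes>\<^bsub>Mat d\<^esub> (X \<oplus>\<^bsub>Mat d\<^esub> Y) = Z \<otimes>\<^bsub>Mat d\<^esub> X \<oplus>\<^bsub>Mat d\<^esub> Z \<otimes>\<^bsub>Mat d\<^esub> Y"
  proof (intro ext)
    fix p q
    have "(\<Oplus>r\<in>{..<d}. Z p r \<otimes> (X r q \<oplus> Y r q)) = (\<Oplus>r\<in>{..<d}. Z p r \<otimes> X r q \<oplus> Z p r \<otimes> Y r q)"
      using XYZ by (intro finsum_cong') (auto simp: r_distr)
    also have "\<dots> = (\<Oplus>r\<in>{..<d}. Z p r \<otimes> X r q) \<oplus> (\<Oplus>r\<in>{..<d}. Z p r \<otimes> Y r q)"
      using XYZ by (intro finsum_addf) auto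
    finally show "(Z \<otimes>\<^bsub>Mat d\<^esub> (X \<oplus>\<^bsub>Mat d\<^esub> Y)) p q = (Z \<otimes>\<^bsub>Mat d\<^esub> X \<oplus>\<^bsub>Mat d\<^esub> Z \<otimes>\<^bsub>Mat d\<^esub> Y) p q"
      by (simp add: mat_simps)
  qed
qed

lemma mst_closed: "X \<in> carrier (Mat d) \<Longrightarrow> mst X \<in> carrier (Mat d)"
  by (rule mat_closedI) (auto simp: mst_def mat_entry_outside st_zero)

lemma msc_closed: "X \<in> carrier (Mat d) \<Longrightarrow> msc r X \<in> carrier (Mat d)"
  by (rule mat_closedI) (auto simp: msc_def mat_entry_outside sc_zero_right)

lemma real_star_ring_mat: "real_star_ring (Mat d) mst msc"
proof (intro real_star_ring.intro ring_mat real_star_ring_axioms.intro)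
  fix X Y and r s :: real
  assume X: "X \<in> carrier (Mat d)"
  then show "mst X \<in> carrier (Mat d)" "msc r X \<in> carrier (Mat d)"
    by (auto intro: mst_closed msc_closed)
  show "mst (mst X) = X" "mst (msc r X) = msc r (mst X)" "msc (r + s) X = msc r X \<oplus>\<^bsub>Mat d\<^esub> msc s X"
    "msc r (msc s X) = msc (r * s) X" "msc 1 X = X"
    using X by (simp_all add: mst_def msc_def fun_eq_iff st_st st_sc mat_simps sc_add_left sc_sc sc_one)
  assume Y: "Y \<in> carrier (Mat d)"
  show "mst (X \<oplus>\<^bsub>Mat d\<^esub> Y) = mst X \<oplus>\<^bsub>Mat d\<^esub> mst Y" "msc r (X \<oplus>\<^bsub>Mat d\<^esub> Y) = msc r X \<oplus>\<^bsub>Mat d\<^esub> msc r Y"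
    using X Y by (simp_all add: mst_def msc_def fun_eq_iff st_add mat_simps sc_add_right)
  show "mst (X \<otimes>\<^bsub>Mat d\<^esub> Y) = mst Y \<otimes>\<^bsub>Mat d\<^esub> mst X"
    using X Y by (auto simp: mst_def fun_eq_iff mat_simps st_finsum st_mult st_zero intro!: finsum_cong')
  show "msc r X \<otimes>\<^bsub>Mat d\<^esub> Y = msc r (X \<otimes>\<^bsub>Mat d\<^esub> Y)"
    using X Y by (auto simp: msc_def fun_eq_iff mat_simps sc_finsum sc_mult_left sc_zero_right intro!: finsum_cong')
  show "X \<otimes>\<^bsub>Mat d\<^esub> msc r Y = msc r (X \<otimes>\<^bsub>Mat d\<^esub> Y)"
    using X Y by (auto simp: msc_def fun_eq_iff mat_simps sc_finsum sc_mult_right sc_zero_right intro!: finsum_cong')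
qed

lemma mat_finsum_entry:
  assumes "finite S" "\<And>s. s \<in> S \<Longrightarrow> f s \<in> carrier (Mat d)"
  shows "(finsum (Mat d) f S) p q = (\<Oplus>s\<in>S. f s p q)"
proof -
  interpret M: real_star_ring "Mat d" mst msc by (rule real_star_ring_mat)
  show ?thesis
    using assms
  proof (induction S)
    case empty
    then show ?case by (simp add: mat_simps)
  next
    case (insert a S)
    have "f s p q \<in> carrier B" if "s \<in> insert a S" for s
      using insert.prems[OF that] by simp
    then show ?case using insert
      by (subst M.finsum_insert) (auto simp: mat_simps Pi_iff)
  qed
qed

text \<open>The determinant of a matrix with two equal columns vanishes.\<close>

lemma alternating_sum_zero:
  fixes k :: nat and x :: "nat \<Rightarrow> 'c \<Rightarrow> 'e \<Rightarrow> 'a"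
  assumes x: "\<And>i p q. i < k \<Longrightarrow> x i p q \<in> carrier B"
    and ab: "a < k" "b < k" "a \<noteq> b" "pq a = pq b"
  shows "(\<Oplus>\<sigma>\<in>{\<sigma>. \<sigma> permutes {..<k}}. sc (of_int (sign \<sigma>)) (\<Otimes>i\<in>{..<k}. x (\<sigma> i) (fst (pq i)) (snd (pq i)))) = \<zero>"
proof -
  define Perm where "Perm = {\<sigma>. \<sigma> permutes {..<k}}"
  have fin: "finite Perm" unfolding Perm_def by (rule finite_permutations) simp
  define \<tau> where "\<tau> = Transposition.transpose a b"
  have \<tau>: "\<tau> permutes {..<k}" unfolding \<tau>_def by (rule permutes_swap_id) (use ab in auto)
  define g where "g = (\<lambda>\<sigma>. \<Otimes>i\<in>{..<k}. x (\<sigma> i) (fst (pq i)) (snd (pq i)))"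
  have im: "\<sigma> i < k" if "\<sigma> \<in> Perm" "i < k" for \<sigma> i
    using that permutes_in_image[of \<sigma> "{..<k}" i] by (auto simp: Perm_def)
  have gc: "g \<sigma> \<in> carrier B" if "\<sigma> \<in> Perm" for \<sigma>
    unfolding g_def using x im[OF that] by (intro finprod_closed) auto
  \<comment> \<open>The swapped positions carry the same index pair, so composing
    \<open>\<sigma>\<close> with \<open>\<tau>\<close> keeps the product and flips the sign.\<close>
  have pq: "pq (\<tau> i) = pq i" for i using ab by (auto simp: \<tau>_def Transposition.transpose_def)
  have g\<tau>: "g (\<sigma> \<circ> \<tau>) = g \<sigma>" if s: "\<sigma> \<in> Perm" for \<sigma>
  proof -
    have inj: "inj_on \<tau> {..<k}" using \<tau> by (rule permutes_inj_on)
    have "g \<sigma> = (\<Otimes>i\<in>\<tau> ` {..<k}. x (\<sigma> i) (fst (pq i)) (snd (pq i)))"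
      using permutes_image[OF \<tau>] by (simp add: g_def)
    also have "\<dots> = (\<Otimes>i\<in>{..<k}. x (\<sigma> (\<tau> i)) (fst (pq (\<tau> i))) (snd (pq (\<tau> i))))"
      using permutes_image[OF \<tau>] x im[OF s] inj by (intro finprod_reindex) auto
    finally show ?thesis by (simp add: g_def pq)
  qed
  have sg: "sign (\<sigma> \<circ> \<tau>) = - sign \<sigma>" if "\<sigma> \<in> Perm" for \<sigma>
    using that \<tau> ab by (subst sign_compose) (auto simp: Perm_def \<tau>_def sign_swap_id permutation_swap_id
        intro: permutation_permutes[THEN iffD2])
  have bij: "inj_on (\<lambda>\<sigma>. \<sigma> \<circ> \<tau>) Perm" "(\<lambda>\<sigma>. \<sigma> \<circ> \<tau>) ` Perm = Perm"
  proof -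
    have \<tau>\<tau>: "\<sigma> \<circ> \<tau> \<circ> \<tau> = \<sigma>" for \<sigma> :: "nat \<Rightarrow> nat" by (simp add: comp_assoc \<tau>_def)
    show "inj_on (\<lambda>\<sigma>. \<sigma> \<circ> \<tau>) Perm" by (rule inj_on_inverseI[where g = "\<lambda>\<sigma>. \<sigma> \<circ> \<tau>"]) (rule \<tau>\<tau>)
    have c: "\<sigma> \<circ> \<tau> \<in> Perm" if "\<sigma> \<in> Perm" for \<sigma>
      using that permutes_compose[OF \<tau>] by (simp add: Perm_def)
    show "(\<lambda>\<sigma>. \<sigma> \<circ> \<tau>) ` Perm = Perm"
    proof
      show "Perm \<subseteq> (\<lambda>\<sigma>. \<sigma> \<circ> \<tau>) ` Perm"
      proof
        fix \<sigma> assume "\<sigma> \<in> Perm"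
        then show "\<sigma> \<in> (\<lambda>\<sigma>. \<sigma> \<circ> \<tau>) ` Perm" using \<tau>\<tau>[of \<sigma>] c by (intro image_eqI[of _ _ "\<sigma> \<circ> \<tau>"]) auto
      qed
    qed (use c in auto)
  qed
  define S where "S = (\<Oplus>\<sigma>\<in>Perm. sc (of_int (sign \<sigma>)) (g \<sigma>))"
  have Sc: "S \<in> carrier B" unfolding S_def using gc by (intro finsum_closed) auto
  have "S = (\<Oplus>\<sigma>\<in>(\<lambda>\<sigma>. \<sigma> \<circ> \<tau>) ` Perm. sc (of_int (sign \<sigma>)) (g \<sigma>))" by (simp add: S_def bij(2))
  also have "\<dots> = (\<Oplus>\<sigma>\<in>Perm. sc (of_int (sign (\<sigma> \<circ> \<tau>))) (g (\<sigma> \<circ> \<tau>)))"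
    using gc bij by (intro finsum_reindex) (auto simp: image_subset_iff)
  also have "\<dots> = (\<Oplus>\<sigma>\<in>Perm. sc (-1) (sc (of_int (sign \<sigma>)) (g \<sigma>)))"
    using gc by (intro finsum_cong') (auto simp: g\<tau> sg sc_sc)
  also have "\<dots> = sc (-1) S" unfolding S_def using gc fin by (intro sc_finsum[symmetric]) auto
  finally have "S \<oplus> S = sc (-1) S \<oplus> S" by simp
  then have "S \<oplus> S = \<zero>" using Sc by (simp add: sc_minus_one l_neg)
  then have "sc 2 S = \<zero>" using sc_add_left[OF Sc, of 1 1] Sc by (simp add: sc_one)
  then have "sc (1/2) (sc 2 S) = \<zero>" by (simp add: sc_zero_right)
  then have "S = \<zero>" using Sc by (simp add: sc_sc sc_one)
  then show ?thesis by (simp add: S_def Perm_def g_def)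
qed

lemma mat_word_closed:
  assumes "\<And>i. i < n \<Longrightarrow> x (\<sigma> i) \<in> carrier (Mat d)"
  shows "real_star_ring.word (Mat d) x \<sigma> n \<in> carrier (Mat d)"
proof -
  interpret M: real_star_ring "Mat d" mst msc by (rule real_star_ring_mat)
  show ?thesis using assms by (induction n) auto
qed

text \<open>The alternating sum over the words in \<open>x\<close> vanishes along every fixed path of index pairs,
  since a path of length greater than \<open>d\<^sup>2\<close> repeats a pair.\<close>

lemma standard_polynomial_mat:
  assumes k: "d * d < k" and x: "\<And>i. i < k \<Longrightarrow> x i \<in> carrier (Mat d)"
  shows "real_star_ring.standard_polynomial (Mat d) msc k x = \<zero>\<^bsub>Mat d\<^esub>"
proof -
  interpret M: real_star_ring "Mat d" mst msc by (rule real_star_ring_mat)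
  define Perm where "Perm = {\<sigma>. \<sigma> permutes {..<k}}"
  have fin: "finite Perm" unfolding Perm_def by (rule finite_permutations) simp
  have im: "\<sigma> i < k" if "\<sigma> \<in> Perm" "i < k" for \<sigma> i
    using that permutes_in_image[of \<sigma> "{..<k}" i] by (auto simp: Perm_def)
  have xc: "x (\<sigma> i) p q \<in> carrier B" if "\<sigma> \<in> Perm" "i < k" for \<sigma> i p q
    using x[OF im[OF that]] by simp
  have wc: "M.word x \<sigma> n p q \<in> carrier B" if "\<sigma> \<in> Perm" "n \<le> k" for \<sigma> n p q
    using mat_word_closed[of n x \<sigma> d] x im[OF that(1)] that(2) by auto
  define tail where "tail = (\<lambda>n \<sigma> pq. \<Otimes>i\<in>{n..<k}. x (\<sigma> i) (fst (pq i)) (snd (pq i)))"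
  have tc: "tail n \<sigma> pq \<in> carrier B" if "\<sigma> \<in> Perm" for n \<sigma> pq
    unfolding tail_def using xc[OF that] by (intro finprod_closed) auto
  \<comment> \<open>For \<open>n = 0\<close> the whole word is a path of more than
    \<open>d * d\<close> index pairs, one of which repeats. The step to \<open>Suc n\<close> expands
    the last matrix product over its inner index \<open>r\<close> and makes \<open>(r, q)\<close>
    the pair number \<open>n\<close> of the path.\<close>
  have claim: "(\<Oplus>\<sigma>\<in>Perm. sc (of_int (sign \<sigma>)) (M.word x \<sigma> n p q \<otimes> tail n \<sigma> pq)) = \<zero>"
    if "n \<le> k" "p < d" "q < d" "\<And>i. i < k \<Longrightarrow> pq i \<in> {..<d} \<times> {..<d}" for n p q pq
    using that
  proof (induction n arbitrary: p q pq)
    case 0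
    have "\<not> inj_on pq {..<k}"
    proof
      assume "inj_on pq {..<k}"
      then have "card {..<k} \<le> card ({..<d} \<times> {..<d})"
        using 0(4) by (intro card_inj_on_le[of pq] image_subsetI) auto
      then show False using k by simp
    qed
    then obtain a b where ab: "a < k" "b < k" "a \<noteq> b" "pq a = pq b" by (auto simp: inj_on_def)
    define e where "e = (if p = q then \<one> else \<zero>)"
    have e: "e \<in> carrier B" by (simp add: e_def)
    have "(\<Oplus>\<sigma>\<in>Perm. sc (of_int (sign \<sigma>)) (M.word x \<sigma> 0 p q \<otimes> tail 0 \<sigma> pq)) =
        (\<Oplus>\<sigma>\<in>Perm. e \<otimes> sc (of_int (sign \<sigma>)) (tail 0 \<sigma> pq))"
      using 0 tc e by (intro finsum_cong') (auto simp: mat_simps e_def sc_mult_right)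
    also have "\<dots> = e \<otimes> (\<Oplus>\<sigma>\<in>Perm. sc (of_int (sign \<sigma>)) (tail 0 \<sigma> pq))"
      using tc e fin by (intro finsum_rdistr[symmetric]) auto
    also have "(\<Oplus>\<sigma>\<in>Perm. sc (of_int (sign \<sigma>)) (tail 0 \<sigma> pq)) = \<zero>"
      unfolding Perm_def tail_def atLeast0LessThan
      by (rule alternating_sum_zero[OF mat_entry_closed[OF x] ab])
    finally show ?case using e by simp
  next
    case (Suc n)
    have n: "n < k" "{n..<k} = insert n {Suc n..<k}" using Suc.prems(1) by auto
    have step: "M.word x \<sigma> (Suc n) p q \<otimes> tail (Suc n) \<sigma> pq =
        (\<Oplus>r\<in>{..<d}. M.word x \<sigma> n p r \<otimes> tail n \<sigma> (pq(n := (r, q))))" if s: "\<sigma> \<in> Perm" for \<sigma>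
    proof -
      have t: "tail n \<sigma> (pq(n := (r, q))) = x (\<sigma> n) r q \<otimes> tail (Suc n) \<sigma> pq" for r
      proof -
        have "tail n \<sigma> (pq(n := (r, q))) = x (\<sigma> n) r q \<otimes>
            (\<Otimes>i\<in>{Suc n..<k}. x (\<sigma> i) (fst ((pq(n := (r, q))) i)) (snd ((pq(n := (r, q))) i)))"
          unfolding tail_def n(2) using xc[OF s] n(1) by (subst finprod_insert) auto
        also have "(\<Otimes>i\<in>{Suc n..<k}. x (\<sigma> i) (fst ((pq(n := (r, q))) i)) (snd ((pq(n := (r, q))) i))) =
            tail (Suc n) \<sigma> pq"
          unfolding tail_def using xc[OF s] by (intro finprod_cong') auto
        finally show ?thesis .
      qed
      have "M.word x \<sigma> (Suc n) p q \<otimes> tail (Suc n) \<sigma> pq =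
          (\<Oplus>r\<in>{..<d}. M.word x \<sigma> n p r \<otimes> x (\<sigma> n) r q) \<otimes> tail (Suc n) \<sigma> pq"
        using Suc.prems by (simp add: mat_mult_entry)
      also have "\<dots> = (\<Oplus>r\<in>{..<d}. M.word x \<sigma> n p r \<otimes> x (\<sigma> n) r q \<otimes> tail (Suc n) \<sigma> pq)"
        using wc[OF s] xc[OF s] tc[OF s] n(1) by (intro finsum_ldistr) auto
      also have "\<dots> = (\<Oplus>r\<in>{..<d}. M.word x \<sigma> n p r \<otimes> tail n \<sigma> (pq(n := (r, q))))"
        unfolding t using wc[OF s] xc[OF s] tc[OF s] n(1) by (intro finsum_cong') (auto simp: m_assoc)
      finally show ?thesis .
    qed
    have "(\<Oplus>\<sigma>\<in>Perm. sc (of_int (sign \<sigma>)) (M.word x \<sigma> (Suc n) p q \<otimes> tail (Suc n) \<sigma> pq)) =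
        (\<Oplus>\<sigma>\<in>Perm. \<Oplus>r\<in>{..<d}. sc (of_int (sign \<sigma>)) (M.word x \<sigma> n p r \<otimes> tail n \<sigma> (pq(n := (r, q)))))"
    proof (intro finsum_cong' refl)
      fix \<sigma> assume s: "\<sigma> \<in> Perm"
      show "sc (of_int (sign \<sigma>)) (M.word x \<sigma> (Suc n) p q \<otimes> tail (Suc n) \<sigma> pq) =
          (\<Oplus>r\<in>{..<d}. sc (of_int (sign \<sigma>)) (M.word x \<sigma> n p r \<otimes> tail n \<sigma> (pq(n := (r, q)))))"
        unfolding step[OF s] using wc[OF s] tc[OF s] n(1) by (intro sc_finsum) auto
    qed (use wc tc n(1) in \<open>auto intro!: finsum_closed\<close>)
    also have "\<dots> = (\<Oplus>r\<in>{..<d}. \<Oplus>\<sigma>\<in>Perm. sc (of_int (sign \<sigma>)) (M.word x \<sigma> n p r \<otimes> tail n \<sigma> (pq(n := (r, q)))))"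
      using wc tc n(1) fin by (intro finsum_swap) auto
    also have "\<dots> = (\<Oplus>r\<in>{..<d}. \<zero>)"
      using Suc.prems Suc.IH n(1) by (intro finsum_cong') auto
    finally show ?case by simp
  qed
  show ?thesis
  proof (intro ext)
    fix p q
    have c: "M.word x \<sigma> k \<in> carrier (Mat d)" if "\<sigma> \<in> Perm" for \<sigma>
      using mat_word_closed[of k x \<sigma> d] x im[OF that] by auto
    show "M.standard_polynomial k x p q = \<zero>\<^bsub>Mat d\<^esub> p q"
    proof (cases "p < d \<and> q < d")
      case True
      have "M.standard_polynomial k x p q = (\<Oplus>\<sigma>\<in>Perm. sc (of_int (sign \<sigma>)) (M.word x \<sigma> k p q))"
        unfolding M.standard_polynomial_def Perm_def[symmetric]
        by (subst mat_finsum_entry[OF fin]) (auto intro!: msc_closed c, simp add: msc_def)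
      also have "\<dots> = (\<Oplus>\<sigma>\<in>Perm. sc (of_int (sign \<sigma>)) (M.word x \<sigma> k p q \<otimes> tail k \<sigma> (\<lambda>_. (p, q))))"
        using wc by (intro finsum_cong') (auto simp: tail_def)
      also have "\<dots> = \<zero>" using True by (intro claim) auto
      finally show ?thesis by (simp add: mat_simps)
    next
      case False
      have "M.standard_polynomial k x \<in> carrier (Mat d)"
        unfolding M.standard_polynomial_def Perm_def[symmetric] using c by (intro M.finsum_closed) auto
      then show ?thesis using mat_entry_outside False by (simp add: mat_simps)
    qed
  qed
qed

end

section \<open>From an order embedding to a positive functional\<close>

context real_star_ring
begin

lemma sos_expand:
  assumes "sos N M"
  shows "\<exists>(m::nat) Z. (\<forall>k<m. \<forall>i<N. Z k i \<in> carrier B) \<and>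
    (\<forall>i<N. \<forall>j<N. M i j = (\<Oplus>k\<in>{..<m}. st (Z k i) \<otimes> Z k j))"
  using assms
proof (induction rule: sos.induct)
  case (sos_zero M)
  then show ?case by (intro exI[of _ 0]) simp
next
  case (sos_step M z M')
  then obtain m :: nat and Z where Z: "\<forall>k<m. \<forall>i<N. Z k i \<in> carrier B"
    "\<forall>i<N. \<forall>j<N. M i j = (\<Oplus>k\<in>{..<m}. st (Z k i) \<otimes> Z k j)" by blast
  define Z' where "Z' = Z(m := z)"
  have "M' i j = (\<Oplus>k\<in>{..<Suc m}. st (Z' k i) \<otimes> Z' k j)" if "i < N" "j < N" for i j
  proof -
    have "(\<Oplus>k\<in>{..<Suc m}. st (Z' k i) \<otimes> Z' k j) = st (Z' m i) \<otimes> Z' m j \<oplus> (\<Oplus>k\<in>{..<m}. st (Z' k i) \<otimes> Z' k j)"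
      unfolding lessThan_Suc using Z sos_step that by (intro finsum_insert) (auto simp: Z'_def)
    also have "(\<Oplus>k\<in>{..<m}. st (Z' k i) \<otimes> Z' k j) = (\<Oplus>k\<in>{..<m}. st (Z k i) \<otimes> Z k j)"
      using Z that by (intro finsum_cong') (auto simp: Z'_def)
    also have "\<dots> = M i j" using Z that by simp
    finally show ?thesis
      using sos_step that sos_closed[OF sos_step(1) that] by (simp add: Z'_def a_comm)
  qed
  moreover have "\<forall>k<Suc m. \<forall>i<N. Z' k i \<in> carrier B"
    using Z sos_step by (auto simp: Z'_def less_Suc_eq)
  ultimately show ?case by (intro exI[of _ "Suc m"] exI[of _ Z']) auto
qed

end

lemma hermitian_psd_restrict:
  assumes "hermitian_psd s A" "N \<le> s"
  shows "hermitian_psd N A"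
  unfolding hermitian_psd_def
proof (intro conjI allI impI)
  show "A j i = cnj (A i j)" if "i < N" "j < N" for i j
    using assms that unfolding hermitian_psd_def by (meson order_less_le_trans)
  fix x :: "nat \<Rightarrow> complex"
  define y where "y = (\<lambda>i. if i < N then x i else 0)"
  have sub: "{..<N} \<subseteq> {..<s}" using assms(2) by auto
  have "(\<Sum>i<N. \<Sum>j<N. cnj (x i) * A i j * x j) = (\<Sum>i<s. \<Sum>j<s. cnj (y i) * A i j * y j)"
  proof -
    have "(\<Sum>i<N. \<Sum>j<N. cnj (x i) * A i j * x j) = (\<Sum>i<N. \<Sum>j<N. cnj (y i) * A i j * y j)"
      by (simp add: y_def)
    also have "\<dots> = (\<Sum>i<N. \<Sum>j<s. cnj (y i) * A i j * y j)"
      by (intro sum.cong refl sum.mono_neutral_left sub) (auto simp: y_def)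
    also have "\<dots> = (\<Sum>i<s. \<Sum>j<s. cnj (y i) * A i j * y j)"
      by (intro sum.mono_neutral_left sub) (auto simp: y_def)
    finally show ?thesis .
  qed
  moreover have "0 \<le> Re (\<Sum>i<s. \<Sum>j<s. cnj (y i) * A i j * y j)"
    using assms(1) unfolding hermitian_psd_def by blast
  ultimately show "0 \<le> Re (\<Sum>i<N. \<Sum>j<N. cnj (x i) * A i j * x j)" by simp
qed

text \<open>On an elementary tensor the functional sees only the real part of the matrix factor,
  because \<open>\<phi>\<close> is applied to \<open>fst\<close>. The level \<open>s\<close> may
  exceed \<open>N\<close>, which leaves room for padding with zeros.\<close>

lemma min_cone_functional_nonneg:
  fixes \<phi> :: "nat \<Rightarrow> nat \<Rightarrow> 'v::real_vector \<Rightarrow> real"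
  assumes X: "X \<in> min_cone C s" and N: "N \<le> s" and lin: "\<And>i j. linear (\<phi> i j)"
    and pos: "\<And>c T. c \<in> C \<Longrightarrow> hermitian_psd N T \<Longrightarrow> 0 \<le> (\<Sum>i<N. \<Sum>j<N. \<phi> i j c * Re (T i j))"
  shows "0 \<le> (\<Sum>i<N. \<Sum>j<N. \<phi> i j (fst (X i j)))"
proof -
  obtain m and t :: "nat \<Rightarrow> real" and A c where A: "\<forall>k<m. 0 \<le> t k \<and> hermitian_psd s (A k) \<and> c k \<in> C"
    and X: "\<forall>i<s. \<forall>j<s. X i j = (\<Sum>k<m. t k *\<^sub>R tensor (A k) (c k) i j)"
    using X unfolding min_cone_def by blast
  have "fst (X i j) = (\<Sum>k<m. (t k * Re (A k i j)) *\<^sub>R c k)" if "i < N" "j < N" for i j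
    using X that N by (simp add: tensor_def fst_sum)
  then have "(\<Sum>i<N. \<Sum>j<N. \<phi> i j (fst (X i j))) = (\<Sum>i<N. \<Sum>j<N. \<Sum>k<m. t k * (\<phi> i j (c k) * Re (A k i j)))"
    by (intro sum.cong refl) (simp add: linear_sum[OF lin] linear_scale[OF lin] algebra_simps)
  also have "\<dots> = (\<Sum>i<N. \<Sum>k<m. \<Sum>j<N. t k * (\<phi> i j (c k) * Re (A k i j)))"
    by (intro sum.cong refl sum.swap)
  also have "\<dots> = (\<Sum>k<m. \<Sum>i<N. \<Sum>j<N. t k * (\<phi> i j (c k) * Re (A k i j)))"
    by (rule sum.swap)
  also have "\<dots> = (\<Sum>k<m. t k * (\<Sum>i<N. \<Sum>j<N. \<phi> i j (c k) * Re (A k i j)))"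
    by (simp add: sum_distrib_left)
  also have "0 \<le> \<dots>"
  proof (rule sum_nonneg)
    fix k assume "k \<in> {..<m}"
    then show "0 \<le> t k * (\<Sum>i<N. \<Sum>j<N. \<phi> i j (c k) * Re (A k i j))"
      using A by (intro mult_nonneg_nonneg pos hermitian_psd_restrict[OF _ N]) auto
  qed
  finally show ?thesis .
qed

lemma (in comm_cstar_algebra) comm_star_ring_cstar:
  "comm_star_ring A (star A) (\<lambda>r x. complex_of_real r \<odot> x)"
proof -
  interpret cring A by (rule is_cring)
  have C: "c \<in> carrier complex_ring" for c by (simp add: complex_ring_def)
  show ?thesis
  proof (intro comm_star_ring.intro real_star_ring.intro real_star_ring_axioms.intro)
    fix a b and r s :: real assume a: "a \<in> carrier A"
    show "star A a \<in> carrier A" "star A (star A a) = a" using a by (auto simp: star_closed star_star)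
    show "star A (complex_of_real r \<odot> a) = complex_of_real r \<odot> star A a" using a by (simp add: star_smult)
    show "complex_of_real r \<odot> a \<in> carrier A" using a C by (simp add: smult_closed)
    show "complex_of_real (r + s) \<odot> a = complex_of_real r \<odot> a \<oplus> complex_of_real s \<odot> a"
      using smult_l_distr[OF C C a, of r s] by (simp add: complex_ring_def)
    show "complex_of_real r \<odot> (complex_of_real s \<odot> a) = complex_of_real (r * s) \<odot> a"
      using smult_assoc1[OF C C a, of r s] by (simp add: complex_ring_def)
    show "complex_of_real 1 \<odot> a = a" using smult_one[OF a] by (simp add: complex_ring_def)
    assume b: "b \<in> carrier A"
    show "star A (a \<oplus> b) = star A a \<oplus> star A b" "star A (a \<otimes> b) = star A b \<otimes> star A a"
      using a b by (auto simp: star_add star_mult)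
    show "complex_of_real r \<odot> (a \<oplus> b) = complex_of_real r \<odot> a \<oplus> complex_of_real r \<odot> b"
      using smult_r_distr[OF C a b] .
    show "(complex_of_real r \<odot> a) \<otimes> b = complex_of_real r \<odot> (a \<otimes> b)"
      using smult_assoc2[OF C a b] .
    show "a \<otimes> (complex_of_real r \<odot> b) = complex_of_real r \<odot> (a \<otimes> b)"
      using smult_assoc2[OF C b a, of r] a b C by (simp add: m_comm smult_closed)
  qed (rule ring_axioms is_cring)+
qed

text \<open>Brings the values of \<open>\<Phi>\<close>, which are unspecified outside the block,
  into the carrier of \<open>mat_ring A d\<close>.\<close>

definition cut :: "'b cstar \<Rightarrow> nat \<Rightarrow> (nat \<Rightarrow> nat \<Rightarrow> 'b) \<Rightarrow> nat \<Rightarrow> nat \<Rightarrow> 'b" where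
  "cut A d X = (\<lambda>p q. if p < d \<and> q < d then X p q else \<zero>\<^bsub>A\<^esub>)"

abbreviation (input) "cstar_mst A \<equiv> comm_star_ring.mst (star A)"
abbreviation (input) "cstar_msc A \<equiv> comm_star_ring.msc (\<lambda>r x. complex_of_real r \<odot>\<^bsub>A\<^esub> x)"

text \<open>A sum of arbitrarily many squares over \<open>N\<close> indices is a single square once the matrix has
  been padded with zeros: no square roots in the \<open>C\<^sup>*\<close>-algebra are needed.\<close>

lemma (in comm_cstar_algebra) embedding_functional:
  fixes \<phi> :: "nat \<Rightarrow> nat \<Rightarrow> 'v::real_vector \<Rightarrow> real"
  assumes emb: "unital_complete_order_embedding A d (min_cone C) u \<Phi>"
    and lin: "\<And>i j. linear (\<phi> i j)"
    and pos: "\<And>c T. c \<in> C \<Longrightarrow> hermitian_psd N T \<Longrightarrow> 0 \<le> (\<Sum>i<N. \<Sum>j<N. \<phi> i j c * Re (T i j))"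
  shows "star_cone_functional (mat_ring A d) (cstar_mst A) (cstar_msc A) (\<lambda>v. cut A d (\<Phi> v)) N \<phi> u C"
proof -
  interpret comm_star_ring A "star A" "\<lambda>r x. complex_of_real r \<odot> x" by (rule comm_star_ring_cstar)
  interpret Mt: real_star_ring "mat_ring A d" mst msc by (rule real_star_ring_mat)
  have lh: "linear_to_hermitian A d \<Phi>"
    and un: "\<And>p q. p < d \<Longrightarrow> q < d \<Longrightarrow> \<Phi> u p q = (if p = q then \<one> else \<zero>)"
    and ord: "\<And>s X. s \<ge> 1 \<Longrightarrow> X \<in> Her s \<Longrightarrow>
      X \<in> min_cone C s \<longleftrightarrow> cstar_mat_positive A ({..<s} \<times> {..<d}) (amplify A \<Phi> X)"
    using emb unfolding unital_complete_order_embedding_def by blast+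
  have Pc: "\<Phi> v p q \<in> carrier A" and Padd: "\<Phi> (v + w) p q = \<Phi> v p q \<oplus> \<Phi> w p q"
    and Psc: "\<Phi> (r *\<^sub>R v) p q = complex_of_real r \<odot> \<Phi> v p q" if "p < d" "q < d" for v w p q r
    using lh that unfolding linear_to_hermitian_def by blast+
  have P0: "\<Phi> 0 p q = \<zero>" if "p < d" "q < d" for p q
    using Psc[OF that, of 0 0] sc_zero_left[OF Pc[OF that, of 0]] by simp
  have ci: "\<i> \<odot> \<zero> = \<zero>"
    using smult_r_null[of \<i>] by (simp add: complex_ring_def)
  have cc: "cut A d (\<Phi> v) \<in> carrier (mat_ring A d)" for v
    by (rule mat_closedI) (auto simp: cut_def Pc)
  show ?thesis
  proof (intro star_cone_functional.intro star_functional.intro star_functional_axioms.intro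
      star_cone_functional_axioms.intro Mt.real_star_ring_axioms cc lin)
    show "cut A d (\<Phi> (v + w)) = cut A d (\<Phi> v) \<oplus>\<^bsub>mat_ring A d\<^esub> cut A d (\<Phi> w)" for v w
      by (auto simp: cut_def mat_simps fun_eq_iff Padd)
    show "cut A d (\<Phi> (r *\<^sub>R v)) = msc r (cut A d (\<Phi> v))" for r v
      by (auto simp: cut_def msc_def fun_eq_iff Psc sc_zero_right)
    show "cut A d (\<Phi> u) = \<one>\<^bsub>mat_ring A d\<^esub>"
      by (auto simp: cut_def mat_simps fun_eq_iff un)
  next
    fix x :: "nat \<Rightarrow> nat \<Rightarrow> 'v"
    assume sym: "\<And>i j. \<lbrakk>i < N; j < N\<rbrakk> \<Longrightarrow> x i j = x j i"
      and "Mt.sos N (\<lambda>i j. cut A d (\<Phi> (x i j)))"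
    from Mt.sos_expand[OF this(2)] obtain m :: nat and Z where
      "\<forall>k<m. \<forall>i<N. Z k i \<in> carrier (mat_ring A d)"
      "\<forall>i<N. \<forall>j<N. cut A d (\<Phi> (x i j)) =
        finsum (mat_ring A d) (\<lambda>k. mst (Z k i) \<otimes>\<^bsub>mat_ring A d\<^esub> Z k j) {..<m}" by blast
    note Zc = this(1)[rule_format] and Z = this(2)[rule_format]
    \<comment> \<open>Room for the \<open>N\<close> columns as well as for one block row per square;
      order embeddings are stated for levels at least 1.\<close>
    define s where "s = max 1 (max N m)"
    have s: "1 \<le> s" "N \<le> s" "m \<le> s" by (auto simp: s_def)
    define X where "X = (\<lambda>i j. if i < N \<and> j < N then (x i j, 0) else (0, 0 :: 'v))"
    have "X \<in> Her s" using sym by (auto simp: Her_def X_def)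
    moreover have "cstar_mat_positive A ({..<s} \<times> {..<d}) (amplify A \<Phi> X)"
    proof -
      \<comment> \<open>Block row \<open>k\<close> holds the factors of the \<open>k\<close>-th
        square; all other blocks are zero.\<close>
      define Y where "Y = (\<lambda>(k, r) (i, p). if k < m \<and> i < N then Z k i r p else \<zero>)"
      have Yc: "Y kr ip \<in> carrier A" for kr ip
        using mat_entry_closed[OF Zc] by (auto simp: Y_def split: prod.splits)
      have "amplify A \<Phi> X (i, p) (j, q) =
          (\<Oplus>k\<in>{..<s} \<times> {..<d}. star A (Y k (i, p)) \<otimes> Y k (j, q))" if "i < s" "j < s" "p < d" "q < d" for i j p q
      proof -
        have "(\<Oplus>k\<in>{..<s} \<times> {..<d}. star A (Y k (i, p)) \<otimes> Y k (j, q)) =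
            (\<Oplus>k\<in>{..<s}. \<Oplus>r\<in>{..<d}. star A (Y (k, r) (i, p)) \<otimes> Y (k, r) (j, q))"
          using Yc by (intro finsum_Times) auto
        also have "\<dots> = (\<Oplus>k\<in>{..<m}. \<Oplus>r\<in>{..<d}. star A (Y (k, r) (i, p)) \<otimes> Y (k, r) (j, q))"
        proof (rule add.finprod_mono_neutral_cong_right)
          show "(\<Oplus>r\<in>{..<d}. star A (Y (k, r) (i, p)) \<otimes> Y (k, r) (j, q)) = \<zero>" if "k \<in> {..<s} - {..<m}" for k
          proof -
            have "(\<Oplus>r\<in>{..<d}. star A (Y (k, r) (i, p)) \<otimes> Y (k, r) (j, q)) = (\<Oplus>r\<in>{..<d}. \<zero>)"
              using that by (intro finsum_cong') (auto simp: Y_def st_zero)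
            then show ?thesis by simp
          qed
        qed (use s Yc in \<open>auto intro!: finsum_closed\<close>)
        also have "\<dots> = amplify A \<Phi> X (i, p) (j, q)"
        proof (cases "i < N \<and> j < N")
          case True
          have "amplify A \<Phi> X (i, p) (j, q) = cut A d (\<Phi> (x i j)) p q"
            using that True by (simp add: amplify_def X_def P0 ci cut_def Pc)
          also have "\<dots> = (\<Oplus>k\<in>{..<m}. (mst (Z k i) \<otimes>\<^bsub>mat_ring A d\<^esub> Z k j) p q)"
            unfolding Z[OF True[THEN conjunct1] True[THEN conjunct2]]
            using Zc True by (intro mat_finsum_entry) (auto intro!: mat_mult_closed mst_closed)
          also have "\<dots> = (\<Oplus>k\<in>{..<m}. \<Oplus>r\<in>{..<d}. star A (Y (k, r) (i, p)) \<otimes> Y (k, r) (j, q))"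
            using that True Yc mat_entry_closed[OF Zc]
            by (intro finsum_cong') (auto simp: mat_mult_entry mst_def Y_def intro!: finsum_closed)
          finally show ?thesis by simp
        next
          case False
          have "(\<Oplus>k\<in>{..<m}. \<Oplus>r\<in>{..<d}. star A (Y (k, r) (i, p)) \<otimes> Y (k, r) (j, q)) =
              (\<Oplus>k\<in>{..<m}. \<Oplus>r\<in>{..<d}. \<zero>)"
            using False mat_entry_closed[OF Zc] by (intro finsum_cong') (auto simp: Y_def st_zero)
          then show ?thesis using that False by (auto simp: amplify_def X_def P0 ci)
        qed
        finally show ?thesis by simp
      qed
      then show ?thesis unfolding cstar_mat_positive_def using Yc by (intro exI[of _ Y]) auto
    qed
    ultimately have "X \<in> min_cone C s" using ord s by blast
    then have "0 \<le> (\<Sum>i<N. \<Sum>j<N. \<phi> i j (fst (X i j)))"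
      by (rule min_cone_functional_nonneg[OF _ s(2) lin pos])
    then show "0 \<le> (\<Sum>i<N. \<Sum>j<N. \<phi> i j (x i j))" by (simp add: X_def)
  next
    fix v assume v: "v \<in> C"
    define X where "X = (\<lambda>(i::nat) (j::nat). (v, 0 :: 'v))"
    have "hermitian_psd 1 (\<lambda>i j. 1)"
      by (simp add: hermitian_psd_def)
    then have "X \<in> min_cone C 1"
      unfolding min_cone_def using v
      by (intro CollectI exI[of _ 1] exI[of _ "\<lambda>_. 1"] exI[of _ "\<lambda>_ _ _. 1"] exI[of _ "\<lambda>_. v"])
        (auto simp: X_def tensor_def)
    moreover have "X \<in> Her 1" by (simp add: Her_def X_def)
    ultimately have "cstar_mat_positive A ({..<1} \<times> {..<d}) (amplify A \<Phi> X)" using ord by blast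
    then obtain Y where "\<forall>i\<in>{..<1::nat} \<times> {..<d}. \<forall>j\<in>{..<1::nat} \<times> {..<d}. Y i j \<in> carrier A"
      "\<forall>i\<in>{..<1::nat} \<times> {..<d}. \<forall>j\<in>{..<1::nat} \<times> {..<d}.
        amplify A \<Phi> X i j = (\<Oplus>k\<in>{..<1::nat} \<times> {..<d}. star A (Y k i) \<otimes> Y k j)"
      unfolding cstar_mat_positive_def by blast
    note Yc = this(1)[rule_format] and Y = this(2)[rule_format]
    define y where "y = cut A d (\<lambda>r p. Y (0, r) (0, p))"
    have yc: "y \<in> carrier (mat_ring A d)" by (rule mat_closedI) (auto simp: y_def cut_def Yc)
    have "cut A d (\<Phi> v) p q = (mst y \<otimes>\<^bsub>mat_ring A d\<^esub> y) p q" for p q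
    proof (cases "p < d \<and> q < d")
      case True
      have "cut A d (\<Phi> v) p q = amplify A \<Phi> X (0, p) (0, q)"
        using True by (simp add: cut_def amplify_def X_def P0 ci Pc)
      also have "\<dots> = (\<Oplus>k\<in>{..<1} \<times> {..<d}. star A (Y k (0, p)) \<otimes> Y k (0, q))"
        using True by (intro Y) auto
      also have "\<dots> = (\<Oplus>k\<in>{..<1}. \<Oplus>r\<in>{..<d}. star A (Y (k, r) (0, p)) \<otimes> Y (k, r) (0, q))"
        using True Yc by (intro finsum_Times) (auto intro!: m_closed st_closed)
      also have "\<dots> = (\<Oplus>r\<in>{..<d}. star A (Y (0, r) (0, p)) \<otimes> Y (0, r) (0, q))"
        using True Yc by (simp add: lessThan_Suc)
      also have "\<dots> = (mst y \<otimes>\<^bsub>mat_ring A d\<^esub> y) p q"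
        using True Yc by (auto simp: mat_mult_entry mst_def y_def cut_def intro!: finsum_cong')
      finally show ?thesis .
    qed (auto simp: cut_def mat_simps)
    then have "cut A d (\<Phi> v) = mst y \<otimes>\<^bsub>mat_ring A d\<^esub> y" by blast
    then show "Mt.pos (cut A d (\<Phi> v))" using Mt.pos_square[OF yc] by simp
  qed
qed

section \<open>Cones with a single linear relation among their generators\<close>

lemma convex_cone_hull_finite:
  assumes "finite S"
  shows "convex_cone hull S = {\<Sum>s\<in>S. c s *\<^sub>R s | c. \<forall>s\<in>S. 0 \<le> c s}" (is "_ = ?K")
proof
  show "convex_cone hull S \<subseteq> ?K"
  proof (rule hull_minimal)
    show "S \<subseteq> ?K"
    proof
      fix s assume s: "s \<in> S"
      have "s = (\<Sum>t\<in>S. (if t = s then 1 else 0) *\<^sub>R t)"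
        using assms s by (simp add: if_distrib[of "\<lambda>c. c *\<^sub>R _"] cong: if_cong)
      then show "s \<in> ?K" by (intro CollectI exI[of _ "\<lambda>t. if t = s then 1 else 0"]) auto
    qed
    show "convex_cone ?K"
      unfolding convex_cone_iff
    proof (intro conjI ballI allI impI)
      show "0 \<in> ?K" by (intro CollectI exI[of _ "\<lambda>_. 0"]) simp
    next
      fix x y assume "x \<in> ?K" "y \<in> ?K"
      then obtain c d where "\<forall>s\<in>S. 0 \<le> c s" "\<forall>s\<in>S. 0 \<le> d s" "x = (\<Sum>s\<in>S. c s *\<^sub>R s)" "y = (\<Sum>s\<in>S. d s *\<^sub>R s)"
        by blast
      then show "x + y \<in> ?K"
        by (intro CollectI exI[of _ "\<lambda>s. c s + d s"]) (auto simp: scaleR_add_left sum.distrib)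
    next
      fix x and r :: real assume "x \<in> ?K" "0 \<le> r"
      then obtain c where "\<forall>s\<in>S. 0 \<le> c s" "x = (\<Sum>s\<in>S. c s *\<^sub>R s)" by blast
      then show "r *\<^sub>R x \<in> ?K" using \<open>0 \<le> r\<close>
        by (intro CollectI exI[of _ "\<lambda>s. r * c s"]) (auto simp: scaleR_sum_right)
    qed
  qed
  show "?K \<subseteq> convex_cone hull S"
  proof
    fix x assume "x \<in> ?K"
    then obtain c where c: "\<forall>s\<in>S. 0 \<le> c s" "x = (\<Sum>s\<in>S. c s *\<^sub>R s)" by blast
    have "(\<Sum>s\<in>T. c s *\<^sub>R s) \<in> convex_cone hull S" if "T \<subseteq> S" for T
      using finite_subset[OF that assms] that
    proof (induction T)
      case (insert s T)
      then show ?case using c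
        by (auto intro!: convex_cone_hull_add convex_cone_hull_mul simp: hull_inc)
    qed (simp add: convex_cone_hull_contains_0)
    then show "x \<in> convex_cone hull S" using c by blast
  qed
qed

lemma in_cone_hullI:
  assumes "finite S" "\<And>s. s \<in> S \<Longrightarrow> 0 \<le> c s"
  shows "(\<Sum>s\<in>S. c s *\<^sub>R s) \<in> convex_cone hull S"
  unfolding convex_cone_hull_finite[OF assms(1)] using assms(2) by blast

lemma sum_nonneg_in_cone:
  assumes "convex_cone C" "finite S" "\<And>s. s \<in> S \<Longrightarrow> f s \<in> C"
  shows "sum f S \<in> C"
  using assms(2,3)
  by (induction S) (auto intro: convex_cone_contains_0[OF assms(1)] convex_cone_add[OF assms(1)])

text \<open>\<open>C\<close> is generated by the disjoint sets \<open>P\<close>, \<open>Q\<close>, \<open>Z\<close>, whose linear relations are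
  spanned by \<open>\<Sum>P = \<Sum>Q\<close>.\<close>

definition presentation :: "'v::euclidean_space set \<Rightarrow> 'v set \<Rightarrow> 'v set \<Rightarrow> 'v set \<Rightarrow> bool" where
  "presentation C P Q Z \<longleftrightarrow> finite P \<and> finite Q \<and> finite Z \<and> P \<inter> Q = {} \<and> P \<inter> Z = {} \<and> Q \<inter> Z = {} \<and>
     C = convex_cone hull (P \<union> Q \<union> Z) \<and> \<Sum>P = \<Sum>Q \<and> P \<noteq> {} \<and> Q \<noteq> {} \<and>
     (\<forall>w\<in>P \<union> Q. independent (P \<union> Q \<union> Z - {w})) \<and> span (P \<union> Q \<union> Z) = UNIV"

lemma presentation_sym: "presentation C P Q Z \<Longrightarrow> presentation C Q P Z"
  unfolding presentation_def by (auto simp: Un_commute Int_commute)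

lemma presentationD:
  assumes "presentation C P Q Z"
  shows "finite P" "finite Q" "finite Z" "P \<inter> Q = {}" "P \<inter> Z = {}" "Q \<inter> Z = {}"
    "C = convex_cone hull (P \<union> Q \<union> Z)" "\<Sum>P = \<Sum>Q" "P \<noteq> {}" "Q \<noteq> {}"
    "\<And>w. w \<in> P \<union> Q \<Longrightarrow> independent (P \<union> Q \<union> Z - {w})" "span (P \<union> Q \<union> Z) = UNIV"
  using assms unfolding presentation_def by auto

text \<open>Dropping one \<open>w\<close> of \<open>Q\<close> leaves an independent set, and the
  relation then dictates the value at \<open>w\<close>.\<close>

lemma presentation_linear_extend:
  fixes g :: "'v::euclidean_space \<Rightarrow> 'w::real_vector"
  assumes pr: "presentation C P Q Z" and eq: "sum g P = sum g Q"
  shows "\<exists>f. linear f \<and> (\<forall>x\<in>P \<union> Q \<union> Z. f x = g x)"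
proof -
  note D = presentationD[OF pr]
  obtain w where w: "w \<in> Q" using D(10) by blast
  have "independent (P \<union> Q \<union> Z - {w})" using D(11) w by blast
  then obtain f where f: "linear f" "\<forall>x\<in>P \<union> Q \<union> Z - {w}. f x = g x"
    using linear_independent_extend by blast
  have "w \<notin> P" using w D(4) by blast
  have "w = \<Sum>P - \<Sum>(Q - {w})"
    using D(2,8) w by (simp add: sum.remove[of Q w])
  then have "f w = f (\<Sum>P - \<Sum>(Q - {w}))" by (rule arg_cong)
  also have "\<dots> = sum f P - sum f (Q - {w})"
    by (simp add: linear_diff[OF f(1)] linear_sum[OF f(1)])
  also have "\<dots> = sum g P - sum g (Q - {w})"
    using f(2) \<open>w \<notin> P\<close> by (intro arg_cong2[where f = "(-)"] sum.cong) auto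
  also have "\<dots> = g w" using eq D(2) w by (simp add: sum.remove[of Q w])
  finally show ?thesis using f by (intro exI[of _ f]) auto
qed

lemma interior_absorbs:
  fixes u :: "'v::real_normed_vector"
  assumes "convex_cone C" "u \<in> interior C"
  shows "\<exists>c>0. \<forall>c'\<ge>c. c' *\<^sub>R u - w \<in> C"
proof -
  obtain e where e: "e > 0" "ball u e \<subseteq> C" using assms(2) by (auto simp: mem_interior)
  define c where "c = (norm w + 1) / e"
  have c: "c > 0" using e(1) by (simp add: c_def add_nonneg_pos)
  have "c' *\<^sub>R u - w \<in> C" if "c' \<ge> c" for c'
  proof -
    have c': "c' > 0" using c that by simp
    have "norm w < e * c'"
    proof -
      have "norm w < e * c" using e(1) by (simp add: c_def)
      also have "\<dots> \<le> e * c'" using that e(1) by simp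
      finally show ?thesis .
    qed
    then have "norm (w /\<^sub>R c') < e" using c' by (simp add: field_simps)
    then have "u - w /\<^sub>R c' \<in> C" using e(2) by (auto simp: dist_norm)
    then have "c' *\<^sub>R (u - w /\<^sub>R c') \<in> C" using c' by (intro convex_cone_scaleR[OF assms(1)]) auto
    then show ?thesis using c' by (simp add: scaleR_diff_right)
  qed
  then show ?thesis using c by blast
qed

text \<open>As every coefficient is positive, a small multiple of any cone element can be subtracted
  coefficient by coefficient.\<close>

lemma positive_combination_absorbs:
  fixes x :: "'v::real_vector"
  assumes S: "finite S" and x: "x \<in> convex_cone hull S" and a: "\<And>s. s \<in> S \<Longrightarrow> 0 < a s"
  shows "\<exists>e>0. \<forall>e'. 0 \<le> e' \<and> e' \<le> e \<longrightarrow> (\<Sum>s\<in>S. a s *\<^sub>R s) - e' *\<^sub>R x \<in> convex_cone hull S"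
proof -
  obtain c where c: "\<forall>s\<in>S. 0 \<le> c s" "x = (\<Sum>s\<in>S. c s *\<^sub>R s)"
    using x unfolding convex_cone_hull_finite[OF S] by blast
  define m where "m = Min (insert 1 (a ` S))"
  define M where "M = (\<Sum>s\<in>S. c s) + 1"
  have m: "0 < m" "\<And>s. s \<in> S \<Longrightarrow> m \<le> a s" using S a by (auto simp: m_def)
  have M: "0 < M" "\<And>s. s \<in> S \<Longrightarrow> c s \<le> M"
  proof -
    show "0 < M" unfolding M_def using c(1) by (intro add_nonneg_pos sum_nonneg) auto
    show "c s \<le> M" if "s \<in> S" for s
      using member_le_sum[of s S c] that c(1) S by (simp add: M_def)
  qed
  have "(\<Sum>s\<in>S. a s *\<^sub>R s) - e' *\<^sub>R x \<in> convex_cone hull S" if e': "0 \<le> e'" "e' \<le> m / M" for e'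
  proof -
    have "(\<Sum>s\<in>S. (a s - e' * c s) *\<^sub>R s) \<in> convex_cone hull S"
    proof (rule in_cone_hullI[OF S])
      fix s assume s: "s \<in> S"
      have "e' * c s \<le> (m / M) * M" using e' M s c(1) m(1) by (intro mult_mono) auto
      then show "0 \<le> a s - e' * c s" using M(1) m(2)[OF s] by simp
    qed
    then show ?thesis by (simp add: c(2) scaleR_diff_left sum_subtractf scaleR_sum_right)
  qed
  then show ?thesis using m M by (intro exI[of _ "m / M"]) auto
qed

section \<open>Gram matrices and measurements\<close>

lemma sum_of_bool_pick:
  fixes h :: "nat \<Rightarrow> real"
  assumes "i < D"
  shows "(\<Sum>r<D. of_bool (i = r) * h r) = h i"
proof -
  have "(\<Sum>r<D. of_bool (i = r) * h r) = (\<Sum>r<D. if r = i then h r else 0)"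
    by (intro sum.cong) auto
  then show ?thesis using assms by simp
qed

text \<open>For the symmetric permutation matrix \<open>s\<close> of an involution,
  \<open>(1 + \<epsilon> s)^2 = 2 (1 + \<epsilon> s)\<close>; half of
  \<open>1 + \<epsilon> s\<close> is thus a projection.\<close>

lemma involution_pair_sum:
  fixes \<epsilon> :: real and D :: nat
  assumes \<sigma>: "\<And>r. r < D \<Longrightarrow> \<sigma> r < D" "\<And>r. r < D \<Longrightarrow> \<sigma> (\<sigma> r) = r"
    and ij: "i < D" "j < D" and \<epsilon>: "\<epsilon> * \<epsilon> = 1"
  shows "(\<Sum>r<D. (of_bool (i = r) + \<epsilon> * of_bool (i = \<sigma> r)) * (of_bool (j = r) + \<epsilon> * of_bool (j = \<sigma> r))) =
    2 * of_bool (i = j) + 2 * \<epsilon> * of_bool (j = \<sigma> i)"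
proof -
  define h where "h = (\<lambda>r. of_bool (j = r) + \<epsilon> * of_bool (j = \<sigma> r))"
  have sw: "i = \<sigma> r \<longleftrightarrow> \<sigma> i = r" if "r < D" for r using \<sigma>[OF that] \<sigma>[OF ij(1)] by auto
  have "(\<Sum>r<D. (of_bool (i = r) + \<epsilon> * of_bool (i = \<sigma> r)) * h r) =
      (\<Sum>r<D. of_bool (i = r) * h r + \<epsilon> * (of_bool (\<sigma> i = r) * h r))"
    by (intro sum.cong refl) (simp add: sw algebra_simps)
  also have "\<dots> = h i + \<epsilon> * h (\<sigma> i)"
    using sum_of_bool_pick[of i D h] sum_of_bool_pick[of "\<sigma> i" D h] ij \<sigma>
    by (simp add: sum.distrib flip: sum_distrib_left)
  also have "\<dots> = of_bool (j = i) + 2 * \<epsilon> * of_bool (j = \<sigma> i) + (\<epsilon> * \<epsilon>) * of_bool (j = i)"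
    using \<sigma>(2)[OF ij(1)] by (simp add: h_def algebra_simps)
  also have "\<dots> = 2 * of_bool (i = j) + 2 * \<epsilon> * of_bool (j = \<sigma> i)"
    by (simp add: \<epsilon> eq_commute[of j i])
  finally show ?thesis by (simp add: h_def)
qed

lemma sum_square_expand:
  fixes L :: "nat \<Rightarrow> nat \<Rightarrow> real"
  shows "(\<Sum>i<D. \<Sum>j<D. (\<Sum>r<D. L r i * L r j) * (\<zeta> i * \<zeta> j)) = (\<Sum>r<D. (\<Sum>i<D. L r i * \<zeta> i)\<^sup>2)"
proof -
  have "(\<Sum>i<D. \<Sum>j<D. (\<Sum>r<D. L r i * L r j) * (\<zeta> i * \<zeta> j)) =
      (\<Sum>i<D. \<Sum>j<D. \<Sum>r<D. (L r i * \<zeta> i) * (L r j * \<zeta> j))"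
    by (simp add: sum_distrib_left sum_distrib_right algebra_simps)
  also have "\<dots> = (\<Sum>i<D. \<Sum>r<D. \<Sum>j<D. (L r i * \<zeta> i) * (L r j * \<zeta> j))"
    by (intro sum.cong refl sum.swap)
  also have "\<dots> = (\<Sum>r<D. \<Sum>i<D. \<Sum>j<D. (L r i * \<zeta> i) * (L r j * \<zeta> j))" by (rule sum.swap)
  also have "\<dots> = (\<Sum>r<D. (\<Sum>i<D. L r i * \<zeta> i)\<^sup>2)"
    by (simp add: power2_eq_square sum_product)
  finally show ?thesis .
qed

lemma gram_pairing_nonneg:
  fixes L :: "nat \<Rightarrow> nat \<Rightarrow> real"
  assumes "hermitian_psd D T"
  shows "0 \<le> (\<Sum>i<D. \<Sum>j<D. (\<Sum>r<D. L r i * L r j) * Re (T i j))"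
proof -
  have "(\<Sum>i<D. \<Sum>j<D. (\<Sum>r<D. L r i * L r j) * Re (T i j)) =
      (\<Sum>i<D. \<Sum>j<D. \<Sum>r<D. L r i * L r j * Re (T i j))"
    by (simp add: sum_distrib_right)
  also have "\<dots> = (\<Sum>i<D. \<Sum>r<D. \<Sum>j<D. L r i * L r j * Re (T i j))"
    by (intro sum.cong refl sum.swap)
  also have "\<dots> = (\<Sum>r<D. \<Sum>i<D. \<Sum>j<D. L r i * L r j * Re (T i j))" by (rule sum.swap)
  also have "\<dots> = (\<Sum>r<D. Re (\<Sum>i<D. \<Sum>j<D. cnj (of_real (L r i)) * T i j * of_real (L r j)))"
    by (simp add: algebra_simps)
  also have "0 \<le> \<dots>"
  proof (rule sum_nonneg)
    fix r
    show "0 \<le> Re (\<Sum>i<D. \<Sum>j<D. cnj (of_real (L r i)) * T i j * of_real (L r j))"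
      using assms unfolding hermitian_psd_def by (elim conjE allE[of _ "\<lambda>i. of_real (L r i)"])
  qed
  finally show ?thesis .
qed

text \<open>Matrices with equal sums over \<open>P\<close> and \<open>Q\<close> respect the only
  relation, so they extend linearly. Being Gram matrices they are positive at the generators, and
  hence on the whole cone.\<close>

lemma presentation_gram_functional:
  fixes L :: "'v::euclidean_space \<Rightarrow> nat \<Rightarrow> nat \<Rightarrow> real"
  assumes pr: "presentation C P Q Z"
    and eq: "\<And>i j. i < D \<Longrightarrow> j < D \<Longrightarrow> (\<Sum>v\<in>P. \<Sum>r<D. L v r i * L v r j) = (\<Sum>v\<in>Q. \<Sum>r<D. L v r i * L v r j)"
  shows "\<exists>\<phi>. (\<forall>i j. linear (\<phi> i j)) \<and>
    (\<forall>i<D. \<forall>j<D. \<forall>v\<in>P \<union> Q \<union> Z. \<phi> i j v = (\<Sum>r<D. L v r i * L v r j)) \<and>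
    (\<forall>c\<in>C. \<forall>T. hermitian_psd D T \<longrightarrow> 0 \<le> (\<Sum>i<D. \<Sum>j<D. \<phi> i j c * Re (T i j)))"
proof -
  note D = presentationD[OF pr]
  define g where "g = (\<lambda>i j v. if i < D \<and> j < D then \<Sum>r<D. L v r i * L v r j else 0)"
  have "\<exists>f. linear f \<and> (\<forall>v\<in>P \<union> Q \<union> Z. f v = g i j v)" for i j
    by (rule presentation_linear_extend[OF pr], cases "i < D \<and> j < D") (use eq in \<open>auto simp: g_def\<close>)
  then obtain \<phi> where \<phi>: "\<And>i j. linear (\<phi> i j)" "\<And>i j v. v \<in> P \<union> Q \<union> Z \<Longrightarrow> \<phi> i j v = g i j v"
    by metis
  have "0 \<le> (\<Sum>i<D. \<Sum>j<D. \<phi> i j c * Re (T i j))" if c: "c \<in> C" and T: "hermitian_psd D T" for c T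
  proof -
    define S where "S = P \<union> Q \<union> Z"
    have "finite S" using D by (simp add: S_def)
    then obtain a where a: "\<forall>s\<in>S. 0 \<le> a s" "c = (\<Sum>s\<in>S. a s *\<^sub>R s)"
      using c D(7) convex_cone_hull_finite[of S] by (auto simp: S_def)
    have "\<phi> i j c = (\<Sum>s\<in>S. a s * g i j s)" for i j
      using \<phi> by (simp add: a(2) linear_sum[OF \<phi>(1)] linear_scale[OF \<phi>(1)] S_def)
    then have "(\<Sum>i<D. \<Sum>j<D. \<phi> i j c * Re (T i j)) = (\<Sum>i<D. \<Sum>j<D. \<Sum>s\<in>S. a s * (g i j s * Re (T i j)))"
      by (simp add: sum_distrib_right mult.assoc)
    also have "\<dots> = (\<Sum>i<D. \<Sum>s\<in>S. \<Sum>j<D. a s * (g i j s * Re (T i j)))"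
      by (intro sum.cong refl sum.swap)
    also have "\<dots> = (\<Sum>s\<in>S. \<Sum>i<D. \<Sum>j<D. a s * (g i j s * Re (T i j)))" by (rule sum.swap)
    also have "\<dots> = (\<Sum>s\<in>S. a s * (\<Sum>i<D. \<Sum>j<D. g i j s * Re (T i j)))"
      by (simp add: sum_distrib_left)
    also have "0 \<le> \<dots>"
    proof (intro sum_nonneg)
      fix s assume "s \<in> S"
      moreover have "(\<Sum>i<D. \<Sum>j<D. g i j s * Re (T i j)) =
          (\<Sum>i<D. \<Sum>j<D. (\<Sum>r<D. L s r i * L s r j) * Re (T i j))"
        by (simp add: g_def)
      ultimately show "0 \<le> a s * (\<Sum>i<D. \<Sum>j<D. g i j s * Re (T i j))"
        using a(1) gram_pairing_nonneg[OF T] by (intro mult_nonneg_nonneg) auto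
    qed
    finally show ?thesis .
  qed
  then show ?thesis using \<phi> by (intro exI[of _ \<phi>]) (auto simp: g_def)
qed

text \<open>Three outcomes \<open>E\<^sub>0\<^sub>0\<close>, \<open>(1 + b)/2 - E\<^sub>0\<^sub>0\<close>, \<open>(1 - b)/2\<close> and two outcomes \<open>(1 \<plusminus> a)/2\<close>, where the
  permutation \<open>a\<close> swaps \<open>2i, 2i + 1\<close> and \<open>b\<close> swaps \<open>2i + 1, 2i + 2\<close>: they generate all matrix units
  of size \<open>D\<close>, whereas \<open>d \<times> d\<close> matrices over a commutative algebra satisfy a standard identity.\<close>

theorem not_d_subhomogeneous:
  fixes C :: "'v::euclidean_space set"
  assumes pr: "presentation C P Q Z" and card: "3 \<le> card P" "2 \<le> card Q" and u: "u \<in> interior C"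
  shows "\<not> d_subhomogeneous TYPE('b) d (min_cone C) u"
proof
  assume "d_subhomogeneous TYPE('b) d (min_cone C) u"
  then obtain A :: "'b cstar" and \<Phi> where A: "comm_cstar_algebra A"
    and emb: "unital_complete_order_embedding A d (min_cone C) u \<Phi>"
    unfolding d_subhomogeneous_def by blast
  note pD = presentationD[OF pr]
  \<comment> \<open>Length above \<open>d * d\<close> makes the standard identity available. The
    size \<open>D\<close> is even for the pairing \<open>a\<close>, and larger than \<open>k\<close>
    so that the units \<open>E_(i, i+1)\<close> with \<open>i < k\<close> exist.\<close>
  define k where "k = d * d + 1"
  define D where "D = 2 * k"
  have D: "even D" "2 \<le> D" "k < D" "d * d < k" by (auto simp: D_def k_def)
  define a where "a = (\<lambda>i::nat. if even i then i + 1 else i - 1)"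
  \<comment> \<open>The shifted pairing leaves the two ends 0 and \<open>D - 1\<close>
    fixed.\<close>
  define b where "b = (\<lambda>i::nat. if i = 0 \<or> i = D - 1 then i else if even i then i - 1 else i + 1)"
  have a: "a r < D" "a (a r) = r" if "r < D" for r
    using that D by (auto simp: a_def elim!: evenE oddE)
  have b: "b r < D" "b (b r) = r" if "r < D" for r
  proof -
    show "b r < D" using that D by (auto simp: b_def)
    show "b (b r) = r"
    proof (cases "r = 0 \<or> r = D - 1")
      case False
      show ?thesis
      proof (cases "even r")
        case True
        then have "odd (r - 1)" "r - 1 \<noteq> D - 1" "r - 1 \<noteq> 0" using False that by (auto elim!: evenE)
        then show ?thesis using True False by (simp add: b_def)
      next
        case odd: False
        then have "even (r + 1)" "r + 1 \<noteq> 0" by auto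
        moreover have "odd (D - 1)" using D by simp
        ultimately have "r + 1 \<noteq> D - 1" by metis
        then show ?thesis using odd False by (simp add: b_def)
      qed
    qed (auto simp: b_def)
  qed
  have b0: "b 0 = 0" by (simp add: b_def)
  obtain v1 v2 v3 where v: "v1 \<in> P" "v2 \<in> P" "v3 \<in> P" "v1 \<noteq> v2" "v1 \<noteq> v3" "v2 \<noteq> v3"
  proof -
    obtain T where "T \<subseteq> P" "card T = 3" using card(1) by (rule obtain_subset_with_card_n)
    then obtain x y z where "{x, y, z} \<subseteq> P" "x \<noteq> y" "x \<noteq> z" "y \<noteq> z"
      unfolding card_3_iff by blast
    then show ?thesis by (intro that[of x y z]) auto
  qed
  obtain w1 w2 where w: "w1 \<in> Q" "w2 \<in> Q" "w1 \<noteq> w2"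
  proof -
    obtain T where "T \<subseteq> Q" "card T = 2" using card(2) by (rule obtain_subset_with_card_n)
    then obtain x y where "{x, y} \<subseteq> Q" "x \<noteq> y" unfolding card_2_iff by blast
    then show ?thesis by (intro that[of x y]) auto
  qed
  have vw: "v \<noteq> w" if "v \<in> P" "w \<in> Q" for v w using that pD(4) by blast
  define pm where "pm = (\<lambda>(\<epsilon>::real) (\<sigma>::nat \<Rightarrow> nat) r i. (of_bool (i = r) + \<epsilon> * of_bool (i = \<sigma> r)) / 2)"
  \<comment> \<open>Gram factors of the outcomes. As \<open>b\<close> fixes 0, row 0 of
    \<open>(1 + b)/2\<close> is the unit vector \<open>e_0\<close>, so dropping this row subtracts
    \<open>E_00\<close>. The remaining generators are sent to 0.\<close>
  define L where "L = (\<lambda>v r (i::nat). if v = v1 then of_bool (r = 0) * of_bool (i = 0) else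
    if v = v2 then of_bool (r \<noteq> 0) * pm 1 b r i else if v = v3 then pm (-1) b r i else
    if v = w1 then pm 1 a r i else if v = w2 then pm (-1) a r i else (0::real))"
  define G where "G = (\<lambda>v i j. \<Sum>r<D. L v r i * L v r j)"
  have pmsum: "(\<Sum>r<D. pm \<epsilon> \<sigma> r i * pm \<epsilon> \<sigma> r j) = (of_bool (i = j) + \<epsilon> * of_bool (j = \<sigma> i)) / 2"
    if "\<And>r. r < D \<Longrightarrow> \<sigma> r < D" "\<And>r. r < D \<Longrightarrow> \<sigma> (\<sigma> r) = r" "i < D" "j < D" "\<epsilon> * \<epsilon> = 1" for \<epsilon> \<sigma> i j
  proof -
    have "(\<Sum>r<D. pm \<epsilon> \<sigma> r i * pm \<epsilon> \<sigma> r j) =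
      (\<Sum>r<D. (of_bool (i = r) + \<epsilon> * of_bool (i = \<sigma> r)) * (of_bool (j = r) + \<epsilon> * of_bool (j = \<sigma> r))) / 4"
      unfolding sum_divide_distrib by (simp add: pm_def)
    then show ?thesis by (simp add: involution_pair_sum[OF that(1,2,3,4,5)])
  qed
  have Gv1: "G v1 i j = of_bool (i = 0) * of_bool (j = 0)" if "i < D" "j < D" for i j
  proof -
    have "G v1 i j = (\<Sum>r<D. if r = 0 then of_bool (i = 0) * of_bool (j = 0) else 0)"
      unfolding G_def by (intro sum.cong) (auto simp: L_def)
    then show ?thesis using D by simp
  qed
  have Gv2: "G v2 i j = (of_bool (i = j) + of_bool (j = b i)) / 2 - of_bool (i = 0) * of_bool (j = 0)"
    if "i < D" "j < D" for i j
  proof -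
    have "G v2 i j = (\<Sum>r<D. pm 1 b r i * pm 1 b r j - (if r = 0 then pm 1 b 0 i * pm 1 b 0 j else 0))"
      unfolding G_def using v by (intro sum.cong) (auto simp: L_def)
    also have "\<dots> = (of_bool (i = j) + of_bool (j = b i)) / 2 - pm 1 b 0 i * pm 1 b 0 j"
      unfolding sum_subtractf using pmsum[OF b that, of 1] D by simp
    finally show ?thesis by (simp add: pm_def b0)
  qed
  have Gv3: "G v3 i j = (of_bool (i = j) - of_bool (j = b i)) / 2" if "i < D" "j < D" for i j
    using pmsum[OF b that, of "-1"] v by (simp add: G_def L_def)
  have Gw1: "G w1 i j = (of_bool (i = j) + of_bool (j = a i)) / 2" if "i < D" "j < D" for i j
    using pmsum[OF a that, of 1] vw[OF v(1) w(1)] vw[OF v(2) w(1)] vw[OF v(3) w(1)] by (simp add: G_def L_def)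
  have Gw2: "G w2 i j = (of_bool (i = j) - of_bool (j = a i)) / 2" if "i < D" "j < D" for i j
    using pmsum[OF a that, of "-1"] vw[OF v(1) w(2)] vw[OF v(2) w(2)] vw[OF v(3) w(2)] w(3)
    by (simp add: G_def L_def)
  have L0: "L s = (\<lambda>r i. 0)" if "s \<notin> {v1, v2, v3, w1, w2}" for s
    using that by (simp add: L_def)
  have GP: "(\<Sum>s\<in>P. G s i j) = of_bool (i = j)" if "i < D" "j < D" for i j
  proof -
    have "(\<Sum>s\<in>P. G s i j) = (\<Sum>s\<in>{v1, v2, v3}. G s i j)"
    proof (rule sum.mono_neutral_right)
      show "\<forall>s\<in>P - {v1, v2, v3}. G s i j = 0"
      proof
        fix s assume "s \<in> P - {v1, v2, v3}"
        then have "s \<notin> {v1, v2, v3, w1, w2}" using vw[of s w1] vw[of s w2] w by auto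
        then show "G s i j = 0" by (simp add: G_def L0)
      qed
    qed (use v pD(1) in auto)
    then show ?thesis using v Gv1[OF that] Gv2[OF that] Gv3[OF that] by (simp add: field_simps)
  qed
  have GQ: "(\<Sum>s\<in>Q. G s i j) = of_bool (i = j)" if "i < D" "j < D" for i j
  proof -
    have "(\<Sum>s\<in>Q. G s i j) = (\<Sum>s\<in>{w1, w2}. G s i j)"
    proof (rule sum.mono_neutral_right)
      show "\<forall>s\<in>Q - {w1, w2}. G s i j = 0"
      proof
        fix s assume "s \<in> Q - {w1, w2}"
        then have "s \<notin> {v1, v2, v3, w1, w2}" using vw[of v1 s] vw[of v2 s] vw[of v3 s] v by auto
        then show "G s i j = 0" by (simp add: G_def L0)
      qed
    qed (use w pD(2) in auto)
    then show ?thesis using w Gw1[OF that] Gw2[OF that] by (simp add: field_simps)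
  qed
  have "\<exists>\<phi>. (\<forall>i j. linear (\<phi> i j)) \<and>
    (\<forall>i<D. \<forall>j<D. \<forall>v\<in>P \<union> Q \<union> Z. \<phi> i j v = (\<Sum>r<D. L v r i * L v r j)) \<and>
    (\<forall>c\<in>C. \<forall>T. hermitian_psd D T \<longrightarrow> 0 \<le> (\<Sum>i<D. \<Sum>j<D. \<phi> i j c * Re (T i j)))"
  proof (rule presentation_gram_functional[OF pr])
    fix i j assume ij: "i < D" "j < D"
    show "(\<Sum>v\<in>P. \<Sum>r<D. L v r i * L v r j) = (\<Sum>v\<in>Q. \<Sum>r<D. L v r i * L v r j)"
      using GP[OF ij] GQ[OF ij] by (simp add: G_def)
  qed
  then obtain \<phi> where "\<forall>i j. linear (\<phi> i j)"
    "\<forall>i<D. \<forall>j<D. \<forall>v\<in>P \<union> Q \<union> Z. \<phi> i j v = (\<Sum>r<D. L v r i * L v r j)"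
    "\<forall>c\<in>C. \<forall>T. hermitian_psd D T \<longrightarrow> 0 \<le> (\<Sum>i<D. \<Sum>j<D. \<phi> i j c * Re (T i j))" by blast
  note lin = this(1)[rule_format] and \<phi> = this(2)[rule_format] and pos = this(3)[rule_format]
  interpret S: star_cone_functional "mat_ring A d" "cstar_mst A" "cstar_msc A" "\<lambda>v. cut A d (\<Phi> v)" D \<phi> u C
    by (rule comm_cstar_algebra.embedding_functional[OF A emb lin pos])
  have form: "S.form s \<zeta> = (\<Sum>r<D. (\<Sum>i<D. L s r i * \<zeta> i)\<^sup>2)" if "s \<in> P \<union> Q \<union> Z" for s \<zeta>
  proof -
    have "S.form s \<zeta> = (\<Sum>i<D. \<Sum>j<D. (\<Sum>r<D. L s r i * L s r j) * (\<zeta> i * \<zeta> j))"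
      unfolding S.form_def using \<phi> that by (intro sum.cong refl) (simp add: G_def)
    then show ?thesis by (simp add: sum_square_expand)
  qed
  have pmz: "(\<Sum>i<D. pm \<epsilon> \<sigma> r i * \<zeta> i) = (\<zeta> r + \<epsilon> * \<zeta> (\<sigma> r)) / 2"
    if "r < D" "\<sigma> r < D" for \<epsilon> \<sigma> r \<zeta>
  proof -
    have "(\<Sum>i<D. pm \<epsilon> \<sigma> r i * \<zeta> i) = (\<Sum>i<D. (of_bool (r = i) * \<zeta> i + \<epsilon> * (of_bool (\<sigma> r = i) * \<zeta> i)) / 2)"
      by (intro sum.cong refl) (auto simp: pm_def algebra_simps)
    also have "\<dots> = (\<zeta> r + \<epsilon> * \<zeta> (\<sigma> r)) / 2"
      using sum_of_bool_pick[of r D \<zeta>] sum_of_bool_pick[of "\<sigma> r" D \<zeta>] that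
      by (simp add: sum.distrib flip: sum_divide_distrib sum_distrib_left)
    finally show ?thesis .
  qed
  have pmb: "(\<Sum>i<D. pm \<epsilon> b r i * \<zeta> i) = (\<zeta> r + \<epsilon> * \<zeta> (b r)) / 2" if "r < D" for \<epsilon> r \<zeta>
    by (rule pmz) (use that b in auto)
  have pma: "(\<Sum>i<D. pm \<epsilon> a r i * \<zeta> i) = (\<zeta> r + \<epsilon> * \<zeta> (a r)) / 2" if "r < D" for \<epsilon> r \<zeta>
    by (rule pmz) (use that a in auto)
  have mem: "v1 \<in> P \<union> Q \<union> Z" "v2 \<in> P \<union> Q \<union> Z" "v3 \<in> P \<union> Q \<union> Z" "w1 \<in> P \<union> Q \<union> Z" "w2 \<in> P \<union> Q \<union> Z"
    using v w by auto
  have f1: "S.form v1 \<zeta> = 0" if "\<zeta> 0 = 0" for \<zeta>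
    unfolding form[OF mem(1)]
  proof (intro sum.neutral ballI)
    fix r assume "r \<in> {..<D}"
    have "(\<Sum>i<D. L v1 r i * \<zeta> i) = 0" by (intro sum.neutral) (auto simp: L_def of_bool_def that)
    then show "(\<Sum>i<D. L v1 r i * \<zeta> i)\<^sup>2 = 0" by simp
  qed
  have f2: "S.form v2 \<zeta> = 0" if "\<And>r. r < D \<Longrightarrow> r \<noteq> 0 \<Longrightarrow> \<zeta> r + \<zeta> (b r) = 0" for \<zeta>
    unfolding form[OF mem(2)]
  proof (intro sum.neutral ballI)
    fix r assume r: "r \<in> {..<D}"
    have "(\<Sum>i<D. L v2 r i * \<zeta> i) = of_bool (r \<noteq> 0) * (\<Sum>i<D. pm 1 b r i * \<zeta> i)"
      unfolding sum_distrib_left using v by (intro sum.cong) (auto simp: L_def)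
    also have "\<dots> = 0" using pmb[of r 1 \<zeta>] that[of r] r by (cases "r = 0") auto
    finally show "(\<Sum>i<D. L v2 r i * \<zeta> i)\<^sup>2 = 0" by simp
  qed
  have f3: "S.form v3 \<zeta> = 0" if "\<And>r. r < D \<Longrightarrow> \<zeta> r = \<zeta> (b r)" for \<zeta>
    unfolding form[OF mem(3)] using that pmb[of _ "-1" \<zeta>] v
    by (intro sum.neutral ballI) (auto simp: L_def)
  have g1: "S.form w1 \<zeta> = 0" if "\<And>r. r < D \<Longrightarrow> \<zeta> r + \<zeta> (a r) = 0" for \<zeta>
    unfolding form[OF mem(4)] using that pma[of _ 1 \<zeta>] vw[OF v(1) w(1)] vw[OF v(2) w(1)] vw[OF v(3) w(1)]
    by (intro sum.neutral ballI) (auto simp: L_def)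
  have g2: "S.form w2 \<zeta> = 0" if "\<And>r. r < D \<Longrightarrow> \<zeta> r = \<zeta> (a r)" for \<zeta>
    unfolding form[OF mem(5)] using that pma[of _ "-1" \<zeta>] vw[OF v(1) w(2)] vw[OF v(2) w(2)] vw[OF v(3) w(2)] w(3)
    by (intro sum.neutral ballI) (auto simp: L_def)
  have f0: "S.form s \<zeta> = 0" if "s \<in> P \<union> Q \<union> Z" "s \<notin> {v1, v2, v3, w1, w2}" for s \<zeta>
    using form[OF that(1)] L0[OF that(2)] by simp
  have cc: "convex_cone C" unfolding pD(7) by (rule convex_cone_convex_cone_hull)
  have finS: "finite (P \<union> Q \<union> Z)" using pD by simp
  have inC: "s \<in> C" if "s \<in> P \<union> Q \<union> Z" for s unfolding pD(7) using that by (rule hull_inc)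
  have uC: "u \<in> C" using u interior_subset by blast
  \<comment> \<open>By the relation this is also the sum over \<open>Q\<close> and \<open>Z\<close>,
    so a single element is inverted for both measurements. Averaging the two sums makes all
    coefficients positive, which puts \<open>g\<close> above a multiple of \<open>u\<close>.\<close>
  define g where "g = \<Sum>(P \<union> Z)"
  have gQ: "g = \<Sum>(Q \<union> Z)" unfolding g_def using pD by (simp add: sum.union_disjoint)
  have gC: "g \<in> C" unfolding g_def using pD by (intro sum_nonneg_in_cone[OF cc]) (auto intro: inC)
  have "\<exists>e>0. \<forall>e'. 0 \<le> e' \<and> e' \<le> e \<longrightarrow> g - e' *\<^sub>R u \<in> C"
  proof -
    have "g = (\<Sum>s\<in>P \<union> Q \<union> Z. (if s \<in> Z then 1 else 1/2) *\<^sub>R s)"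
    proof -
      have "(\<Sum>s\<in>P \<union> Q \<union> Z. (if s \<in> Z then 1 else 1/2) *\<^sub>R s) =
          (\<Sum>s\<in>P. (1/2) *\<^sub>R s) + (\<Sum>s\<in>Q. (1/2) *\<^sub>R s) + \<Sum>Z"
      proof -
        have "(P \<union> Q) \<inter> Z = {}" using pD by blast
        then have "(\<Sum>s\<in>P \<union> Q \<union> Z. (if s \<in> Z then 1 else 1/2) *\<^sub>R s) =
          (\<Sum>s\<in>P. (if s \<in> Z then 1 else 1/2) *\<^sub>R s) + (\<Sum>s\<in>Q. (if s \<in> Z then 1 else 1/2) *\<^sub>R s) +
          (\<Sum>s\<in>Z. (if s \<in> Z then 1 else 1/2) *\<^sub>R s)"
          using pD by (simp add: sum.union_disjoint)
        moreover have "(\<Sum>s\<in>P. (if s \<in> Z then 1 else 1/2) *\<^sub>R s) = (\<Sum>s\<in>P. (1/2) *\<^sub>R s)"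
          "(\<Sum>s\<in>Q. (if s \<in> Z then 1 else 1/2) *\<^sub>R s) = (\<Sum>s\<in>Q. (1/2) *\<^sub>R s)"
          "(\<Sum>s\<in>Z. (if s \<in> Z then 1 else 1/2) *\<^sub>R s) = \<Sum>Z"
          using pD(5,6) by (auto intro!: sum.cong)
        ultimately show ?thesis by simp
      qed
      also have "\<dots> = \<Sum>P + \<Sum>Z" using pD(8) by (simp flip: scaleR_sum_right scaleR_add_left)
      finally show ?thesis using pD by (simp add: g_def sum.union_disjoint)
    qed
    moreover have "\<exists>e>0. \<forall>e'. 0 \<le> e' \<and> e' \<le> e \<longrightarrow>
        (\<Sum>s\<in>P \<union> Q \<union> Z. (if s \<in> Z then 1 else 1/2) *\<^sub>R s) - e' *\<^sub>R u \<in> convex_cone hull (P \<union> Q \<union> Z)"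
      by (rule positive_combination_absorbs[OF finS]) (use uC pD(7) in auto)
    ultimately show ?thesis by (simp flip: pD(7))
  qed
  then obtain e0 where e0: "e0 > 0" "\<And>e. 0 \<le> e \<Longrightarrow> e \<le> e0 \<Longrightarrow> g - e *\<^sub>R u \<in> C" by blast
  have bnd: "\<exists>c0. \<forall>c\<ge>c0. S.bounded_by c x" if "x \<in> C" for x
    using interior_absorbs[OF cc u, of x] that unfolding S.bounded_by_def by (meson order_less_le_trans)
  obtain c0 where c0: "\<And>c. c \<ge> c0 \<Longrightarrow> S.bounded_by c g" using bnd[OF gC] by blast
  define c where "c = max c0 (e0 + 1)"
  have c: "S.bounded_by c g" "g - e0 *\<^sub>R u \<in> C" "0 < e0" "e0 < c"
    using c0[of c] e0 by (auto simp: c_def)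
  have bd: "\<exists>d. S.bounded_by d s" if "s \<in> P \<union> Q \<union> Z" for s
    using bnd[OF inC[OF that]] by blast
  \<comment> \<open>\<open>v1\<close> is the outcome \<open>E_00\<close>, a projection orthogonal to
    the other outcomes on its side.\<close>
  have ap1: "\<exists>X. S.apx X (S.munit 0 0)"
  proof -
    have "S.apx (\<lambda>m. S.neumann (1 / c) (cut A d (\<Phi> (\<Sum>(P \<union> Z)))) m \<otimes>\<^bsub>mat_ring A d\<^esub> cut A d (\<Phi> v1)) (S.munit 0 0)"
    proof (rule S.apx_projection)
      fix \<xi> s assume s: "s \<in> P \<union> Z - {v1}"
      show "S.form s (S.munit 0 0 \<xi>) = 0"
      proof (cases "s \<in> {v2, v3}")
        case True
        have bz: "b r = 0 \<longleftrightarrow> r = 0" if "r < D" for r using b(2)[OF that] b0 by metis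
        show ?thesis using True by (auto simp: S.munit_def bz intro!: f2 f3)
      next
        case False
        then show ?thesis using s w pD(4,6) by (intro f0) auto
      qed
    qed (use pD v bd c in \<open>auto simp: g_def S.munit_def intro!: f1\<close>)
    then show ?thesis by blast
  qed
  have ap3: "\<exists>X. S.apx X (\<lambda>\<xi> l. (\<xi> l - \<xi> (b l)) / 2)"
  proof -
    have "S.apx (\<lambda>m. S.neumann (1 / c) (cut A d (\<Phi> (\<Sum>(P \<union> Z)))) m \<otimes>\<^bsub>mat_ring A d\<^esub> cut A d (\<Phi> v3))
        (\<lambda>\<xi> l. (\<xi> l - \<xi> (b l)) / 2)"
    proof (rule S.apx_projection)
      fix \<xi> s assume s: "s \<in> P \<union> Z - {v3}"
      show "S.form s (\<lambda>l. (\<xi> l - \<xi> (b l)) / 2) = 0"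
      proof (cases "s \<in> {v1, v2}")
        case True
        then show ?thesis using b(2) by (auto simp: b0 intro!: f1 f2 simp flip: add_divide_distrib)
      next
        case False
        then show ?thesis using s w pD(4,6) by (intro f0) auto
      qed
    next
      fix \<xi>
      show "S.form v3 (\<lambda>i. \<xi> i - (\<xi> i - \<xi> (b i)) / 2) = 0"
        by (rule f3) (simp add: b(2) field_simps)
    qed (use pD v bd c in \<open>auto simp: g_def\<close>)
    then show ?thesis by blast
  qed
  have apw: "\<exists>X. S.apx X (\<lambda>\<xi> l. (\<xi> l - \<xi> (a l)) / 2)"
  proof -
    have "S.apx (\<lambda>m. S.neumann (1 / c) (cut A d (\<Phi> (\<Sum>(Q \<union> Z)))) m \<otimes>\<^bsub>mat_ring A d\<^esub> cut A d (\<Phi> w2))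
        (\<lambda>\<xi> l. (\<xi> l - \<xi> (a l)) / 2)"
    proof (rule S.apx_projection)
      fix \<xi> s assume s: "s \<in> Q \<union> Z - {w2}"
      show "S.form s (\<lambda>l. (\<xi> l - \<xi> (a l)) / 2) = 0"
      proof (cases "s = w1")
        case True
        then show ?thesis using a(2) by (auto intro!: g1 simp flip: add_divide_distrib)
      next
        case False
        then show ?thesis using s v pD(4,5) by (intro f0) auto
      qed
    next
      fix \<xi>
      show "S.form w2 (\<lambda>i. \<xi> i - (\<xi> i - \<xi> (a i)) / 2) = 0"
        by (rule g2) (simp add: a(2) field_simps)
    qed (use pD w bd c gQ in \<open>auto\<close>)
    then show ?thesis by blast
  qed
  \<comment> \<open>The permutation is 1 minus twice the projection
    \<open>(1 - \<sigma>)/2\<close>.\<close>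
  have swap: "\<exists>X. S.apx X (\<lambda>\<xi> l. \<xi> (\<sigma> l))" if \<sigma>: "\<exists>X. S.apx X (\<lambda>\<xi> l. (\<xi> l - \<xi> (\<sigma> l)) / 2)" for \<sigma>
  proof -
    obtain X where X: "S.apx X (\<lambda>\<xi> l. (\<xi> l - \<xi> (\<sigma> l)) / 2)" using \<sigma> by blast
    show ?thesis
      using S.apx_cong[OF S.apx_add[OF S.apx_one S.apx_sc[OF X, of "-2"]], of "\<lambda>\<xi> l. \<xi> (\<sigma> l)"]
      by (fastforce simp: field_simps)
  qed
  have comp: "\<exists>X. S.apx X U" if ex: "\<exists>X. S.apx X S1" "\<exists>X. S.apx X S2" "\<And>\<xi> l. l < D \<Longrightarrow> U \<xi> l = S1 (S2 \<xi>) l" for S1 S2 U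
  proof -
    obtain X1 X2 where "S.apx X1 S1" "S.apx X2 S2" using ex(1,2) by blast
    from S.apx_cong[OF S.apx_mult[OF this], of U] ex(3) show ?thesis by blast
  qed
  \<comment> \<open>Neighbouring indices are exchanged by \<open>a\<close> or by \<open>b\<close>,
    according to the parity of the smaller one.\<close>
  have next': "\<exists>\<sigma>. (\<exists>X. S.apx X (\<lambda>\<xi> l. \<xi> (\<sigma> l))) \<and> (\<forall>r<D. \<sigma> r < D \<and> \<sigma> (\<sigma> r) = r) \<and> \<sigma> i = Suc i"
    if "Suc i < D" for i
  proof (cases "even i")
    case True
    then show ?thesis using swap[OF apw] a by (intro exI[of _ a]) (auto simp: a_def)
  next
    case False
    then have "i \<noteq> 0" "i \<noteq> D - 1" using that by (auto intro!: gr0I)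
    then show ?thesis using swap[OF ap3] b False by (intro exI[of _ b]) (auto simp: b_def)
  qed
  have col: "\<exists>X. S.apx X (S.munit i 0)" if "i < D" for i
    using that
  proof (induction i)
    case 0
    show ?case by (rule ap1)
  next
    case (Suc i)
    then obtain \<sigma> where \<sigma>: "\<exists>X. S.apx X (\<lambda>\<xi> l. \<xi> (\<sigma> l))" "\<forall>r<D. \<sigma> r < D \<and> \<sigma> (\<sigma> r) = r" "\<sigma> i = Suc i"
      using next' by blast
    have "\<sigma> l = i \<longleftrightarrow> l = Suc i" if "l < D" for l using \<sigma>(2,3) that Suc.prems by (metis Suc_lessD)
    then show ?case
      using Suc by (intro comp[OF \<sigma>(1) Suc.IH]) (auto simp: S.munit_def)
  qed
  have row: "\<exists>X. S.apx X (S.munit 0 j)" if "j < D" for j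
    using that
  proof (induction j)
    case 0
    show ?case by (rule ap1)
  next
    case (Suc j)
    then obtain \<sigma> where \<sigma>: "\<exists>X. S.apx X (\<lambda>\<xi> l. \<xi> (\<sigma> l))" "\<forall>r<D. \<sigma> r < D \<and> \<sigma> (\<sigma> r) = r" "\<sigma> j = Suc j"
      using next' by blast
    show ?case
      using Suc \<sigma>(3) by (intro comp[OF Suc.IH \<sigma>(1)]) (auto simp: S.munit_def)
  qed
  have unit: "\<exists>X. S.apx X (S.munit i j)" if "i < D" "j < D" for i j
    by (rule comp[OF col[OF that(1)] row[OF that(2)]]) (simp add: S.munit_def)
  have "\<forall>i<k. \<exists>X. S.apx X (S.munit i (Suc i))" using unit D by auto
  then obtain X where X: "\<And>i. i < k \<Longrightarrow> S.apx (X i) (S.munit i (Suc i))" by metis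
  show False
  proof (rule S.standard_polynomial_obstruction)
    show "real_star_ring.standard_polynomial (mat_ring A d) (cstar_msc A) k x = \<zero>\<^bsub>mat_ring A d\<^esub>"
      if "\<And>i. i < k \<Longrightarrow> x i \<in> carrier (mat_ring A d)" for x
      by (rule comm_star_ring.standard_polynomial_mat[OF comm_cstar_algebra.comm_star_ring_cstar[OF A] D(4) that])
    show "S.apx (X i) (S.munit i (Suc i))" if "i < k" for i by (rule X[OF that])
    define \<delta> where "\<delta> = (\<lambda>i::nat. of_bool (i = 0) :: real)"
    have form00: "S.form x \<delta> = \<phi> 0 0 x" for x
    proof -
      have "(\<Sum>j<D. \<phi> i j x * (\<delta> i * \<delta> j)) = (\<Sum>j<D. if j = 0 then \<phi> i 0 x * \<delta> i else 0)" for i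
        by (intro sum.cong) (auto simp: \<delta>_def)
      then have "S.form x \<delta> = (\<Sum>i<D. \<phi> i 0 x * \<delta> i)" using D by (simp add: S.form_def)
      also have "\<dots> = (\<Sum>i<D. if i = 0 then \<phi> 0 0 x else 0)" by (intro sum.cong) (auto simp: \<delta>_def)
      finally show ?thesis using D by simp
    qed
    have ge0: "0 \<le> \<phi> 0 0 x" if "x \<in> C" for x
    proof -
      define T where "T = (\<lambda>i j. complex_of_real (\<delta> i * \<delta> j))"
      have "hermitian_psd D T"
      proof -
        have "(\<Sum>i<D. \<Sum>j<D. cnj (y i) * T i j * y j) = cnj (\<Sum>i<D. of_real (\<delta> i) * y i) * (\<Sum>j<D. of_real (\<delta> j) * y j)" for y
          unfolding cnj_sum sum_product by (intro sum.cong refl) (simp add: T_def)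
        then have "0 \<le> Re (\<Sum>i<D. \<Sum>j<D. cnj (y i) * T i j * y j)" for y
          by (simp only: mult.commute[of "cnj _"] complex_mult_cnj Re_complex_of_real) simp
        then show ?thesis by (simp add: hermitian_psd_def T_def mult.commute)
      qed
      from pos[OF that this] show ?thesis using form00[of x] by (simp add: S.form_def T_def)
    qed
    have \<phi>P: "\<phi> 0 0 (\<Sum>P) = 1"
    proof -
      have "\<phi> 0 0 (\<Sum>P) = (\<Sum>s\<in>P. G s 0 0)" using \<phi>[of 0 0] D by (simp add: linear_sum[OF lin] G_def)
      then show ?thesis using GP[of 0 0] D by simp
    qed
    \<comment> \<open>A multiple of \<open>u\<close> dominates \<open>\<Sum>P\<close>, which is
      represented by the identity matrix, so \<open>u\<close> has a positive value at the entry (0,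
      0).\<close>
    obtain c1 where c1: "c1 > 0" "c1 *\<^sub>R u - \<Sum>P \<in> C" using interior_absorbs[OF cc u, of "\<Sum>P"] by blast
    have "0 \<le> c1 * \<phi> 0 0 u - 1"
      using ge0[OF c1(2)] \<phi>P by (simp add: linear_diff[OF lin] linear_scale[OF lin])
    then have "0 < \<phi> 0 0 u" using c1(1) by (smt (verit) mult_nonneg_nonpos)
    moreover have "S.F (\<lambda>i j. (of_bool (i = 0) * of_bool (j = 0)) *\<^sub>R u) = S.form u \<delta>"
      using S.F_rank_one[of \<delta> u] by (simp add: \<delta>_def)
    ultimately show "0 < S.F (\<lambda>i j. (of_bool (i = 0) * of_bool (j = 0)) *\<^sub>R u)" by (simp add: form00)
  qed
qed

section \<open>The algebra of bounded sequences\<close>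

definition sup_cmod :: "(nat \<Rightarrow> complex) \<Rightarrow> real" where
  "sup_cmod f = (SUP n. cmod (f n))"

text \<open>The algebra is carried over along an injection into \<open>'b\<close>, since its carrier
  has to live in that type.\<close>

definition linf :: "((nat \<Rightarrow> complex) \<Rightarrow> 'b) \<Rightarrow> 'b cstar" where
  "linf \<iota> = \<lparr>carrier = \<iota> ` {f. bounded (range f)},
     mult = (\<lambda>x y. \<iota> (\<lambda>n. inv_into UNIV \<iota> x n * inv_into UNIV \<iota> y n)),
     one = \<iota> (\<lambda>n. 1), zero = \<iota> (\<lambda>n. 0),
     add = (\<lambda>x y. \<iota> (\<lambda>n. inv_into UNIV \<iota> x n + inv_into UNIV \<iota> y n)),
     smult = (\<lambda>c x. \<iota> (\<lambda>n. c * inv_into UNIV \<iota> x n)),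
     star = (\<lambda>x. \<iota> (\<lambda>n. cnj (inv_into UNIV \<iota> x n))),
     cnorm = (\<lambda>x. sup_cmod (inv_into UNIV \<iota> x))\<rparr>"

lemma bounded_range_bdd: "bounded (range f) \<Longrightarrow> bdd_above (range (\<lambda>n. cmod (f n)))"
  by (auto simp: bounded_iff bdd_above_def)

lemma cmod_le_sup: "bounded (range f) \<Longrightarrow> cmod (f n) \<le> sup_cmod f"
  unfolding sup_cmod_def by (rule cSUP_upper[OF UNIV_I bounded_range_bdd])

lemma sup_cmod_least: "(\<And>n. cmod (f n) \<le> c) \<Longrightarrow> sup_cmod f \<le> c"
  unfolding sup_cmod_def by (rule cSUP_least) auto

lemma sup_cmod_nonneg: "bounded (range f) \<Longrightarrow> 0 \<le> sup_cmod f"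
  using cmod_le_sup[of f 0] norm_ge_zero order_trans by blast

lemma boundedI_cmod: "(\<And>n. cmod (f n) \<le> c) \<Longrightarrow> bounded (range f)"
  by (auto simp: bounded_iff)

lemma bounded_seq_closed:
  fixes f g :: "nat \<Rightarrow> complex"
  assumes "bounded (range f)" "bounded (range g)"
  shows "bounded (range (\<lambda>n. f n + g n))" "bounded (range (\<lambda>n. f n * g n))"
    "bounded (range (\<lambda>n. c * f n))" "bounded (range (\<lambda>n. cnj (f n)))" "bounded (range (\<lambda>n. - f n))"
    "bounded (range (\<lambda>n. f n - g n))"
proof -
  note fg = cmod_le_sup[OF assms(1)] cmod_le_sup[OF assms(2)]
  show "bounded (range (\<lambda>n. f n + g n))"
    by (rule boundedI_cmod[of _ "sup_cmod f + sup_cmod g"]) (meson fg norm_triangle_le add_mono)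
  show "bounded (range (\<lambda>n. f n - g n))"
    by (rule boundedI_cmod[of _ "sup_cmod f + sup_cmod g"]) (meson fg norm_triangle_le_diff add_mono)
  show "bounded (range (\<lambda>n. f n * g n))"
    by (rule boundedI_cmod[of _ "sup_cmod f * sup_cmod g"])
      (simp add: norm_mult mult_mono fg sup_cmod_nonneg[OF assms(1)])
  show "bounded (range (\<lambda>n. c * f n))"
    by (rule boundedI_cmod[of _ "cmod c * sup_cmod f"]) (simp add: norm_mult mult_left_mono fg)
  show "bounded (range (\<lambda>n. cnj (f n)))" "bounded (range (\<lambda>n. - f n))"
    by (rule boundedI_cmod[of _ "sup_cmod f"], simp add: fg)+
qed

context
  fixes \<iota> :: "(nat \<Rightarrow> complex) \<Rightarrow> 'b"
  assumes inj: "inj \<iota>"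
begin

lemma linf_simps [simp]:
  "\<iota> f \<otimes>\<^bsub>linf \<iota>\<^esub> \<iota> g = \<iota> (\<lambda>n. f n * g n)"
  "\<iota> f \<oplus>\<^bsub>linf \<iota>\<^esub> \<iota> g = \<iota> (\<lambda>n. f n + g n)"
  "c \<odot>\<^bsub>linf \<iota>\<^esub> \<iota> f = \<iota> (\<lambda>n. c * f n)"
  "star (linf \<iota>) (\<iota> f) = \<iota> (\<lambda>n. cnj (f n))"
  "cnorm (linf \<iota>) (\<iota> f) = sup_cmod f"
  "\<one>\<^bsub>linf \<iota>\<^esub> = \<iota> (\<lambda>n. 1)"
  "\<zero>\<^bsub>linf \<iota>\<^esub> = \<iota> (\<lambda>n. 0)"
  by (simp_all add: linf_def inv_f_f[OF inj])

lemma linf_carrier: "x \<in> carrier (linf \<iota>) \<longleftrightarrow> (\<exists>f. x = \<iota> f \<and> bounded (range f))"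
  by (auto simp: linf_def)

lemma linf_mem [simp]: "\<iota> f \<in> carrier (linf \<iota>) \<longleftrightarrow> bounded (range f)"
  using inj by (auto simp: linf_def inj_def)

lemma cring_complex_ring: "cring complex_ring"
proof -
  have ex: "\<exists>y\<in>carrier complex_ring. y \<oplus>\<^bsub>complex_ring\<^esub> x = \<zero>\<^bsub>complex_ring\<^esub>" for x
    by (rule bexI[of _ "- x"]) (auto simp: complex_ring_def)
  show ?thesis
    by (intro cringI abelian_groupI comm_monoidI ex) (auto simp: complex_ring_def algebra_simps)
qed

lemma cring_linf: "cring (linf \<iota>)"
proof -
  have b1: "bounded (range (\<lambda>n::nat. c :: complex))" for c by (rule boundedI_cmod[of _ "cmod c"]) simp
  have ex: "\<exists>y\<in>carrier (linf \<iota>). y \<oplus>\<^bsub>linf \<iota>\<^esub> x = \<zero>\<^bsub>linf \<iota>\<^esub>" if "x \<in> carrier (linf \<iota>)" for x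
  proof -
    obtain f where f: "x = \<iota> f" "bounded (range f)" using \<open>x \<in> carrier (linf \<iota>)\<close> by (auto simp: linf_carrier)
    show ?thesis
      by (rule bexI[of _ "\<iota> (\<lambda>n. - f n)"]) (use f bounded_seq_closed(5)[OF f(2) f(2)] in simp_all)
  qed
  show ?thesis
    by (intro cringI abelian_groupI comm_monoidI ex)
      (auto simp: linf_carrier algebra_simps intro: bounded_seq_closed b1)
qed

lemma linf_minus:
  assumes "bounded (range f)" "bounded (range g)"
  shows "\<iota> f \<ominus>\<^bsub>linf \<iota>\<^esub> \<iota> g = \<iota> (\<lambda>n. f n - g n)"
proof -
  interpret cring "linf \<iota>" by (rule cring_linf)
  have "\<ominus>\<^bsub>linf \<iota>\<^esub> \<iota> g = \<iota> (\<lambda>n. - g n)"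
    by (rule minus_equality) (use assms bounded_seq_closed(5)[OF assms(2) assms(2)] in simp_all)
  then show ?thesis by (simp add: a_minus_def)
qed

lemma sup_cmod_eq_0: "bounded (range f) \<Longrightarrow> sup_cmod f = 0 \<longleftrightarrow> f = (\<lambda>n. 0)"
proof
  assume b: "bounded (range f)" and "sup_cmod f = 0"
  then have "cmod (f n) \<le> 0" for n using cmod_le_sup[OF b, of n] by simp
  then show "f = (\<lambda>n. 0)" by auto
next
  assume "f = (\<lambda>n. 0)"
  then show "sup_cmod f = 0" by (simp add: sup_cmod_def)
qed

lemma sup_cmod_square:
  assumes b: "bounded (range f)"
  shows "sup_cmod (\<lambda>n. cnj (f n) * f n) = (sup_cmod f)\<^sup>2"
proof (rule antisym)
  have b2: "bounded (range (\<lambda>n. cnj (f n) * f n))"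
    using bounded_seq_closed(2)[OF bounded_seq_closed(4)[OF b b] b] .
  show "sup_cmod (\<lambda>n. cnj (f n) * f n) \<le> (sup_cmod f)\<^sup>2"
    by (rule sup_cmod_least) (simp add: norm_mult power2_eq_square mult_mono cmod_le_sup[OF b] sup_cmod_nonneg[OF b])
  have "sup_cmod f \<le> sqrt (sup_cmod (\<lambda>n. cnj (f n) * f n))"
  proof (rule sup_cmod_least)
    fix n
    have "(cmod (f n))\<^sup>2 \<le> sup_cmod (\<lambda>n. cnj (f n) * f n)"
      using cmod_le_sup[OF b2, of n] by (simp add: norm_mult power2_eq_square)
    then show "cmod (f n) \<le> sqrt (sup_cmod (\<lambda>n. cnj (f n) * f n))" by (rule real_le_rsqrt)
  qed
  then show "(sup_cmod f)\<^sup>2 \<le> sup_cmod (\<lambda>n. cnj (f n) * f n)"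
    using sup_cmod_nonneg[OF b] sup_cmod_nonneg[OF b2]
    by (metis power_mono real_sqrt_pow2)
qed

lemma linf_complete:
  assumes F: "\<And>m. bounded (range (F m))"
    and cauchy: "\<forall>e>0. \<exists>N. \<forall>m\<ge>N. \<forall>n\<ge>N. sup_cmod (\<lambda>k. F m k - F n k) < e"
  shows "\<exists>g. bounded (range g) \<and> (\<lambda>n. sup_cmod (\<lambda>k. F n k - g k)) \<longlonglongrightarrow> 0"
proof -
  have le: "cmod (F m k - F n k) \<le> sup_cmod (\<lambda>k. F m k - F n k)" for m n k
    by (rule cmod_le_sup[OF bounded_seq_closed(6)[OF F F]])
  have "Cauchy (\<lambda>n. F n k)" for k
  proof (rule metric_CauchyI)
    fix e :: real assume "0 < e"
    then obtain N where "\<forall>m\<ge>N. \<forall>n\<ge>N. sup_cmod (\<lambda>k. F m k - F n k) < e" using cauchy by blast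
    then show "\<exists>N. \<forall>m\<ge>N. \<forall>n\<ge>N. dist (F m k) (F n k) < e"
      by (intro exI[of _ N]) (auto simp: dist_norm intro: order_le_less_trans[OF le])
  qed
  then have "\<forall>k. \<exists>l. (\<lambda>n. F n k) \<longlonglongrightarrow> l" by (auto intro: Cauchy_convergent simp: convergent_def[symmetric])
  then obtain g where g: "\<And>k. (\<lambda>n. F n k) \<longlonglongrightarrow> g k" by metis
  have lim: "cmod (F m k - g k) \<le> e" if "\<forall>m\<ge>N. \<forall>n\<ge>N. sup_cmod (\<lambda>k. F m k - F n k) < e" "m \<ge> N" for N m k e
  proof (rule tendsto_upperbound)
    show "(\<lambda>n. cmod (F m k - F n k)) \<longlonglongrightarrow> cmod (F m k - g k)"
      by (intro tendsto_intros g)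
    show "\<forall>\<^sub>F n in sequentially. cmod (F m k - F n k) \<le> e"
      unfolding eventually_sequentially
    proof (intro exI[of _ N] allI impI)
      fix n assume "N \<le> n"
      then have "sup_cmod (\<lambda>k. F m k - F n k) < e" using that by blast
      then show "cmod (F m k - F n k) \<le> e" using le[of m k n] by simp
    qed
  qed simp
  \<comment> \<open>Tolerance 1 is enough to see that the pointwise limit is bounded.\<close>
  obtain N where N: "\<forall>m\<ge>N. \<forall>n\<ge>N. sup_cmod (\<lambda>k. F m k - F n k) < 1" using cauchy zero_less_one by blast
  have "bounded (range (\<lambda>k. F N k - g k))"
    by (rule boundedI_cmod[of _ 1]) (use lim[OF N, of N] in simp)
  from bounded_seq_closed(6)[OF F[of N] this] have bg: "bounded (range g)" by simp
  have "(\<lambda>n. sup_cmod (\<lambda>k. F n k - g k)) \<longlonglongrightarrow> 0"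
  proof (rule LIMSEQ_I)
    fix r :: real assume "0 < r"
    then have "0 < r / 2" by simp
    then obtain N where N: "\<forall>m\<ge>N. \<forall>n\<ge>N. sup_cmod (\<lambda>k. F m k - F n k) < r / 2" using cauchy by blast
    have "norm (sup_cmod (\<lambda>k. F n k - g k) - 0) < r" if "n \<ge> N" for n
    proof -
      have "sup_cmod (\<lambda>k. F n k - g k) \<le> r / 2" by (rule sup_cmod_least) (rule lim[OF N that])
      then show ?thesis
        using sup_cmod_nonneg[OF bounded_seq_closed(6)[OF F bg], of n] \<open>0 < r\<close> by simp
    qed
    then show "\<exists>N. \<forall>n\<ge>N. norm (sup_cmod (\<lambda>k. F n k - g k) - 0) < r" by blast
  qed
  then show ?thesis using bg by blast
qed

lemma comm_cstar_linf: "comm_cstar_algebra (linf \<iota>)"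
proof -
  have alg: "Module.algebra complex_ring (linf \<iota>)"
    by (rule algebraI[OF cring_complex_ring cring_linf])
      (auto simp: linf_carrier complex_ring_def algebra_simps intro: bounded_seq_closed)
  show ?thesis
  proof (intro comm_cstar_algebra.intro alg comm_cstar_algebra_axioms.intro)
    fix f :: "nat \<Rightarrow> 'b"
    assume f: "range f \<subseteq> carrier (linf \<iota>)"
      and c: "\<forall>e>0. \<exists>N. \<forall>m\<ge>N. \<forall>n\<ge>N. cnorm (linf \<iota>) (f m \<ominus>\<^bsub>linf \<iota>\<^esub> f n) < e"
    have "\<forall>m. \<exists>g. f m = \<iota> g \<and> bounded (range g)" using f by (simp flip: linf_carrier add: image_subset_iff)
    from choice[OF this] obtain F where "\<forall>m. f m = \<iota> (F m) \<and> bounded (range (F m))" by blast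
    then have F: "f m = \<iota> (F m)" "bounded (range (F m))" for m by blast+
    have "\<forall>e>0. \<exists>N. \<forall>m\<ge>N. \<forall>n\<ge>N. sup_cmod (\<lambda>k. F m k - F n k) < e"
      using c by (simp add: F linf_minus)
    from linf_complete[of F, OF F(2) this] obtain g where
      "bounded (range g)" "(\<lambda>n. sup_cmod (\<lambda>k. F n k - g k)) \<longlonglongrightarrow> 0" by blast
    then show "\<exists>x\<in>carrier (linf \<iota>). (\<lambda>n. cnorm (linf \<iota>) (f n \<ominus>\<^bsub>linf \<iota>\<^esub> x)) \<longlonglongrightarrow> 0"
      by (intro bexI[of _ "\<iota> g"]) (simp_all add: F linf_minus)
  next
    fix x y assume "x \<in> carrier (linf \<iota>)" "y \<in> carrier (linf \<iota>)"
    then obtain f g where fg: "x = \<iota> f" "y = \<iota> g" "bounded (range f)" "bounded (range g)"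
      by (auto simp: linf_carrier)
    note le = cmod_le_sup[OF fg(3)] cmod_le_sup[OF fg(4)]
    show "cnorm (linf \<iota>) (x \<oplus>\<^bsub>linf \<iota>\<^esub> y) \<le> cnorm (linf \<iota>) x + cnorm (linf \<iota>) y"
      unfolding fg linf_simps by (rule sup_cmod_least) (meson le norm_triangle_le add_mono)
    show "cnorm (linf \<iota>) (x \<otimes>\<^bsub>linf \<iota>\<^esub> y) \<le> cnorm (linf \<iota>) x * cnorm (linf \<iota>) y"
      unfolding fg linf_simps
      by (rule sup_cmod_least) (simp add: norm_mult mult_mono le sup_cmod_nonneg[OF fg(3)])
    show "star (linf \<iota>) (x \<otimes>\<^bsub>linf \<iota>\<^esub> y) = star (linf \<iota>) y \<otimes>\<^bsub>linf \<iota>\<^esub> star (linf \<iota>) x"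
      "star (linf \<iota>) (x \<oplus>\<^bsub>linf \<iota>\<^esub> y) = star (linf \<iota>) x \<oplus>\<^bsub>linf \<iota>\<^esub> star (linf \<iota>) y"
      by (simp_all add: fg mult.commute)
  next
    fix x assume "x \<in> carrier (linf \<iota>)"
    then obtain f where f: "x = \<iota> f" "bounded (range f)" by (auto simp: linf_carrier)
    show "star (linf \<iota>) x \<in> carrier (linf \<iota>)" "star (linf \<iota>) (star (linf \<iota>) x) = x"
      using f bounded_seq_closed(4)[OF f(2) f(2)] by simp_all
    show "star (linf \<iota>) (c \<odot>\<^bsub>linf \<iota>\<^esub> x) = cnj c \<odot>\<^bsub>linf \<iota>\<^esub> star (linf \<iota>) x" for c
      by (simp add: f)
    show "0 \<le> cnorm (linf \<iota>) x" using f by (simp add: sup_cmod_nonneg)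
    show "cnorm (linf \<iota>) x = 0 \<longleftrightarrow> x = \<zero>\<^bsub>linf \<iota>\<^esub>"
      using f inj by (simp add: sup_cmod_eq_0 inj_eq)
    show "cnorm (linf \<iota>) (star (linf \<iota>) x \<otimes>\<^bsub>linf \<iota>\<^esub> x) = (cnorm (linf \<iota>) x)\<^sup>2"
      using f by (simp add: sup_cmod_square)
    show "cnorm (linf \<iota>) (c \<odot>\<^bsub>linf \<iota>\<^esub> x) = cmod c * cnorm (linf \<iota>) x" for c
    proof -
      have le: "sup_cmod (\<lambda>n. c * g n) \<le> cmod c * sup_cmod g" if "bounded (range g)" for c g
        by (rule sup_cmod_least) (simp add: norm_mult mult_left_mono cmod_le_sup[OF that])
      \<comment> \<open>The reverse inequality is the same estimate for
        \<open>inverse c\<close>.\<close>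
      have "cmod c * sup_cmod f \<le> sup_cmod (\<lambda>n. c * f n)"
      proof (cases "c = 0")
        case False
        have "sup_cmod f \<le> cmod (inverse c) * sup_cmod (\<lambda>n. c * f n)"
          using le[of "\<lambda>n. c * f n" "inverse c"] bounded_seq_closed(3)[OF f(2) f(2), of c] False
          by (simp flip: mult.assoc)
        then have "cmod c * sup_cmod f \<le> cmod c * (cmod (inverse c) * sup_cmod (\<lambda>n. c * f n))"
          by (rule mult_left_mono) simp
        also have "\<dots> = sup_cmod (\<lambda>n. c * f n)" using False by (simp add: norm_inverse)
        finally show ?thesis .
      qed (simp add: sup_cmod_nonneg bounded_seq_closed)
      then show ?thesis using le[OF f(2), of c] by (simp add: f)
    qed
  qed
qed

lemma linf_finsum:
  assumes "finite K" "\<And>k. k \<in> K \<Longrightarrow> bounded (range (f k))"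
  shows "(\<Oplus>\<^bsub>linf \<iota>\<^esub>k\<in>K. \<iota> (f k)) = \<iota> (\<lambda>n. \<Sum>k\<in>K. f k n) \<and> bounded (range (\<lambda>n. \<Sum>k\<in>K. f k n))"
proof -
  interpret cring "linf \<iota>" by (rule cring_linf)
  show ?thesis
    using assms
  proof (induction K)
    case empty
    then show ?case by (simp add: boundedI_cmod[of _ 0])
  next
    case (insert k K)
    then show ?case by (simp add: Pi_iff bounded_seq_closed)
  qed
qed

end

section \<open>Positive matrices over finite index sets\<close>

definition psd_on :: "'i set \<Rightarrow> ('i \<Rightarrow> 'i \<Rightarrow> complex) \<Rightarrow> bool" where
  "psd_on I M \<longleftrightarrow> (\<forall>i\<in>I. \<forall>j\<in>I. M j i = cnj (M i j)) \<and>
    (\<forall>x. 0 \<le> Re (\<Sum>i\<in>I. \<Sum>j\<in>I. cnj (x i) * M i j * x j))"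

lemma psd_onD: "psd_on I M \<Longrightarrow> i \<in> I \<Longrightarrow> j \<in> I \<Longrightarrow> cnj (M i j) = M j i"
  unfolding psd_on_def by (rule sym) blast

lemma psd_on_form: "psd_on I M \<Longrightarrow> 0 \<le> Re (\<Sum>i\<in>I. \<Sum>j\<in>I. cnj (x i) * M i j * x j)"
  unfolding psd_on_def by blast

lemma form_insert:
  fixes M :: "'i \<Rightarrow> 'i \<Rightarrow> complex"
  assumes "finite I" "a \<notin> I" and M: "psd_on (insert a I) M"
  shows "(\<Sum>i\<in>insert a I. \<Sum>j\<in>insert a I. cnj (x i) * M i j * x j) =
    cnj (x a) * M a a * x a + cnj (x a) * (\<Sum>j\<in>I. M a j * x j) + cnj (\<Sum>j\<in>I. M a j * x j) * x a +
    (\<Sum>i\<in>I. \<Sum>j\<in>I. cnj (x i) * M i j * x j)"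
proof -
  have "(\<Sum>i\<in>I. cnj (x i) * M i a * x a) = cnj (\<Sum>j\<in>I. M a j * x j) * x a"
    unfolding cnj_sum sum_distrib_right
    by (intro sum.cong refl) (simp add: psd_onD[OF M] mult.commute)
  moreover have "(\<Sum>j\<in>I. cnj (x a) * M a j * x j) = cnj (x a) * (\<Sum>j\<in>I. M a j * x j)"
    by (simp add: sum_distrib_left mult.assoc)
  ultimately show ?thesis using assms(1,2) by (simp add: sum.distrib)
qed

lemma psd_on_diag:
  assumes "finite I" "a \<in> I" "psd_on I M"
  shows "M a a = complex_of_real (Re (M a a))" "0 \<le> Re (M a a)"
proof -
  have "cnj (M a a) = M a a" using psd_onD[OF assms(3,2,2)] .
  then show "M a a = complex_of_real (Re (M a a))" by (simp add: complex_eq_iff)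
  define x where "x = (\<lambda>i. if i = a then 1 else 0 :: complex)"
  have "(\<Sum>j\<in>I. cnj (x i) * M i j * x j) = (\<Sum>j\<in>I. if j = a then cnj (x i) * M i a else 0)" for i
    by (intro sum.cong) (auto simp: x_def)
  then have "(\<Sum>i\<in>I. \<Sum>j\<in>I. cnj (x i) * M i j * x j) = (\<Sum>i\<in>I. if i = a then M a a else 0)"
    using assms(1,2) by (intro sum.cong) (auto simp: x_def)
  then show "0 \<le> Re (M a a)" using psd_on_form[OF assms(3), of x] assms(1,2) by simp
qed

lemma psd_on_subset:
  assumes "finite I" "J \<subseteq> I" "psd_on I M"
  shows "psd_on J M"
  unfolding psd_on_def
proof (intro conjI ballI allI)
  show "M j i = cnj (M i j)" if "i \<in> J" "j \<in> J" for i j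
    by (rule psd_onD[OF assms(3), symmetric]) (use that assms(2) in auto)
  fix x :: "'a \<Rightarrow> complex"
  define y where "y = (\<lambda>i. if i \<in> J then x i else 0)"
  have "(\<Sum>i\<in>I. \<Sum>j\<in>I. cnj (y i) * M i j * y j) = (\<Sum>i\<in>J. \<Sum>j\<in>I. cnj (y i) * M i j * y j)"
    by (intro sum.mono_neutral_right assms) (auto simp: y_def)
  also have "\<dots> = (\<Sum>i\<in>J. \<Sum>j\<in>J. cnj (y i) * M i j * y j)"
    by (intro sum.cong refl sum.mono_neutral_right assms) (auto simp: y_def)
  also have "\<dots> = (\<Sum>i\<in>J. \<Sum>j\<in>J. cnj (x i) * M i j * x j)" by (intro sum.cong refl) (auto simp: y_def)
  finally show "0 \<le> Re (\<Sum>i\<in>J. \<Sum>j\<in>J. cnj (x i) * M i j * x j)"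
    using psd_on_form[OF assms(3), of y] by simp
qed

text \<open>With a zero diagonal entry at \<open>a\<close> the form has no quadratic term in that
  coordinate, so a nonzero cross term would make it negative.\<close>

lemma psd_on_null_diag:
  assumes "finite I" "a \<in> I" "j \<in> I" "psd_on I M" "M a a = 0"
  shows "M a j = 0"
proof (cases "j = a")
  case False
  have P: "psd_on (insert a {j}) M" using assms by (intro psd_on_subset[OF assms(1) _ assms(4)]) auto
  have nj: "a \<notin> {j}" using False by simp
  define m where "m = M a j"
  have m: "0 \<le> - 2 * e * (cmod m)\<^sup>2 + Re (M j j)" for e :: real
  proof -
    define x where "x = (\<lambda>i. if i = a then - (of_real e) * m else 1)"
    have "0 \<le> Re (cnj (x a) * m + cnj m * x a + M j j)"
      using psd_on_form[OF P, of x] False assms(5)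
      unfolding form_insert[OF finite.emptyI[THEN finite.insertI] nj P, of x]
      by (simp add: x_def m_def)
    also have "Re (cnj (x a) * m + cnj m * x a + M j j) = - 2 * e * (cmod m)\<^sup>2 + Re (M j j)"
      unfolding cmod_power2 by (simp add: x_def power2_eq_square algebra_simps)
    finally show ?thesis .
  qed
  have "cmod m = 0"
  proof (rule ccontr)
    assume "cmod m \<noteq> 0"
    then have p: "(cmod m)\<^sup>2 > 0" by simp
    \<comment> \<open>Chosen so large that the linear term outweighs
      \<open>Re (M j j)\<close>.\<close>
    have "0 \<le> - 2 * ((\<bar>Re (M j j)\<bar> + 1) / (cmod m)\<^sup>2) * (cmod m)\<^sup>2 + Re (M j j)" by (rule m)
    also have "\<dots> = - 2 * (\<bar>Re (M j j)\<bar> + 1) + Re (M j j)" using p by simp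
    finally show False by simp
  qed
  then show ?thesis by (simp add: m_def)
qed (use assms in simp)

text \<open>Cholesky: the Schur complement of the entry \<open>(a, a)\<close> is again positive.\<close>

lemma psd_on_gram:
  assumes "finite I" "psd_on I M"
  shows "\<exists>Y. \<forall>i\<in>I. \<forall>j\<in>I. M i j = (\<Sum>k\<in>I. cnj (Y k i) * Y k j)"
  using assms
proof (induction I arbitrary: M)
  case empty
  then show ?case by simp
next
  case (insert a I)
  note P = insert.prems
  define m where "m = Re (M a a)"
  have m: "M a a = of_real m" "0 \<le> m" using psd_on_diag[OF _ _ P] insert.hyps by (auto simp: m_def)
  have mz: "M a j = 0" if "m = 0" "j \<in> insert a I" for j
    using psd_on_null_diag[OF _ _ that(2) P] insert.hyps m that by auto
  \<comment> \<open>For \<open>m = 0\<close> division by zero yields 0, so \<open>M' = M\<close> on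
    \<open>I\<close>, which fits the vanishing row \<open>a\<close>.\<close>
  define M' where "M' = (\<lambda>i j. M i j - M i a * M a j / of_real m)"
  have P': "psd_on I M'"
    unfolding psd_on_def
  proof (intro conjI ballI allI)
    show "M' j i = cnj (M' i j)" if "i \<in> I" "j \<in> I" for i j
      using that by (simp add: M'_def psd_onD[OF P] mult.commute)
    fix x :: "'a \<Rightarrow> complex"
    define s where "s = (\<Sum>j\<in>I. M a j * x j)"
    \<comment> \<open>The value at \<open>a\<close> that minimises the form over that coordinate;
      the minimum is the form of the Schur complement at \<open>x\<close>.\<close>
    define y where "y = x(a := - s / of_real m)"
    have yI: "y i = x i" if "i \<in> I" for i using that insert.hyps by (auto simp: y_def)
    have sy: "(\<Sum>j\<in>I. M a j * y j) = s" by (simp add: s_def yI)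
    have ya: "y a = - s / of_real m" by (simp add: y_def)
    have yy: "(\<Sum>i\<in>I. \<Sum>j\<in>I. cnj (y i) * M i j * y j) = (\<Sum>i\<in>I. \<Sum>j\<in>I. cnj (x i) * M i j * x j)"
      by (intro sum.cong refl) (simp add: yI)
    have s0: "s = 0" if "m = 0" using mz[OF that] by (simp add: s_def)
    have "(\<Sum>i\<in>I. \<Sum>j\<in>I. cnj (x i) * M' i j * x j) = (\<Sum>i\<in>I. \<Sum>j\<in>I. cnj (x i) * M i j * x j) -
        (\<Sum>i\<in>I. \<Sum>j\<in>I. (cnj (x i) * M i a) * (M a j * x j)) / of_real m"
      by (simp add: M'_def algebra_simps sum_subtractf sum_divide_distrib)
    also have "(\<Sum>i\<in>I. \<Sum>j\<in>I. (cnj (x i) * M i a) * (M a j * x j)) = cnj s * s"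
    proof -
      have "cnj s = (\<Sum>i\<in>I. cnj (x i) * M i a)"
        unfolding s_def cnj_sum by (intro sum.cong refl) (simp add: psd_onD[OF P] mult.commute)
      then show ?thesis by (simp add: sum_product s_def)
    qed
    also have "(\<Sum>i\<in>I. \<Sum>j\<in>I. cnj (x i) * M i j * x j) - cnj s * s / of_real m =
        (\<Sum>i\<in>insert a I. \<Sum>j\<in>insert a I. cnj (y i) * M i j * y j)"
      unfolding form_insert[OF insert.hyps P] sy yy ya m(1)
      using s0 by (cases "m = 0") simp_all
    finally show "0 \<le> Re (\<Sum>i\<in>I. \<Sum>j\<in>I. cnj (x i) * M' i j * x j)"
      using psd_on_form[OF P, of y] by simp
  qed
  from insert.IH[OF this] obtain Y' where Y': "\<forall>i\<in>I. \<forall>j\<in>I. M' i j = (\<Sum>k\<in>I. cnj (Y' k i) * Y' k j)" by blast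
  define Y where "Y = (\<lambda>k i. if k = a then M a i / of_real (sqrt m) else if i = a then 0 else Y' k i)"
  have "M i j = (\<Sum>k\<in>insert a I. cnj (Y k i) * Y k j)" if ij: "i \<in> insert a I" "j \<in> insert a I" for i j
  proof -
    have "complex_of_real (sqrt m) * complex_of_real (sqrt m) = of_real m"
      using m(2) by (simp flip: of_real_mult)
    then have first: "cnj (Y a i) * Y a j = M i a * M a j / of_real m"
      using ij by (simp add: Y_def psd_onD[OF P] times_divide_times_eq)
    have "(\<Sum>k\<in>I. cnj (Y k i) * Y k j) = (if i = a \<or> j = a then 0 else M' i j)"
    proof (cases "i = a \<or> j = a")
      case True
      then show ?thesis using insert.hyps by (auto simp: Y_def intro!: sum.neutral)
    next
      case False
      then have "M' i j = (\<Sum>k\<in>I. cnj (Y' k i) * Y' k j)" using ij Y' by auto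
      also have "\<dots> = (\<Sum>k\<in>I. cnj (Y k i) * Y k j)"
        using False insert.hyps by (intro sum.cong) (auto simp: Y_def)
      finally show ?thesis using False by simp
    qed
    moreover have "M i a * M a j / of_real m = M i j" if "i = a \<or> j = a"
    proof (cases "m = 0")
      case True
      have "M i a = 0" using psd_onD[OF P, of a i] mz[OF True, of i] ij by (metis complex_cnj_zero insertI1)
      then show ?thesis using True mz[OF True, of j] ij \<open>i = a \<or> j = a\<close> by auto
    next
      case False
      then show ?thesis using \<open>i = a \<or> j = a\<close> m by auto
    qed
    ultimately show ?thesis using insert.hyps first by (auto simp: M'_def)
  qed
  then show ?case by blast
qed

lemma gram_psd_on:
  assumes M: "\<And>i j. i \<in> I \<Longrightarrow> j \<in> I \<Longrightarrow> M i j = (\<Sum>k\<in>K. cnj (Y k i) * Y k j)"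
  shows "psd_on I M"
  unfolding psd_on_def
proof (intro conjI ballI allI)
  show "M j i = cnj (M i j)" if "i \<in> I" "j \<in> I" for i j
    using that by (simp add: M mult.commute)
  fix x
  have "(\<Sum>i\<in>I. \<Sum>j\<in>I. cnj (x i) * M i j * x j) =
      (\<Sum>i\<in>I. \<Sum>j\<in>I. \<Sum>k\<in>K. cnj (Y k i * x i) * (Y k j * x j))"
    by (intro sum.cong refl) (simp add: M sum_distrib_left sum_distrib_right algebra_simps)
  also have "\<dots> = (\<Sum>i\<in>I. \<Sum>k\<in>K. \<Sum>j\<in>I. cnj (Y k i * x i) * (Y k j * x j))"
    by (intro sum.cong refl sum.swap)
  also have "\<dots> = (\<Sum>k\<in>K. \<Sum>i\<in>I. \<Sum>j\<in>I. cnj (Y k i * x i) * (Y k j * x j))" by (rule sum.swap)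
  also have "\<dots> = (\<Sum>k\<in>K. cnj (\<Sum>i\<in>I. Y k i * x i) * (\<Sum>j\<in>I. Y k j * x j))"
    by (simp only: cnj_sum sum_product)
  finally have "(\<Sum>i\<in>I. \<Sum>j\<in>I. cnj (x i) * M i j * x j) =
      (\<Sum>k\<in>K. complex_of_real ((cmod (\<Sum>i\<in>I. Y k i * x i))\<^sup>2))"
    by (simp only: mult.commute[of "cnj _"] complex_norm_square)
  then show "0 \<le> Re (\<Sum>i\<in>I. \<Sum>j\<in>I. cnj (x i) * M i j * x j)"
    by (simp add: sum_nonneg)
qed

text \<open>Positivity over \<open>l\<^sup>\<infinity>\<close> is pointwise: the Cholesky factors are bounded by the diagonal.\<close>

lemma linf_mat_positive:
  fixes \<iota> :: "(nat \<Rightarrow> complex) \<Rightarrow> 'b"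
  assumes inj: "inj \<iota>" and I: "finite I" and b: "\<And>i j. i \<in> I \<Longrightarrow> j \<in> I \<Longrightarrow> bounded (range (M i j))"
    and X: "\<And>i j. i \<in> I \<Longrightarrow> j \<in> I \<Longrightarrow> X i j = \<iota> (M i j)"
  shows "cstar_mat_positive (linf \<iota>) I X \<longleftrightarrow> (\<forall>n. psd_on I (\<lambda>i j. M i j n))"
proof
  assume "cstar_mat_positive (linf \<iota>) I X"
  then obtain Y where "\<forall>i\<in>I. \<forall>j\<in>I. Y i j \<in> carrier (linf \<iota>)"
    and Y: "\<forall>i\<in>I. \<forall>j\<in>I. X i j = (\<Oplus>\<^bsub>linf \<iota>\<^esub>k\<in>I. star (linf \<iota>) (Y k i) \<otimes>\<^bsub>linf \<iota>\<^esub> Y k j)"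
    unfolding cstar_mat_positive_def by blast
  then have Yc: "\<exists>f. Y i j = \<iota> f \<and> bounded (range f)" if "i \<in> I" "j \<in> I" for i j
    using that unfolding linf_carrier[OF inj] by blast
  define G where "G = (\<lambda>i j. SOME f. Y i j = \<iota> f \<and> bounded (range f))"
  have G: "Y i j = \<iota> (G i j)" "bounded (range (G i j))" if "i \<in> I" "j \<in> I" for i j
    using someI_ex[OF Yc[OF that]] by (simp_all add: G_def)
  have MG: "M i j n = (\<Sum>k\<in>I. cnj (G k i n) * G k j n)" if ij: "i \<in> I" "j \<in> I" for i j n
  proof -
    interpret cring "linf \<iota>" by (rule cring_linf[OF inj])
    have bb: "bounded (range (\<lambda>n. cnj (G k i n) * G k j n))" if "k \<in> I" for k
      using bounded_seq_closed(2)[OF bounded_seq_closed(4)[OF G(2)[OF that ij(1)] G(2)[OF that ij(1)]] G(2)[OF that ij(2)]] .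
    have "\<iota> (M i j) = (\<Oplus>\<^bsub>linf \<iota>\<^esub>k\<in>I. star (linf \<iota>) (Y k i) \<otimes>\<^bsub>linf \<iota>\<^esub> Y k j)"
      using X[OF ij] Y ij by simp
    also have "\<dots> = (\<Oplus>\<^bsub>linf \<iota>\<^esub>k\<in>I. \<iota> (\<lambda>n. cnj (G k i n) * G k j n))"
      using ij bb by (intro finsum_cong') (auto simp: G(1) linf_simps[OF inj] linf_mem[OF inj])
    also have "\<dots> = \<iota> (\<lambda>n. \<Sum>k\<in>I. cnj (G k i n) * G k j n)"
      using linf_finsum[OF inj I bb] by simp
    finally have "M i j = (\<lambda>n. \<Sum>k\<in>I. cnj (G k i n) * G k j n)" using inj by (simp add: inj_eq)
    then show ?thesis by simp
  qed
  show "\<forall>n. psd_on I (\<lambda>i j. M i j n)"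
  proof
    fix n
    show "psd_on I (\<lambda>i j. M i j n)"
      by (rule gram_psd_on[where K = I and Y = "\<lambda>k i. G k i n"]) (rule MG)
  qed
next
  assume "\<forall>n. psd_on I (\<lambda>i j. M i j n)"
  then have "\<forall>n. \<exists>Y. \<forall>i\<in>I. \<forall>j\<in>I. M i j n = (\<Sum>k\<in>I. cnj (Y k i) * Y k j)"
    using psd_on_gram[OF I] by blast
  from choice[OF this] obtain Y where
    Y: "\<forall>n. \<forall>i\<in>I. \<forall>j\<in>I. M i j n = (\<Sum>k\<in>I. cnj (Y n k i) * Y n k j)" by blast
  have bY: "bounded (range (\<lambda>n. Y n k i))" if ki: "k \<in> I" "i \<in> I" for k i
  proof (rule boundedI_cmod)
    fix n
    have "(cmod (Y n k i))\<^sup>2 \<le> (\<Sum>k\<in>I. (cmod (Y n k i))\<^sup>2)"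
      using ki I by (intro member_le_sum) auto
    also have "\<dots> = Re (M i i n)"
    proof -
      have "M i i n = (\<Sum>k\<in>I. complex_of_real ((cmod (Y n k i))\<^sup>2))"
        using Y ki by (simp only: mult.commute[of "cnj _"] complex_norm_square)
      then show ?thesis by simp
    qed
    also have "\<dots> \<le> sup_cmod (M i i)"
      using complex_Re_le_cmod cmod_le_sup[OF b[OF ki(2,2)]] order_trans by blast
    finally show "cmod (Y n k i) \<le> sqrt (sup_cmod (M i i))" by (rule real_le_rsqrt)
  qed
  interpret cring "linf \<iota>" by (rule cring_linf[OF inj])
  have "X i j = (\<Oplus>\<^bsub>linf \<iota>\<^esub>k\<in>I. star (linf \<iota>) (\<iota> (\<lambda>n. Y n k i)) \<otimes>\<^bsub>linf \<iota>\<^esub> \<iota> (\<lambda>n. Y n k j))"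
    if ij: "i \<in> I" "j \<in> I" for i j
  proof -
    have bb: "bounded (range (\<lambda>n. cnj (Y n k i) * Y n k j))" if "k \<in> I" for k
      using bounded_seq_closed(2)[OF bounded_seq_closed(4)[OF bY[OF that ij(1)] bY[OF that ij(1)]] bY[OF that ij(2)]] .
    have "(\<Oplus>\<^bsub>linf \<iota>\<^esub>k\<in>I. star (linf \<iota>) (\<iota> (\<lambda>n. Y n k i)) \<otimes>\<^bsub>linf \<iota>\<^esub> \<iota> (\<lambda>n. Y n k j)) =
        \<iota> (\<lambda>n. \<Sum>k\<in>I. cnj (Y n k i) * Y n k j)"
      using linf_finsum[OF inj I bb] by (simp add: linf_simps[OF inj])
    also have "\<dots> = \<iota> (M i j)" using Y ij by (intro arg_cong[where f = \<iota>]) auto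
    finally show ?thesis using X[OF ij] by simp
  qed
  then show "cstar_mat_positive (linf \<iota>) I X"
    unfolding cstar_mat_positive_def using bY
    by (intro exI[of _ "\<lambda>k i. \<iota> (\<lambda>n. Y n k i)"]) (auto simp: linf_mem[OF inj])
qed

lemma psd_on_cong:
  "(\<And>i j. i \<in> I \<Longrightarrow> j \<in> I \<Longrightarrow> M i j = N i j) \<Longrightarrow> psd_on I M \<longleftrightarrow> psd_on I N"
  by (simp add: psd_on_def)

lemma hermitian_psd_on: "hermitian_psd s A \<longleftrightarrow> psd_on {..<s} A"
  by (simp only: hermitian_psd_def psd_on_def Ball_def lessThan_iff)

text \<open>A Gram factorisation reduces this to the inequality between a product and a sum of
  squares. It turns bounds on diagonals into bounds on all entries.\<close>

lemma psd_on_entry_le: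
  assumes "finite I" "psd_on I M" "i \<in> I" "j \<in> I"
  shows "cmod (M i j) \<le> Re (M i i) + Re (M j j)"
proof -
  obtain Y where Y: "\<forall>i\<in>I. \<forall>j\<in>I. M i j = (\<Sum>k\<in>I. cnj (Y k i) * Y k j)"
    using psd_on_gram[OF assms(1,2)] by blast
  have diag: "Re (M l l) = (\<Sum>k\<in>I. (cmod (Y k l))\<^sup>2)" if "l \<in> I" for l
  proof -
    have "M l l = (\<Sum>k\<in>I. complex_of_real ((cmod (Y k l))\<^sup>2))"
      using Y that by (simp only: mult.commute[of "cnj _"] complex_norm_square)
    then show ?thesis by simp
  qed
  have "cmod (M i j) \<le> (\<Sum>k\<in>I. cmod (cnj (Y k i) * Y k j))"
    using Y assms(3,4) by (simp add: norm_sum)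
  also have "\<dots> \<le> (\<Sum>k\<in>I. (cmod (Y k i))\<^sup>2 + (cmod (Y k j))\<^sup>2)"
  proof (rule sum_mono)
    fix k
    have "2 * cmod (Y k i) * cmod (Y k j) \<le> (cmod (Y k i))\<^sup>2 + (cmod (Y k j))\<^sup>2" by (rule sum_squares_bound)
    moreover have "0 \<le> cmod (Y k i) * cmod (Y k j)" by simp
    ultimately show "cmod (cnj (Y k i) * Y k j) \<le> (cmod (Y k i))\<^sup>2 + (cmod (Y k j))\<^sup>2"
      unfolding norm_mult complex_mod_cnj by linarith
  qed
  finally show ?thesis using diag assms(3,4) by (simp add: sum.distrib)
qed

text \<open>The Kronecker product of Gram factors is a Gram factor.\<close>

lemma psd_on_kronecker:
  assumes "finite I" "finite J" "psd_on I A" "psd_on J M"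
  shows "psd_on (I \<times> J) (\<lambda>(i, p) (j, q). A i j * M p q)"
proof -
  obtain Y where Y: "\<forall>i\<in>I. \<forall>j\<in>I. A i j = (\<Sum>k\<in>I. cnj (Y k i) * Y k j)"
    using psd_on_gram[OF assms(1,3)] by blast
  obtain W where W: "\<forall>i\<in>J. \<forall>j\<in>J. M i j = (\<Sum>k\<in>J. cnj (W k i) * W k j)"
    using psd_on_gram[OF assms(2,4)] by blast
  show ?thesis
  proof (rule gram_psd_on[where K = "I \<times> J" and Y = "\<lambda>(k, l) (i, p). Y k i * W l p"])
    fix x y assume xy: "x \<in> I \<times> J" "y \<in> I \<times> J"
    obtain i p j q where ij: "x = (i, p)" "y = (j, q)" by (cases x, cases y)
    have "A i j * M p q = (\<Sum>k\<in>I. \<Sum>l\<in>J. (cnj (Y k i) * Y k j) * (cnj (W l p) * W l q))"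
      using Y W xy ij by (simp add: sum_product)
    also have "\<dots> = (\<Sum>(k, l)\<in>I \<times> J. cnj (Y k i * W l p) * (Y k j * W l q))"
      unfolding sum.cartesian_product by (intro sum.cong refl) (auto simp: algebra_simps)
    finally show "(\<lambda>(i, p) (j, q). A i j * M p q) x y =
        (\<Sum>k\<in>I \<times> J. cnj ((\<lambda>(k, l) (i, p). Y k i * W l p) k x) * (\<lambda>(k, l) (i, p). Y k i * W l p) k y)"
      by (simp add: ij split_def)
  qed
qed

lemma psd_on_sum:
  assumes "\<And>k. k \<in> K \<Longrightarrow> 0 \<le> t k" "\<And>k. k \<in> K \<Longrightarrow> psd_on I (M k)"
  shows "psd_on I (\<lambda>i j. \<Sum>k\<in>K. complex_of_real (t k) * M k i j)"
  unfolding psd_on_def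
proof (intro conjI ballI allI)
  show "(\<Sum>k\<in>K. complex_of_real (t k) * M k j i) = cnj (\<Sum>k\<in>K. complex_of_real (t k) * M k i j)"
    if "i \<in> I" "j \<in> I" for i j
    unfolding cnj_sum using that by (intro sum.cong refl) (simp add: psd_onD[OF assms(2)])
  fix x
  have "(\<Sum>i\<in>I. \<Sum>j\<in>I. cnj (x i) * (\<Sum>k\<in>K. complex_of_real (t k) * M k i j) * x j) =
      (\<Sum>i\<in>I. \<Sum>j\<in>I. \<Sum>k\<in>K. complex_of_real (t k) * (cnj (x i) * M k i j * x j))"
    by (intro sum.cong refl) (simp add: sum_distrib_left sum_distrib_right algebra_simps)
  also have "\<dots> = (\<Sum>i\<in>I. \<Sum>k\<in>K. \<Sum>j\<in>I. complex_of_real (t k) * (cnj (x i) * M k i j * x j))"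
    by (intro sum.cong refl sum.swap)
  also have "\<dots> = (\<Sum>k\<in>K. \<Sum>i\<in>I. \<Sum>j\<in>I. complex_of_real (t k) * (cnj (x i) * M k i j * x j))"
    by (rule sum.swap)
  also have "\<dots> = (\<Sum>k\<in>K. complex_of_real (t k) * (\<Sum>i\<in>I. \<Sum>j\<in>I. cnj (x i) * M k i j * x j))"
    by (simp only: sum_distrib_left)
  finally show "0 \<le> Re (\<Sum>i\<in>I. \<Sum>j\<in>I. cnj (x i) * (\<Sum>k\<in>K. complex_of_real (t k) * M k i j) * x j)"
    using assms(1) psd_on_form[OF assms(2)] by (simp add: sum_nonneg)
qed

definition amp :: "('v \<Rightarrow> nat \<Rightarrow> nat \<Rightarrow> complex) \<Rightarrow> 'v vmat \<Rightarrow> nat \<times> nat \<Rightarrow> nat \<times> nat \<Rightarrow> complex" where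
  "amp \<phi> X = (\<lambda>(i, p) (j, q). \<phi> (fst (X i j)) p q + \<i> * \<phi> (snd (X i j)) p q)"

text \<open>The easy half of the embedding: a positive map sends an elementary tensor to a Kronecker
  product of positive matrices.\<close>

lemma amp_min_cone:
  fixes \<phi> :: "'v::real_vector \<Rightarrow> nat \<Rightarrow> nat \<Rightarrow> complex"
  assumes lin: "\<And>p q. linear (\<lambda>v. \<phi> v p q)" and pos: "\<And>v. v \<in> C \<Longrightarrow> psd_on {..<d} (\<phi> v)"
    and X: "X \<in> min_cone C s"
  shows "psd_on ({..<s} \<times> {..<d}) (amp \<phi> X)"
proof -
  obtain m :: nat and t A c where
    k: "\<forall>k<m. 0 \<le> (t k :: real) \<and> hermitian_psd s (A k) \<and> c k \<in> C" and
    Xe: "\<forall>i<s. \<forall>j<s. X i j = (\<Sum>k<m. t k *\<^sub>R tensor (A k) (c k) i j)"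
    using X unfolding min_cone_def by blast
  have "psd_on ({..<s} \<times> {..<d})
      (\<lambda>x y. \<Sum>k<m. complex_of_real (t k) * (\<lambda>(i, p) (j, q). A k i j * \<phi> (c k) p q) x y)"
    using k by (intro psd_on_sum psd_on_kronecker pos) (auto simp flip: hermitian_psd_on)
  moreover have "amp \<phi> X x y = (\<Sum>k<m. complex_of_real (t k) * (\<lambda>(i, p) (j, q). A k i j * \<phi> (c k) p q) x y)"
    if xy: "x \<in> {..<s} \<times> {..<d}" "y \<in> {..<s} \<times> {..<d}" for x y
  proof -
    obtain i p j q where ij: "x = (i, p)" "y = (j, q)" by (cases x, cases y)
    have "X i j = (\<Sum>k<m. t k *\<^sub>R tensor (A k) (c k) i j)" using Xe xy ij by simp
    then have "amp \<phi> X x y =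
        (\<Sum>k<m. t k *\<^sub>R Re (A k i j) *\<^sub>R \<phi> (c k) p q) + \<i> * (\<Sum>k<m. t k *\<^sub>R Im (A k i j) *\<^sub>R \<phi> (c k) p q)"
      by (simp add: ij amp_def fst_sum snd_sum tensor_def linear_sum[OF lin] linear_scale[OF lin])
    also have "\<dots> = (\<Sum>k<m. complex_of_real (t k) *
        (complex_of_real (Re (A k i j)) + \<i> * complex_of_real (Im (A k i j))) * \<phi> (c k) p q)"
      by (simp add: sum_distrib_left scaleR_conv_of_real algebra_simps flip: sum.distrib)
    also have "\<dots> = (\<Sum>k<m. complex_of_real (t k) * (A k i j * \<phi> (c k) p q))"
      by (simp add: mult.assoc flip: complex_eq)
    finally show ?thesis by (simp add: ij)
  qed
  ultimately show ?thesis by (subst psd_on_cong) auto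
qed

text \<open>A sequence is determined by the rationals below the real and imaginary parts of its
  members, that is, by a subset of a countable set.\<close>

lemma complex_sequences_lepoll_reals: "(UNIV :: (nat \<Rightarrow> complex) set) \<lesssim> (UNIV :: real set)"
proof -
  define h where "h f = {(n, r, b). real_of_rat r < (if b then Re (f n) else Im (f n))}"
    for f :: "nat \<Rightarrow> complex"
  have lt: "\<not> x < y" if "{r. real_of_rat r < x} = {r. real_of_rat r < y}" for x y :: real
    using of_rat_dense[of x y] that by (metis less_asym mem_Collect_eq)
  have inj: "inj (\<lambda>f. to_nat ` h f)"
  proof (rule injI)
    fix f g assume "to_nat ` h f = to_nat ` h g"
    then have hh: "h f = h g" using inj_image_eq_iff[OF inj_to_nat] by blast
    have e: "{r. real_of_rat r < (if b then Re (f n) else Im (f n))} =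
        {r. real_of_rat r < (if b then Re (g n) else Im (g n))}" for n b
    proof -
      have "(n, r, b) \<in> h f \<longleftrightarrow> (n, r, b) \<in> h g" for r using hh by simp
      then show ?thesis by (simp add: h_def)
    qed
    have "Re (f n) = Re (g n)" "Im (f n) = Im (g n)" for n
      using lt[OF e[of True n]] lt[OF e[of True n, symmetric]] lt[OF e[of False n]] lt[OF e[of False n, symmetric]]
      by auto
    then show "f = g" by (auto simp: complex_eq_iff)
  qed
  have "(UNIV :: (nat \<Rightarrow> complex) set) \<lesssim> (UNIV :: nat set set)"
    unfolding lepoll_def using inj by blast
  also have "(UNIV :: nat set set) \<lesssim> (UNIV :: real set)"
    by (rule eqpoll_imp_lepoll[OF nat_sets_eqpoll_reals])
  finally show ?thesis .
qed

text \<open>A countable family of unital positive maps into \<open>Mat\<^sub>d(\<complex>)\<close> that detects the minimal matrix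
  cones embeds the operator system into \<open>Mat\<^sub>d(l\<^sup>\<infinity>)\<close>.\<close>

lemma d_subhomogeneous_of_family:
  fixes \<phi> :: "'k \<Rightarrow> 'v::euclidean_space \<Rightarrow> nat \<Rightarrow> nat \<Rightarrow> complex"
  assumes card: "(UNIV :: real set) \<lesssim> (UNIV :: 'b set)"
    and K: "countable K" "K \<noteq> {}" and C: "convex_cone C" and u: "u \<in> interior C"
    and lin: "\<And>k p q. k \<in> K \<Longrightarrow> linear (\<lambda>v. \<phi> k v p q)"
    and unit: "\<And>k p q. k \<in> K \<Longrightarrow> p < d \<Longrightarrow> q < d \<Longrightarrow> \<phi> k u p q = (if p = q then 1 else 0)"
    and pos: "\<And>k v. k \<in> K \<Longrightarrow> v \<in> C \<Longrightarrow> psd_on {..<d} (\<phi> k v)"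
    and det: "\<And>s X. X \<in> Her s \<Longrightarrow> (\<And>k. k \<in> K \<Longrightarrow> psd_on ({..<s} \<times> {..<d}) (amp (\<phi> k) X)) \<Longrightarrow>
      X \<in> min_cone C s"
  shows "d_subhomogeneous TYPE('b) d (min_cone C) u"
proof -
  have "(UNIV :: (nat \<Rightarrow> complex) set) \<lesssim> (UNIV :: 'b set)"
    using lepoll_trans[OF complex_sequences_lepoll_reals card] .
  then obtain \<iota> :: "(nat \<Rightarrow> complex) \<Rightarrow> 'b" where inj: "inj \<iota>" unfolding lepoll_def by blast
  note [simp] = linf_simps[OF inj] linf_mem[OF inj]
  \<comment> \<open>An enumeration of \<open>K\<close>, possibly with repetitions, so finite and
    infinite families are treated alike.\<close>
  define \<kappa> where "\<kappa> = from_nat_into K"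
  have \<kappa>: "\<kappa> n \<in> K" for n using from_nat_into[OF K(2)] by (simp add: \<kappa>_def)
  have absorb: "\<exists>c>0. c *\<^sub>R u - v \<in> C \<and> c *\<^sub>R u + v \<in> C" for v
  proof -
    obtain c1 c2 where "c1 > 0" "\<forall>c'\<ge>c1. c' *\<^sub>R u - v \<in> C" "\<forall>c'\<ge>c2. c' *\<^sub>R u - (- v) \<in> C"
      using interior_absorbs[OF C u, of v] interior_absorbs[OF C u, of "- v"] by blast
    then show ?thesis by (intro exI[of _ "max c1 c2"]) auto
  qed
  \<comment> \<open>Every \<open>v\<close> is a multiple of the unit minus an element of the cone,
    so Hermitian symmetry and boundedness are inherited from positive values.\<close>
  have split: "\<phi> k v p q = of_real c * (if p = q then 1 else 0) - \<phi> k (c *\<^sub>R u - v) p q"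
    if "k \<in> K" "p < d" "q < d" for k v p q c
    using unit[OF that] by (simp add: linear_diff[OF lin] linear_scale[OF lin] that scaleR_conv_of_real)
  have herm: "\<phi> k v q p = cnj (\<phi> k v p q)" if kpq: "k \<in> K" "p < d" "q < d" for k v p q
  proof -
    obtain c where c: "c *\<^sub>R u - v \<in> C" using absorb[of v] by blast
    show ?thesis
      unfolding split[OF kpq(1,2,3), of v c] split[OF kpq(1,3,2), of v c]
      using psd_onD[OF pos[OF kpq(1) c], of p q] kpq by simp
  qed
  have bd: "bounded (range (\<lambda>n. \<phi> (\<kappa> n) v p q))" if pq: "p < d" "q < d" for v p q
  proof -
    obtain c where c: "c > 0" "c *\<^sub>R u - v \<in> C" "c *\<^sub>R u + v \<in> C" using absorb[of v] by blast
    show ?thesis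
    proof (rule boundedI_cmod)
      fix n
      let ?M = "\<phi> (\<kappa> n) (c *\<^sub>R u - v)"
      \<comment> \<open>Uses positivity at \<open>c u + v\<close> and unitality. With
        \<open>psd_on_entry_le\<close> it gives the bound \<open>4 * c\<close> for entries, and
        \<open>5 * c\<close> after adding the multiple of the unit.\<close>
      have diag: "Re (?M r r) \<le> 2 * c" if r: "r < d" for r
      proof -
        have "0 \<le> Re (\<phi> (\<kappa> n) (c *\<^sub>R u + v) r r)"
          using psd_on_diag(2)[OF _ _ pos[OF \<kappa> c(3)]] r by simp
        then show ?thesis
          using unit[OF \<kappa> r r]
          by (simp add: linear_diff[OF lin[OF \<kappa>]] linear_add[OF lin[OF \<kappa>]] linear_scale[OF lin[OF \<kappa>]])
      qed
      have "cmod (?M p q) \<le> 4 * c"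
        using psd_on_entry_le[OF _ pos[OF \<kappa>[of n] c(2)], of p q] diag[OF pq(1)] diag[OF pq(2)] pq by simp
      moreover have "cmod (of_real c * (if p = q then 1 else 0)) \<le> c" using c(1) by simp
      ultimately show "cmod (\<phi> (\<kappa> n) v p q) \<le> 5 * c"
        unfolding split[OF \<kappa> pq, of n v c]
        using norm_triangle_ineq4[of "of_real c * (if p = q then 1 else 0)" "?M p q"] by linarith
    qed
  qed
  define \<Phi> where "\<Phi> = (\<lambda>v p q. \<iota> (\<lambda>n. \<phi> (\<kappa> n) v p q))"
  have lh: "linear_to_hermitian (linf \<iota>) d \<Phi>"
    unfolding linear_to_hermitian_def
  proof (intro allI impI conjI)
    fix p q v assume pq: "p < d" "q < d"
    show "\<Phi> v p q \<in> carrier (linf \<iota>)" by (simp add: \<Phi>_def bd pq)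
    have "(\<lambda>n. \<phi> (\<kappa> n) v q p) = (\<lambda>n. cnj (\<phi> (\<kappa> n) v p q))"
      by (rule ext) (rule herm[OF \<kappa> pq])
    then show "\<Phi> v q p = star (linf \<iota>) (\<Phi> v p q)" by (simp add: \<Phi>_def)
    show "\<Phi> (v + w) p q = \<Phi> v p q \<oplus>\<^bsub>linf \<iota>\<^esub> \<Phi> w p q" for w
      by (simp add: \<Phi>_def linear_add[OF lin[OF \<kappa>]])
    show "\<Phi> (r *\<^sub>R v) p q = complex_of_real r \<odot>\<^bsub>linf \<iota>\<^esub> \<Phi> v p q" for r
      by (simp add: \<Phi>_def linear_scale[OF lin[OF \<kappa>]] scaleR_conv_of_real)
  qed
  have pos_iff: "cstar_mat_positive (linf \<iota>) ({..<s} \<times> {..<d}) (amplify (linf \<iota>) \<Phi> X) \<longleftrightarrow>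
      (\<forall>n. psd_on ({..<s} \<times> {..<d}) (\<lambda>i j. amp (\<phi> (\<kappa> n)) X i j))" for s X
  proof (rule linf_mat_positive[OF inj])
    fix x y assume xy: "x \<in> {..<s} \<times> {..<d}" "y \<in> {..<s} \<times> {..<d}"
    obtain i p j q where ij: "x = (i, p)" "y = (j, q)" by (cases x, cases y)
    have pq: "p < d" "q < d" using xy ij by auto
    show "bounded (range (\<lambda>n. amp (\<phi> (\<kappa> n)) X x y))"
      unfolding amp_def ij prod.case
      by (rule bounded_seq_closed(1)[OF bd[OF pq] bounded_seq_closed(3)[OF bd[OF pq] bd[OF pq]]])
    show "amplify (linf \<iota>) \<Phi> X x y = \<iota> (\<lambda>n. amp (\<phi> (\<kappa> n)) X x y)"
      by (simp add: amplify_def amp_def ij \<Phi>_def)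
  qed simp
  have "X \<in> min_cone C s \<longleftrightarrow> (\<forall>n. psd_on ({..<s} \<times> {..<d}) (amp (\<phi> (\<kappa> n)) X))" if X: "X \<in> Her s" for s X
  proof
    show "\<forall>n. psd_on ({..<s} \<times> {..<d}) (amp (\<phi> (\<kappa> n)) X)" if "X \<in> min_cone C s"
      using amp_min_cone[OF lin[OF \<kappa>] pos[OF \<kappa>] that] by blast
    assume "\<forall>n. psd_on ({..<s} \<times> {..<d}) (amp (\<phi> (\<kappa> n)) X)"
    then show "X \<in> min_cone C s"
      using from_nat_into_to_nat_on[OF K(1)] by (intro det[OF X]) (metis \<kappa>_def)
  qed
  moreover have "\<forall>p<d. \<forall>q<d. \<Phi> u p q = (if p = q then \<one>\<^bsub>linf \<iota>\<^esub> else \<zero>\<^bsub>linf \<iota>\<^esub>)"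
    by (simp add: \<Phi>_def unit[OF \<kappa>])
  ultimately have "unital_complete_order_embedding (linf \<iota>) d (min_cone C) u \<Phi>"
    unfolding unital_complete_order_embedding_def using lh pos_iff by simp
  then show ?thesis
    unfolding d_subhomogeneous_def using comm_cstar_linf[OF inj] by blast
qed

section \<open>Subhomogeneity of the square cone\<close>

lemma min_cone_sum:
  assumes S: "finite S" and G: "\<And>v. v \<in> S \<Longrightarrow> hermitian_psd s (G v)" "S \<subseteq> C"
    and X: "\<And>i j. i < s \<Longrightarrow> j < s \<Longrightarrow> X i j = (\<Sum>v\<in>S. tensor (G v) v i j)"
  shows "X \<in> min_cone C s"
proof -
  obtain h where h: "bij_betw h {..<card S} S"
    using ex_bij_betw_nat_finite[OF S] unfolding lessThan_atLeast0 by blast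
  have hS: "h k \<in> S" if "k < card S" for k using bij_betwE[OF h] that by blast
  have "X i j = (\<Sum>k<card S. (1::real) *\<^sub>R tensor (G (h k)) (h k) i j)" if "i < s" "j < s" for i j
    using X[OF that] sum.reindex_bij_betw[OF h, of "\<lambda>v. tensor (G v) v i j"] by simp
  then show ?thesis
    unfolding min_cone_def using hS G
    by (intro CollectI exI[of _ "card S"] exI[of _ "\<lambda>_. 1"] exI[of _ "\<lambda>k. G (h k)"] exI[of _ h]) auto
qed

definition coeff_mat :: "('v \<Rightarrow> real) \<Rightarrow> 'v vmat \<Rightarrow> nat \<Rightarrow> nat \<Rightarrow> complex" where
  "coeff_mat f X = (\<lambda>i j. Complex (f (fst (X i j))) (f (snd (X i j))))"

lemma herm_coeff_mat:
  assumes f: "linear f" and X: "X \<in> Her s"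
  shows "herm s (coeff_mat f X)"
  unfolding herm_def
proof (intro allI impI)
  fix i j assume "i < s" "j < s"
  then have e: "X j i = (fst (X i j), - snd (X i j))" using X unfolding Her_def by blast
  show "coeff_mat f X j i = cnj (coeff_mat f X i j)"
    unfolding coeff_mat_def e by (simp add: linear_neg[OF f] complex_eq_iff)
qed

lemma rank_one_form:
  "(\<Sum>p\<in>D. \<Sum>q\<in>D. cnj (x p) * complex_of_real (\<rho> p * \<rho> q) * x q) =
     complex_of_real ((cmod (\<Sum>p\<in>D. of_real (\<rho> p) * x p))\<^sup>2)"
proof -
  have "(\<Sum>p\<in>D. \<Sum>q\<in>D. cnj (x p) * complex_of_real (\<rho> p * \<rho> q) * x q) =
      cnj (\<Sum>p\<in>D. of_real (\<rho> p) * x p) * (\<Sum>p\<in>D. of_real (\<rho> p) * x p)"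
    unfolding cnj_sum sum_product by (intro sum.cong refl) (simp add: algebra_simps)
  then show ?thesis by (simp only: mult.commute[of "cnj _"] complex_norm_square)
qed

text \<open>Contracting the inner index with \<open>\<rho>\<close> turns the form of
  \<open>A\<close> tensor \<open>\<rho> \<rho>^T\<close> into the form of \<open>A\<close>.\<close>

lemma rank_one_kronecker_form:
  "(\<Sum>x\<in>{..<s} \<times> D. \<Sum>y\<in>{..<s} \<times> D.
      cnj (z x) * (A (fst x) (fst y) * complex_of_real (\<rho> (snd x) * \<rho> (snd y))) * z y) =
     dp s (\<lambda>i. \<Sum>p\<in>D. of_real (\<rho> p) * z (i, p)) (mv s A (\<lambda>i. \<Sum>p\<in>D. of_real (\<rho> p) * z (i, p)))"
proof -
  define \<xi> where "\<xi> = (\<lambda>i. \<Sum>p\<in>D. complex_of_real (\<rho> p) * z (i, p))"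
  have cp: "(\<Sum>x\<in>{..<s} \<times> D. f x) = (\<Sum>i<s. \<Sum>p\<in>D. f (i, p))" for f :: "nat \<times> 'a \<Rightarrow> complex"
    by (simp add: sum.cartesian_product split_def)
  have "(\<Sum>x\<in>{..<s} \<times> D. \<Sum>y\<in>{..<s} \<times> D.
      cnj (z x) * (A (fst x) (fst y) * complex_of_real (\<rho> (snd x) * \<rho> (snd y))) * z y) =
    (\<Sum>i<s. \<Sum>p\<in>D. \<Sum>j<s. \<Sum>q\<in>D. cnj (z (i, p)) * (A i j * complex_of_real (\<rho> p * \<rho> q)) * z (j, q))"
    unfolding cp prod.sel ..
  also have "\<dots> = (\<Sum>i<s. \<Sum>j<s. \<Sum>p\<in>D. \<Sum>q\<in>D. cnj (z (i, p)) * (A i j * complex_of_real (\<rho> p * \<rho> q)) * z (j, q))"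
    by (intro sum.cong refl sum.swap)
  also have "\<dots> = (\<Sum>i<s. \<Sum>j<s. cnj (\<xi> i) * A i j * \<xi> j)"
  proof (intro sum.cong refl)
    fix i j
    have "cnj (\<xi> i) * A i j * \<xi> j = A i j * (cnj (\<xi> i) * \<xi> j)" by simp
    also have "\<dots> = A i j * (\<Sum>p\<in>D. \<Sum>q\<in>D. of_real (\<rho> p) * cnj (z (i, p)) * (of_real (\<rho> q) * z (j, q)))"
      by (simp add: \<xi>_def sum_product)
    also have "\<dots> = (\<Sum>p\<in>D. \<Sum>q\<in>D. cnj (z (i, p)) * (A i j * complex_of_real (\<rho> p * \<rho> q)) * z (j, q))"
      by (simp add: sum_distrib_left algebra_simps)
    finally show "(\<Sum>p\<in>D. \<Sum>q\<in>D. cnj (z (i, p)) * (A i j * complex_of_real (\<rho> p * \<rho> q)) * z (j, q)) =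
      cnj (\<xi> i) * A i j * \<xi> j" by simp
  qed
  also have "\<dots> = dp s \<xi> (mv s A \<xi>)" by (simp add: dp_def mv_def sum_distrib_left mult.assoc)
  finally show ?thesis by (simp add: \<xi>_def)
qed

text \<open>Three rank-one matrices with linear coefficients: one shape that covers both the maps
  for the angles and the coordinates along \<open>Z\<close>.\<close>

definition squares :: "(nat \<Rightarrow> nat \<Rightarrow> real) \<Rightarrow> (nat \<Rightarrow> 'v \<Rightarrow> real) \<Rightarrow> 'v \<Rightarrow> nat \<Rightarrow> nat \<Rightarrow> complex" where
  "squares \<rho> a = (\<lambda>v p q. complex_of_real (\<Sum>l<3. a l v * (\<rho> l p * \<rho> l q)))"

lemma linear_squares:
  fixes a :: "nat \<Rightarrow> 'v::real_vector \<Rightarrow> real"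
  assumes "\<And>l. l < 3 \<Longrightarrow> linear (a l)"
  shows "linear (\<lambda>v. squares \<rho> a v p q)"
proof (rule linearI)
  show "squares \<rho> a (v + w) p q = squares \<rho> a v p q + squares \<rho> a w p q" for v w
    unfolding squares_def of_real_add[symmetric] sum.distrib[symmetric]
    by (intro arg_cong[where f = complex_of_real] sum.cong refl) (simp add: linear_add[OF assms] algebra_simps)
  show "squares \<rho> a (r *\<^sub>R v) p q = r *\<^sub>R squares \<rho> a v p q" for v r
    unfolding squares_def scaleR_conv_of_real of_real_mult[symmetric] sum_distrib_left
    by (intro arg_cong[where f = complex_of_real] sum.cong refl) (simp add: linear_scale[OF assms])
qed

lemma psd_on_squares:
  assumes "\<And>x. 0 \<le> (\<Sum>l<3. a l v * (cmod (\<Sum>p<d. of_real (\<rho> l p) * x p))\<^sup>2)"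
  shows "psd_on {..<d} (squares \<rho> a v)"
  unfolding psd_on_def
proof (intro conjI ballI allI)
  show "squares \<rho> a v j i = cnj (squares \<rho> a v i j)" for i j by (simp add: squares_def mult.commute)
  fix x :: "nat \<Rightarrow> complex"
  have "(\<Sum>i<d. \<Sum>j<d. cnj (x i) * squares \<rho> a v i j * x j) =
      (\<Sum>i<d. \<Sum>j<d. \<Sum>l<3. of_real (a l v) * (cnj (x i) * of_real (\<rho> l i * \<rho> l j) * x j))"
    by (intro sum.cong refl) (simp add: squares_def sum_distrib_left sum_distrib_right algebra_simps)
  also have "\<dots> = (\<Sum>i<d. \<Sum>l<3. \<Sum>j<d. of_real (a l v) * (cnj (x i) * of_real (\<rho> l i * \<rho> l j) * x j))"
    by (intro sum.cong refl sum.swap)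
  also have "\<dots> = (\<Sum>l<3. \<Sum>i<d. \<Sum>j<d. of_real (a l v) * (cnj (x i) * of_real (\<rho> l i * \<rho> l j) * x j))"
    by (rule sum.swap)
  also have "\<dots> = (\<Sum>l<3. of_real (a l v) * (\<Sum>i<d. \<Sum>j<d. cnj (x i) * of_real (\<rho> l i * \<rho> l j) * x j))"
    by (simp only: sum_distrib_left)
  also have "\<dots> = of_real (\<Sum>l<3. a l v * (cmod (\<Sum>p<d. of_real (\<rho> l p) * x p))\<^sup>2)"
    by (simp only: rank_one_form) (simp only: of_real_sum of_real_mult)
  finally show "0 \<le> Re (\<Sum>i<d. \<Sum>j<d. cnj (x i) * squares \<rho> a v i j * x j)"
    using assms[of x] by simp
qed

text \<open>Testing the amplified matrix on \<open>z\<close> contracts the inner index of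
  \<open>z\<close> with each row, by \<open>rank_one_kronecker_form\<close>. What remains is an
  inequality between forms of the coefficient matrices.\<close>

lemma amp_squares_form:
  assumes "psd_on ({..<s} \<times> {..<d}) (amp (squares \<rho> a) X)"
  shows "0 \<le> (\<Sum>l<3. qf s (coeff_mat (a l) X) (\<lambda>i. \<Sum>p<d. of_real (\<rho> l p) * z (i, p)))"
proof -
  let ?I = "{..<s} \<times> {..<d}"
  have e: "amp (squares \<rho> a) X x y =
      (\<Sum>l<3. coeff_mat (a l) X (fst x) (fst y) * complex_of_real (\<rho> l (snd x) * \<rho> l (snd y)))" for x y
    by (simp add: amp_def squares_def coeff_mat_def split_def Complex_eq sum_distrib_left
        algebra_simps flip: sum.distrib)
  have "(\<Sum>x\<in>?I. \<Sum>y\<in>?I. cnj (z x) * amp (squares \<rho> a) X x y * z y) =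
      (\<Sum>x\<in>?I. \<Sum>y\<in>?I. \<Sum>l<3. cnj (z x) *
        (coeff_mat (a l) X (fst x) (fst y) * complex_of_real (\<rho> l (snd x) * \<rho> l (snd y))) * z y)"
    unfolding e by (simp only: sum_distrib_left sum_distrib_right)
  also have "\<dots> = (\<Sum>x\<in>?I. \<Sum>l<3. \<Sum>y\<in>?I. cnj (z x) *
        (coeff_mat (a l) X (fst x) (fst y) * complex_of_real (\<rho> l (snd x) * \<rho> l (snd y))) * z y)"
    by (intro sum.cong refl sum.swap)
  also have "\<dots> = (\<Sum>l<3. \<Sum>x\<in>?I. \<Sum>y\<in>?I. cnj (z x) *
        (coeff_mat (a l) X (fst x) (fst y) * complex_of_real (\<rho> l (snd x) * \<rho> l (snd y))) * z y)"
    by (rule sum.swap)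
  also have "\<dots> = (\<Sum>l<3. dp s (\<lambda>i. \<Sum>p<d. of_real (\<rho> l p) * z (i, p))
      (mv s (coeff_mat (a l) X) (\<lambda>i. \<Sum>p<d. of_real (\<rho> l p) * z (i, p))))"
    by (simp only: rank_one_kronecker_form)
  finally show ?thesis using psd_on_form[OF assms, of z] by (simp add: qf_def)
qed

text \<open>The columns \<open>(r, 0)\<close> and \<open>(s, t)\<close> of a triangular matrix are
  made orthonormal for the form with coefficients \<open>m11\<close>, \<open>m12\<close>,
  \<open>m22\<close>, as in Gram-Schmidt; \<open>c\<close> witnesses that the form is
  definite.\<close>

lemma positive_form_factors:
  fixes m11 m12 m22 c :: real
  assumes c: "0 < c" and pos: "\<And>x y. x\<^sup>2 + y\<^sup>2 \<le> c * (m11 * x\<^sup>2 + 2 * m12 * x * y + m22 * y\<^sup>2)"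
  shows "\<exists>r s t. r \<noteq> 0 \<and> t \<noteq> 0 \<and> r * r * m11 = 1 \<and> m11 * s + m12 * t = 0 \<and>
    m11 * s * s + 2 * m12 * s * t + m22 * t * t = 1"
proof -
  have "1 \<le> c * m11" using pos[of 1 0] by simp
  then have m11: "0 < m11" using c by (metis less_le_trans zero_less_mult_pos zero_less_one)
  define \<delta> where "\<delta> = m11 * m22 - m12\<^sup>2"
  have "0 < m11\<^sup>2" using m11 by simp
  also have "\<dots> \<le> m12\<^sup>2 + m11\<^sup>2" by simp
  \<comment> \<open>At the vector \<open>(- m12, m11)\<close> the form has the value
    \<open>m11 * \<delta>\<close>.\<close>
  also have "\<dots> \<le> c * (m11 * \<delta>)"
    using pos[of "- m12" m11] unfolding \<delta>_def power2_eq_square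
    by (simp add: algebra_simps)
  finally have d: "0 < \<delta>" using c m11 by (simp add: zero_less_mult_iff)
  define t where "t = sqrt (m11 / \<delta>)"
  have t: "t \<noteq> 0" "t * t = m11 / \<delta>" using m11 d by (auto simp: t_def)
  define s where "s = - (m12 * t / m11)"
  have "m11 * s * s + 2 * m12 * s * t + m22 * t * t = (t * t) * (\<delta> / m11)"
    using m11 unfolding s_def \<delta>_def by (simp add: field_simps power2_eq_square)
  also have "\<dots> = 1" using t(2) m11 d by simp
  finally have "m11 * s * s + 2 * m12 * s * t + m22 * t * t = 1" .
  moreover have "m11 * s + m12 * t = 0" using m11 by (simp add: s_def)
  moreover have "(1 / sqrt m11) * (1 / sqrt m11) * m11 = 1" using m11 by simp
  moreover have "1 / sqrt m11 \<noteq> 0" using m11 by simp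
  ultimately show ?thesis using t(1) by blast
qed

lemma rotated_form_continuous:
  "continuous_on UNIV (\<lambda>\<theta>. qf s E (\<lambda>i. of_real (cos \<theta>) * x i + of_real (sin \<theta>) * y i))"
  unfolding qf_def dp_def mv_def by (intro continuous_intros)

lemma qf_zero: "qf s A (\<lambda>i. 0) = 0"
  by (simp add: qf_def dp_def)

text \<open>In coordinates along \<open>v1\<close>, \<open>v2\<close>, \<open>w1\<close> and
  \<open>Z\<close>, an element of level \<open>s\<close> is a triple of Hermitian matrices together
  with one matrix per \<open>z\<close>. It lies in the minimal cone as soon as a positive
  coefficient \<open>G\<close> at \<open>w2 = v1 + v2 - w1\<close> can be split off suitably. This
  is \<open>psd_interpolation\<close>, whose hypothesis is what the maps for all angles
  detect.\<close>

theorem two_subhomogeneous: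
  fixes C :: "'v::euclidean_space set"
  assumes card: "(UNIV :: real set) \<lesssim> (UNIV :: 'b set)"
    and pr: "presentation C {v1, v2} {w1, w2} Z" and ne: "v1 \<noteq> v2" "w1 \<noteq> w2" and u: "u \<in> interior C"
  shows "d_subhomogeneous TYPE('b) 2 (min_cone C) u"
proof -
  note D = presentationD[OF pr]
  have neq: "v1 \<noteq> w1" "v1 \<noteq> w2" "v2 \<noteq> w1" "v2 \<noteq> w2" "v1 \<notin> Z" "v2 \<notin> Z" "w1 \<notin> Z" "w2 \<notin> Z"
    using D(4,5,6) by auto
  note neq = neq ne neq(1-4)[symmetric] ne[symmetric]
  define S where "S = insert v1 (insert v2 (insert w1 (insert w2 Z)))"
  have Seq: "{v1, v2} \<union> {w1, w2} \<union> Z = S" by (auto simp: S_def)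
  have finS: "finite S" using D(3) by (simp add: S_def)
  have C: "C = convex_cone hull S" using D(7) unfolding Seq .
  have spanS: "span S = UNIV" using D(12) unfolding Seq .
  have cc: "convex_cone C" unfolding C by (rule convex_cone_convex_cone_hull)
  have SC: "S \<subseteq> C" unfolding C by (rule hull_subset)
  have w2: "w2 = v1 + v2 - w1"
  proof -
    have "v1 + v2 = w1 + w2" using D(8) ne by simp
    then show ?thesis by (simp add: algebra_simps)
  qed
  have ext: "\<exists>f. linear f \<and> (\<forall>x\<in>S. f x = (g x :: real))" if "g v1 + g v2 = g w1 + g w2" for g
    using presentation_linear_extend[OF pr, of g] that ne unfolding Seq by simp
  \<comment> \<open>Coordinates after eliminating \<open>w2 = v1 + v2 - w1\<close>, which accounts
    for the values 1, 1 and -1 of \<open>a\<close>, \<open>b\<close> and \<open>e\<close> at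
    \<open>w2\<close>.\<close>
  obtain a where a: "linear a" "\<forall>x\<in>S. a x = (if x = v1 \<or> x = w2 then 1 else 0::real)"
    using ext[of "\<lambda>x. if x = v1 \<or> x = w2 then 1 else 0"] neq by auto
  obtain b where b: "linear b" "\<forall>x\<in>S. b x = (if x = v2 \<or> x = w2 then 1 else 0::real)"
    using ext[of "\<lambda>x. if x = v2 \<or> x = w2 then 1 else 0"] neq by auto
  obtain e where e: "linear e" "\<forall>x\<in>S. e x = (if x = w1 then 1 else if x = w2 then - 1 else 0::real)"
    using ext[of "\<lambda>x. if x = w1 then 1 else if x = w2 then - 1 else 0"] neq by auto
  have "\<forall>z. \<exists>f. z \<in> Z \<longrightarrow> linear f \<and> (\<forall>x\<in>S. f x = (if x = z then 1 else 0::real))"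
  proof
    fix z
    show "\<exists>f. z \<in> Z \<longrightarrow> linear f \<and> (\<forall>x\<in>S. f x = (if x = z then 1 else 0::real))"
    proof (cases "z \<in> Z")
      case True
      then have "v1 \<noteq> z" "v2 \<noteq> z" "w1 \<noteq> z" "w2 \<noteq> z" using neq by auto
      then show ?thesis using ext[of "\<lambda>x. if x = z then 1 else 0"] by simp
    qed simp
  qed
  from choice[OF this] obtain cf where
    cf: "\<forall>z. z \<in> Z \<longrightarrow> linear (cf z) \<and> (\<forall>x\<in>S. cf z x = (if x = z then 1 else 0::real))" by blast
  note cf = cf[rule_format]
  have vals: "a v1 = 1" "a v2 = 0" "a w1 = 0" "a w2 = 1" "b v1 = 0" "b v2 = 1" "b w1 = 0" "b w2 = 1"
    "e v1 = 0" "e v2 = 0" "e w1 = 1" "e w2 = - 1"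
    using a(2) b(2) e(2) neq by (auto simp: S_def)
  have valsZ: "a z = 0" "b z = 0" "e z = 0" if "z \<in> Z" for z
    using a(2) b(2) e(2) neq that by (auto simp: S_def)
  have rep: "v = a v *\<^sub>R v1 + b v *\<^sub>R v2 + e v *\<^sub>R w1 + (\<Sum>z\<in>Z. cf z v *\<^sub>R z)" (is "_ = ?r v") for v
  proof -
    have cfl: "linear (cf z)" if "z \<in> Z" for z using cf[OF that] by blast
    have lin: "linear ?r"
    proof (rule linearI)
      fix x y :: 'v and c :: real
      have "(\<Sum>z\<in>Z. cf z (x + y) *\<^sub>R z) = (\<Sum>z\<in>Z. cf z x *\<^sub>R z + cf z y *\<^sub>R z)"
        by (intro sum.cong refl) (simp add: linear_add[OF cfl] scaleR_add_left)
      then show "?r (x + y) = ?r x + ?r y"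
        by (simp add: linear_add a(1) b(1) e(1) scaleR_add_left sum.distrib)
      have "(\<Sum>z\<in>Z. cf z (c *\<^sub>R x) *\<^sub>R z) = (\<Sum>z\<in>Z. c *\<^sub>R cf z x *\<^sub>R z)"
        by (intro sum.cong refl) (simp add: linear_scale[OF cfl])
      then show "?r (c *\<^sub>R x) = c *\<^sub>R ?r x"
        by (simp add: linear_scale a(1) b(1) e(1) scaleR_add_right scaleR_sum_right)
    qed
    have "id x = ?r x" if x: "x \<in> S" for x
    proof (cases "x \<in> Z")
      case True
      have "(\<Sum>z\<in>Z. cf z x *\<^sub>R z) = (\<Sum>z\<in>Z. if z = x then x else 0)"
        using cf x by (intro sum.cong) auto
      then show ?thesis using True D(3) valsZ by simp
    next
      case False
      have "(\<Sum>z\<in>Z. cf z x *\<^sub>R z) = (\<Sum>z\<in>Z. 0)"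
        using cf x False by (intro sum.cong) auto
      moreover have "x = v1 \<or> x = v2 \<or> x = w1 \<or> x = w2" using x False by (auto simp: S_def)
      ultimately show ?thesis using vals w2 by auto
    qed
    then have "id v = ?r v"
      using linear_eq_on_span[OF linear_id lin, of S v] spanS by simp
    then show ?thesis by simp
  qed
  \<comment> \<open>The form, at the vector \<open>(\<xi>, \<eta>)\<close>, of the image of
    \<open>v\<close> when \<open>v1\<close> and \<open>v2\<close> go to the diagonal units and
    \<open>w1\<close> to the projection at angle \<open>\<theta>\<close>.\<close>
  define F where "F \<theta> v \<xi> \<eta> = a v * (cmod \<xi>)\<^sup>2 + b v * (cmod \<eta>)\<^sup>2 +
      e v * (cmod (of_real (cos \<theta>) * \<xi> + of_real (sin \<theta>) * \<eta>))\<^sup>2" for \<theta> v \<xi> \<eta>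
  have Fpos: "0 \<le> F \<theta> v \<xi> \<eta>" if v: "v \<in> C" for \<theta> v \<xi> \<eta>
  proof -
    \<comment> \<open>At \<open>w2\<close> the form is the squared component orthogonal to the
      direction that belongs to \<open>w1\<close>.\<close>
    have "(cmod \<xi>)\<^sup>2 + (cmod \<eta>)\<^sup>2 - (cmod (of_real (cos \<theta>) * \<xi> + of_real (sin \<theta>) * \<eta>))\<^sup>2 =
        (cmod (of_real (sin \<theta>) * \<xi> - of_real (cos \<theta>) * \<eta>))\<^sup>2"
    proof -
      have c: "(cos \<theta>)\<^sup>2 = 1 - (sin \<theta>)\<^sup>2" by (simp add: cos_squared_eq)
      show ?thesis
        unfolding cmod_power2
        by (simp add: power2_sum power2_diff power_mult_distrib c algebra_simps)
    qed
    then have w2F: "0 \<le> F \<theta> w2 \<xi> \<eta>"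
      using zero_le_power2[of "cmod (of_real (sin \<theta>) * \<xi> - of_real (cos \<theta>) * \<eta>)"] unfolding F_def vals
      by linarith
    have "C \<subseteq> {v. 0 \<le> F \<theta> v \<xi> \<eta>}"
      unfolding C
    proof (rule hull_minimal)
      show "S \<subseteq> {v. 0 \<le> F \<theta> v \<xi> \<eta>}"
        using w2F unfolding S_def by (auto simp: F_def vals valsZ)
      show "convex_cone {v. 0 \<le> F \<theta> v \<xi> \<eta>}"
        unfolding convex_cone_iff
      proof (intro conjI ballI allI impI)
        show "0 \<in> {v. 0 \<le> F \<theta> v \<xi> \<eta>}" by (simp add: F_def linear_0 a(1) b(1) e(1))
        fix x y :: 'v and c :: real
        have "F \<theta> (x + y) \<xi> \<eta> = F \<theta> x \<xi> \<eta> + F \<theta> y \<xi> \<eta>" "F \<theta> (c *\<^sub>R x) \<xi> \<eta> = c * F \<theta> x \<xi> \<eta>"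
          unfolding F_def by (simp_all add: linear_add linear_scale a(1) b(1) e(1) algebra_simps)
        moreover assume "x \<in> {v. 0 \<le> F \<theta> v \<xi> \<eta>}"
        ultimately show "y \<in> {v. 0 \<le> F \<theta> v \<xi> \<eta>} \<Longrightarrow> x + y \<in> {v. 0 \<le> F \<theta> v \<xi> \<eta>}"
          "0 \<le> c \<Longrightarrow> c *\<^sub>R x \<in> {v. 0 \<le> F \<theta> v \<xi> \<eta>}" by simp_all
      qed
    qed
    then show ?thesis using v by blast
  qed
  have cfpos: "0 \<le> cf z v" if v: "v \<in> C" and z: "z \<in> Z" for z v
  proof -
    note lin = cf[OF z, THEN conjunct1] and val = cf[OF z, THEN conjunct2]
    have "C \<subseteq> {v. 0 \<le> cf z v}"
      unfolding C
    proof (rule hull_minimal)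
      show "S \<subseteq> {v. 0 \<le> cf z v}" using val by auto
      show "convex_cone {v. 0 \<le> cf z v}"
        unfolding convex_cone_iff by (simp add: linear_0[OF lin] linear_add[OF lin] linear_scale[OF lin])
    qed
    then show ?thesis using v by blast
  qed
  have cfu: "0 < cf z u" if z: "z \<in> Z" for z
  proof -
    note lin = cf[OF z, THEN conjunct1] and val = cf[OF z, THEN conjunct2]
    obtain c where c: "c > 0" "c *\<^sub>R u - z \<in> C" using interior_absorbs[OF cc u, of z] by blast
    have "cf z z = 1" using val z by (simp add: S_def)
    then have "1 \<le> c * cf z u"
      using cfpos[OF c(2) z] by (simp add: linear_diff[OF lin] linear_scale[OF lin])
    then show ?thesis using c(1) by (metis less_le_trans zero_less_mult_pos zero_less_one)
  qed
  \<comment> \<open>\<open>v1 + v2\<close> is sent to the identity, so this makes the form at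
    \<open>u\<close> at least \<open>1 / c0\<close> times the identity, for every angle.\<close>
  obtain c0 where c0: "c0 > 0" "c0 *\<^sub>R u - (v1 + v2) \<in> C"
    using interior_absorbs[OF cc u, of "v1 + v2"] by blast
  define m11 where "m11 \<theta> = a u + e u * (cos \<theta>)\<^sup>2" for \<theta>
  define m12 where "m12 \<theta> = e u * cos \<theta> * sin \<theta>" for \<theta>
  define m22 where "m22 \<theta> = b u + e u * (sin \<theta>)\<^sup>2" for \<theta>
  have "\<forall>\<theta>. \<exists>R. case R of (r, s, t) \<Rightarrow> r \<noteq> 0 \<and> t \<noteq> 0 \<and> r * r * m11 \<theta> = 1 \<and> m11 \<theta> * s + m12 \<theta> * t = 0 \<and>
      m11 \<theta> * s * s + 2 * m12 \<theta> * s * t + m22 \<theta> * t * t = 1"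
  proof
    fix \<theta>
    have "x\<^sup>2 + y\<^sup>2 \<le> c0 * (m11 \<theta> * x\<^sup>2 + 2 * m12 \<theta> * x * y + m22 \<theta> * y\<^sup>2)" for x y
    proof -
      have F: "F \<theta> u (of_real x) (of_real y) = m11 \<theta> * x\<^sup>2 + 2 * m12 \<theta> * x * y + m22 \<theta> * y\<^sup>2"
      proof -
        have "cmod (of_real (cos \<theta>) * of_real x + of_real (sin \<theta>) * of_real y) = \<bar>cos \<theta> * x + sin \<theta> * y\<bar>"
          unfolding of_real_mult[symmetric] of_real_add[symmetric] norm_of_real ..
        then show ?thesis
          unfolding F_def m11_def m12_def m22_def
          by (simp add: power2_eq_square algebra_simps)
      qed
      have "0 \<le> F \<theta> (c0 *\<^sub>R u - (v1 + v2)) (of_real x) (of_real y)" by (rule Fpos[OF c0(2)])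
      also have "\<dots> = c0 * F \<theta> u (of_real x) (of_real y) - (x\<^sup>2 + y\<^sup>2)"
        unfolding F_def
        by (simp add: linear_diff linear_add linear_scale a(1) b(1) e(1) vals algebra_simps)
      finally show ?thesis unfolding F by simp
    qed
    from positive_form_factors[OF c0(1) this] obtain r s t where
      "r \<noteq> 0 \<and> t \<noteq> 0 \<and> r * r * m11 \<theta> = 1 \<and> m11 \<theta> * s + m12 \<theta> * t = 0 \<and>
      m11 \<theta> * s * s + 2 * m12 \<theta> * s * t + m22 \<theta> * t * t = 1" by blast
    then show "\<exists>R. case R of (r, s, t) \<Rightarrow> r \<noteq> 0 \<and> t \<noteq> 0 \<and> r * r * m11 \<theta> = 1 \<and> m11 \<theta> * s + m12 \<theta> * t = 0 \<and>
      m11 \<theta> * s * s + 2 * m12 \<theta> * s * t + m22 \<theta> * t * t = 1"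
      by (intro exI[of _ "(r, s, t)"]) simp
  qed
  from choice[OF this] obtain R where R: "\<forall>\<theta>. case R \<theta> of (r, s, t) \<Rightarrow> r \<noteq> 0 \<and> t \<noteq> 0 \<and> r * r * m11 \<theta> = 1 \<and>
      m11 \<theta> * s + m12 \<theta> * t = 0 \<and> m11 \<theta> * s * s + 2 * m12 \<theta> * s * t + m22 \<theta> * t * t = 1" by blast
  define r where "r \<theta> = fst (R \<theta>)" for \<theta>
  define s' where "s' \<theta> = fst (snd (R \<theta>))" for \<theta>
  define t where "t \<theta> = snd (snd (R \<theta>))" for \<theta>
  have rst: "r \<theta> \<noteq> 0" "t \<theta> \<noteq> 0" "r \<theta> * r \<theta> * m11 \<theta> = 1" "m11 \<theta> * s' \<theta> + m12 \<theta> * t \<theta> = 0"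
      "m11 \<theta> * s' \<theta> * s' \<theta> + 2 * m12 \<theta> * s' \<theta> * t \<theta> + m22 \<theta> * t \<theta> * t \<theta> = 1" for \<theta>
    using R[rule_format, of \<theta>] by (simp_all add: r_def s'_def t_def split_def)
  \<comment> \<open>The rank-one factors after the congruence by the triangular matrix with columns
    \<open>(r, 0)\<close> and \<open>(s', t)\<close>, which makes the value at \<open>u\<close> the
    identity. Row 2 is the combination of rows 0 and 1 at the angle.\<close>
  define row where "row \<theta> l p =
      (if l = 0 then (if p = 0 then r \<theta> else s' \<theta>) else if l = 1 then (if p = 0 then 0 else t \<theta>)
       else if p = 0 then cos \<theta> * r \<theta> else cos \<theta> * s' \<theta> + sin \<theta> * t \<theta>)" for \<theta> and l p :: nat
  define abe where "abe l = (if l = 0 then a else if l = 1 then b else e)" for l :: nat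
  define unitrow where "unitrow l p = (if l = p then 1 else 0 :: real)" for l p :: nat
  \<comment> \<open>The coordinate along \<open>z\<close>, normalised at \<open>u\<close>, is to
    multiply the \<open>2 x 2\<close> identity; the third summand is zero.\<close>
  define cfz where "cfz z l v = (if l < 2 then cf z v / cf z u else 0)" for z v and l :: nat
  define \<phi> where "\<phi> k = (case k of Inl q \<Rightarrow> squares (row (of_rat q)) abe | Inr z \<Rightarrow> squares unitrow (cfz z))"
    for k :: "rat + 'v"
  define K where "K = (range Inl \<union> Inr ` Z :: (rat + 'v) set)"
  have three: "(\<Sum>l<3. f l) = f 0 + f 1 + f 2" for f :: "nat \<Rightarrow> 'z::comm_monoid_add"
    by (simp add: eval_nat_numeral)
  have two: "(\<Sum>l<2. f l) = f 0 + f 1" for f :: "nat \<Rightarrow> 'z::comm_monoid_add"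
    by (simp add: eval_nat_numeral)
  show ?thesis
  proof (rule d_subhomogeneous_of_family[OF card _ _ cc u])
    show "countable K" "K \<noteq> {}" unfolding K_def using D(3) by (auto intro: countable_finite)
    show "linear (\<lambda>v. \<phi> k v p q)" if k: "k \<in> K" for k p q
    proof (cases k)
      case (Inl x)
      then show ?thesis unfolding \<phi>_def by (auto simp: abe_def intro!: linear_squares a b e)
    next
      case (Inr z)
      then have z: "z \<in> Z" using k by (auto simp: K_def)
      have "linear (cfz z l)" for l
        using linear_compose_scale_right[OF cf[OF z, THEN conjunct1], of "1 / cf z u"]
        by (cases "l < 2") (simp_all add: cfz_def[abs_def] linear_zero)
      then show ?thesis unfolding \<phi>_def Inr by (auto intro!: linear_squares)
    qed
    show "\<phi> k u p q = (if p = q then 1 else 0)" if k: "k \<in> K" and pq: "p < 2" "q < 2" for k p q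
    proof (cases k)
      case (Inl x)
      define \<theta> where "\<theta> = real_of_rat x"
      have cs: "(\<Sum>l<3. abe l u * (row \<theta> l p * row \<theta> l q)) = (if p = q then 1 else 0)"
      proof -
        have "p = 0 \<or> p = 1" "q = 0 \<or> q = 1" using pq by auto
        moreover have "a u * (r \<theta> * r \<theta>) + e u * (cos \<theta> * r \<theta> * (cos \<theta> * r \<theta>)) = 1"
          using rst(3)[of \<theta>] by (simp add: m11_def algebra_simps power2_eq_square)
        moreover have "a u * (r \<theta> * s' \<theta>) + e u * (cos \<theta> * r \<theta> * (cos \<theta> * s' \<theta> + sin \<theta> * t \<theta>)) = 0"
        proof -
          have "a u * (r \<theta> * s' \<theta>) + e u * (cos \<theta> * r \<theta> * (cos \<theta> * s' \<theta> + sin \<theta> * t \<theta>)) =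
            r \<theta> * (m11 \<theta> * s' \<theta> + m12 \<theta> * t \<theta>)"
            by (simp add: m11_def m12_def algebra_simps power2_eq_square)
          then show ?thesis using rst(4) by simp
        qed
        moreover have "a u * (s' \<theta> * s' \<theta>) + b u * (t \<theta> * t \<theta>) +
            e u * ((cos \<theta> * s' \<theta> + sin \<theta> * t \<theta>) * (cos \<theta> * s' \<theta> + sin \<theta> * t \<theta>)) = 1"
          using rst(5)[of \<theta>] by (simp add: m11_def m12_def m22_def algebra_simps power2_eq_square)
        ultimately show ?thesis
          unfolding three by (elim disjE) (simp_all add: abe_def row_def mult.commute)
      qed
      show ?thesis unfolding \<phi>_def Inl sum.case squares_def \<theta>_def[symmetric] cs by simp
    next
      case (Inr z)
      then have z: "z \<in> Z" using k by (auto simp: K_def)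
      have "(\<Sum>l<3. cfz z l u * (unitrow l p * unitrow l q)) = (if p = q then 1 else 0)"
        using pq cfu[OF z] unfolding three by (auto simp: cfz_def unitrow_def)
      then show ?thesis unfolding \<phi>_def Inr sum.case squares_def by simp
    qed
    show "psd_on {..<2} (\<phi> k v)" if k: "k \<in> K" and v: "v \<in> C" for k v
    proof (cases k)
      case (Inl x)
      define \<theta> where "\<theta> = real_of_rat x"
      have "psd_on {..<2} (squares (row \<theta>) abe v)"
      proof (rule psd_on_squares)
        fix x :: "nat \<Rightarrow> complex"
        define \<xi> where "\<xi> = (\<Sum>p<2. of_real (row \<theta> 0 p) * x p)"
        define \<eta> where "\<eta> = (\<Sum>p<2. of_real (row \<theta> 1 p) * x p)"
        have row2: "(\<Sum>p<2. of_real (row \<theta> 2 p) * x p) = of_real (cos \<theta>) * \<xi> + of_real (sin \<theta>) * \<eta>"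
          unfolding two \<xi>_def \<eta>_def by (simp add: row_def algebra_simps)
        have "(\<Sum>l<3. abe l v * (cmod (\<Sum>p<2. of_real (row \<theta> l p) * x p))\<^sup>2) = F \<theta> v \<xi> \<eta>"
          unfolding three row2 \<xi>_def[symmetric] \<eta>_def[symmetric] by (simp add: abe_def F_def)
        then show "0 \<le> (\<Sum>l<3. abe l v * (cmod (\<Sum>p<2. of_real (row \<theta> l p) * x p))\<^sup>2)"
          using Fpos[OF v] by simp
      qed
      then show ?thesis unfolding \<phi>_def Inl sum.case \<theta>_def .
    next
      case (Inr z)
      then have z: "z \<in> Z" using k by (auto simp: K_def)
      have "psd_on {..<2} (squares unitrow (cfz z) v)"
        using cfpos[OF v z] cfu[OF z]
        by (intro psd_on_squares sum_nonneg mult_nonneg_nonneg) (auto simp: cfz_def)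
      then show ?thesis unfolding \<phi>_def Inr sum.case .
    qed
    fix s :: nat and X :: "'v vmat"
    assume X: "X \<in> Her s"
    assume "\<And>k. k \<in> K \<Longrightarrow> psd_on ({..<s} \<times> {..<2}) (amp (\<phi> k) X)"
    then have psdK: "\<forall>k\<in>K. psd_on ({..<s} \<times> {..<2}) (amp (\<phi> k) X)" by blast
    define A B E where "A = coeff_mat a X" and "B = coeff_mat b X" and "E = coeff_mat e X"
    define \<Gamma> where "\<Gamma> z = coeff_mat (cf z) X" for z
    have rat: "0 \<le> qf s A x + qf s B y + qf s E (\<lambda>i. of_real (cos \<theta>) * x i + of_real (sin \<theta>) * y i)"
      if "\<theta> \<in> \<rat>" for \<theta> x y
    proof -
      obtain q where q: "\<theta> = of_rat q" using \<open>\<theta> \<in> \<rat>\<close> unfolding Rats_def by blast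
      have "Inl q \<in> K" by (simp add: K_def)
      then have P: "psd_on ({..<s} \<times> {..<2}) (amp (squares (row \<theta>) abe) X)"
        using psdK unfolding \<phi>_def q by force
      \<comment> \<open>Inverts the triangular matrix, so that contraction with rows 0 and 1 returns
        \<open>x\<close> and \<open>y\<close>.\<close>
      define z where "z = (\<lambda>(i, p::nat). if p = 0 then (x i - of_real (s' \<theta> / t \<theta>) * y i) / of_real (r \<theta>)
        else y i / of_real (t \<theta>) :: complex)"
      have rows: "(\<lambda>i. \<Sum>p<2. of_real (row \<theta> 0 p) * z (i, p)) = x"
        "(\<lambda>i. \<Sum>p<2. of_real (row \<theta> 1 p) * z (i, p)) = y"
        unfolding two using rst(1,2)[of \<theta>] by (auto simp: row_def z_def fun_eq_iff)
      have "(\<Sum>p<2. of_real (row \<theta> 2 p) * z (i, p)) =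
          of_real (cos \<theta>) * (\<Sum>p<2. of_real (row \<theta> 0 p) * z (i, p)) + of_real (sin \<theta>) * (\<Sum>p<2. of_real (row \<theta> 1 p) * z (i, p))" for i
        unfolding two by (simp add: row_def algebra_simps)
      then have row2: "(\<lambda>i. \<Sum>p<2. of_real (row \<theta> 2 p) * z (i, p)) = (\<lambda>i. of_real (cos \<theta>) * x i + of_real (sin \<theta>) * y i)"
        using rows[THEN fun_cong] by simp
      show ?thesis
        using amp_squares_form[OF P, of z] unfolding three rows row2 by (simp add: abe_def A_def B_def E_def)
    qed
    have circle: "0 \<le> qf s A x + qf s B y + qf s E (\<lambda>i. of_real c * x i + of_real d * y i)"
      if "c\<^sup>2 + d\<^sup>2 = 1" for x y c d
    proof -
      obtain \<theta> where \<theta>: "c = cos \<theta>" "d = sin \<theta>" using sincos_total_2pi[OF \<open>c\<^sup>2 + d\<^sup>2 = 1\<close>] by blast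
      show ?thesis
        unfolding \<theta>
      proof (rule continuous_ge_on_closure[where S = \<rat> and x = \<theta>])
        show "continuous_on (closure \<rat>) (\<lambda>\<theta>. qf s A x + qf s B y + qf s E (\<lambda>i. of_real (cos \<theta>) * x i + of_real (sin \<theta>) * y i))"
          unfolding Rats_closure_real by (intro continuous_intros rotated_form_continuous)
      qed (use rat Rats_closure_real in auto)
    qed
    have \<Gamma>psd: "hermitian_psd s (\<Gamma> z)" if z: "z \<in> Z" for z
      unfolding hermitian_psd_iff
    proof (intro conjI allI)
      show "herm s (\<Gamma> z)" unfolding \<Gamma>_def by (rule herm_coeff_mat[OF cf[OF z, THEN conjunct1] X])
      fix x :: "nat \<Rightarrow> complex"
      have "Inr z \<in> K" using z by (simp add: K_def)
      then have P: "psd_on ({..<s} \<times> {..<2}) (amp (squares unitrow (cfz z)) X)"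
        using psdK unfolding \<phi>_def by force
      have rows: "(\<lambda>i. \<Sum>p<2. of_real (unitrow 0 p) * (\<lambda>(i, p::nat). if p = 0 then x i else 0) (i, p)) = x"
        "(\<lambda>i. \<Sum>p<2. of_real (unitrow (Suc 0) p) * (\<lambda>(i, p::nat). if p = 0 then x i else 0) (i, p)) = (\<lambda>i. 0)"
        "(\<lambda>i. \<Sum>p<2. of_real (unitrow 2 p) * (\<lambda>(i, p::nat). if p = 0 then x i else 0) (i, p)) = (\<lambda>i. 0)"
        unfolding two by (auto simp: unitrow_def)
      have "0 \<le> qf s (coeff_mat (cfz z 0) X) x"
        using amp_squares_form[OF P, of "\<lambda>(i, p::nat). if p = 0 then x i else 0"]
        unfolding three One_nat_def rows qf_zero by simp
      also have "qf s (coeff_mat (cfz z 0) X) x = qf s (\<lambda>i j. complex_of_real (1 / cf z u) * \<Gamma> z i j) x"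
        by (intro qf_cong) (simp add: coeff_mat_def cfz_def \<Gamma>_def complex_eq_iff)
      also have "\<dots> = qf s (\<Gamma> z) x / cf z u" unfolding qf_scale by simp
      finally show "0 \<le> qf s (\<Gamma> z) x" using cfu[OF z] by (simp add: zero_le_divide_iff)
    qed
    have hA: "herm s A" "herm s B" "herm s E"
      unfolding A_def B_def E_def by (intro herm_coeff_mat a b e X)+
    obtain G where G: "hermitian_psd s G" "hermitian_psd s (\<lambda>i j. A i j - G i j)"
      "hermitian_psd s (\<lambda>i j. B i j - G i j)" "hermitian_psd s (\<lambda>i j. E i j + G i j)"
      using psd_interpolation[OF hA circle] by blast
    \<comment> \<open>By the relation, putting the coefficient \<open>G\<close> at \<open>w2\<close>
      lowers those of \<open>v1\<close> and \<open>v2\<close> by \<open>G\<close> and raises that of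
      \<open>w1\<close>.\<close>
    define H where "H v = (if v = v1 then (\<lambda>i j. A i j - G i j) else if v = v2 then (\<lambda>i j. B i j - G i j)
      else if v = w1 then (\<lambda>i j. E i j + G i j) else if v = w2 then G else \<Gamma> v)" for v
    have HZ: "H z = \<Gamma> z" if "z \<in> Z" for z using that neq by (auto simp: H_def)
    show "X \<in> min_cone C s"
    proof (rule min_cone_sum[OF finS _ SC, where G = H])
      show "hermitian_psd s (H v)" if "v \<in> S" for v
        using that G \<Gamma>psd HZ unfolding S_def by (auto simp: H_def)
      fix i j
      have co: "(\<Sum>v\<in>S. f v) = f v1 + (f v2 + (f w1 + (f w2 + (\<Sum>z\<in>Z. f z))))" for f :: "'v \<Rightarrow> 'v \<times> 'v"
        using D(3) neq by (simp add: S_def)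
      have Hv: "H v1 = (\<lambda>i j. A i j - G i j)" "H v2 = (\<lambda>i j. B i j - G i j)" "H w1 = (\<lambda>i j. E i j + G i j)" "H w2 = G"
        using neq by (simp_all add: H_def)
      have Z: "(\<Sum>z\<in>Z. tensor (H z) z i j) = (\<Sum>z\<in>Z. tensor (\<Gamma> z) z i j)"
        by (intro sum.cong refl) (simp add: HZ)
      show "X i j = (\<Sum>v\<in>S. tensor (H v) v i j)"
        unfolding co Hv Z
      proof (rule prod_eqI)
        show "fst (X i j) = fst (tensor (\<lambda>i j. A i j - G i j) v1 i j + (tensor (\<lambda>i j. B i j - G i j) v2 i j +
            (tensor (\<lambda>i j. E i j + G i j) w1 i j + (tensor G w2 i j + (\<Sum>z\<in>Z. tensor (\<Gamma> z) z i j)))))"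
          by (subst rep) (simp add: tensor_def fst_sum A_def B_def E_def \<Gamma>_def coeff_mat_def w2 algebra_simps)
        show "snd (X i j) = snd (tensor (\<lambda>i j. A i j - G i j) v1 i j + (tensor (\<lambda>i j. B i j - G i j) v2 i j +
            (tensor (\<lambda>i j. E i j + G i j) w1 i j + (tensor G w2 i j + (\<Sum>z\<in>Z. tensor (\<Gamma> z) z i j)))))"
          by (subst rep) (simp add: tensor_def snd_sum A_def B_def E_def \<Gamma>_def coeff_mat_def w2 algebra_simps)
      qed
    qed
  qed
qed

section \<open>Extreme rays\<close>

definition ray :: "'v::real_vector \<Rightarrow> 'v set" where
  "ray x = {t *\<^sub>R x | t. 0 \<le> t}"

definition pointed :: "'v::real_vector set \<Rightarrow> bool" where
  "pointed C \<longleftrightarrow> C \<inter> uminus ` C = {0}"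

definition irredundant :: "'v::real_vector set \<Rightarrow> bool" where
  "irredundant S \<longleftrightarrow> (\<forall>s\<in>S. s \<notin> convex_cone hull (S - {s}))"

lemma pointedD: "pointed C \<Longrightarrow> x \<in> C \<Longrightarrow> - x \<in> C \<Longrightarrow> x = 0"
  unfolding pointed_def by (metis IntI add.inverse_inverse image_eqI singletonD)

lemma irredundant_nonzero: "irredundant S \<Longrightarrow> s \<in> S \<Longrightarrow> s \<noteq> 0"
  unfolding irredundant_def using convex_cone_hull_contains_0 by metis

lemma scaleR_in_convex_cone_hull_iff:
  "0 < t \<Longrightarrow> t *\<^sub>R x \<in> convex_cone hull S \<longleftrightarrow> x \<in> convex_cone hull S"
  using convex_cone_hull_mul[of x S t] convex_cone_hull_mul[of "t *\<^sub>R x" S "inverse t"] by auto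

lemma aff_dim_ray:
  fixes s :: "'v::euclidean_space"
  assumes "s \<noteq> 0"
  shows "aff_dim (ray s) = 1"
proof -
  have z: "0 \<in> ray s" unfolding ray_def by (intro CollectI exI[of _ 0]) simp
  have s: "s \<in> ray s" unfolding ray_def by (intro CollectI exI[of _ 1]) simp
  have "ray s \<subseteq> span {s}" by (auto simp: ray_def span_singleton)
  then have "dim (ray s) \<le> 1" using dim_subset[of "ray s" "span {s}"] assms by simp
  moreover have "1 \<le> dim (ray s)" using dim_subset[of "{s}" "ray s"] s assms by simp
  ultimately show ?thesis using aff_dim_zero[of "ray s"] z hull_inc by fastforce
qed

lemma pointed_zero_sum:
  assumes C: "convex_cone C" "pointed C" and "finite S" "\<And>s. s \<in> S \<Longrightarrow> f s \<in> C" "sum f S = 0" "s \<in> S"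
  shows "f s = 0"
proof (rule pointedD[OF C(2)])
  show "f s \<in> C" using assms by blast
  have "f s + sum f (S - {s}) = 0" using assms(3,5,6) by (simp add: sum.remove)
  then have "- f s = sum f (S - {s})" by (rule minus_unique)
  then show "- f s \<in> C" using sum_nonneg_in_cone[OF C(1), of "S - {s}" f] assms by simp
qed

text \<open>Let a point \<open>t s\<close> of the ray lie between two cone elements, and let
  \<open>c\<close> be the coefficients of their mixture. If \<open>t > c s\<close>, then
  \<open>s\<close> is a combination of the others, against irredundancy; if \<open>t < c s\<close>,
  then \<open>- s\<close> is in the cone, against pointedness. So \<open>t = c s\<close>, the rest
  sums to zero, and pointedness makes each of its terms vanish.\<close>

lemma ray_face:
  fixes S :: "'v::euclidean_space set"
  assumes S: "finite S" "irredundant S" and P: "pointed (convex_cone hull S)" and s: "s \<in> S"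
  shows "ray s face_of (convex_cone hull S)"
  unfolding face_of_def
proof (intro conjI ballI impI)
  let ?C = "convex_cone hull S"
  have cc: "convex_cone ?C" by (rule convex_cone_convex_cone_hull)
  show "ray s \<subseteq> ?C" using s by (auto simp: ray_def intro!: convex_cone_hull_mul intro: hull_inc)
  show "convex (ray s)"
    unfolding convex_def ray_def
  proof safe
    fix u v a b :: real assume "0 \<le> u" "0 \<le> v" "0 \<le> a" "0 \<le> b"
    then show "\<exists>t. u *\<^sub>R a *\<^sub>R s + v *\<^sub>R b *\<^sub>R s = t *\<^sub>R s \<and> 0 \<le> t"
      by (intro exI[of _ "u * a + v * b"]) (simp add: scaleR_add_left)
  qed
  fix x y z assume xy: "x \<in> ?C" "y \<in> ?C" "z \<in> ray s" "z \<in> open_segment x y"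
  obtain a where a: "\<forall>r\<in>S. 0 \<le> a r" "x = (\<Sum>r\<in>S. a r *\<^sub>R r)"
    using xy(1) unfolding convex_cone_hull_finite[OF S(1)] by blast
  obtain b where b: "\<forall>r\<in>S. 0 \<le> b r" "y = (\<Sum>r\<in>S. b r *\<^sub>R r)"
    using xy(2) unfolding convex_cone_hull_finite[OF S(1)] by blast
  obtain t where t: "0 \<le> t" "z = t *\<^sub>R s" using xy(3) by (auto simp: ray_def)
  obtain u where u: "0 < u" "u < 1" "z = (1 - u) *\<^sub>R x + u *\<^sub>R y" using xy(4) by (auto simp: in_segment)
  define c where "c r = (1 - u) * a r + u * b r" for r
  have c0: "\<forall>r\<in>S. 0 \<le> c r" using a(1) b(1) u by (simp add: c_def)
  have "t *\<^sub>R s = (\<Sum>r\<in>S. c r *\<^sub>R r)"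
    unfolding t(2)[symmetric] u(3) a(2) b(2) c_def
    by (simp add: scaleR_sum_right scaleR_add_left sum.distrib)
  also have "\<dots> = c s *\<^sub>R s + (\<Sum>r\<in>S - {s}. c r *\<^sub>R r)" by (rule sum.remove[OF S(1) s])
  finally have rest: "(t - c s) *\<^sub>R s = (\<Sum>r\<in>S - {s}. c r *\<^sub>R r)" by (simp add: scaleR_diff_left)
  have inR: "(\<Sum>r\<in>S - {s}. c r *\<^sub>R r) \<in> convex_cone hull (S - {s})"
    using c0 S(1) by (intro in_cone_hullI) auto
  have s0: "s \<noteq> 0" by (rule irredundant_nonzero[OF S(2) s])
  have "t = c s"
  proof (rule linorder_cases[of t "c s"])
    assume "t > c s"
    then have "s \<in> convex_cone hull (S - {s})"
      using inR unfolding rest[symmetric] by (simp add: scaleR_in_convex_cone_hull_iff)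
    then show ?thesis using S(2) s by (auto simp: irredundant_def)
  next
    assume lt: "t < c s"
    have "(c s - t) *\<^sub>R (- s) \<in> convex_cone hull (S - {s})"
      using inR unfolding rest[symmetric] by (simp add: algebra_simps)
    then have "- s \<in> convex_cone hull (S - {s})" using lt by (simp only: scaleR_in_convex_cone_hull_iff diff_gt_0_iff_gt)
    then have "- s \<in> ?C" using hull_mono[of "S - {s}" S convex_cone] by blast
    then show ?thesis using pointedD[OF P hull_inc[OF s]] s0 by simp
  qed
  then have z0: "(\<Sum>r\<in>S - {s}. c r *\<^sub>R r) = 0" using rest by simp
  have "c r = 0" if r: "r \<in> S - {s}" for r
  proof -
    have "c r *\<^sub>R r = 0"
      using S(1) c0 by (intro pointed_zero_sum[OF cc P _ _ z0 r]) (auto intro!: convex_cone_hull_mul intro: hull_inc)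
    then show ?thesis using irredundant_nonzero[OF S(2)] r by auto
  qed
  then have ab: "a r = 0 \<and> b r = 0" if "r \<in> S - {s}" for r
    using a(1) b(1) u that unfolding c_def
    by (smt (verit) DiffD1 mult_eq_0_iff mult_nonneg_nonneg)
  have "x = a s *\<^sub>R s" "y = b s *\<^sub>R s"
    using ab unfolding a(2) b(2) by (simp_all add: sum.remove[OF S(1) s])
  then show "x \<in> ray s" "y \<in> ray s" using a(1) b(1) s by (auto simp: ray_def)
qed

text \<open>A nonzero \<open>x\<close> in the face lies strictly between 0 and its larger multiples,
  so the whole ray is in the face. Having dimension 1, the face lies in the line of
  \<open>x\<close>, and pointedness excludes the opposite half.\<close>

lemma face_is_ray:
  fixes C :: "'v::euclidean_space set"
  assumes C: "convex_cone C" "pointed C" and R: "R face_of C" "aff_dim R = 1"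
  shows "\<exists>x. x \<noteq> 0 \<and> x \<in> C \<and> R = ray x"
proof -
  have RC: "R \<subseteq> C" and face: "\<And>a b x. a \<in> C \<Longrightarrow> b \<in> C \<Longrightarrow> x \<in> R \<Longrightarrow> x \<in> open_segment a b \<Longrightarrow> a \<in> R \<and> b \<in> R"
    using R(1) unfolding face_of_def by auto
  have "\<not> R \<subseteq> {0}"
  proof
    assume "R \<subseteq> {0}"
    then have "aff_dim R \<le> aff_dim {0::'v}" by (rule aff_dim_subset)
    then show False using R(2) by simp
  qed
  then obtain x where x: "x \<in> R" "x \<noteq> 0" by blast
  have seg: "x \<in> open_segment 0 (t *\<^sub>R x)" if "t > 1" for t
    unfolding in_segment using that x(2) by (intro conjI exI[of _ "1 / t"]) auto
  have big: "0 \<in> R \<and> t *\<^sub>R x \<in> R" if "t > 1" for t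
  proof (rule face[OF _ _ x(1) seg[OF that]])
    show "0 \<in> C" by (rule convex_cone_contains_0[OF C(1)])
    show "t *\<^sub>R x \<in> C" using x RC that by (intro convex_cone_scaleR[OF C(1)]) auto
  qed
  have conv: "convex R" using R(1) unfolding face_of_def by blast
  have zero: "0 \<in> R" using big[of 2] by simp
  have "ray x \<subseteq> R"
  proof
    fix y assume "y \<in> ray x"
    then obtain t where t: "0 \<le> t" "y = t *\<^sub>R x" by (auto simp: ray_def)
    show "y \<in> R"
    proof (cases "t > 1")
      case False
      then show ?thesis
        using convexD[OF conv zero x(1), of "1 - t" t] t by simp
    qed (use big t in simp)
  qed
  moreover have "R \<subseteq> ray x"
  proof
    fix y assume y: "y \<in> R"
    have aff: "affine hull R = span R" using zero by (intro affine_hull_span_0) (simp add: hull_inc)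
    have "dim R = 1" using R(2) aff_dim_zero[of R] zero by (simp add: hull_inc)
    then have "dim (insert x R) = 1" "dim {x} = 1" using x by (simp_all add: insert_absorb)
    then have "span {x} = span R"
      using x by (intro dim_eq_span) (auto simp: insert_absorb)
    then have "y \<in> span {x}" using span_base[OF y] by simp
    then obtain t where t: "y = t *\<^sub>R x" by (auto simp: span_singleton)
    have "0 \<le> t"
    proof (rule ccontr)
      assume "\<not> 0 \<le> t"
      then have "- x = (1 / - t) *\<^sub>R y" "0 \<le> 1 / - t" using t by auto
      then have "- x \<in> C" using convex_cone_scaleR[OF C(1), of "1 / - t" y] y RC by auto
      then show False using pointedD[OF C(2), of x] x RC by blast
    qed
    then show "y \<in> ray x" using t by (auto simp: ray_def)
  qed
  ultimately show ?thesis using x RC by blast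
qed

text \<open>An extreme ray is spanned by some nonnegative combination \<open>x\<close> of
  generators. A generator \<open>s\<close> that occurs in \<open>x\<close> lies in the ray, because
  \<open>x\<close> is the midpoint of \<open>2 c_s s\<close> and twice the remaining terms.\<close>

lemma extreme_rays_irredundant:
  fixes S :: "'v::euclidean_space set"
  assumes S: "finite S" "irredundant S" and P: "pointed (convex_cone hull S)"
  shows "card (extreme_rays (convex_cone hull S)) = card S"
proof -
  let ?C = "convex_cone hull S"
  have cc: "convex_cone ?C" by (rule convex_cone_convex_cone_hull)
  have "extreme_rays ?C = ray ` S"
  proof
    show "ray ` S \<subseteq> extreme_rays ?C"
      using ray_face[OF S P] aff_dim_ray irredundant_nonzero[OF S(2)] by (auto simp: extreme_rays_def)
    show "extreme_rays ?C \<subseteq> ray ` S"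
    proof
      fix R assume "R \<in> extreme_rays ?C"
      then have R: "R face_of ?C" "aff_dim R = 1" by (auto simp: extreme_rays_def)
      then obtain x where x: "x \<noteq> 0" "x \<in> ?C" "R = ray x" using face_is_ray[OF cc P] by blast
      obtain c where c: "\<forall>r\<in>S. 0 \<le> c r" "x = (\<Sum>r\<in>S. c r *\<^sub>R r)"
        using x(2) unfolding convex_cone_hull_finite[OF S(1)] by blast
      have "\<exists>s\<in>S. c s \<noteq> 0"
      proof (rule ccontr)
        assume "\<not> (\<exists>s\<in>S. c s \<noteq> 0)"
        then have "x = 0" unfolding c(2) by (intro sum.neutral) auto
        then show False using x(1) by simp
      qed
      then obtain s where s: "s \<in> S" "0 < c s" using c(1) by force
      define y where "y = (\<Sum>r\<in>S - {s}. c r *\<^sub>R r)"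
      have xs: "x = c s *\<^sub>R s + y" unfolding c(2) y_def by (rule sum.remove[OF S(1) s(1)])
      have yC: "y \<in> ?C" unfolding y_def
        using c(1) S(1) by (intro sum_nonneg_in_cone[OF cc]) (auto intro!: convex_cone_hull_mul intro: hull_inc)
      have sC: "(2 * c s) *\<^sub>R s \<in> ?C" "2 *\<^sub>R y \<in> ?C"
        using s yC by (auto intro!: convex_cone_hull_mul intro: hull_inc)
      have xR: "x \<in> R" unfolding x(3) ray_def by (intro CollectI exI[of _ 1]) simp
      have "(2 * c s) *\<^sub>R s \<in> R"
      proof (cases "(2 * c s) *\<^sub>R s = 2 *\<^sub>R y")
        \<comment> \<open>Coinciding endpoints have an empty open segment, but then \<open>x\<close>
          itself is the required multiple of \<open>s\<close>.\<close>
        case True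
        then have "2 *\<^sub>R (c s *\<^sub>R s) = 2 *\<^sub>R y" by simp
        then have "c s *\<^sub>R s = y" by (simp only: scaleR_cancel_left) simp
        then have "x = (2 * c s) *\<^sub>R s" using xs by (simp add: scaleR_2 flip: scaleR_scaleR)
        then show ?thesis using xR by simp
      next
        case False
        have "x = (1 - 1 / 2) *\<^sub>R ((2 * c s) *\<^sub>R s) + (1 / 2) *\<^sub>R (2 *\<^sub>R y)" using xs by simp
        then have "x \<in> open_segment ((2 * c s) *\<^sub>R s) (2 *\<^sub>R y)"
          unfolding in_segment using False by (intro conjI exI[of _ "1 / 2"]) auto
        then show ?thesis using R(1) sC xR unfolding face_of_def by blast
      qed
      then obtain t where t: "0 \<le> t" "(2 * c s) *\<^sub>R s = t *\<^sub>R x" unfolding x(3) ray_def by blast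
      have s0: "s \<noteq> 0" by (rule irredundant_nonzero[OF S(2) s(1)])
      have t0: "t > 0" using t s(2) s0 by (cases "t = 0") auto
      have "(1 / (2 * c s)) *\<^sub>R ((2 * c s) *\<^sub>R s) = (1 / (2 * c s)) *\<^sub>R (t *\<^sub>R x)" unfolding t(2) ..
      then have sx: "s = (t / (2 * c s)) *\<^sub>R x" using s(2) by simp
      have "ray s = ray x"
      proof
        show "ray s \<subseteq> ray x" using t0 s(2) by (subst sx) (force simp: ray_def)
        show "ray x \<subseteq> ray s"
        proof
          fix z assume "z \<in> ray x"
          then obtain r where r: "0 \<le> r" "z = r *\<^sub>R x" by (auto simp: ray_def)
          have "x = (2 * c s / t) *\<^sub>R s" using t0 s(2) by (subst sx) simp
          then show "z \<in> ray s" unfolding ray_def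
            using r t0 s(2) by (intro CollectI exI[of _ "r * (2 * c s / t)"]) auto
        qed
      qed
      then show "R \<in> ray ` S" using x(3) s(1) by blast
    qed
  qed
  moreover have "inj_on ray S"
  proof (rule inj_onI, rule ccontr)
    fix s s' assume s: "s \<in> S" "s' \<in> S" "ray s = ray s'" "s \<noteq> s'"
    have "s \<in> ray s" unfolding ray_def by (intro CollectI exI[of _ 1]) simp
    then have "s \<in> ray s'" using s(3) by simp
    then obtain t where t: "0 \<le> t" "s = t *\<^sub>R s'" by (auto simp: ray_def)
    have "s' \<in> convex_cone hull (S - {s})" using s by (intro hull_inc) auto
    then have "s \<in> convex_cone hull (S - {s})" using convex_cone_hull_mul[of s' "S - {s}" t] t by simp
    then show False using S(2) s(1) by (auto simp: irredundant_def)
  qed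
  ultimately show ?thesis by (simp add: card_image)
qed

lemma irredundant_generators:
  fixes C :: "'v::real_vector set"
  assumes "finite S" "C = convex_cone hull S"
  shows "\<exists>T. finite T \<and> C = convex_cone hull T \<and> irredundant T"
proof -
  let ?P = "\<lambda>T. finite T \<and> C = convex_cone hull T"
  define T where "T = arg_min card ?P"
  have T: "?P T" and least: "\<And>T'. ?P T' \<Longrightarrow> card T \<le> card T'"
    using arg_min_nat_lemma[of ?P S card] assms unfolding T_def by blast+
  have "s \<notin> convex_cone hull (T - {s})" if s: "s \<in> T" for s
  proof
    assume "s \<in> convex_cone hull (T - {s})"
    then have "T \<subseteq> convex_cone hull (T - {s})" using hull_inc[of _ "T - {s}" convex_cone] by blast
    then have "convex_cone hull T \<subseteq> convex_cone hull (T - {s})"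
      by (rule hull_minimal) (rule convex_cone_convex_cone_hull)
    then have "?P (T - {s})" using T hull_mono[of "T - {s}" T convex_cone] by blast
    then show False using least[of "T - {s}"] T s by (metis card_Diff1_less leD)
  qed
  then show ?thesis using T by (auto simp: irredundant_def)
qed

section \<open>From extreme rays to a presentation and back\<close>

lemma independent_of_card:
  fixes S :: "'v::euclidean_space set"
  assumes "finite S" "span S = UNIV" "card S = DIM('v)"
  shows "independent S"
proof -
  obtain B where B: "B \<subseteq> S" "independent B" "S \<subseteq> span B" "card B = dim S" using basis_exists by blast
  have "dim S = DIM('v)" using assms(2) by (metis dim_UNIV dim_span)
  then show ?thesis using B assms card_subset_eq by metis
qed

text \<open>The relation expresses each \<open>w\<close> in \<open>P\<close> or \<open>Q\<close>
  through the other generators, so these still span; being \<open>DIM('v)\<close> many, they are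
  independent. A count thus replaces the independence condition.\<close>

lemma presentationI:
  fixes C :: "'v::euclidean_space set"
  assumes "finite P" "finite Q" "finite Z" "P \<inter> Q = {}" "P \<inter> Z = {}" "Q \<inter> Z = {}"
    "C = convex_cone hull (P \<union> Q \<union> Z)" "\<Sum>P = \<Sum>Q" "P \<noteq> {}" "Q \<noteq> {}"
    "card P + card Q + card Z = DIM('v) + 1" "span (P \<union> Q \<union> Z) = UNIV"
  shows "presentation C P Q Z"
proof -
  let ?S = "P \<union> Q \<union> Z"
  have card: "card ?S = DIM('v) + 1"
    using assms by (simp add: card_Un_disjoint Int_Un_distrib2)
  have ind: "independent (?S - {w})" if w: "w \<in> P \<union> Q" for w
  proof (rule independent_of_card)
    have gen: "w \<in> span (?S - {w})"
      if "P \<inter> Q = {}" "finite P" "finite Q" "\<Sum>P = \<Sum>Q" "w \<in> P" "?S = P \<union> Q \<union> Z" for P Q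
    proof -
      have "w + \<Sum>(P - {w}) = \<Sum>Q" using that by (simp add: sum.remove[of P w])
      then have "w = \<Sum>Q - \<Sum>(P - {w})" by (simp add: eq_diff_eq)
      moreover have "\<Sum>Q \<in> span (?S - {w})" using that by (intro span_sum span_base) auto
      moreover have "\<Sum>(P - {w}) \<in> span (?S - {w})" using that by (intro span_sum span_base) auto
      ultimately show ?thesis using span_diff by metis
    qed
    have "w \<in> span (?S - {w})" using w gen[of P Q] gen[of Q P] assms by (auto simp: Un_commute Int_commute)
    then have "?S \<subseteq> span (?S - {w})" using span_base[of _ "?S - {w}"] by blast
    then have "span ?S \<subseteq> span (?S - {w})" by (rule span_minimal) simp
    then show "span (?S - {w}) = UNIV" using assms(12) by auto
    show "card (?S - {w}) = DIM('v)" using card w assms(1-3) by (subst card_Diff_singleton) auto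
  qed (use assms in auto)
  then show ?thesis using assms unfolding presentation_def by blast
qed

text \<open>An empty side would make a nonempty sum of generators zero, against pointedness. A
  single element would be a sum of other generators, against irredundancy.\<close>

lemma relation_side_card:
  fixes S :: "'v::euclidean_space set"
  assumes S: "finite S" "irredundant S" "pointed (convex_cone hull S)"
    and PQ: "P \<subseteq> S" "Q \<subseteq> S" "P \<inter> Q = {}" "\<Sum>P = \<Sum>Q" "P \<union> Q \<noteq> {}"
  shows "2 \<le> card P"
proof (rule ccontr)
  have fin: "finite P" "finite Q" using finite_subset[OF PQ(1) S(1)] finite_subset[OF PQ(2) S(1)] by auto
  assume "\<not> 2 \<le> card P"
  then have "card P = 0 \<or> card P = 1" by linarith
  then consider "P = {}" | p where "P = {p}" using fin(1) by (auto simp: card_1_singleton_iff)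
  then show False
  proof cases
    case 1
    then obtain q where q: "q \<in> Q" using PQ by blast
    have "\<Sum>Q = 0" using PQ(4) 1 by simp
    moreover have "x \<in> convex_cone hull S" if "x \<in> Q" for x using that PQ(2) by (intro hull_inc) auto
    ultimately have "q = 0"
      using pointed_zero_sum[OF convex_cone_convex_cone_hull S(3) fin(2), of "\<lambda>x. x" q] q by simp
    then show False using irredundant_nonzero[OF S(2)] q PQ by blast
  next
    case 2
    have "\<Sum>Q \<in> convex_cone hull (S - {p})"
      using PQ 2 by (intro sum_nonneg_in_cone[OF convex_cone_convex_cone_hull fin(2)]) (auto intro!: hull_inc)
    moreover have "\<Sum>Q = p" using PQ(4) 2 by simp
    ultimately show False using S(2) PQ(1) 2 by (auto simp: irredundant_def)
  qed
qed

lemma rescale_generators: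
  fixes S :: "'v::real_vector set" and \<mu> :: "'v \<Rightarrow> real"
  assumes S: "irredundant S" and \<mu>: "\<And>s. s \<in> S \<Longrightarrow> 0 < \<mu> s"
  defines "f \<equiv> \<lambda>s. \<mu> s *\<^sub>R s"
  shows "inj_on f S" "convex_cone hull (f ` S) = convex_cone hull S" "irredundant (f ` S)"
proof -
  have hull: "convex_cone hull (f ` T) = convex_cone hull T" if T: "T \<subseteq> S" for T
  proof
    show "convex_cone hull (f ` T) \<subseteq> convex_cone hull T"
      using T \<mu> by (intro hull_minimal convex_cone_convex_cone_hull)
        (auto simp: f_def less_imp_le subset_iff intro!: convex_cone_hull_mul intro: hull_inc)
    have "t \<in> convex_cone hull (f ` T)" if "t \<in> T" for t
      using scaleR_in_convex_cone_hull_iff[of "\<mu> t" t "f ` T"] hull_inc[of "f t" "f ` T"] \<mu> T that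
      by (auto simp: f_def)
    then show "convex_cone hull T \<subseteq> convex_cone hull (f ` T)"
      by (intro hull_minimal convex_cone_convex_cone_hull) auto
  qed
  then show "convex_cone hull (f ` S) = convex_cone hull S" by blast
  show inj: "inj_on f S"
  proof (rule inj_onI, rule ccontr)
    fix s s' assume s: "s \<in> S" "s' \<in> S" "f s = f s'" "s \<noteq> s'"
    have "s' \<in> convex_cone hull (S - {s})" using s by (intro hull_inc) auto
    then have "f s' \<in> convex_cone hull (S - {s})"
      unfolding f_def using \<mu>[OF s(2)] by (intro convex_cone_hull_mul) auto
    then have "\<mu> s *\<^sub>R s \<in> convex_cone hull (S - {s})" using s(3) by (simp add: f_def)
    then have "s \<in> convex_cone hull (S - {s})"
      by (simp add: scaleR_in_convex_cone_hull_iff[OF \<mu>[OF s(1)]])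
    then show False using S s(1) by (auto simp: irredundant_def)
  qed
  show "irredundant (f ` S)"
    unfolding irredundant_def
  proof safe
    fix s assume s: "s \<in> S" "f s \<in> convex_cone hull (f ` S - {f s})"
    have "f ` S - {f s} = f ` (S - {s})" using inj s(1) by (auto simp: inj_on_def)
    then have "f s \<in> convex_cone hull (S - {s})" using s hull[of "S - {s}"] by auto
    then have "s \<in> convex_cone hull (S - {s})"
      by (simp add: f_def scaleR_in_convex_cone_hull_iff[OF \<mu>[OF s(1)]])
    then show False using S s(1) by (auto simp: irredundant_def)
  qed
qed

text \<open>The \<open>DIM('v) + 1\<close> irredundant generators satisfy a linear relation. Scaling
  each generator by the absolute value of its coefficient leaves only signs, which sort the
  generators into \<open>P\<close>, \<open>Q\<close> and \<open>Z\<close>.\<close>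

lemma cone_presentation:
  fixes C :: "'v::euclidean_space set"
  assumes C: "proper_polyhedral_cone C" and card: "card (extreme_rays C) = DIM('v) + 1"
  shows "\<exists>P Q Z. presentation C P Q Z \<and> 2 \<le> card P \<and> 2 \<le> card Q \<and> card P + card Q + card Z = DIM('v) + 1"
proof -
  obtain S0 where S0: "finite S0" "C = convex_cone hull S0" and P: "pointed C" and int: "interior C \<noteq> {}"
    using C unfolding proper_polyhedral_cone_def pointed_def by blast
  obtain S where S: "finite S" "C = convex_cone hull S" "irredundant S"
    using irredundant_generators[OF S0] by blast
  have cS: "card S = DIM('v) + 1" using extreme_rays_irredundant[OF S(1,3)] P card unfolding S(2) by simp
  then have "dependent S" using dependent_biggerset[of S] by simp
  then obtain \<nu> where \<nu>: "\<exists>v\<in>S. \<nu> v \<noteq> 0" "(\<Sum>v\<in>S. \<nu> v *\<^sub>R v) = 0"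
    using dependent_finite[OF S(1)] by blast
  \<comment> \<open>Generators with coefficient zero keep their length.\<close>
  define \<mu> where "\<mu> s = (if \<nu> s = 0 then 1 else \<bar>\<nu> s\<bar>)" for s
  define f where "f s = \<mu> s *\<^sub>R s" for s
  have \<mu>: "0 < \<mu> s" for s by (simp add: \<mu>_def)
  have inj: "inj_on f S" and hull: "convex_cone hull (f ` S) = C" and irr: "irredundant (f ` S)"
    using rescale_generators[OF S(3), of \<mu>] \<mu> S(2) unfolding f_def by auto
  define Pp where "Pp = f ` {s \<in> S. 0 < \<nu> s}"
  define Q where "Q = f ` {s \<in> S. \<nu> s < 0}"
  define Z where "Z = f ` {s \<in> S. \<nu> s = 0}"
  have fin: "finite Pp" "finite Q" "finite Z" using S(1) by (auto simp: Pp_def Q_def Z_def)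
  have disj: "Pp \<inter> Q = {}" "Pp \<inter> Z = {}" "Q \<inter> Z = {}"
    unfolding Pp_def Q_def Z_def by (auto dest!: inj_onD[OF inj])
  have un: "Pp \<union> Q \<union> Z = f ` S"
    unfolding Pp_def Q_def Z_def image_Un[symmetric] by (intro arg_cong[where f = "image f"]) auto
  have sums: "\<Sum>Pp = \<Sum>Q"
  proof -
    have sub: "sum (\<lambda>x. x) (f ` T) = (\<Sum>s\<in>T. f s)" if "T \<subseteq> S" for T
      using sum.reindex[OF inj_on_subset[OF inj that], of "\<lambda>x. x"] by simp
    have "(\<Sum>v\<in>S. \<nu> v *\<^sub>R v) = (\<Sum>v\<in>S. (if 0 < \<nu> v then f v else 0) - (if \<nu> v < 0 then f v else 0))"
      by (intro sum.cong) (auto simp: f_def \<mu>_def)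
    also have "\<dots> = (\<Sum>v\<in>{s \<in> S. 0 < \<nu> s}. f v) - (\<Sum>v\<in>{s \<in> S. \<nu> s < 0}. f v)"
      using S(1) by (simp add: sum_subtractf sum.inter_filter)
    finally show ?thesis unfolding Pp_def Q_def using \<nu>(2) by (simp add: sub)
  qed
  have ne: "Pp \<union> Q \<noteq> {}" using \<nu>(1) unfolding Pp_def Q_def by force
  have cards: "2 \<le> card Pp" "2 \<le> card Q"
    using relation_side_card[of "f ` S" Pp Q] relation_side_card[of "f ` S" Q Pp]
      S(1) irr P hull sums ne un disj by (auto simp: Un_commute Int_commute)
  have "card (Pp \<union> Q \<union> Z) = card S" unfolding un by (rule card_image[OF inj])
  then have total: "card Pp + card Q + card Z = DIM('v) + 1"
    using fin disj cS by (simp add: card_Un_disjoint Int_Un_distrib2)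
  have "span C = UNIV"
    using affine_hull_nonempty_interior[OF int] affine_hull_subset_span[of C] by auto
  moreover have "C \<subseteq> span (f ` S)"
    unfolding hull[symmetric] by (intro hull_minimal span_superset convex_cone_span)
  ultimately have "span (f ` S) = UNIV" using span_minimal[of C "span (f ` S)"] by auto
  then have "presentation C Pp Q Z"
    using fin disj sums cards total hull un by (intro presentationI) auto
  then show ?thesis using cards total by blast
qed

text \<open>Functionals prescribed on the generators separate each generator from the others, which
  gives irredundancy, and one that is positive on all of them gives pointedness.\<close>

lemma presentation_cone:
  fixes C :: "'v::euclidean_space set"
  assumes pr: "presentation C P Q Z" and cP: "2 \<le> card P" "2 \<le> card Q"
  shows "proper_polyhedral_cone C" "card (extreme_rays C) = card P + card Q + card Z"
proof -
  note D = presentationD[OF pr]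
  let ?S = "P \<union> Q \<union> Z"
  have finS: "finite ?S" using D(1-3) by simp
  have cc: "convex_cone C" unfolding D(7) by (rule convex_cone_convex_cone_hull)
  have sep: "s \<notin> convex_cone hull (?S - {s})" if f: "linear f" "f s = 1" "\<forall>x\<in>?S - {s}. f x \<le> (0::real)" for s f
  proof
    assume s: "s \<in> convex_cone hull (?S - {s})"
    have "convex_cone hull (?S - {s}) \<subseteq> {x. f x \<le> 0}"
    proof (rule hull_minimal)
      show "convex_cone {x. f x \<le> 0}"
        unfolding convex_cone_iff
        by (auto simp: linear_0[OF f(1)] linear_add[OF f(1)] linear_scale[OF f(1)] mult_nonneg_nonpos)
    qed (use f in auto)
    then show False using s f(2) by auto
  qed
  have side: "s \<notin> convex_cone hull (?S - {s})" if pr': "presentation C P Q Z" "2 \<le> card P" "s \<in> P" "?S = P \<union> Q \<union> Z" for s P Q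
  proof -
    note D' = presentationD[OF pr'(1)]
    have "P - {s} \<noteq> {}"
    proof
      assume "P - {s} = {}"
      then have "card P \<le> card {s}" by (intro card_mono) auto
      then show False using pr'(2) by simp
    qed
    then obtain p where p: "p \<in> P" "p \<noteq> s" by blast
    \<comment> \<open>The value -1 at a second element of the same side balances the 1 at
      \<open>s\<close>, so both sums are zero.\<close>
    define g where "g x = (if x = s then 1 else if x = p then - 1 else 0 :: real)" for x
    have nQ: "s \<notin> Q" "p \<notin> Q" using D'(4) p pr'(3) by auto
    have "sum g P = (\<Sum>x\<in>P. (if x = s then 1 else 0) - (if x = p then 1 else 0))"
      using p by (intro sum.cong) (auto simp: g_def)
    also have "\<dots> = 0" using D'(1) p pr'(3) by (simp add: sum_subtractf)
    also have "\<dots> = sum g Q" using nQ by (intro sum.neutral[symmetric]) (auto simp: g_def)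
    finally obtain f where "linear f" "\<forall>x\<in>P \<union> Q \<union> Z. f x = g x"
      using presentation_linear_extend[OF pr'(1), of g] by blast
    then show ?thesis using pr'(3,4) by (intro sep[of f]) (auto simp: g_def)
  qed
  have "irredundant ?S"
    unfolding irredundant_def
  proof
    fix s assume "s \<in> ?S"
    then consider "s \<in> P" | "s \<in> Q" | "s \<in> Z" by blast
    then show "s \<notin> convex_cone hull (?S - {s})"
    proof cases
      case 1
      then show ?thesis using side[OF pr cP(1)] by blast
    next
      case 2
      then show ?thesis using side[OF presentation_sym[OF pr] cP(2)] by blast
    next
      case 3
      define g where "g x = (if x = s then 1 else 0 :: real)" for x
      have "s \<notin> P" "s \<notin> Q" using 3 D(5,6) by auto
      then have "sum g P = 0" "sum g Q = 0" by (auto simp: g_def intro!: sum.neutral)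
      then obtain f where "linear f" "\<forall>x\<in>?S. f x = g x"
        using presentation_linear_extend[OF pr, of g] by auto
      then show ?thesis using 3 by (intro sep[of f]) (auto simp: g_def)
    qed
  qed
  moreover have pointed: "pointed C"
  proof -
    \<comment> \<open>Positive weights with equal sums over the two sides, namely
      \<open>card P * card Q\<close>.\<close>
    define g where "g x = (if x \<in> P then real (card Q) else if x \<in> Q then real (card P) else 1)" for x
    have "sum g P = (\<Sum>x\<in>P. real (card Q))" by (intro sum.cong) (auto simp: g_def)
    moreover have "sum g Q = (\<Sum>x\<in>Q. real (card P))" using D(4) by (intro sum.cong) (auto simp: g_def)
    ultimately have "sum g P = sum g Q" by simp
    then obtain f where f: "linear f" "\<forall>x\<in>?S. f x = g x"
      using presentation_linear_extend[OF pr, of g] by blast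
    have fpos: "0 < f x" if "x \<in> ?S" for x using that f(2) cP by (auto simp: g_def)
    have nonneg: "0 \<le> f x" if x: "x \<in> C" for x
    proof -
      have "C \<subseteq> {x. 0 \<le> f x}"
        unfolding D(7)
      proof (rule hull_minimal)
        show "?S \<subseteq> {x. 0 \<le> f x}" using fpos by (auto intro: less_imp_le)
        show "convex_cone {x. 0 \<le> f x}"
          unfolding convex_cone_iff by (simp add: linear_0[OF f(1)] linear_add[OF f(1)] linear_scale[OF f(1)])
      qed
      then show ?thesis using x by blast
    qed
    have "x = 0" if x: "x \<in> C" "- x \<in> C" for x
    proof -
      have fx: "f x = 0" using nonneg[OF x(1)] nonneg[OF x(2)] by (simp add: linear_neg[OF f(1)])
      obtain c where c: "\<forall>r\<in>?S. 0 \<le> c r" "x = (\<Sum>r\<in>?S. c r *\<^sub>R r)"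
        using x(1) unfolding D(7) convex_cone_hull_finite[OF finS] by blast
      have "(\<Sum>r\<in>?S. c r * f r) = 0"
        using fx unfolding c(2) by (simp add: linear_sum[OF f(1)] linear_scale[OF f(1)])
      then have "\<forall>r\<in>?S. c r * f r = 0"
        using sum_nonneg_eq_0_iff[OF finS, of "\<lambda>r. c r * f r"] c(1) fpos by (simp add: less_imp_le)
      then have "\<forall>r\<in>?S. c r = 0" using fpos by force
      then show ?thesis unfolding c(2) by (intro sum.neutral) auto
    qed
    then show ?thesis unfolding pointed_def using convex_cone_contains_0[OF cc]
      by (auto intro!: rev_image_eqI[of 0])
  qed
  ultimately have "card (extreme_rays C) = card ?S"
    using extreme_rays_irredundant[OF finS] unfolding D(7)[symmetric] by blast
  then show "card (extreme_rays C) = card P + card Q + card Z"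
    using D(1-6) by (simp add: card_Un_disjoint Int_Un_distrib2)
  have "?S \<subseteq> C" unfolding D(7) by (rule hull_subset)
  then have "span C = UNIV" using D(12) span_mono by blast
  moreover have "affine hull C = span C"
    using convex_cone_contains_0[OF cc] by (intro affine_hull_span_0) (simp add: hull_inc)
  ultimately have "rel_interior C = interior C" by (intro rel_interior_interior) simp
  moreover have "convex C" "C \<noteq> {}" using cc by (auto simp: convex_cone_def)
  ultimately have "interior C \<noteq> {}" using rel_interior_eq_empty[of C] by auto
  then show "proper_polyhedral_cone C"
    using pointed unfolding proper_polyhedral_cone_def pointed_def[symmetric]
    by (intro conjI exI[of _ ?S] finS D(7))
qed

section \<open>Direct sums with an orthant\<close>

lemma lookup_scaleR:
  fixes x :: "'a \<Rightarrow>\<^sub>0 real"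
  shows "Poly_Mapping.lookup (r *\<^sub>R x) i = r * Poly_Mapping.lookup x i"
proof -
  have "finite {i. r *\<^sub>R Poly_Mapping.lookup x i \<noteq> 0}"
    by (rule finite_subset[OF _ finite_lookup[of x]]) auto
  then show ?thesis unfolding scaleR_poly_mapping_def by (simp add: Abs_poly_mapping_inverse)
qed

abbreviation unit_seq :: "nat \<Rightarrow> nat \<Rightarrow>\<^sub>0 real" where
  "unit_seq i \<equiv> Poly_Mapping.single i 1"

lemma coord_space_expand:
  assumes "x \<in> coord_space k"
  shows "x = (\<Sum>i<k. Poly_Mapping.lookup x i *\<^sub>R unit_seq i)"
proof (rule poly_mapping_eqI)
  fix j
  have "(\<Sum>i<k. Poly_Mapping.lookup x i * Poly_Mapping.lookup (unit_seq i) j) =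
      (\<Sum>i<k. if i = j then Poly_Mapping.lookup x j else 0)"
    by (intro sum.cong) (auto simp: lookup_single when_def)
  also have "\<dots> = Poly_Mapping.lookup x j" using assms by (auto simp: coord_space_def)
  finally show "Poly_Mapping.lookup x j = Poly_Mapping.lookup (\<Sum>i<k. Poly_Mapping.lookup x i *\<^sub>R unit_seq i) j"
    by (simp add: lookup_sum lookup_scaleR)
qed

lemma pair_expand:
  assumes "x \<in> coord_space k"
  shows "(y, x) = (y, 0) + (\<Sum>i<k. Poly_Mapping.lookup x i *\<^sub>R (0 :: 'q::real_vector, unit_seq i))"
proof (rule prod_eqI)
  show "snd (y, x) = snd ((y, 0) + (\<Sum>i<k. Poly_Mapping.lookup x i *\<^sub>R (0 :: 'q, unit_seq i)))"
    using coord_space_expand[OF assms] by (simp add: snd_sum)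
qed (simp add: fst_sum)

lemma subspace_coord_space: "subspace (coord_space k)"
  by (auto simp: subspace_def coord_space_def lookup_add lookup_scaleR)

lemma convex_cone_orthant: "convex_cone (orthant k)"
  by (auto simp: convex_cone_iff orthant_def coord_space_def lookup_add lookup_scaleR)

lemma unit_seq_in_orthant: "i < k \<Longrightarrow> unit_seq i \<in> orthant k"
  by (auto simp: orthant_def coord_space_def lookup_single when_def)

lemma product_cone_subset:
  fixes S :: "'q::real_vector set"
  assumes T: "convex_cone T" and S: "\<And>p. p \<in> S \<Longrightarrow> (p, 0) \<in> T" and e: "\<And>i. i < k \<Longrightarrow> (0, unit_seq i) \<in> T"
  shows "(convex_cone hull S) \<times> orthant k \<subseteq> T"
proof safe
  fix y x assume y: "y \<in> convex_cone hull S" and x: "x \<in> orthant k"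
  have "convex_cone hull S \<subseteq> {y. (y, 0) \<in> T}"
  proof (rule hull_minimal)
    show "convex_cone {y. (y, 0) \<in> T}"
      unfolding convex_cone_iff
      using convex_cone_contains_0[OF T] convex_cone_add[OF T] convex_cone_scaleR[OF T]
      by (force simp: zero_prod_def)
  qed (use S in auto)
  moreover have "(\<Sum>i<k. Poly_Mapping.lookup x i *\<^sub>R (0 :: 'q, unit_seq i)) \<in> T"
    using x e by (intro sum_nonneg_in_cone[OF T] convex_cone_scaleR[OF T]) (auto simp: orthant_def)
  moreover have "x \<in> coord_space k" using x by (simp add: orthant_def)
  ultimately show "(y, x) \<in> T"
    using y by (subst pair_expand[where k = k]) (auto intro: convex_cone_add[OF T] simp del: scaleR_Pair)
qed

lemma product_span_subset:
  fixes S :: "'q::real_vector set"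
  assumes T: "subspace T" and S: "\<And>p. p \<in> S \<Longrightarrow> (p, 0) \<in> T" and e: "\<And>i. i < k \<Longrightarrow> (0, unit_seq i) \<in> T"
  shows "span S \<times> coord_space k \<subseteq> T"
proof safe
  fix y x assume y: "y \<in> span S" and x: "x \<in> coord_space k"
  have "span S \<subseteq> {y. (y, 0) \<in> T}"
  proof (rule span_minimal)
    show "subspace {y. (y, 0) \<in> T}"
      unfolding subspace_def
      using subspace_0[OF T] subspace_add[OF T] subspace_scale[OF T] by (force simp: zero_prod_def)
  qed (use S in auto)
  moreover have "(\<Sum>i<k. Poly_Mapping.lookup x i *\<^sub>R (0 :: 'q, unit_seq i)) \<in> T"
    using e by (intro subspace_sum[OF T] subspace_scale[OF T]) auto
  ultimately show "(y, x) \<in> T"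
    using y by (subst pair_expand[OF x]) (auto intro: subspace_add[OF T] simp del: scaleR_Pair)
qed

text \<open>The generators correspond and obey the same single relation, so linear maps exist in
  both directions. \<open>G\<close> is a left inverse of \<open>f\<close>, which gives injectivity;
  the two images are found by looking at generators.\<close>

lemma presentation_isomorphic:
  fixes C :: "'v::euclidean_space set" and Q :: "'q::euclidean_space set"
  assumes pr: "presentation C {v1, v2} {w1, w2} Z" "v1 \<noteq> v2" "w1 \<noteq> w2"
    and prQ: "presentation Q {p1, p2} {q1, q2} {}" "p1 \<noteq> p2" "q1 \<noteq> q2"
  shows "cone_isomorphic UNIV C (UNIV \<times> coord_space (card Z)) (Q \<times> orthant (card Z))"
proof -
  note D = presentationD[OF pr(1)] and DQ = presentationD[OF prQ(1)]
  define k where "k = card Z"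
  define S where "S = {v1, v2} \<union> {w1, w2} \<union> Z"
  define SQ where "SQ = {p1, p2} \<union> {q1, q2}"
  have Q: "Q = convex_cone hull SQ" and spQ: "span SQ = UNIV" using DQ(7,12) by (simp_all add: SQ_def)
  have C: "C = convex_cone hull S" and sp: "span S = UNIV" using D(7,12) by (simp_all add: S_def)
  have neq: "v1 \<noteq> w1" "v1 \<noteq> w2" "v2 \<noteq> w1" "v2 \<noteq> w2" "v1 \<notin> Z" "v2 \<notin> Z" "w1 \<notin> Z" "w2 \<notin> Z"
    using D(4,5,6) by auto
  have neqQ: "p1 \<noteq> q1" "p1 \<noteq> q2" "p2 \<noteq> q1" "p2 \<noteq> q2" using DQ(4) by auto
  have rel: "v1 + v2 = w1 + w2" using D(8) pr by simp
  have relQ: "p1 + p2 = q1 + q2" using DQ(8) prQ by simp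
  obtain h where h: "bij_betw h {..<k} Z"
    using ex_bij_betw_nat_finite[OF D(3)] unfolding lessThan_atLeast0 k_def by blast
  define g :: "'v \<Rightarrow> 'q \<times> (nat \<Rightarrow>\<^sub>0 real)" where "g v = (if v = v1 then (p1, 0) else if v = v2 then (p2, 0) else
    if v = w1 then (q1, 0) else if v = w2 then (q2, 0) else (0, unit_seq (inv_into {..<k} h v)))" for v
  have "sum g {v1, v2} = sum g {w1, w2}" using pr neq relQ by (simp add: g_def)
  then obtain f where f: "linear f" "\<forall>x\<in>S. f x = g x"
    using presentation_linear_extend[OF pr(1), of g] unfolding S_def by blast
  have fv: "f v1 = (p1, 0)" "f v2 = (p2, 0)" "f w1 = (q1, 0)" "f w2 = (q2, 0)"
    using f(2) pr neq by (auto simp: S_def g_def)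
  have hZ: "h i \<in> Z" if "i < k" for i using bij_betwE[OF h] that by blast
  have fh: "f (h i) = (0, unit_seq i)" if i: "i < k" for i
  proof -
    have "inv_into {..<k} h (h i) = i" using h i by (simp add: bij_betw_def)
    then show ?thesis using f(2) hZ[OF i] neq by (auto simp: S_def g_def)
  qed
  have Zh: "\<exists>i<k. z = h i" if "z \<in> Z" for z using h that by (auto simp: bij_betw_def)
  define gQ where "gQ y = (if y = p1 then v1 else if y = p2 then v2 else if y = q1 then w1 else w2)" for y
  have "sum gQ {p1, p2} = sum gQ {q1, q2}" using prQ neqQ rel by (simp add: gQ_def)
  then obtain G1 where G1: "linear G1" "\<forall>y\<in>SQ. G1 y = gQ y"
    using presentation_linear_extend[OF prQ(1), of gQ] unfolding SQ_def by auto
  have G1v: "G1 p1 = v1" "G1 p2 = v2" "G1 q1 = w1" "G1 q2 = w2"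
    using G1(2) prQ neqQ by (auto simp: SQ_def gQ_def)
  define G where "G t = G1 (fst t) + (\<Sum>i<k. Poly_Mapping.lookup (snd t) i *\<^sub>R h i)" for t
  have linG: "linear G"
    by (rule linearI) (simp_all add: G_def linear_add[OF G1(1)] linear_scale[OF G1(1)] lookup_add lookup_scaleR
        scaleR_add_left sum.distrib scaleR_add_right scaleR_sum_right)
  have Gf: "G (f v) = v" for v
  proof -
    have "(G \<circ> f) x = id x" if x: "x \<in> S" for x
    proof -
      have "G (f (h i)) = h i" if i: "i < k" for i
      proof -
        have "(\<Sum>j<k. Poly_Mapping.lookup (unit_seq i) j *\<^sub>R h j) = (\<Sum>j<k. if j = i then h i else 0)"
          by (intro sum.cong) (auto simp: lookup_single when_def)
        then show ?thesis using i by (simp add: fh G_def linear_0[OF G1(1)])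
      qed
      moreover have "x \<in> {v1, v2, w1, w2} \<or> (\<exists>i<k. x = h i)" using x Zh by (auto simp: S_def)
      ultimately show ?thesis by (auto simp: fv G_def G1v)
    qed
    then show ?thesis
      using linear_eq_on_span[OF linear_compose[OF f(1) linG] linear_id, of S v] sp by simp
  qed
  have inj: "inj f" by (rule inj_on_inverseI[of _ G]) (rule Gf)
  have fS: "f s \<in> Q \<times> orthant k" if s: "s \<in> S" for s
  proof -
    have z: "0 \<in> orthant k" by (rule convex_cone_contains_0[OF convex_cone_orthant])
    have "0 \<in> Q" unfolding Q by (rule convex_cone_hull_contains_0)
    moreover have "{p1, p2, q1, q2} \<subseteq> Q" unfolding Q SQ_def by (rule order_trans[OF _ hull_subset]) auto
    moreover have "s \<in> {v1, v2, w1, w2} \<or> (\<exists>i<k. s = h i)" using s Zh by (auto simp: S_def)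
    ultimately show ?thesis using z unit_seq_in_orthant[of _ k] by (auto simp: fv fh)
  qed
  have gens: "(p, 0) \<in> f ` S" if "p \<in> SQ" for p
    using that fv by (auto simp: SQ_def S_def intro: rev_image_eqI)
  have genZ: "(0, unit_seq i) \<in> f ` S" if "i < k" for i
    using fh[OF that] hZ[OF that] by (auto simp: S_def intro: rev_image_eqI)
  have "range f = UNIV \<times> coord_space k"
  proof
    have "f ` S \<subseteq> UNIV \<times> coord_space k" using fS by (force simp: orthant_def)
    then have "span (f ` S) \<subseteq> UNIV \<times> coord_space k"
      by (rule span_minimal) (rule subspace_Times[OF subspace_UNIV subspace_coord_space])
    then show "range f \<subseteq> UNIV \<times> coord_space k" unfolding linear_span_image[OF f(1)] sp .
    have "subspace (range f)" by (rule linear_subspace_image[OF f(1) subspace_UNIV])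
    then have "span SQ \<times> coord_space k \<subseteq> range f"
      by (rule product_span_subset) (use gens genZ in blast)+
    then show "UNIV \<times> coord_space k \<subseteq> range f" unfolding spQ .
  qed
  moreover have "f ` C = Q \<times> orthant k"
  proof
    have "convex_cone (Q \<times> orthant k)"
      unfolding Q by (intro convex_cone_Times convex_cone_convex_cone_hull convex_cone_orthant)
    then show "f ` C \<subseteq> Q \<times> orthant k"
      unfolding C convex_cone_hull_linear_image[OF f(1), symmetric]
      by (intro hull_minimal) (use fS in blast)+
    have sub: "f ` S \<subseteq> f ` C" unfolding C by (intro image_mono hull_subset)
    have "convex_cone (f ` C)" using f(1) convex_cone_convex_cone_hull unfolding C by (intro convex_cone_linear_image conjI)
    then show "Q \<times> orthant k \<subseteq> f ` C"
      unfolding Q by (rule product_cone_subset) (use gens genZ sub in blast)+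
  qed
  ultimately show ?thesis unfolding cone_isomorphic_def bij_betw_def k_def[symmetric] using f(1) inj by blast
qed

text \<open>The generators of \<open>Q\<close> and the unit sequences are pulled back along the
  isomorphism. There are \<open>4 + k = DIM('v) + 1\<close> of them, which is the count that
  \<open>presentationI\<close> asks for.\<close>

lemma isomorphic_presentation:
  fixes C :: "'v::euclidean_space set" and Q :: "'q::euclidean_space set"
  assumes iso: "cone_isomorphic UNIV C (UNIV \<times> coord_space k) (Q \<times> orthant k)" and C: "convex_cone C"
    and prQ: "presentation Q {p1, p2} {q1, q2} {}" "p1 \<noteq> p2" "q1 \<noteq> q2" and dim: "DIM('v) = k + 3"
  shows "\<exists>v1 v2 w1 w2 Z. presentation C {v1, v2} {w1, w2} Z \<and> v1 \<noteq> v2 \<and> w1 \<noteq> w2"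
proof -
  note DQ = presentationD[OF prQ(1)]
  obtain f where f: "linear f" "bij_betw f UNIV (UNIV \<times> coord_space k)" "f ` C = Q \<times> orthant k"
    using iso unfolding cone_isomorphic_def by blast
  have inj: "inj f" and rng: "range f = UNIV \<times> coord_space k" using f(2) by (auto simp: bij_betw_def)
  define SQ where "SQ = {p1, p2} \<union> {q1, q2}"
  have Q: "Q = convex_cone hull SQ" and spQ: "span SQ = UNIV" using DQ(7,12) by (simp_all add: SQ_def)
  have neqQ: "p1 \<noteq> q1" "p1 \<noteq> q2" "p2 \<noteq> q1" "p2 \<noteq> q2" using DQ(4) by auto
  have relQ: "p1 + p2 = q1 + q2" using DQ(8) prQ by simp
  define J where "J = inv_into UNIV f"
  have fJ: "f (J t) = t" if "t \<in> UNIV \<times> coord_space k" for t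
    using that unfolding J_def rng[symmetric] by (rule f_inv_into_f)
  have c0: "0 \<in> coord_space k" by (rule subspace_0[OF subspace_coord_space])
  have ce: "unit_seq i \<in> coord_space k" if "i < k" for i
    using unit_seq_in_orthant[OF that] by (auto simp: orthant_def)
  have fp: "f (J (p, 0)) = (p, 0)" for p by (rule fJ) (use c0 in auto)
  have fe: "f (J (0, unit_seq i)) = (0, unit_seq i)" if "i < k" for i by (rule fJ) (use ce that in auto)
  define Z where "Z = (\<lambda>i. J (0, unit_seq i)) ` {..<k}"
  have Jp: "J (p, 0) = J (q, 0) \<longleftrightarrow> p = q" for p q by (metis fp prod.inject)
  have e0: "unit_seq i \<noteq> 0" for i by (metis lookup_single_eq lookup_zero zero_neq_one)
  have JZ: "J (p, 0) \<notin> Z" for p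
  proof
    assume "J (p, 0) \<in> Z"
    then obtain i where i: "i < k" "J (p, 0) = J (0, unit_seq i)" by (auto simp: Z_def)
    then have "(p, 0) = (0, unit_seq i)" using fp[of p] fe[OF i(1)] by metis
    then show False using e0[of i] by simp
  qed
  have "inj_on (\<lambda>i. J (0, unit_seq i)) {..<k}"
  proof (rule inj_onI)
    fix i j assume "i \<in> {..<k}" "j \<in> {..<k}" "J (0, unit_seq i) = J (0, unit_seq j)"
    then have "(0 :: 'q, unit_seq i) = (0, unit_seq j)" using fe[of i] fe[of j] by (metis lessThan_iff)
    then have "unit_seq i = unit_seq j" by simp
    then show "i = j" by (metis lookup_single_eq lookup_single_not_eq zero_neq_one)
  qed
  then have cZ: "card Z = k" unfolding Z_def by (simp add: card_image)
  define S where "S = {J (p1, 0), J (p2, 0)} \<union> {J (q1, 0), J (q2, 0)} \<union> Z"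
  have gens: "(p, 0) \<in> f ` S" if "p \<in> SQ" for p
    using that fp[of p] by (auto simp: SQ_def S_def intro: rev_image_eqI)
  have genZ: "(0, unit_seq i) \<in> f ` S" if "i < k" for i
  proof -
    have "J (0, unit_seq i) \<in> S" using that by (auto simp: S_def Z_def)
    then show ?thesis using fe[OF that] by (metis imageI)
  qed
  have "presentation C {J (p1, 0), J (p2, 0)} {J (q1, 0), J (q2, 0)} Z"
  proof (rule presentationI)
    show "finite Z" by (simp add: Z_def)
    show "{J (p1, 0), J (p2, 0)} \<inter> {J (q1, 0), J (q2, 0)} = {}" using neqQ by (auto simp: Jp)
    show "{J (p1, 0), J (p2, 0)} \<inter> Z = {}" "{J (q1, 0), J (q2, 0)} \<inter> Z = {}" using JZ by auto
    have "f (J (p1, 0) + J (p2, 0)) = f (J (q1, 0) + J (q2, 0))"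
      by (simp add: linear_add[OF f(1)] fp relQ)
    then have "J (p1, 0) + J (p2, 0) = J (q1, 0) + J (q2, 0)" using inj by (simp add: inj_eq)
    then show "\<Sum>{J (p1, 0), J (p2, 0)} = \<Sum>{J (q1, 0), J (q2, 0)}" using prQ by (simp add: Jp)
    show "card {J (p1, 0), J (p2, 0)} + card {J (q1, 0), J (q2, 0)} + card Z = DIM('v) + 1"
      using prQ cZ dim by (simp add: Jp)
    have "subspace (f ` span S)" by (rule linear_subspace_image[OF f(1) subspace_span])
    moreover have sub: "f ` S \<subseteq> f ` span S" by (intro image_mono span_superset)
    ultimately have "span SQ \<times> coord_space k \<subseteq> f ` span S"
      by (intro product_span_subset) (use gens genZ in blast)+
    then have "f ` UNIV \<subseteq> f ` span S" unfolding spQ rng .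
    then have "span S = UNIV" using inj by (simp add: inj_image_subset_iff top.extremum_unique)
    then show "span ({J (p1, 0), J (p2, 0)} \<union> {J (q1, 0), J (q2, 0)} \<union> Z) = UNIV" by (simp add: S_def)
    have "C = convex_cone hull S"
    proof
      have "convex_cone (f ` (convex_cone hull S))"
        using f(1) convex_cone_convex_cone_hull by (intro convex_cone_linear_image conjI)
      moreover have "f ` S \<subseteq> f ` (convex_cone hull S)" by (intro image_mono hull_subset)
      ultimately have "(convex_cone hull SQ) \<times> orthant k \<subseteq> f ` (convex_cone hull S)"
        by (intro product_cone_subset) (use gens genZ in blast)+
      then have "f ` C \<subseteq> f ` (convex_cone hull S)" unfolding f(3) Q .
      then show "C \<subseteq> convex_cone hull S" using inj by (simp add: inj_image_subset_iff)
      have z: "0 \<in> orthant k" by (rule convex_cone_contains_0[OF convex_cone_orthant])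
      have "0 \<in> Q" unfolding Q by (rule convex_cone_hull_contains_0)
      moreover have "{p1, p2, q1, q2} \<subseteq> Q" unfolding Q SQ_def by (rule order_trans[OF _ hull_subset]) auto
      ultimately have "f ` S \<subseteq> Q \<times> orthant k"
        using z unit_seq_in_orthant[of _ k] by (auto simp: S_def Z_def fp fe)
      then have "S \<subseteq> C" unfolding f(3)[symmetric] using inj by (simp add: inj_image_subset_iff)
      then show "convex_cone hull S \<subseteq> C" using C by (rule hull_minimal)
    qed
    then show "C = convex_cone hull ({J (p1, 0), J (p2, 0)} \<union> {J (q1, 0), J (q2, 0)} \<union> Z)" by (simp add: S_def)
  qed auto
  moreover have "J (p1, 0) \<noteq> J (p2, 0)" "J (q1, 0) \<noteq> J (q2, 0)" using prQ by (simp_all add: Jp)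
  ultimately show ?thesis by blast
qed

text \<open>Four generators with at least two on each side leave none for \<open>Z\<close>.\<close>

lemma square_presentation:
  fixes Q :: "'q::euclidean_space set"
  assumes "proper_polyhedral_cone Q" "DIM('q) = 3" "card (extreme_rays Q) = 4"
  shows "\<exists>p1 p2 q1 q2. presentation Q {p1, p2} {q1, q2} {} \<and> p1 \<noteq> p2 \<and> q1 \<noteq> q2"
proof -
  obtain P Q' Z where pr: "presentation Q P Q' Z" and c: "2 \<le> card P" "2 \<le> card Q'" "card P + card Q' + card Z = 4"
    using cone_presentation[OF assms(1)] assms(2,3) by auto
  then have "card P = 2" "card Q' = 2" "card Z = 0" by auto
  then show ?thesis using pr presentationD(3)[OF pr] by (auto simp: card_2_iff)
qed

lemma nonsubhomogeneous_presentation_exists: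
  assumes dim: "4 \<le> DIM('v::euclidean_space)"
  shows "\<exists>C P Q (Z :: 'v set). presentation C P Q Z \<and> card P = 3 \<and> card Q = 2 \<and> card Z = DIM('v) - 4"
proof -
  obtain P :: "'v set" where P: "P \<subseteq> Basis" "card P = 3" "finite P"
    using obtain_subset_with_card_n[of 3 "Basis :: 'v set"] dim by auto
  have "P \<noteq> Basis" using P dim by auto
  then obtain b where b: "b \<in> Basis" "b \<notin> P" using P by blast
  \<comment> \<open>The fifth vector of the relation is defined by it; its coordinate -1 at
    \<open>b\<close> tells it apart from the basis vectors.\<close>
  define q where "q = \<Sum>P - b"
  define Z where "Z = Basis - P - {b}"
  have "p \<bullet> b = 0" if "p \<in> P" for p using that P b by (metis inner_not_same_Basis subsetD)
  then have "\<Sum>P \<bullet> b = 0" by (simp add: inner_sum_left)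
  then have "q \<bullet> b = - 1" using b by (simp add: q_def inner_diff_left)
  moreover have "x \<bullet> b \<noteq> - 1" if "x \<in> Basis" for x using that b by (simp add: inner_Basis)
  ultimately have q: "q \<notin> Basis" by blast
  then have qb: "q \<noteq> b" using b by blast
  have cZ: "card Z = DIM('v) - 4"
    unfolding Z_def using P b by (simp add: card_Diff_subset)
  have "presentation (convex_cone hull (P \<union> {b, q} \<union> Z)) P {b, q} Z"
  proof (rule presentationI)
    show "finite Z" "P \<inter> Z = {}" "{b, q} \<inter> Z = {}" "P \<inter> {b, q} = {}" using P b q by (auto simp: Z_def)
    show "\<Sum>P = \<Sum>{b, q}" using qb by (simp add: q_def)
    show "P \<noteq> {}" using P by auto
    show "card P + card {b, q} + card Z = DIM('v) + 1" using P qb cZ dim by simp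
    have "Basis \<subseteq> P \<union> {b, q} \<union> Z" by (auto simp: Z_def)
    then show "span (P \<union> {b, q} \<union> Z) = UNIV" using span_mono span_Basis by blast
  qed (use P in auto)
  then show ?thesis using P qb cZ by (intro exI conjI) auto
qed

text \<open>\<open>'q\<close> is the ambient type of the three-dimensional cones, both for
  \<open>Q\<close> and in the second claim, and \<open>'v\<close> that of the cones of dimension
  \<open>n\<close>. The cardinality assumption on \<open>'b\<close> lets the bounded sequences be
  carried into it.\<close>

theorem corollary4p6:
  fixes n :: nat
  assumes carrier_type: "(UNIV :: real set) \<lesssim> (UNIV :: 'b set)"
    and dim: "DIM('v::euclidean_space) = n"
  shows
    "(\<forall>(Q :: 'q::euclidean_space set) (C :: 'v set) u.
        3 \<le> n \<longrightarrow> square_cone Q \<longrightarrow>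
        proper_polyhedral_cone C \<longrightarrow> card (extreme_rays C) = n + 1 \<longrightarrow> u \<in> interior C \<longrightarrow>
          (subhomogeneous TYPE('b) (min_cone C) u \<longleftrightarrow>
             cone_isomorphic UNIV C (UNIV \<times> coord_space (n - 3)) (Q \<times> orthant (n - 3))) \<and>
          (cone_isomorphic UNIV C (UNIV \<times> coord_space (n - 3)) (Q \<times> orthant (n - 3)) \<longrightarrow>
             d_subhomogeneous TYPE('b) 2 (min_cone C) u))
     \<and> (\<forall>(C :: 'q set) u.
        DIM('q) = 3 \<longrightarrow> proper_polyhedral_cone C \<longrightarrow> card (extreme_rays C) = 4 \<longrightarrow>
        u \<in> interior C \<longrightarrow> d_subhomogeneous TYPE('b) 2 (min_cone C) u)
     \<and> (4 \<le> n \<longrightarrow>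
        (\<exists>C :: 'v set. proper_polyhedral_cone C \<and> card (extreme_rays C) = n + 1 \<and>
           (\<forall>u\<in>interior C. \<not> subhomogeneous TYPE('b) (min_cone C) u)))"
proof (intro conjI allI impI)
  fix Q :: "'q set" and C :: "'v set" and u
  assume n: "3 \<le> n" and Q: "square_cone Q" and C: "proper_polyhedral_cone C"
    and rays: "card (extreme_rays C) = n + 1" and u: "u \<in> interior C"
  let ?iso = "cone_isomorphic UNIV C (UNIV \<times> coord_space (n - 3)) (Q \<times> orthant (n - 3))"
  obtain p1 p2 q1 q2 where prQ: "presentation Q {p1, p2} {q1, q2} {}" "p1 \<noteq> p2" "q1 \<noteq> q2"
    using Q square_presentation[of Q] unfolding square_cone_def by blast
  show two: "d_subhomogeneous TYPE('b) 2 (min_cone C) u" if ?iso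
  proof -
    have "convex_cone C"
      using C convex_cone_convex_cone_hull unfolding proper_polyhedral_cone_def by blast
    then obtain v1 v2 w1 w2 Z where "presentation C {v1, v2} {w1, w2} Z" "v1 \<noteq> v2" "w1 \<noteq> w2"
      using isomorphic_presentation[OF \<open>?iso\<close> _ prQ] dim n by auto
    then show ?thesis using two_subhomogeneous[OF carrier_type _ _ _ u] by blast
  qed
  show "subhomogeneous TYPE('b) (min_cone C) u \<longleftrightarrow> ?iso"
  proof
    assume sub: "subhomogeneous TYPE('b) (min_cone C) u"
    obtain P R Z where pr: "presentation C P R Z" and c: "2 \<le> card P" "2 \<le> card R" "card P + card R + card Z = n + 1"
      using cone_presentation[OF C] rays dim by auto
    \<comment> \<open>Three terms on either side contradict subhomogeneity; for \<open>R\<close> the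
      relation is read backwards.\<close>
    have "\<not> 3 \<le> card P" "\<not> 3 \<le> card R"
      using not_d_subhomogeneous[OF pr _ c(2) u] not_d_subhomogeneous[OF presentation_sym[OF pr] _ c(1) u] sub
      unfolding subhomogeneous_def by blast+
    then have cards: "card P = 2" "card R = 2" "card Z = n - 3" using c by auto
    then obtain v1 v2 w1 w2 where "P = {v1, v2}" "v1 \<noteq> v2" "R = {w1, w2}" "w1 \<noteq> w2"
      by (auto simp: card_2_iff)
    then show ?iso using presentation_isomorphic[OF _ _ _ prQ] pr cards(3) by metis
  next
    assume ?iso
    then show "subhomogeneous TYPE('b) (min_cone C) u"
      unfolding subhomogeneous_def using two by (intro exI[of _ 2]) auto
  qed
next
  fix C :: "'q set" and u
  assume "DIM('q) = 3" "proper_polyhedral_cone C" "card (extreme_rays C) = 4" and u: "u \<in> interior C"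
  then obtain p1 p2 q1 q2 where "presentation C {p1, p2} {q1, q2} {}" "p1 \<noteq> p2" "q1 \<noteq> q2"
    using square_presentation by blast
  then show "d_subhomogeneous TYPE('b) 2 (min_cone C) u" using two_subhomogeneous[OF carrier_type _ _ _ u] by blast
next
  assume "4 \<le> n"
  then obtain P R Z and C :: "'v set" where pr: "presentation C P R Z"
    and c: "card P = 3" "card R = 2" "card Z = n - 4"
    using nonsubhomogeneous_presentation_exists[where ?'v = 'v] dim by auto
  have "proper_polyhedral_cone C" "card (extreme_rays C) = n + 1"
    using presentation_cone[OF pr] c \<open>4 \<le> n\<close> by auto
  moreover have "\<not> subhomogeneous TYPE('b) (min_cone C) u" if "u \<in> interior C" for u
    using not_d_subhomogeneous[where ?'b = 'b, OF pr _ _ that] c unfolding subhomogeneous_def by simp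
  ultimately show "\<exists>C :: 'v set. proper_polyhedral_cone C \<and> card (extreme_rays C) = n + 1 \<and>
      (\<forall>u\<in>interior C. \<not> subhomogeneous TYPE('b) (min_cone C) u)" by blast
qed

end
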